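(* Let $d\ge2$, let $0<\varepsilon\le1$, and let $\mathfrak a$ be the coefficient on $\mathbb R^2$ constructed in the context. Then the isotropic coefficient matrix $$\mathfrak B_d(t,x)=\mathfrak a(t,x_1)\,\mathrm{Id}_d\in C^{0,1/2}([0,1];L^\infty(\mathbb R^d;\mathbb R^{d\times d}))$$ is real symmetric, bounded, and uniformly elliptic. Moreover, there exist a real-valued $F\in L^2(0,1;L^2(\mathbb R^d))$ and a unique Lions variational solution $U$ with $U(0)=0$ such that $$\partial_tU-\operatorname{div}(\mathfrak B_d\nabla U)=F,\qquad \partial_tU\notin L^2(0,1;L^2(\mathbb R^d)).$$
   Context: Construction of $\mathfrak a$. For integers $j\ge1$ set $\tau_j=\frac5{16}-\frac1{16j}$, $\ell_j=\tau_{j+1}-\tau_j=\frac1{16j(j+1)}$, $M_j=j$. Fix $\eta\in C_c^\infty(0,1)$ with $0\le\eta\le1$, $\operatorname{supp}\eta\subset[1/10,9/10]$, $\eta=1$ on $[1/3,2/3]$, and put $\eta_j(t)=\eta((t-\tau_j)/\ell_j)$ (zero outside $(\tau_j,\tau_{j+1})$). For $1\le m\le M_j$ put $K_{j,m}=16^m\ell_j^{-1}=16^{m+1}j(j+1)$ and $\theta_{j,m}(t)=K_{j,m}^2(t-\tau_j)$. Define on $\mathbb R^2$ $$\beta(t,x)=\sum_{j=1}^\infty\sum_{m=1}^{M_j}\eta_j(t)K_{j,m}^{-1}\sin\theta_{j,m}(t)\cos(K_{j,m}x),\qquad \mathfrak a(t,x)=1+\varepsilon\beta(t,x)$$ (a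 finite sum at each point). Points of $\mathbb R^d$ are written $x=(x_1,x')$. For $F\in L^2(0,1;L^2(\mathbb R^d))$, the Lions variational solution with zero initial value is the unique $U\in L^2(0,1;H^1(\mathbb R^d))\cap H^1(0,1;H^{-1}(\mathbb R^d))$ with $U(0)=0$ satisfying $\partial_tU-\operatorname{div}(\mathfrak B_d\nabla U)=F$ in $H^{-1}(\mathbb R^d)$ for a.e. $t\in(0,1)$. Uniformly elliptic means $\mathfrak a\ge\lambda$ a.e. for some constant $\lambda>0$. $C^{0,1/2}([0,1];X)$ is the space of $X$-valued bounded $\frac12$-Hölder continuous functions. *)

theory Defs
  imports "HOL-Analysis.Analysis" "HOL-Probability.Essential_Supremum"
begin

section \<open>Test functions\<close>

primrec iter_dir_deriv ::
  "'a list \<Rightarrow> ('a::real_normed_vector \<Rightarrow> real) \<Rightarrow> 'a \<Rightarrow> real" where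
  "iter_dir_deriv [] f = f"
| "iter_dir_deriv (v # vs) f = (\<lambda>x. frechet_derivative (iter_dir_deriv vs f) (at x) v)"

definition smooth :: "('a::real_normed_vector \<Rightarrow> real) \<Rightarrow> bool" where
  "smooth f \<longleftrightarrow> (\<forall>vs x. iter_dir_deriv vs f differentiable (at x))"

definition supp :: "('a::real_normed_vector \<Rightarrow> real) \<Rightarrow> 'a set" where
  "supp f = closure {x. f x \<noteq> 0}"

text \<open>The space \<open>C_c\<^sup>\<infinity>(\<Omega>)\<close>; its elements are extended by zero to the whole space.\<close>

definition test_functions :: "'a::euclidean_space set \<Rightarrow> ('a \<Rightarrow> real) set" where
  "test_functions \<Omega> = {\<phi>. smooth \<phi> \<and> compact (supp \<phi>) \<and> supp \<phi> \<subseteq> \<Omega>}"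


section \<open>The coefficient\<close>

definition cutoff :: "(real \<Rightarrow> real) \<Rightarrow> bool" where
  "cutoff \<eta> \<longleftrightarrow> \<eta> \<in> test_functions {0<..<1} \<and> (\<forall>t. 0 \<le> \<eta> t \<and> \<eta> t \<le> 1) \<and>
     supp \<eta> \<subseteq> {1/10..9/10} \<and> (\<forall>t\<in>{1/3..2/3}. \<eta> t = 1)"

definition tau :: "nat \<Rightarrow> real" where
  "tau j = 5/16 - 1 / (16 * real j)"

definition ell :: "nat \<Rightarrow> real" where
  "ell j = tau (Suc j) - tau j"

definition num_modes :: "nat \<Rightarrow> nat" where
  "num_modes j = j"

text \<open>No separate truncation outside \<open>(\<tau>\<^sub>j, \<tau>\<^sub>j\<^sub>+\<^sub>1)\<close> is needed, since \<open>\<eta>\<close> is a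
  function on the whole line that vanishes outside \<open>(0, 1)\<close>.\<close>

definition eta_j :: "(real \<Rightarrow> real) \<Rightarrow> nat \<Rightarrow> real \<Rightarrow> real" where
  "eta_j \<eta> j t = \<eta> ((t - tau j) / ell j)"

definition freq :: "nat \<Rightarrow> nat \<Rightarrow> real" where
  "freq j m = 16 ^ m / ell j"

definition theta :: "nat \<Rightarrow> nat \<Rightarrow> real \<Rightarrow> real" where
  "theta j m t = (freq j m)\<^sup>2 * (t - tau j)"

text \<open>The index \<open>i\<close> of the series is \<open>j - 1\<close>. At each \<open>t\<close> at most one term is nonzero.\<close>

definition beta :: "(real \<Rightarrow> real) \<Rightarrow> real \<Rightarrow> real \<Rightarrow> real" where
  "beta \<eta> t x = (\<Sum>i. let j = Suc i in
     (\<Sum>m = 1..num_modes j. eta_j \<eta> j t / freq j m * sin (theta j m t) * cos (freq j m * x)))"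

definition scalar_coeff :: "(real \<Rightarrow> real) \<Rightarrow> real \<Rightarrow> real \<Rightarrow> real \<Rightarrow> real" where
  "scalar_coeff \<eta> \<epsilon> t x = 1 + \<epsilon> * beta \<eta> t x"

text \<open>The index \<open>k\<close> names the coordinate that plays the role of \<open>x\<^sub>1\<close>.\<close>

definition coeff_matrix ::
  "(real \<Rightarrow> real) \<Rightarrow> real \<Rightarrow> 'n::finite \<Rightarrow> real \<Rightarrow> real^'n \<Rightarrow> real^'n^'n" where
  "coeff_matrix \<eta> \<epsilon> k t x = scalar_coeff \<eta> \<epsilon> t (x $ k) *\<^sub>R mat 1"

definition uniformly_elliptic :: "(real \<Rightarrow> real \<Rightarrow> real) \<Rightarrow> bool" where
  "uniformly_elliptic a \<longleftrightarrow> (\<exists>c>0. AE p in lborel. a (fst p) (snd p) \<ge> c)"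


section \<open>Lebesgue and Hoelder spaces\<close>

text \<open>Elements of Lebesgue and Sobolev spaces are represented by Borel functions, not by
  equivalence classes; the norms below are accordingly seminorms on these representatives.\<close>

definition Linf_norm :: "('a::euclidean_space \<Rightarrow> 'b::euclidean_space) \<Rightarrow> ereal" where
  "Linf_norm f = esssup lborel (\<lambda>x. ereal (norm (f x)))"

definition Linf :: "('a::euclidean_space \<Rightarrow> 'b::euclidean_space) set" where
  "Linf = {f. f \<in> borel_measurable lborel \<and> Linf_norm f < \<infinity>}"

text \<open>\<open>C\<^sup>0\<^sup>,\<^sup>\<alpha>([0,1]; L\<^sup>\<infinity>)\<close>\<close>

definition Holder_Linf ::
  "real \<Rightarrow> (real \<Rightarrow> 'a::euclidean_space \<Rightarrow> 'b::euclidean_space) set" where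
  "Holder_Linf \<alpha> = {f. (\<forall>t\<in>{0..1}. f t \<in> Linf) \<and>
     (\<exists>C::real. (\<forall>t\<in>{0..1}. Linf_norm (f t) \<le> ereal C) \<and>
        (\<forall>s\<in>{0..1}. \<forall>t\<in>{0..1}.
           Linf_norm (\<lambda>x. f t x - f s x) \<le> ereal (C * \<bar>t - s\<bar> powr \<alpha>)))}"

definition L2 :: "('a::euclidean_space \<Rightarrow> 'b::euclidean_space) set" where
  "L2 = {f. f \<in> borel_measurable lborel \<and> integrable lborel (\<lambda>x. (norm (f x))\<^sup>2)}"

definition L2_norm :: "('a::euclidean_space \<Rightarrow> 'b::euclidean_space) \<Rightarrow> real" where
  "L2_norm f = sqrt (LINT x|lborel. (norm (f x))\<^sup>2)"


section \<open>The spaces \<open>H\<^sup>1\<close> and \<open>H\<^sup>-\<^sup>1\<close>\<close>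

definition has_weak_grad :: "('a::euclidean_space \<Rightarrow> real) \<Rightarrow> ('a \<Rightarrow> 'a) \<Rightarrow> bool" where
  "has_weak_grad u g \<longleftrightarrow> (\<forall>\<phi>\<in>test_functions UNIV. \<forall>b\<in>Basis.
     (LINT x|lborel. u x * frechet_derivative \<phi> (at x) b) = - (LINT x|lborel. (g x \<bullet> b) * \<phi> x))"

definition H1 :: "('a::euclidean_space \<Rightarrow> real) set" where
  "H1 = {u \<in> L2. \<exists>g\<in>L2. has_weak_grad u g}"

text \<open>For \<open>u \<in> H1\<close> the weak gradient is determined up to a null set.\<close>

definition weak_grad :: "('a::euclidean_space \<Rightarrow> real) \<Rightarrow> 'a \<Rightarrow> 'a" where
  "weak_grad u = (SOME g. g \<in> L2 \<and> has_weak_grad u g)"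

definition H1_norm :: "('a::euclidean_space \<Rightarrow> real) \<Rightarrow> real" where
  "H1_norm u = sqrt ((L2_norm u)\<^sup>2 + (L2_norm (weak_grad u))\<^sup>2)"

text \<open>\<open>H\<^sup>-\<^sup>1\<close> is the dual of \<open>H1\<close>. The values of a functional outside \<open>H1\<close> are irrelevant, so
  equality in \<open>H\<^sup>-\<^sup>1\<close> always means equality on all of \<open>H1\<close>.\<close>

definition Hm1 :: "(('a::euclidean_space \<Rightarrow> real) \<Rightarrow> real) set" where
  "Hm1 = {l. (\<forall>u\<in>H1. \<forall>v\<in>H1. l (\<lambda>x. u x + v x) = l u + l v) \<and>
             (\<forall>c. \<forall>u\<in>H1. l (\<lambda>x. c * u x) = c * l u) \<and>
             (\<exists>C. \<forall>u\<in>H1. \<bar>l u\<bar> \<le> C * H1_norm u)}"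

definition Hm1_norm :: "(('a::euclidean_space \<Rightarrow> real) \<Rightarrow> real) \<Rightarrow> real" where
  "Hm1_norm l = (SUP v \<in> {v \<in> H1. H1_norm v \<le> 1}. \<bar>l v\<bar>)"

text \<open>The embedding of \<open>L2\<close> (hence of \<open>H1\<close>) into \<open>H\<^sup>-\<^sup>1\<close>.\<close>

definition embed :: "('a::euclidean_space \<Rightarrow> real) \<Rightarrow> ('a \<Rightarrow> real) \<Rightarrow> real" where
  "embed f v = (LINT x|lborel. f x * v x)"

text \<open>The divergence of a square integrable vector field, as an element of \<open>H\<^sup>-\<^sup>1\<close>.\<close>

definition weak_div :: "('a::euclidean_space \<Rightarrow> 'a) \<Rightarrow> ('a \<Rightarrow> real) \<Rightarrow> real" where
  "weak_div p v = - (LINT x|lborel. p x \<bullet> weak_grad v x)"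


section \<open>Bochner spaces over \<open>(0,1)\<close>\<close>

abbreviation unit_time :: "real measure" where
  "unit_time \<equiv> lebesgue_on {0<..<1}"

text \<open>Strong (Bochner) measurability with respect to a space \<open>X\<close> with seminorm \<open>N\<close>: almost
  everywhere the limit of a sequence of simple functions.\<close>

definition strongly_measurable ::
  "'c::minus set \<Rightarrow> ('c \<Rightarrow> real) \<Rightarrow> (real \<Rightarrow> 'c) \<Rightarrow> bool" where
  "strongly_measurable X N f \<longleftrightarrow>
     (\<exists>s. (\<forall>n::nat. simple_function unit_time (s n) \<and> (\<forall>t\<in>{0<..<1}. s n t \<in> X)) \<and>
          (AE t in unit_time. (\<lambda>n. N (s n t - f t)) \<longlonglongrightarrow> 0))"

definition L2_Bochner ::
  "'c::minus set \<Rightarrow> ('c \<Rightarrow> real) \<Rightarrow> (real \<Rightarrow> 'c) set" where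
  "L2_Bochner X N = {f. (AE t in unit_time. f t \<in> X) \<and> strongly_measurable X N f \<and>
     integrable unit_time (\<lambda>t. (N (f t))\<^sup>2)}"

text \<open>The defining identity \<open>\<integral> \<phi>' W dt = - \<integral> \<phi> G dt\<close> of the weak time derivative is an equality of
  \<open>H\<^sup>-\<^sup>1\<close>-valued Bochner integrals, i.e. of functionals on \<open>H1\<close>, and evaluation at \<open>v\<close> commutes
  with the Bochner integral. Thus \<open>W \<in> H\<^sup>1(0,1; H\<^sup>-\<^sup>1)\<close> with \<open>\<partial>\<^sub>t W = G\<close>.\<close>

definition has_weak_time_deriv ::
  "(real \<Rightarrow> ('a::euclidean_space \<Rightarrow> real) \<Rightarrow> real) \<Rightarrow> (real \<Rightarrow> ('a \<Rightarrow> real) \<Rightarrow> real) \<Rightarrow> bool" where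
  "has_weak_time_deriv W G \<longleftrightarrow>
     W \<in> L2_Bochner Hm1 Hm1_norm \<and> G \<in> L2_Bochner Hm1 Hm1_norm \<and>
     (\<forall>\<phi>\<in>test_functions {0<..<1}. \<forall>v\<in>H1.
        (LINT t|unit_time. deriv \<phi> t * W t v) = - (LINT t|unit_time. \<phi> t * G t v))"

text \<open>The initial value of an element of \<open>H\<^sup>1(0,1; H\<^sup>-\<^sup>1)\<close> is that of its representative in
  \<open>C([0,1]; H\<^sup>-\<^sup>1)\<close>.\<close>

definition zero_initial_value ::
  "(real \<Rightarrow> ('a::euclidean_space \<Rightarrow> real) \<Rightarrow> real) \<Rightarrow> bool" where
  "zero_initial_value W \<longleftrightarrow>
     (\<exists>C. (\<forall>t\<in>{0..1}. C t \<in> Hm1 \<and> ((\<lambda>s. Hm1_norm (C s - C t)) \<longlongrightarrow> 0) (at t within {0..1})) \<and>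
          (AE t in unit_time. \<forall>v\<in>H1. C t v = W t v) \<and>
          (\<forall>v\<in>H1. C 0 v = 0))"


section \<open>Lions variational solutions\<close>

definition lions_solution ::
  "(real \<Rightarrow> real^'n \<Rightarrow> real^'n^'n) \<Rightarrow> (real \<Rightarrow> real^'n::finite \<Rightarrow> real) \<Rightarrow>
   (real \<Rightarrow> real^'n \<Rightarrow> real) \<Rightarrow> bool" where
  "lions_solution B F U \<longleftrightarrow>
     U \<in> L2_Bochner H1 H1_norm \<and>
     (\<exists>G. has_weak_time_deriv (\<lambda>t. embed (U t)) G \<and>
        (AE t in unit_time. \<forall>v\<in>H1.
           G t v - weak_div (\<lambda>x. B t x *v weak_grad (U t) x) v = embed (F t) v)) \<and>
     zero_initial_value (\<lambda>t. embed (U t))"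

definition time_deriv_in_L2L2 :: "(real \<Rightarrow> 'a::euclidean_space \<Rightarrow> real) \<Rightarrow> bool" where
  "time_deriv_in_L2L2 U \<longleftrightarrow>
     (\<exists>H \<in> L2_Bochner L2 L2_norm. has_weak_time_deriv (\<lambda>t. embed (U t)) (\<lambda>t. embed (H t)))"

end

theory Submission
  imports Defs
begin

text \<open>
  The coefficient \<open>a = 1 + \<epsilon> \<beta>\<close> is a small perturbation of \<open>1\<close>, but the modes of \<open>\<beta>\<close> are tuned to the
  heat operator: a mode with spatial frequency \<open>K\<close> oscillates in time with frequency \<open>K\<^sup>2\<close>. Fix a bump
  \<open>\<psi>\<close> on the whole space, write \<open>\<partial>\<close> for the derivative in the distinguished coordinate \<open>y\<close>, and look at
  \<open>t \<psi>\<close>. The divergence of \<open>a \<nabla>(t \<psi>)\<close> contains \<open>t \<epsilon> (\<partial>\<beta>) (\<partial>\<psi>)\<close>, and \<open>\<partial>\<beta>\<close> is a sum of \<open>j\<close> almost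
  orthogonal waves of amplitude one on the \<open>j\<close>-th time block, which has length about \<open>1 / (16 j\<^sup>2)\<close>. The
  square of its norm over the blocks is therefore comparable with the harmonic series and diverges.

  This term is not the source; it is absorbed by a corrector. The amplitude \<open>w\<close> of a mode of frequency
  \<open>K\<close> has to solve \<open>w' + K\<^sup>2 w = - \<epsilon> sin (K\<^sup>2 s)\<close>, which has the solution
  \<open>w = - \<epsilon> (sin (K\<^sup>2 s) - cos (K\<^sup>2 s)) / (2 K\<^sup>2)\<close>. It is tiny, but \<open>w'\<close> and \<open>K\<^sup>2 w\<close> both have size one: by
  resonance neither the time derivative nor the Laplacian of the corrector is small, and only their
  difference matches \<open>\<epsilon> \<partial>\<beta>\<close> (lemma \<open>resonance\<close>). With \<open>g\<close> the sum of these waves, cut off in time, put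
  \<open>U = t (\<psi> + (\<partial>\<psi>) g)\<close> and let \<open>F\<close> be what the equation then dictates. Each remaining unbounded factor
  (\<open>\<partial>\<beta>\<close> or the second derivative of \<open>g\<close>, of size \<open>j\<close>) occurs only in a product with \<open>\<beta>\<close>, \<open>g\<close> or
  \<open>\<partial>g\<close>, which are bounded by the sum of the \<open>1 / K\<close>; such products are bounded uniformly in \<open>j\<close>
  (\<open>sum_inverse_freq\<close>, \<open>wave_bounds\<close>). So \<open>F\<close> is bounded with fixed compact support
  (\<open>uniform_bounds\<close>), while \<open>\<partial>\<^sub>t U\<close> equals a bounded function minus \<open>t \<epsilon> / 2\<close> times a sum of \<open>j\<close>
  almost orthogonal waves. Testing with that sum itself shows that a square integrable time derivative
  would bound the partial sums of the harmonic series (\<open>almost_orthogonal\<close>, \<open>not_in_L2L2\<close>).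

  Uniqueness is an energy estimate for the difference \<open>W\<close> of two solutions, whose time derivative takes
  values in \<open>H\<^sup>-\<^sup>1\<close> only. Backward difference quotients of \<open>\<parallel>W\<parallel>\<^sup>2\<close> are bounded by averages over
  \<open>(t - h, t)\<close> of the equation tested with \<open>W t\<close>. After \<open>W\<close> is replaced by a simple function in the
  test slot, these averages converge as \<open>h\<close> tends to \<open>0\<close>, and the limit is nonpositive by ellipticity
  (\<open>avg_tendsto_L1\<close>, \<open>lions_solution_unique\<close>).

  The regularity in time is the interpolation inherent in the construction: over a time step \<open>\<delta>\<close> a mode
  changes by at most a multiple of the minimum of \<open>1 / K\<close> and \<open>K \<delta>\<close>, and over a geometric progression
  of frequencies these minima add up to a multiple of the square root of \<open>\<delta>\<close> (\<open>beta_Holder\<close>).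
\<close>

section \<open>Smooth functions and test functions\<close>

definition dir_deriv :: "'a::real_normed_vector \<Rightarrow> ('a \<Rightarrow> real) \<Rightarrow> 'a \<Rightarrow> real" where
  "dir_deriv v f = (\<lambda>x. frechet_derivative f (at x) v)"

lemma dir_deriv_eq:
  assumes "(f has_derivative f') (at x)" shows "dir_deriv v f x = f' v"
  unfolding dir_deriv_def using frechet_derivative_at[OF assms] by simp

lemma iter_dir_deriv_snoc: "iter_dir_deriv (vs @ [v]) f = iter_dir_deriv vs (dir_deriv v f)"
  by (induction vs) (auto simp: dir_deriv_def)

text \<open>A class of differentiable functions that is closed under directional derivatives
  consists of smooth functions. Every smoothness proof below exhibits such a class.\<close>

lemma smooth_coinduct [case_names base step]:
  assumes P: "P f"
    and step: "\<And>f. P f \<Longrightarrow> (\<forall>x. f differentiable (at x)) \<and> (\<forall>v. P (dir_deriv v f))"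
  shows "smooth f"
proof -
  have "iter_dir_deriv vs f differentiable (at x)" for vs x
    using P
  proof (induction vs arbitrary: f rule: rev_induct)
    case Nil then show ?case using step by simp
  next
    case (snoc v vs) then show ?case using step by (simp only: iter_dir_deriv_snoc)
  qed
  then show ?thesis by (simp add: smooth_def)
qed

lemma smooth_differentiable: "smooth f \<Longrightarrow> f differentiable (at x)"
  unfolding smooth_def using iter_dir_deriv.simps(1) by metis

lemma smooth_has_derivative:
  "smooth f \<Longrightarrow> (f has_derivative (\<lambda>v. dir_deriv v f x)) (at x)"
  unfolding dir_deriv_def using smooth_differentiable frechet_derivative_works by blast

lemma smooth_dir_deriv: "smooth f \<Longrightarrow> smooth (dir_deriv v f)"
  unfolding smooth_def by (metis iter_dir_deriv_snoc)

lemma smooth_continuous: "smooth f \<Longrightarrow> continuous_on S f"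
  by (meson smooth_differentiable continuous_at_imp_continuous_on differentiable_imp_continuous_within)

lemma smooth_measurable: "smooth (f :: 'a::euclidean_space \<Rightarrow> real) \<Longrightarrow> f \<in> borel_measurable borel"
  by (intro borel_measurable_continuous_onI smooth_continuous)

lemma dir_deriv_add:
  "smooth f \<Longrightarrow> smooth g \<Longrightarrow> dir_deriv v (\<lambda>x. f x + g x) = (\<lambda>x. dir_deriv v f x + dir_deriv v g x)"
  by (rule ext, rule dir_deriv_eq) (intro derivative_intros smooth_has_derivative)

lemma dir_deriv_mult:
  "smooth f \<Longrightarrow> smooth g \<Longrightarrow>
     dir_deriv v (\<lambda>x. f x * g x) = (\<lambda>x. f x * dir_deriv v g x + dir_deriv v f x * g x)"
  by (rule ext, rule dir_deriv_eq) (rule has_derivative_mult; rule smooth_has_derivative)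

lemma dir_deriv_const [simp]: "dir_deriv v (\<lambda>x. c) = (\<lambda>x. 0)"
  by (rule ext, rule dir_deriv_eq) simp

inductive smooth_ring :: "('a::real_normed_vector \<Rightarrow> real) \<Rightarrow> bool" where
  base: "smooth f \<Longrightarrow> smooth_ring f"
| add: "smooth_ring f \<Longrightarrow> smooth_ring g \<Longrightarrow> smooth_ring (\<lambda>x. f x + g x)"
| mult: "smooth_ring f \<Longrightarrow> smooth_ring g \<Longrightarrow> smooth_ring (\<lambda>x. f x * g x)"

text \<open>By the product rule, the ring generated by the smooth functions is closed under directional
  derivatives, so that coinduction applies to it.\<close>

lemma smooth_ring_smooth:
  assumes "smooth_ring f" shows "smooth f"
proof (rule smooth_coinduct[where P = smooth_ring, OF assms])
  fix f :: "'a \<Rightarrow> real"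
  assume "smooth_ring f"
  then show "(\<forall>x. f differentiable (at x)) \<and> (\<forall>v. smooth_ring (dir_deriv v f))"
  proof induction
    case (base f)
    then show ?case by (auto intro: smooth_differentiable smooth_ring.base smooth_dir_deriv)
  next
    case (add f g)
    have "dir_deriv v (\<lambda>x. f x + g x) = (\<lambda>x. dir_deriv v f x + dir_deriv v g x)" for v
      using add.IH
      by (intro ext dir_deriv_eq) (auto simp: dir_deriv_def intro!: derivative_intros
          dest: frechet_derivative_works[THEN iffD1, rule_format])
    then show ?case using add by (auto intro: smooth_ring.add)
  next
    case (mult f g)
    have "dir_deriv v (\<lambda>x. f x * g x) = (\<lambda>x. f x * dir_deriv v g x + dir_deriv v f x * g x)" for v
    proof (intro ext dir_deriv_eq)
      fix x
      have "(f has_derivative frechet_derivative f (at x)) (at x)"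
           "(g has_derivative frechet_derivative g (at x)) (at x)"
        using mult.IH frechet_derivative_works by blast+
      from has_derivative_mult[OF this]
      show "((\<lambda>x. f x * g x) has_derivative (\<lambda>v. f x * dir_deriv v g x + dir_deriv v f x * g x)) (at x)"
        by (simp add: dir_deriv_def)
    qed
    moreover have "smooth_ring (\<lambda>x. f x * dir_deriv v g x + dir_deriv v f x * g x)" for v
      by (rule smooth_ring.add; rule smooth_ring.mult) (use mult in auto)
    ultimately show ?case using mult by auto
  qed
qed

lemma smooth_add: "smooth f \<Longrightarrow> smooth g \<Longrightarrow> smooth (\<lambda>x. f x + g x)"
  by (rule smooth_ring_smooth) (blast intro: smooth_ring.intros)

lemma smooth_mult: "smooth f \<Longrightarrow> smooth g \<Longrightarrow> smooth (\<lambda>x. f x * g x)"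
  by (rule smooth_ring_smooth) (blast intro: smooth_ring.intros)

lemma smooth_const: "smooth (\<lambda>x. c)"
  by (rule smooth_coinduct[where P = "\<lambda>f. \<exists>c. f = (\<lambda>x. c)"]) auto

lemma smooth_cmult: "smooth f \<Longrightarrow> smooth (\<lambda>x. c * f x)"
  by (intro smooth_mult smooth_const)

lemma smooth_sum: "(\<And>i. i \<in> I \<Longrightarrow> smooth (f i)) \<Longrightarrow> smooth (\<lambda>x. \<Sum>i\<in>I. f i x)"
  by (induction I rule: infinite_finite_induct) (simp_all add: smooth_add smooth_const)

lemma smooth_prod: "(\<And>i. i \<in> I \<Longrightarrow> smooth (f i)) \<Longrightarrow> smooth (\<lambda>x. \<Prod>i\<in>I. f i x)"
  by (induction I rule: infinite_finite_induct) (simp_all add: smooth_mult smooth_const)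

lemma dir_deriv_cmult: "smooth f \<Longrightarrow> dir_deriv v (\<lambda>x. c * f x) = (\<lambda>x. c * dir_deriv v f x)"
  by (subst dir_deriv_mult) (auto intro: smooth_const)

lemma smooth_real_DERIV:
  fixes h :: "real \<Rightarrow> real"
  assumes "smooth h" shows "(h has_real_derivative dir_deriv 1 h x) (at x)"
proof -
  have d: "(h has_derivative (\<lambda>v. dir_deriv v h x)) (at x)" by (rule smooth_has_derivative[OF assms])
  have "(\<lambda>v. dir_deriv v h x) = (*) (dir_deriv 1 h x)"
  proof
    show "dir_deriv v h x = dir_deriv 1 h x * v" for v
      using linear_scale[OF has_derivative_linear[OF d], of v 1] by simp
  qed
  then show ?thesis using d unfolding has_field_derivative_def by metis
qed

lemma has_derivative_compose_inner:
  fixes w :: "'a::real_inner" and h :: "real \<Rightarrow> real"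
  assumes "(h has_real_derivative D) (at (x \<bullet> w + c))"
  shows "((\<lambda>x. h (x \<bullet> w + c)) has_derivative (\<lambda>v. (v \<bullet> w) * D)) (at x)"
proof -
  have "((\<lambda>x. x \<bullet> w + c) has_derivative (\<lambda>v. v \<bullet> w)) (at x)"
    by (auto intro!: derivative_eq_intros)
  from diff_chain_at[OF this assms[unfolded has_field_derivative_def]]
  show ?thesis by (simp add: o_def mult.commute)
qed

lemma dir_deriv_compose_inner:
  fixes w :: "'a::real_inner" and h :: "real \<Rightarrow> real"
  assumes "smooth h"
  shows "dir_deriv v (\<lambda>x. h (x \<bullet> w + c)) = (\<lambda>x. (v \<bullet> w) * dir_deriv 1 h (x \<bullet> w + c))"
  by (rule ext, rule dir_deriv_eq, rule has_derivative_compose_inner, rule smooth_real_DERIV[OF assms])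

lemma smooth_compose_inner:
  fixes w :: "'a::real_inner" and h :: "real \<Rightarrow> real"
  assumes "smooth h" shows "smooth (\<lambda>x. h (x \<bullet> w + c))"
proof -
  have "\<exists>a g. smooth g \<and> (\<lambda>x. h (x \<bullet> w + c)) = (\<lambda>x. a * g (x \<bullet> w + c))"
    using assms by (intro exI[of _ 1] exI[of _ h]) auto
  then show ?thesis
  proof (rule smooth_coinduct[where P = "\<lambda>f. \<exists>a g. smooth g \<and> f = (\<lambda>x. a * g (x \<bullet> w + c))"])
    fix f :: "'a \<Rightarrow> real"
    assume "\<exists>a g. smooth g \<and> f = (\<lambda>x. a * g (x \<bullet> w + c))"
    then obtain a g where g: "smooth g" and f: "f = (\<lambda>x. a * g (x \<bullet> w + c))" by blast
    have d: "(f has_derivative (\<lambda>v. a * ((v \<bullet> w) * dir_deriv 1 g (x \<bullet> w + c)))) (at x)" for x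
      unfolding f by (intro has_derivative_mult_right has_derivative_compose_inner smooth_real_DERIV g)
    have "dir_deriv v f = (\<lambda>x. (a * (v \<bullet> w)) * dir_deriv 1 g (x \<bullet> w + c))" for v
      using dir_deriv_eq[OF d] by (auto simp: mult.assoc)
    then show "(\<forall>x. f differentiable at x) \<and>
         (\<forall>v. \<exists>a g. smooth g \<and> dir_deriv v f = (\<lambda>x. a * g (x \<bullet> w + c)))"
      using d g smooth_dir_deriv by (metis differentiable_def)
  qed
qed

lemma smooth_compose_affine:
  fixes h :: "real \<Rightarrow> real"
  assumes "smooth h" shows "smooth (\<lambda>x. h (a * x + c))"
  using smooth_compose_inner[OF assms, of a c] by (simp add: mult.commute)

lemma smooth_trig: "smooth (\<lambda>x::real. a * sin x + b * cos x)"
proof (rule smooth_coinduct[where P = "\<lambda>f. \<exists>a b. f = (\<lambda>x::real. a * sin x + b * cos x)"])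
  fix f :: "real \<Rightarrow> real"
  assume "\<exists>a b. f = (\<lambda>x. a * sin x + b * cos x)"
  then obtain a b where f: "f = (\<lambda>x. a * sin x + b * cos x)" by blast
  have d: "(f has_derivative (\<lambda>v. v * (a * cos x - b * sin x))) (at x)" for x
    unfolding f by (auto intro!: derivative_eq_intros simp: algebra_simps)
  have "dir_deriv v f = (\<lambda>x. (- v * b) * sin x + (v * a) * cos x)" for v
    by (rule ext, rule dir_deriv_eq[OF d, THEN trans]) (simp add: algebra_simps)
  then show "(\<forall>x. f differentiable at x) \<and> (\<forall>v. \<exists>a b. dir_deriv v f = (\<lambda>x. a * sin x + b * cos x))"
    using d by (metis differentiable_def)
qed blast

lemma smooth_sin: "smooth (sin :: real \<Rightarrow> real)" and smooth_cos: "smooth (cos :: real \<Rightarrow> real)"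
  using smooth_trig[of 1 0] smooth_trig[of 0 1] by simp_all

lemma dir_deriv_DERIV:
  fixes h :: "real \<Rightarrow> real"
  assumes "(h has_real_derivative D) (at x)" shows "dir_deriv v h x = D * v"
  by (rule dir_deriv_eq) (use assms in \<open>simp add: has_field_derivative_def\<close>)

lemma dir_deriv_sin: "dir_deriv 1 (sin :: real \<Rightarrow> real) = cos"
  by (rule ext) (simp add: dir_deriv_DERIV[OF DERIV_sin])

lemma dir_deriv_cos: "dir_deriv 1 (cos :: real \<Rightarrow> real) = (\<lambda>x. - sin x)"
  by (rule ext) (simp add: dir_deriv_DERIV[OF DERIV_cos])

lemma support_subset_supp: "f x \<noteq> 0 \<Longrightarrow> x \<in> supp f"
  unfolding supp_def by (rule subsetD[OF closure_subset]) simp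

lemma outside_supp: "x \<notin> supp f \<Longrightarrow> f x = 0"
  using support_subset_supp by blast

lemma test_functionsD:
  assumes "f \<in> test_functions S"
  shows "smooth f" "compact (supp f)" "x \<notin> S \<Longrightarrow> f x = 0"
proof -
  show "smooth f" "compact (supp f)" using assms by (simp_all add: test_functions_def)
  show "f x = 0" if "x \<notin> S"
    using assms that support_subset_supp[of f x] by (auto simp: test_functions_def)
qed

lemma test_functionsI:
  fixes f :: "'a::euclidean_space \<Rightarrow> real"
  assumes "smooth f" "compact K" "K \<subseteq> S" "\<And>x. x \<notin> K \<Longrightarrow> f x = 0"
  shows "f \<in> test_functions S"
proof -
  have "{x. f x \<noteq> 0} \<subseteq> K" using assms(4) by blast
  then have "supp f \<subseteq> K" unfolding supp_def
    using assms(2) by (meson closure_minimal compact_imp_closed)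
  moreover then have "compact (supp f)"
    by (metis assms(2) compact_Int_closed closed_closure inf.absorb_iff2 supp_def)
  ultimately show ?thesis using assms by (simp add: test_functions_def)
qed

lemma test_functions_mult_smooth:
  fixes f :: "'a::euclidean_space \<Rightarrow> real"
  assumes "f \<in> test_functions S" "smooth g"
  shows "(\<lambda>x. g x * f x) \<in> test_functions S"
  using assms by (intro test_functionsI[of _ "supp f"])
    (simp_all add: test_functions_def smooth_mult outside_supp)

lemma test_functions_cmult:
  fixes f :: "'a::euclidean_space \<Rightarrow> real"
  shows "f \<in> test_functions S \<Longrightarrow> (\<lambda>x. c * f x) \<in> test_functions S"
  by (intro test_functions_mult_smooth smooth_const)

lemma test_functions_add:
  fixes f g :: "'a::euclidean_space \<Rightarrow> real"
  assumes "f \<in> test_functions S" "g \<in> test_functions S"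
  shows "(\<lambda>x. f x + g x) \<in> test_functions S"
  using assms by (intro test_functionsI[of _ "supp f \<union> supp g"])
    (simp_all add: test_functions_def smooth_add compact_Un outside_supp)

lemma dir_deriv_outside_supp:
  assumes "x \<notin> supp f" shows "dir_deriv v f x = 0"
proof (rule dir_deriv_eq)
  have "open (- supp f)" by (simp add: supp_def open_Compl)
  moreover have "f y = 0" if "y \<in> - supp f" for y using that support_subset_supp by force
  ultimately show "(f has_derivative (\<lambda>v. 0)) (at x)"
    using has_derivative_transform_within_open[of "\<lambda>_. 0" "\<lambda>_. 0" x UNIV "- supp f" f] assms by auto
qed

lemma test_functions_dir_deriv:
  fixes f :: "'a::euclidean_space \<Rightarrow> real"
  assumes "f \<in> test_functions S" shows "dir_deriv v f \<in> test_functions S"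
  using assms by (intro test_functionsI[of _ "supp f"])
    (auto simp: test_functions_def smooth_dir_deriv dir_deriv_outside_supp)

lemma test_functions_bounded:
  fixes f :: "'a::euclidean_space \<Rightarrow> real"
  assumes "f \<in> test_functions S"
  obtains M where "\<And>x. \<bar>f x\<bar> \<le> M" "M > 0"
proof -
  have "compact (f ` supp f)"
    using test_functionsD[OF assms] by (intro compact_continuous_image smooth_continuous)
  then have "bounded (f ` supp f)" by (rule compact_imp_bounded)
  then obtain M where "\<forall>y\<in>f ` supp f. norm y \<le> M" unfolding bounded_iff by blast
  then have M: "\<And>x. x \<in> supp f \<Longrightarrow> \<bar>f x\<bar> \<le> M" by simp
  show thesis
  proof
    show "\<bar>f x\<bar> \<le> max M 1" for x
      using M[of x] support_subset_supp[of f x] by (cases "f x = 0") auto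
  qed auto
qed

lemma integrable_bounded_support:
  fixes f :: "'a::euclidean_space \<Rightarrow> 'b::{banach, second_countable_topology}"
  assumes "f \<in> borel_measurable borel" "bounded K" "\<And>x. x \<notin> K \<Longrightarrow> f x = 0" "\<And>x. norm (f x) \<le> M"
  shows "integrable lborel f"
proof -
  obtain a where a: "K \<subseteq> cbox (-a) a" using bounded_subset_cbox_symmetric[OF assms(2)] by blast
  have i: "integrable lborel (\<lambda>x. indicat_real (cbox (-a) a) x * M)"
    by (intro integrable_mult_left integrable_real_indicator) (auto simp: emeasure_lborel_cbox_finite[unfolded infinity_ennreal_def])
  show ?thesis
    by (rule Bochner_Integration.integrable_bound[OF i])
      (use assms a in \<open>auto simp: indicator_def intro!: AE_I2 order_trans[OF assms(4)]\<close>)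
qed

lemma test_functions_integrable:
  fixes f :: "'a::euclidean_space \<Rightarrow> real"
  assumes "f \<in> test_functions S" shows "integrable lborel f"
proof -
  obtain M where M: "\<And>x. \<bar>f x\<bar> \<le> M" "M > 0" using test_functions_bounded[OF assms] by blast
  show ?thesis
    using test_functionsD[OF assms] M(1)
    by (intro integrable_bounded_support[of _ "supp f" M])
      (simp_all add: smooth_measurable compact_imp_bounded outside_supp)
qed

lemma lborel_integral_translate:
  fixes f :: "'a::euclidean_space \<Rightarrow> real"
  shows "(LINT x|lborel. f (c + x)) = (LINT x|lborel. f x)"
proof (cases "f \<in> borel_measurable borel")
  case True
  then show ?thesis using integral_distr[of "(+) c" lborel borel f] by (simp add: lborel_distr_plus)
next
  case False
  have "(\<lambda>x. f (c + x)) \<notin> borel_measurable borel"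
  proof
    assume m: "(\<lambda>x. f (c + x)) \<in> borel_measurable borel"
    have "(\<lambda>x. f (c + (x - c))) \<in> borel_measurable borel" using m by measurable
    then show False using False by simp
  qed
  then show ?thesis using False
    by (metis borel_measurable_integrable measurable_lborel2 not_integrable_integral_eq)
qed

text \<open>The integral of the difference quotient vanishes by translation invariance; on the compact
  support the difference quotients are dominated.\<close>

lemma integral_dir_deriv_test_function:
  fixes f :: "'a::euclidean_space \<Rightarrow> real"
  assumes f: "f \<in> test_functions S"
  shows "(LINT x|lborel. dir_deriv v f x) = 0"
proof -
  obtain M where M: "\<And>x. \<bar>dir_deriv v f x\<bar> \<le> M" "M > 0"
    using test_functions_bounded[OF test_functions_dir_deriv[OF f]] by blast
  have sm: "smooth f" and cK: "compact (supp f)" using test_functionsD[OF f] by auto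
  obtain R where R: "\<And>x. x \<in> supp f \<Longrightarrow> norm x \<le> R"
    using compact_imp_bounded[OF cK] unfolding bounded_iff by blast
  define q where "q n x = (f (x + (1 / Suc n) *\<^sub>R v) - f x) * Suc n" for n x
  have meas [measurable]: "f \<in> borel_measurable borel" by (rule smooth_measurable[OF sm])
  have "(\<lambda>n. LINT x|lborel. q n x) \<longlonglongrightarrow> (LINT x|lborel. dir_deriv v f x)"
  proof (rule integral_dominated_convergence)
    show "integrable lborel (\<lambda>x. indicat_real (cball (0::'a) (R + norm v)) x * M)"
      by (intro integrable_bounded_support[of _ "cball 0 (R + norm v)" M])
        (use M in \<open>auto simp: indicator_def\<close>)
    show "dir_deriv v f \<in> borel_measurable lborel"
      using smooth_measurable[OF smooth_dir_deriv[OF sm]] by simp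
    show "q n \<in> borel_measurable lborel" for n unfolding q_def by measurable
    show "AE x in lborel. (\<lambda>n. q n x) \<longlonglongrightarrow> dir_deriv v f x"
    proof (rule AE_I2)
      fix x
      have "((\<lambda>t. f (x + t *\<^sub>R v)) has_real_derivative dir_deriv v f x) (at 0)"
      proof -
        have "((\<lambda>t::real. x + t *\<^sub>R v) has_derivative (\<lambda>t. t *\<^sub>R v)) (at 0)"
          by (auto intro!: derivative_eq_intros)
        moreover have "(f has_derivative (\<lambda>v. dir_deriv v f x)) (at (x + 0 *\<^sub>R v))"
          using smooth_has_derivative[OF sm] by simp
        ultimately have "(f \<circ> (\<lambda>t. x + t *\<^sub>R v) has_derivative (\<lambda>v. dir_deriv v f x) \<circ> (\<lambda>t. t *\<^sub>R v)) (at 0)"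
          by (rule diff_chain_at)
        moreover have "dir_deriv (t *\<^sub>R v) f x = dir_deriv v f x * t" for t
          using linear_scale[OF has_derivative_linear[OF smooth_has_derivative[OF sm, of x]]] by simp
        ultimately show ?thesis by (simp add: has_field_derivative_def o_def)
      qed
      then have lim: "((\<lambda>h. (f (x + h *\<^sub>R v) - f x) / h) \<longlongrightarrow> dir_deriv v f x) (at 0)"
        by (simp add: DERIV_def)
      have "filterlim (\<lambda>n. 1 / real (Suc n)) (at 0) sequentially"
        unfolding filterlim_at using LIMSEQ_inverse_real_of_nat by (auto simp: inverse_eq_divide)
      from filterlim_compose[OF lim this]
      show "(\<lambda>n. q n x) \<longlonglongrightarrow> dir_deriv v f x" by (simp add: q_def field_simps)
    qed
    show "AE x in lborel. norm (q n x) \<le> indicat_real (cball 0 (R + norm v)) x * M" for n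
    proof (rule AE_I2)
      fix x
      let ?h = "1 / real (Suc n)"
      have h: "0 < ?h" "?h \<le> 1" by auto
      show "norm (q n x) \<le> indicat_real (cball 0 (R + norm v)) x * M"
      proof (cases "x \<in> cball 0 (R + norm v)")
        case False
        have "norm (x + ?h *\<^sub>R v) \<ge> norm x - norm (?h *\<^sub>R v)" using norm_diff_ineq by blast
        moreover have "norm (?h *\<^sub>R v) \<le> norm v" using h mult_left_le_one_le[of "norm v" ?h] by simp
        ultimately have "norm (x + ?h *\<^sub>R v) > R" "norm x > R"
          using False norm_ge_zero[of v] by (auto simp del: norm_ge_zero)
        then have "f x = 0" "f (x + ?h *\<^sub>R v) = 0" using R support_subset_supp[of f] by force+
        then show ?thesis using False by (simp add: q_def)
      next
        case True
        have "((\<lambda>t. f (x + t *\<^sub>R v)) has_real_derivative dir_deriv v f (x + t *\<^sub>R v)) (at t)" for t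
        proof -
          have "((\<lambda>t::real. x + t *\<^sub>R v) has_derivative (\<lambda>t. t *\<^sub>R v)) (at t)"
            by (auto intro!: derivative_eq_intros)
          from diff_chain_at[OF this smooth_has_derivative[OF sm]]
          have "(f \<circ> (\<lambda>t. x + t *\<^sub>R v) has_derivative (\<lambda>w. dir_deriv w f (x + t *\<^sub>R v)) \<circ> (\<lambda>t. t *\<^sub>R v)) (at t)" .
          moreover have "dir_deriv (s *\<^sub>R v) f y = dir_deriv v f y * s" for s y
            using linear_scale[OF has_derivative_linear[OF smooth_has_derivative[OF sm, of y]]] by simp
          ultimately show ?thesis by (simp add: has_field_derivative_def o_def)
        qed
        from MVT2[OF h(1), of "\<lambda>t. f (x + t *\<^sub>R v)", OF this]
        obtain z where "f (x + ?h *\<^sub>R v) - f x = ?h * dir_deriv v f (x + z *\<^sub>R v)" by auto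
        then have "q n x = dir_deriv v f (x + z *\<^sub>R v)" by (simp add: q_def)
        then show ?thesis using True M by simp
      qed
    qed
  qed
  moreover have "(LINT x|lborel. q n x) = 0" for n
  proof -
    have i: "integrable lborel f" by (rule test_functions_integrable[OF f])
    have tr: "(LINT x|lborel. f (x + (1 / Suc n) *\<^sub>R v)) = (LINT x|lborel. f x)"
      using lborel_integral_translate[of f "(1 / Suc n) *\<^sub>R v"] by (simp add: add.commute)
    have i2: "integrable lborel (\<lambda>x. f (x + (1 / Suc n) *\<^sub>R v))"
    proof -
      have "integrable (distr lborel borel ((+) ((1 / Suc n) *\<^sub>R v))) f" using i by (simp add: lborel_distr_plus)
      then show ?thesis by (subst (asm) integrable_distr_eq) (auto simp: add.commute)
    qed
    show ?thesis unfolding q_def using i i2 tr by simp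
  qed
  ultimately show ?thesis by (simp add: LIMSEQ_const_iff)
qed

lemma integral_by_parts_test_function:
  fixes f g :: "'a::euclidean_space \<Rightarrow> real"
  assumes f: "f \<in> test_functions S" and g: "smooth g"
  shows "(LINT x|lborel. g x * dir_deriv v f x) = - (LINT x|lborel. dir_deriv v g x * f x)"
proof -
  have sf: "smooth f" using f by (rule test_functionsD)
  have "dir_deriv v (\<lambda>x. g x * f x) = (\<lambda>x. g x * dir_deriv v f x + dir_deriv v g x * f x)"
    by (rule dir_deriv_mult[OF g sf])
  then have "0 = (LINT x|lborel. g x * dir_deriv v f x + dir_deriv v g x * f x)"
    using integral_dir_deriv_test_function[OF test_functions_mult_smooth[OF f g], of v] by simp
  also have "\<dots> = (LINT x|lborel. g x * dir_deriv v f x) + (LINT x|lborel. dir_deriv v g x * f x)"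
  proof (rule Bochner_Integration.integral_add)
    show "integrable lborel (\<lambda>x. g x * dir_deriv v f x)"
      by (rule test_functions_integrable[OF test_functions_mult_smooth[OF test_functions_dir_deriv[OF f] g]])
    show "integrable lborel (\<lambda>x. dir_deriv v g x * f x)"
      by (rule test_functions_integrable[OF test_functions_mult_smooth[OF f smooth_dir_deriv[OF g]]])
  qed
  finally show ?thesis by simp
qed

section \<open>Smooth approximations of indicators and the fundamental lemma\<close>

lemma smooth_if_dir_deriv_smooth:
  assumes "\<And>x. f differentiable (at x)" "\<And>v. smooth (dir_deriv v f)"
  shows "smooth f"
  by (rule smooth_coinduct[where P = "\<lambda>g. g = f \<or> smooth g"])
    (use assms smooth_differentiable smooth_dir_deriv in \<open>blast+\<close>)

locale smooth_cutoff =
  fixes \<eta> :: "real \<Rightarrow> real"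
  assumes cutoff: "cutoff \<eta>"
begin

lemma eta_test: "\<eta> \<in> test_functions {0<..<1}" and eta_nonneg: "0 \<le> \<eta> t" and eta_le_1: "\<eta> t \<le> 1"
  and eta_one: "1/3 \<le> t \<Longrightarrow> t \<le> 2/3 \<Longrightarrow> \<eta> t = 1"
  using cutoff by (auto simp: cutoff_def)

lemma eta_supp: "t \<notin> {1/10..9/10} \<Longrightarrow> \<eta> t = 0"
  using cutoff support_subset_supp[of \<eta> t] unfolding cutoff_def by blast

lemma eta_smooth: "smooth \<eta>"
  using eta_test by (rule test_functionsD)

lemma eta_continuous: "continuous_on S \<eta>"
  by (rule smooth_continuous[OF eta_smooth])

lemma eta_zero: "t \<le> 0 \<or> 1 \<le> t \<Longrightarrow> \<eta> t = 0"
  by (rule eta_supp) auto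

definition mass :: real where "mass = integral {-1..1} \<eta>"

text \<open>A smooth step from \<open>0\<close> to \<open>1\<close> across the unit interval. Steep
  copies of it approximate indicators.\<close>

definition smooth_step :: "real \<Rightarrow> real" where
  "smooth_step x = integral {-1..x} \<eta> / mass"

lemma eta_integrable_on: "\<eta> integrable_on {a..b}"
  by (rule integrable_continuous_real[OF eta_continuous])

lemma mass_pos: "mass > 0"
proof -
  have "integral {1/3..2/3::real} (\<lambda>_. 1::real) \<le> integral {1/3..2/3} \<eta>"
    by (rule integral_le) (auto simp: eta_integrable_on eta_one)
  also have "\<dots> \<le> mass" unfolding mass_def
    by (rule integral_subset_le) (auto simp: eta_integrable_on eta_nonneg)
  finally show ?thesis by simp
qed

lemma smooth_step_nonneg: "0 \<le> smooth_step x"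
  unfolding smooth_step_def using mass_pos
  by (intro divide_nonneg_pos integral_nonneg) (auto simp: eta_integrable_on eta_nonneg)

lemma smooth_step_left: assumes "x \<le> 0" shows "smooth_step x = 0"
proof -
  have "integral {-1..x} \<eta> = integral {-1..x} (\<lambda>_. 0)"
    by (rule integral_cong) (use assms in \<open>auto simp: eta_zero\<close>)
  then show ?thesis by (simp add: smooth_step_def)
qed

lemma smooth_step_right: assumes "1 \<le> x" shows "smooth_step x = 1"
proof -
  have "integral {1..x} \<eta> = integral {1..x} (\<lambda>_. 0)"
    by (rule integral_cong) (auto simp: eta_zero)
  then have "integral {-1..x} \<eta> = mass"
    using Henstock_Kurzweil_Integration.integral_combine[of "-1" 1 x \<eta>] assms eta_integrable_on by (simp add: mass_def)
  then show ?thesis using mass_pos by (simp add: smooth_step_def)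
qed

lemma smooth_step_le_1: "smooth_step x \<le> 1"
proof (cases "1 \<le> x")
  case False
  then have "integral {-1..x} \<eta> \<le> mass" unfolding mass_def
    by (intro integral_subset_le) (auto simp: eta_integrable_on eta_nonneg)
  then show ?thesis using mass_pos by (simp add: smooth_step_def)
qed (simp add: smooth_step_right)

lemma smooth_step_DERIV: "(smooth_step has_real_derivative \<eta> x / mass) (at x)"
proof (cases "x < 0")
  case True
  have "((\<lambda>_. 0) has_real_derivative \<eta> x / mass) (at x)"
    using True by (simp add: eta_zero)
  moreover have "open {..<0::real}" by simp
  ultimately show ?thesis
    by (rule has_field_derivative_transform_within_open) (use True smooth_step_left in auto)
next
  case False
  have "((\<lambda>x. integral {-1..x} \<eta>) has_real_derivative \<eta> x) (at x within {-1..x+1})"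
    by (rule integral_has_real_derivative) (use False in \<open>auto simp: eta_continuous\<close>)
  moreover have "at x within {-1..x+1} = at x" by (rule at_within_interior) (use False in simp)
  ultimately have "((\<lambda>x. integral {-1..x} \<eta>) has_real_derivative \<eta> x) (at x)" by simp
  then have "((\<lambda>x. integral {-1..x} \<eta> / mass) has_real_derivative \<eta> x / mass) (at x)"
    by (rule DERIV_cdivide)
  then show ?thesis by (simp add: smooth_step_def[abs_def])
qed

lemma smooth_step_smooth: "smooth smooth_step"
proof (rule smooth_if_dir_deriv_smooth)
  show "smooth_step differentiable (at x)" for x
    using smooth_step_DERIV[of x] unfolding has_field_derivative_def differentiable_def by blast
  have "dir_deriv v smooth_step = (\<lambda>x. (v / mass) * \<eta> x)" for v
    by (rule ext) (simp add: dir_deriv_DERIV[OF smooth_step_DERIV])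
  then show "smooth (dir_deriv v smooth_step)" for v
    using smooth_cmult[OF eta_smooth, of "v / mass"] by simp
qed

text \<open>For growing \<open>n\<close> these test functions converge to the indicator of the open
  box from inside, so their supports stay in the closed box.\<close>

definition box_bump :: "nat \<Rightarrow> 'a::euclidean_space \<Rightarrow> 'a \<Rightarrow> 'a \<Rightarrow> real" where
  "box_bump n a b x = (\<Prod>i\<in>Basis. smooth_step (n * (x \<bullet> i - a \<bullet> i)) * smooth_step (n * (b \<bullet> i - x \<bullet> i)))"

lemma box_bump_outside: assumes "x \<notin> box a b" shows "box_bump n a b x = 0"
proof -
  obtain i where i: "i \<in> Basis" "x \<bullet> i \<le> a \<bullet> i \<or> b \<bullet> i \<le> x \<bullet> i"
    using assms by (auto simp: mem_box not_less)
  then have "smooth_step (n * (x \<bullet> i - a \<bullet> i)) = 0 \<or> smooth_step (n * (b \<bullet> i - x \<bullet> i)) = 0"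
    using smooth_step_left by (auto simp: mult_nonneg_nonpos)
  then show ?thesis using i(1) by (auto simp: box_bump_def)
qed

lemma box_bump_bounds: "0 \<le> box_bump n a b x" "box_bump n a b x \<le> 1"
  unfolding box_bump_def
  by (auto intro!: prod_nonneg prod_le_1 mult_le_one mult_nonneg_nonneg simp: smooth_step_nonneg smooth_step_le_1)

lemma box_bump_test: "box_bump n a b \<in> test_functions UNIV"
proof (rule test_functionsI[of _ "cbox a b"])
  have 1: "smooth (\<lambda>x::'a. smooth_step (n * (x \<bullet> i - a \<bullet> i)))" for i
    using smooth_compose_inner[OF smooth_step_smooth, of "real n *\<^sub>R i" "- (n * (a \<bullet> i))"]
    by (simp add: algebra_simps)
  have 2: "smooth (\<lambda>x::'a. smooth_step (n * (b \<bullet> i - x \<bullet> i)))" for i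
    using smooth_compose_inner[OF smooth_step_smooth, of "- real n *\<^sub>R i" "n * (b \<bullet> i)"]
    by (simp add: algebra_simps)
  show "smooth (box_bump n a b)" unfolding box_bump_def[abs_def]
    by (intro smooth_prod smooth_mult 1 2)
  show "x \<notin> cbox a b \<Longrightarrow> box_bump n a b x = 0" for x
    using box_bump_outside[of x a b n] box_subset_cbox by blast
qed auto

lemma box_bump_tendsto: "(\<lambda>n. box_bump n a b x) \<longlonglongrightarrow> indicat_real (box a b) x"
proof (cases "x \<in> box a b")
  case True
  have ev: "eventually (\<lambda>n. smooth_step (real n * c) = 1) sequentially" if "c > 0" for c
  proof -
    obtain N where "1 / c < real N" using reals_Archimedean2 by blast
    then have "smooth_step (real n * c) = 1" if "n \<ge> N" for n
    proof -
      have "1 / c < real n" using \<open>1 / c < real N\<close> that by simp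
      then show ?thesis using \<open>c > 0\<close> by (intro smooth_step_right) (simp add: field_simps)
    qed
    then show ?thesis unfolding eventually_sequentially by blast
  qed
  have "eventually (\<lambda>n. \<forall>i\<in>Basis. smooth_step (n * (x \<bullet> i - a \<bullet> i)) * smooth_step (n * (b \<bullet> i - x \<bullet> i)) = 1) sequentially"
  proof (intro eventually_ball_finite ballI)
    fix i :: 'a assume "i \<in> Basis"
    then have "x \<bullet> i - a \<bullet> i > 0" "b \<bullet> i - x \<bullet> i > 0" using True by (auto simp: mem_box)
    from ev[OF this(1)] ev[OF this(2)]
    show "eventually (\<lambda>n. smooth_step (n * (x \<bullet> i - a \<bullet> i)) * smooth_step (n * (b \<bullet> i - x \<bullet> i)) = 1) sequentially"
      by eventually_elim simp
  qed auto
  then have "eventually (\<lambda>n. box_bump n a b x = 1) sequentially"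
    by eventually_elim (simp add: box_bump_def)
  then show ?thesis using True by (simp add: tendsto_eventually)
qed (simp add: box_bump_outside)

end

text \<open>Boxes form an intersection-stable generator of the Borel sets. Inside a fixed bounded
  box, where the function is integrable, the Dynkin class of sets with vanishing integral is
  therefore everything; bounded boxes exhaust the space.\<close>

lemma AE_zero_if_box_integrals_zero:
  fixes f :: "'a::euclidean_space \<Rightarrow> real"
  assumes [measurable]: "f \<in> borel_measurable borel"
    and int: "\<And>a b. set_integrable lborel (box a b) f"
    and zero: "\<And>a b. (LINT x:box a b|lborel. f x) = 0"
  shows "AE x in lborel. f x = 0"
proof -
  have main: "AE x in lborel. indicat_real (box c d) x * f x = 0" for c d :: 'a
  proof (rule sigma_finite_measure.density_zero[OF sigma_finite_lborel])
    let ?g = "\<lambda>x. indicat_real (box c d) x * f x"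
    show ig: "integrable lborel ?g" using int[of c d] by (simp add: set_integrable_def)
    have sg: "set_integrable lborel A ?g" if "A \<in> sets borel" for A
      unfolding set_integrable_def using that ig by (intro integrable_mult_indicator) auto
    fix A :: "'a set" assume "A \<in> sets lborel"
    then have A: "A \<in> sigma_sets UNIV (range (\<lambda>(a, b). box a b))" by (simp add: borel_eq_box)
    have Is: "Int_stable (range (\<lambda>(a, b). box a b :: 'a set))" by (auto simp: Int_stable_def box_Int_box)
    have tot: "(LINT x:UNIV|lborel. ?g x) = 0"
      using zero[of c d] by (simp add: set_lebesgue_integral_def)
    have "range (\<lambda>(a, b). box a b :: 'a set) \<subseteq> Pow UNIV" by simp
    from Is this A show "(LINT x:A|lborel. ?g x) = 0"
    proof (induction rule: sigma_sets_induct_disjoint)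
      case (basic A)
      then obtain a b where A: "A = box a b" by auto
      have "(LINT x:A|lborel. ?g x) = (LINT x:(box a b \<inter> box c d)|lborel. f x)"
        by (simp add: A set_lebesgue_integral_def indicator_inter_arith mult.assoc)
      then show ?case by (simp add: box_Int_box zero)
    next
      case empty then show ?case by (simp add: set_lebesgue_integral_def)
    next
      case (compl A)
      then have "A \<in> sets borel" by (simp add: borel_eq_box)
      then have "(LINT x:(UNIV - A)|lborel. ?g x) = (LINT x:UNIV|lborel. ?g x) - (LINT x:A|lborel. ?g x)"
        using Bochner_Integration.integral_diff[OF sg[of UNIV, unfolded set_integrable_def] sg[of A, unfolded set_integrable_def]]
        by (simp add: set_lebesgue_integral_def indicator_diff left_diff_distrib)
      then show ?case using compl tot by simp
    next
      case (union A)
      then have "A i \<in> sets borel" for i by (auto simp: borel_eq_box)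
      then have "(LINT x:(\<Union>i. A i)|lborel. ?g x) = (\<Sum>i. (LINT x:A i|lborel. ?g x))"
        using union by (intro lebesgue_integral_countable_add sg) (auto simp: disjoint_family_on_def)
      then show ?case using union by simp
    qed
  qed
  have "AE x in lborel. \<forall>n::nat. indicat_real (box (- real n *\<^sub>R One) (real n *\<^sub>R One)) x * f x = 0"
    unfolding AE_all_countable using main by blast
  then show ?thesis
  proof eventually_elim
    case (elim x)
    obtain n :: nat where "norm x < real n" using reals_Archimedean2 by blast
    then have "x \<in> box (- real n *\<^sub>R One) (real n *\<^sub>R One)"
      using Basis_le_norm[of _ x] by (force simp: mem_box abs_less_iff)
    then show ?case using elim[rule_format, of n] by simp
  qed
qed

context smooth_cutoff
begin

text \<open>Testing with the functions \<open>box_bump\<close> and passing to the limit gives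
  vanishing integrals over all boxes.\<close>

lemma fundamental_lemma:
  fixes f :: "'a::euclidean_space \<Rightarrow> real"
  assumes m [measurable]: "f \<in> borel_measurable borel"
    and int: "\<And>a b. set_integrable lborel (box a b) f"
    and zero: "\<And>\<phi>. \<phi> \<in> test_functions UNIV \<Longrightarrow> (LINT x|lborel. f x * \<phi> x) = 0"
  shows "AE x in lborel. f x = 0"
proof (rule AE_zero_if_box_integrals_zero[OF m int])
  fix a b :: 'a
  have "(\<lambda>n. LINT x|lborel. f x * box_bump n a b x) \<longlonglongrightarrow> (LINT x|lborel. f x * indicat_real (box a b) x)"
  proof (rule integral_dominated_convergence)
    show "integrable lborel (\<lambda>x. norm (indicat_real (box a b) x * f x))"
      using int[of a b] by (simp add: set_integrable_def)
    show "(\<lambda>x. f x * box_bump n a b x) \<in> borel_measurable lborel" for n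
      using smooth_measurable[OF test_functionsD(1)[OF box_bump_test]] by measurable
    show "AE x in lborel. norm (f x * box_bump n a b x) \<le> norm (indicat_real (box a b) x * f x)" for n
    proof (rule AE_I2)
      fix x
      show "norm (f x * box_bump n a b x) \<le> norm (indicat_real (box a b) x * f x)"
        using box_bump_bounds[of n a b x] box_bump_outside[of x a b n]
        by (cases "x \<in> box a b") (auto simp: abs_mult mult_left_le)
    qed
  qed (auto intro!: tendsto_intros box_bump_tendsto)
  then have "(LINT x|lborel. f x * indicat_real (box a b) x) = 0"
    using zero[OF box_bump_test] by (simp add: LIMSEQ_const_iff)
  then show "(LINT x:box a b|lborel. f x) = 0" by (simp add: set_lebesgue_integral_def mult.commute)
qed

end

text \<open>Integrals in time occur as Lebesgue integrals in the definitions and as gauge integrals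
  in the calculus; this passes between the two.\<close>

lemma unit_time_integral_interval:
  fixes \<gamma> :: "real \<Rightarrow> real"
  assumes int: "integrable unit_time \<gamma>" and ab: "0 \<le> a" "a \<le> b" "b \<le> 1"
  shows "\<gamma> integrable_on {a..b}"
    "integral {a..b} \<gamma> = (LINT t|unit_time. indicat_real {a<..b} t * \<gamma> t)"
proof -
  have "indicat_real {a<..b} \<in> borel_measurable unit_time"
    by (intro measurable_restrict_space1 measurable_completion) simp
  then have i2: "integrable unit_time (\<lambda>t. indicat_real {a<..b} t * \<gamma> t)"
    using int by (intro Bochner_Integration.integrable_bound[OF int] borel_measurable_times AE_I2)
      (simp_all add: indicator_times_eq_if abs_mult mult_left_le_one_le)
  have eq: "(\<lambda>t. indicat_real {a<..b} t * \<gamma> t) = (\<lambda>t. if t \<in> {a<..b} then \<gamma> t else 0)"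
    by (auto simp: indicator_def)
  have "\<gamma> integrable_on {0<..<1}"
    by (rule integrable_on_lebesgue_on[OF int]) simp
  then have "\<gamma> integrable_on {0..1}"
    by (simp add: integrable_on_open_interval_real)
  then show "\<gamma> integrable_on {a..b}"
    by (rule integrable_on_subinterval) (use ab in auto)
  have "(LINT t|unit_time. indicat_real {a<..b} t * \<gamma> t) = integral {0<..<1} (\<lambda>t. indicat_real {a<..b} t * \<gamma> t)"
    by (rule lebesgue_integral_eq_integral[OF i2]) simp
  also have "\<dots> = integral ({a<..b} \<inter> {0<..<1}) \<gamma>"
    unfolding eq by (rule Henstock_Kurzweil_Integration.integral_restrict_Int)
  also have "\<dots> = integral {a..b} \<gamma>"
  proof (rule integral_spike_set)
    show "negligible {x \<in> ({a<..b} \<inter> {0<..<1}) - {a..b}. \<gamma> x \<noteq> 0}"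
      "negligible {x \<in> {a..b} - ({a<..b} \<inter> {0<..<1}). \<gamma> x \<noteq> 0}"
      by (rule negligible_subset[of "{a, b}"]; use ab in auto)+
  qed
  finally show "integral {a..b} \<gamma> = (LINT t|unit_time. indicat_real {a<..b} t * \<gamma> t)" by simp
qed

context smooth_cutoff
begin

text \<open>The difference of two steep steps, located at \<open>a\<close> and at \<open>b\<close>,
  converges to the indicator of the interval while its derivative concentrates at the end points.
  This gives the identity inside the open interval; continuity extends it to the closed one.\<close>

lemma weak_derivative_imp_integral:
  fixes w \<gamma> :: "real \<Rightarrow> real"
  assumes w: "continuous_on {0..1} w" and \<gamma>: "integrable unit_time \<gamma>"
    and weak: "\<And>\<phi>. \<phi> \<in> test_functions {0<..<1} \<Longrightarrow>
      (LINT t|unit_time. deriv \<phi> t * w t) = - (LINT t|unit_time. \<phi> t * \<gamma> t)"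
    and ab: "0 \<le> a" "a \<le> b" "b \<le> 1"
  shows "w b - w a = integral {a..b} \<gamma>"
proof -
  have inner: "w b - w a = integral {a..b} \<gamma>" if ab: "0 < a" "a < b" "b < 1" for a b
  proof -
    \<comment> \<open>for large \<open>n\<close> the ramps, of width \<open>1 / n\<close>, fit into \<open>(a, b + 1 / n)\<close>, inside the unit interval\<close>
    define \<phi> where "\<phi> n t = smooth_step (real n * t + - (real n * a)) - smooth_step (real n * t + - (real n * b))" for n t
    obtain N where N: "1 / (1 - b) < real N" using reals_Archimedean2 by blast
    have N0: "n > 0" "b + 1 / n < 1" if "n \<ge> N" for n
    proof -
      have "1 / (1 - b) < real n" using N that by simp
      moreover have "0 < 1 / (1 - b)" using ab by simp
      ultimately have "0 < real n" by linarith
      then show "n > 0" by simp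
      with \<open>1 / (1 - b) < real n\<close> show "b + 1 / n < 1" using ab by (simp add: field_simps)
    qed
    have test: "\<phi> n \<in> test_functions {0<..<1}" if n: "n \<ge> N" for n
    proof (rule test_functionsI[of _ "{a..b + 1/n}"])
      have "smooth (\<lambda>t. smooth_step (real n * t + - (real n * a)) + (-1) * smooth_step (real n * t + - (real n * b)))"
        by (intro smooth_add smooth_cmult smooth_compose_affine smooth_step_smooth)
      then show "smooth (\<phi> n)" by (simp add: \<phi>_def[abs_def])
      show "{a..b + 1/n} \<subseteq> {0<..<1}" using N0[OF n] ab by auto
      show "\<phi> n t = 0" if "t \<notin> {a..b + 1/n}" for t
      proof (cases "t < a")
        case True
        then have "real n * t \<le> real n * a" "real n * t \<le> real n * b"
          using ab by (auto intro!: mult_left_mono)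
        then show ?thesis by (simp add: \<phi>_def smooth_step_left)
      next
        case False
        then have "b + 1/n \<le> t" using that by auto
        then have "real n * b + 1 \<le> real n * t" using N0(1)[OF n] by (simp add: field_simps)
        moreover have "real n * a \<le> real n * b" using ab by (auto intro!: mult_left_mono)
        ultimately show ?thesis by (simp add: \<phi>_def smooth_step_right)
      qed
    qed auto
    have deriv: "deriv (\<phi> n) t = (n * \<eta> (n * (t - a)) - n * \<eta> (n * (t - b))) / mass" for n t
    proof (rule DERIV_imp_deriv)
      have "((\<lambda>t. smooth_step (real n * t + - (real n * c))) has_real_derivative
              (\<eta> (real n * t + - (real n * c)) / mass) * n) (at t)" for c
        by (rule DERIV_chain2[OF smooth_step_DERIV]) (auto intro!: derivative_eq_intros)
      from DERIV_diff[OF this[of a] this[of b]]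
      show "(\<phi> n has_real_derivative (n * \<eta> (n * (t - a)) - n * \<eta> (n * (t - b))) / mass) (at t)"
        by (simp add: \<phi>_def[abs_def] algebra_simps diff_divide_distrib)
    qed
    define w' where "w' t = indicat_real {0..1} t * w t" for t
    have w'm [measurable]: "w' \<in> borel_measurable borel"
      using borel_measurable_continuous_on_indicator[OF _ w] by (simp add: w'_def[abs_def])
    obtain M where M: "\<And>t. t \<in> {0..1} \<Longrightarrow> \<bar>w t\<bar> \<le> M"
      using compact_imp_bounded[OF compact_continuous_image[OF w compact_Icc]] unfolding bounded_iff by fastforce
    have w'M: "\<bar>w' t\<bar> \<le> \<bar>M\<bar>" for t using M[of t] by (auto simp: w'_def indicator_def)
    have \<eta>i: "integrable lborel \<eta>" by (rule test_functions_integrable[OF eta_test])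
    have \<eta>m [measurable]: "\<eta> \<in> borel_measurable borel" by (rule smooth_measurable[OF eta_smooth])
    have mass_eq: "(LINT s|lborel. \<eta> s) = mass"
    proof -
      have "mass = (LINT s:{-1..1}|lborel. \<eta> s)" unfolding mass_def
        by (rule set_borel_integral_eq_integral(2)[symmetric])
          (auto intro: borel_integrable_atLeastAtMost' eta_continuous)
      also have "\<dots> = (LINT s|lborel. \<eta> s)" unfolding set_lebesgue_integral_def
      proof (rule Bochner_Integration.integral_cong)
        show "indicat_real {-1..1} s *\<^sub>R \<eta> s = \<eta> s" for s
          by (cases "s \<in> {-1..1}") (auto simp: eta_zero)
      qed simp
      finally show ?thesis by simp
    qed
    have shift: "(LINT t|lborel. (n * \<eta> (n * (t - c))) * w' t) = (LINT s|lborel. \<eta> s * w' (c + s / n))"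
      if n: "n > 0" for n :: nat and c
      using lborel_integral_real_affine[of "1 / real n" "\<lambda>t. (n * \<eta> (n * (t - c))) * w' t" c] n
      by (simp add: mult.assoc)
    have conc: "(\<lambda>n. LINT s|lborel. \<eta> s * w' (c + s / real n)) \<longlonglongrightarrow> mass * w c" if c: "0 < c" "c < 1" for c
    proof -
      have "(\<lambda>n. LINT s|lborel. \<eta> s * w' (c + s / real n)) \<longlonglongrightarrow> (LINT s|lborel. \<eta> s * w c)"
      proof (rule integral_dominated_convergence)
        show "integrable lborel (\<lambda>s. \<eta> s * \<bar>M\<bar>)" using \<eta>i by simp
        show "AE s in lborel. norm (\<eta> s * w' (c + s / real n)) \<le> \<eta> s * \<bar>M\<bar>" for n
          using w'M by (auto simp: abs_mult eta_nonneg intro!: mult_left_mono AE_I2)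
        show "AE s in lborel. (\<lambda>n. \<eta> s * w' (c + s / real n)) \<longlonglongrightarrow> \<eta> s * w c"
        proof (rule AE_I2)
          fix s
          have "(\<lambda>n. c + s / real n) \<longlonglongrightarrow> c + 0"
            by (intro tendsto_intros lim_const_over_n)
          then have l: "(\<lambda>n. c + s / real n) \<longlonglongrightarrow> c" by simp
          have "eventually (\<lambda>n. c + s / real n \<in> {0<..<1}) sequentially"
            by (rule topological_tendstoD[OF l]) (use c in auto)
          moreover have "isCont w c"
            using w c by (metis continuous_on_interior interior_atLeastAtMost_real greaterThanLessThan_iff)
          then have "(\<lambda>n. w (c + s / real n)) \<longlonglongrightarrow> w c"
            using l isCont_tendsto_compose by blast
          ultimately have "(\<lambda>n. w' (c + s / real n)) \<longlonglongrightarrow> w c"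
            by (elim Lim_transform_eventually) (auto elim!: eventually_mono simp: w'_def)
          then show "(\<lambda>n. \<eta> s * w' (c + s / real n)) \<longlonglongrightarrow> \<eta> s * w c" by (rule tendsto_mult_left)
        qed
      qed simp_all
      then show ?thesis using \<eta>i by (simp add: mass_eq)
    qed
    have intw: "integrable lborel (\<lambda>t. (n * \<eta> (n * (t - c))) * w' t)" for n :: nat and c
    proof (rule integrable_bounded_support[of _ "{0..1}" "n * \<bar>M\<bar>"])
      show "norm (n * \<eta> (n * (t - c)) * w' t) \<le> n * \<bar>M\<bar>" for t
      proof -
        have "\<eta> (n * (t - c)) * \<bar>w' t\<bar> \<le> 1 * \<bar>M\<bar>"
          by (rule mult_mono) (use w'M[of t] eta_nonneg eta_le_1 in auto)
        then show ?thesis by (simp add: abs_mult eta_nonneg mult.assoc mult_left_mono)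
      qed
    qed (measurable, auto simp: w'_def)
    have lhs: "(LINT t|unit_time. deriv (\<phi> n) t * w t)
       = ((LINT s|lborel. \<eta> s * w' (a + s / n)) - (LINT s|lborel. \<eta> s * w' (b + s / n))) / mass"
      if n: "n \<ge> N" for n
    proof -
      have dm [measurable]: "deriv (\<phi> n) \<in> borel_measurable borel"
        unfolding deriv[abs_def] by measurable
      have "(LINT t|unit_time. deriv (\<phi> n) t * w t) = (LINT t|lebesgue. indicat_real {0<..<1} t * (deriv (\<phi> n) t * w t))"
        by (subst integral_restrict_space) auto
      also have "\<dots> = (LINT t|lebesgue. deriv (\<phi> n) t * w' t)"
      proof (rule Bochner_Integration.integral_cong)
        show "indicat_real {0<..<1} t * (deriv (\<phi> n) t * w t) = deriv (\<phi> n) t * w' t" for t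
        proof (cases "t \<in> {0<..<1}")
          case False
          then have "t \<le> 0 \<or> b + 1/n \<le> t" using N0[OF n] by auto
          then have "real n * (t - a) \<le> 0 \<and> real n * (t - b) \<le> 0 \<or> real n * (t - b) \<ge> 1 \<and> real n * (t - a) \<ge> 1"
          proof
            assume "t \<le> 0"
            then have "real n * (t - a) \<le> 0" "real n * (t - b) \<le> 0"
              using ab by (simp_all add: mult_nonneg_nonpos)
            then show ?thesis by blast
          next
            assume t: "b + 1/n \<le> t"
            then have "1 \<le> real n * (t - b)" using N0(1)[OF n] by (simp add: field_simps)
            moreover have "real n * (t - b) \<le> real n * (t - a)" using ab by (intro mult_left_mono) auto
            ultimately show ?thesis by linarith
          qed
          then have "\<eta> (real n * (t - a)) = 0 \<and> \<eta> (real n * (t - b)) = 0" using eta_zero by blast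
          then have "deriv (\<phi> n) t = 0" by (simp add: deriv)
          then show ?thesis by simp
        qed (auto simp: w'_def)
      qed simp
      also have "\<dots> = (LINT t|lborel. deriv (\<phi> n) t * w' t)"
        by (rule integral_completion) measurable
      also have "\<dots> = (LINT t|lborel. ((n * \<eta> (n * (t - a))) * w' t - (n * \<eta> (n * (t - b))) * w' t) / mass)"
        by (simp add: deriv left_diff_distrib)
      also have "\<dots> = ((LINT t|lborel. (n * \<eta> (n * (t - a))) * w' t) - (LINT t|lborel. (n * \<eta> (n * (t - b))) * w' t)) / mass"
        by (simp only: integral_divide_zero Bochner_Integration.integral_diff[OF intw intw])
      finally show ?thesis using shift[OF N0(1)[OF n]] by simp
    qed
    have "(\<lambda>n. ((LINT s|lborel. \<eta> s * w' (a + s / n)) - (LINT s|lborel. \<eta> s * w' (b + s / n))) / mass)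
          \<longlonglongrightarrow> (mass * w a - mass * w b) / mass"
      using ab mass_pos by (intro tendsto_intros conc) auto
    also have "(mass * w a - mass * w b) / mass = w a - w b" using mass_pos by (simp add: field_simps)
    finally have L: "(\<lambda>n. LINT t|unit_time. deriv (\<phi> n) t * w t) \<longlonglongrightarrow> w a - w b"
      by (rule Lim_transform_eventually) (unfold eventually_sequentially, intro exI[of _ N] allI impI, rule lhs[symmetric])
    have "(\<lambda>n. LINT t|unit_time. \<phi> n t * \<gamma> t) \<longlonglongrightarrow> (LINT t|unit_time. indicat_real {a<..b} t * \<gamma> t)"
    proof (rule integral_dominated_convergence)
      show "integrable unit_time (\<lambda>t. \<bar>\<gamma> t\<bar>)" using \<gamma> by simp
      have [measurable]: "\<gamma> \<in> borel_measurable unit_time" using \<gamma> by simp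
      have sm: "smooth_step \<in> borel_measurable borel" by (rule smooth_measurable[OF smooth_step_smooth])
      have "\<phi> n \<in> borel_measurable borel" for n unfolding \<phi>_def[abs_def] using sm by measurable
      then have [measurable]: "\<phi> n \<in> borel_measurable unit_time" for n
        by (intro measurable_restrict_space1 measurable_completion) simp
      show "(\<lambda>t. \<phi> n t * \<gamma> t) \<in> borel_measurable unit_time" for n by measurable
      have "indicat_real {a<..b} \<in> borel_measurable unit_time"
        by (intro measurable_restrict_space1 measurable_completion) simp
      then show "(\<lambda>t. indicat_real {a<..b} t * \<gamma> t) \<in> borel_measurable unit_time" by measurable
      have "\<bar>\<phi> n t\<bar> \<le> 1" for n t unfolding \<phi>_def
        using smooth_step_nonneg smooth_step_le_1 by (smt (verit, best))
      then show "AE t in unit_time. norm (\<phi> n t * \<gamma> t) \<le> \<bar>\<gamma> t\<bar>" for n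
        by (intro AE_I2) (simp add: abs_mult mult_left_le_one_le)
      show "AE t in unit_time. (\<lambda>n. \<phi> n t * \<gamma> t) \<longlonglongrightarrow> indicat_real {a<..b} t * \<gamma> t"
      proof (intro AE_I2 tendsto_mult_right)
        fix t
        have step: "(\<lambda>n. smooth_step (real n * t + - (real n * c))) \<longlonglongrightarrow> indicat_real {c<..} t" for c
        proof (cases "c < t")
          case True
          obtain N where N: "1 / (t - c) < real N" using reals_Archimedean2 by blast
          have "smooth_step (real n * t + - (real n * c)) = 1" if "n \<ge> N" for n
          proof -
            have "1 / (t - c) < real n" using N that by simp
            then show ?thesis using True by (intro smooth_step_right) (simp add: field_simps)
          qed
          then show ?thesis using True by (intro tendsto_eventually) (auto simp: eventually_sequentially)
        next
          case False
          then have "real n * t \<le> real n * c" for n by (intro mult_left_mono) auto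
          then show ?thesis using False by (simp add: smooth_step_left)
        qed
        have "indicat_real {a<..b} t = indicat_real {a<..} t - indicat_real {b<..} t"
          using ab by (auto simp: indicator_def)
        then show "(\<lambda>n. \<phi> n t) \<longlonglongrightarrow> indicat_real {a<..b} t"
          unfolding \<phi>_def using tendsto_diff[OF step[of a] step[of b]] by simp
      qed
    qed
    then have "(\<lambda>n. - (LINT t|unit_time. \<phi> n t * \<gamma> t)) \<longlonglongrightarrow> - integral {a..b} \<gamma>"
      using unit_time_integral_interval(2)[OF \<gamma>, of a b] ab by (intro tendsto_minus) auto
    then have "(\<lambda>n. LINT t|unit_time. deriv (\<phi> n) t * w t) \<longlonglongrightarrow> - integral {a..b} \<gamma>"
      by (rule Lim_transform_eventually) (unfold eventually_sequentially, intro exI[of _ N] allI impI, rule weak[OF test, symmetric])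
    from LIMSEQ_unique[OF L this] show ?thesis by simp
  qed
  have int01: "\<gamma> integrable_on {0..1}" using unit_time_integral_interval(1)[OF \<gamma>, of 0 1] by simp
  have comb: "integral {0..a} \<gamma> + integral {a..b} \<gamma> = integral {0..b} \<gamma>" if "0 \<le> a" "a \<le> b" "b \<le> 1" for a b
    using that by (intro Henstock_Kurzweil_Integration.integral_combine integrable_on_subinterval[OF int01]) auto
  define d where "d t = w t - integral {0..t} \<gamma>" for t
  have cd: "continuous_on (closure {0<..<1}) d"
    unfolding d_def using w indefinite_integral_continuous_1[OF int01] by (auto intro: continuous_on_diff)
  have dc: "d t = d (1/2)" if "t \<in> {0<..<1}" for t
  proof (cases t "1/2 :: real" rule: linorder_cases)
    case less
    then show ?thesis using inner[of t "1/2"] comb[of t "1/2"] that by (simp add: d_def)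
  next
    case greater
    then show ?thesis using inner[of "1/2" t] comb[of "1/2" t] that by (simp add: d_def)
  next
    case equal
    then show ?thesis by (rule arg_cong)
  qed
  have "d t = d (1/2)" if "t \<in> {0..1}" for t
    by (rule continuous_constant_on_closure[OF cd dc]) (use that in auto)
  from this[of a] this[of b] show ?thesis using comb[of a b] ab by (simp add: d_def)
qed

end

section \<open>Square integrable functions, weak gradients and the dual of \<open>H\<^sup>1\<close>\<close>

lemma L2_measurable: "f \<in> L2 \<Longrightarrow> f \<in> borel_measurable borel"
  by (simp add: L2_def)

lemma L2_integrable_sq: "f \<in> L2 \<Longrightarrow> integrable lborel (\<lambda>x. (norm (f x))\<^sup>2)"
  by (simp add: L2_def)

lemma L2_inner_integrable:
  fixes f g :: "'a::euclidean_space \<Rightarrow> 'b::euclidean_space"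
  assumes "f \<in> L2" "g \<in> L2" shows "integrable lborel (\<lambda>x. f x \<bullet> g x)"
proof (rule Bochner_Integration.integrable_bound[of _ "\<lambda>x. (norm (f x))\<^sup>2 + (norm (g x))\<^sup>2"])
  show "integrable lborel (\<lambda>x. (norm (f x))\<^sup>2 + (norm (g x))\<^sup>2)"
    using assms by (intro Bochner_Integration.integrable_add L2_integrable_sq)
  show "(\<lambda>x. f x \<bullet> g x) \<in> borel_measurable lborel"
    using assms[THEN L2_measurable] by simp
  show "AE x in lborel. norm (f x \<bullet> g x) \<le> norm ((norm (f x))\<^sup>2 + (norm (g x))\<^sup>2)"
  proof (rule AE_I2)
    fix x
    have "\<bar>f x \<bullet> g x\<bar> \<le> norm (f x) * norm (g x)" by (rule Cauchy_Schwarz_ineq2)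
    also have "\<dots> \<le> (norm (f x))\<^sup>2 + (norm (g x))\<^sup>2"
      using sum_squares_bound[of "norm (f x)" "norm (g x)"] mult_nonneg_nonneg[OF norm_ge_zero[of "f x"] norm_ge_zero[of "g x"]]
      by linarith
    finally show "norm (f x \<bullet> g x) \<le> norm ((norm (f x))\<^sup>2 + (norm (g x))\<^sup>2)" by simp
  qed
qed

lemma L2_mult_integrable:
  fixes f g :: "'a::euclidean_space \<Rightarrow> real"
  assumes "f \<in> L2" "g \<in> L2" shows "integrable lborel (\<lambda>x. f x * g x)"
  using L2_inner_integrable[OF assms] by simp

lemma L2_I_inner:
  fixes f :: "'a::euclidean_space \<Rightarrow> 'b::euclidean_space"
  assumes "f \<in> borel_measurable borel" "integrable lborel (\<lambda>x. f x \<bullet> f x)"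
  shows "f \<in> L2"
  using assms by (simp add: L2_def dot_square_norm)

lemma L2_lincomb:
  fixes f g :: "'a::euclidean_space \<Rightarrow> 'b::euclidean_space"
  assumes "f \<in> L2" "g \<in> L2" shows "(\<lambda>x. a *\<^sub>R f x + b *\<^sub>R g x) \<in> L2"
proof (rule L2_I_inner)
  show "(\<lambda>x. a *\<^sub>R f x + b *\<^sub>R g x) \<in> borel_measurable borel"
    using assms[THEN L2_measurable] by simp
  have "integrable lborel (\<lambda>x. a\<^sup>2 * (f x \<bullet> f x) + (2 * a * b) * (f x \<bullet> g x) + b\<^sup>2 * (g x \<bullet> g x))"
    using assms by (intro Bochner_Integration.integrable_add integrable_mult_right L2_inner_integrable)
  then show "integrable lborel (\<lambda>x. (a *\<^sub>R f x + b *\<^sub>R g x) \<bullet> (a *\<^sub>R f x + b *\<^sub>R g x))"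
    by (simp add: inner_add_left inner_add_right inner_commute algebra_simps power2_eq_square)
qed

lemma L2_add: "f \<in> L2 \<Longrightarrow> g \<in> L2 \<Longrightarrow> (\<lambda>x. f x + g x) \<in> L2"
  using L2_lincomb[of f g 1 1] by simp

lemma L2_diff: "f \<in> L2 \<Longrightarrow> g \<in> L2 \<Longrightarrow> (\<lambda>x. f x - g x) \<in> L2"
  using L2_lincomb[of f g 1 "-1"] by simp

lemma L2_scaleR: "f \<in> L2 \<Longrightarrow> (\<lambda>x. c *\<^sub>R f x) \<in> L2"
  using L2_lincomb[of f f c 0] by simp

lemma L2_zero: "(\<lambda>x. 0) \<in> L2"
  by (simp add: L2_def)

lemma L2_norm_nonneg [simp]: "0 \<le> L2_norm f"
  by (simp add: L2_norm_def)

lemma L2_norm_sq: "(L2_norm f)\<^sup>2 = (LINT x|lborel. f x \<bullet> f x)"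
  by (simp add: L2_norm_def dot_square_norm)

lemma L2_norm_cong_AE:
  assumes "f \<in> L2" "g \<in> L2" "AE x in lborel. f x = g x" shows "L2_norm f = L2_norm g"
proof -
  have "(LINT x|lborel. (norm (f x))\<^sup>2) = (LINT x|lborel. (norm (g x))\<^sup>2)"
    using assms(3) assms(1,2)[THEN L2_measurable] by (intro integral_cong_AE) (auto elim: eventually_mono)
  then show ?thesis by (simp add: L2_norm_def)
qed

text \<open>Polarisation, the only place where the integral is expanded; the Cauchy-Schwarz and
  triangle inequalities follow from it.\<close>

lemma L2_lincomb_sq:
  fixes f g :: "'a::euclidean_space \<Rightarrow> 'b::euclidean_space"
  assumes "f \<in> L2" "g \<in> L2"
  shows "(L2_norm (\<lambda>x. f x + c *\<^sub>R g x))\<^sup>2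
    = (L2_norm f)\<^sup>2 + 2 * c * (LINT x|lborel. f x \<bullet> g x) + c\<^sup>2 * (L2_norm g)\<^sup>2"
proof -
  have "(L2_norm (\<lambda>x. f x + c *\<^sub>R g x))\<^sup>2
     = (LINT x|lborel. (f x \<bullet> f x + (2 * c) * (f x \<bullet> g x)) + c\<^sup>2 * (g x \<bullet> g x))"
    unfolding L2_norm_sq
    by (rule Bochner_Integration.integral_cong)
      (simp_all add: inner_add_left inner_add_right inner_commute algebra_simps power2_eq_square)
  also have "\<dots> = ((L2_norm f)\<^sup>2 + (2 * c) * (LINT x|lborel. f x \<bullet> g x)) + c\<^sup>2 * (L2_norm g)\<^sup>2"
    using L2_inner_integrable[OF assms(1,1)] L2_inner_integrable[OF assms] L2_inner_integrable[OF assms(2,2)]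
    by (simp add: L2_norm_sq)
  finally show ?thesis by simp
qed

text \<open>The squared norm of \<open>f + c g\<close> is a nonnegative quadratic polynomial in
  \<open>c\<close>.\<close>

lemma L2_Cauchy_Schwarz:
  fixes f g :: "'a::euclidean_space \<Rightarrow> 'b::euclidean_space"
  assumes "f \<in> L2" "g \<in> L2"
  shows "\<bar>LINT x|lborel. f x \<bullet> g x\<bar> \<le> L2_norm f * L2_norm g"
proof -
  define A B C where "A = L2_norm f" and "B = (LINT x|lborel. f x \<bullet> g x)" and "C = L2_norm g"
  have q: "0 \<le> A\<^sup>2 + 2 * c * B + c\<^sup>2 * C\<^sup>2" for c
    using L2_lincomb_sq[OF assms, of c] zero_le_power2[of "L2_norm (\<lambda>x. f x + c *\<^sub>R g x)"]
    unfolding A_def B_def C_def by linarith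
  have nn: "A \<ge> 0" "C \<ge> 0" by (simp_all add: A_def C_def)
  have "\<bar>B\<bar> \<le> A * C"
  proof (cases "C = 0")
    case True
    have "B = 0"
    proof (rule ccontr)
      assume "B \<noteq> 0"
      \<comment> \<open>a linear polynomial that is bounded below is constant; this value of \<open>c\<close> would make it \<open>-1\<close>\<close>
      have "0 \<le> A\<^sup>2 + 2 * (- (A\<^sup>2 + 1) / (2 * B)) * B"
        using q[of "- (A\<^sup>2 + 1) / (2 * B)"] True by simp
      also have "\<dots> = -1" using \<open>B \<noteq> 0\<close> by (simp add: field_simps)
      finally show False by simp
    qed
    then show ?thesis using nn by simp
  next
    case False
    then have C: "C > 0" using nn by simp
    have "0 \<le> A\<^sup>2 + 2 * (- B / C\<^sup>2) * B + (- B / C\<^sup>2)\<^sup>2 * C\<^sup>2" by (rule q)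
    also have "\<dots> = A\<^sup>2 - B\<^sup>2 / C\<^sup>2" using C by (simp add: field_simps power2_eq_square)
    finally have "B\<^sup>2 / C\<^sup>2 \<le> A\<^sup>2" by simp
    then have "B\<^sup>2 \<le> A\<^sup>2 * C\<^sup>2" using C by (simp add: divide_le_eq)
    then have "\<bar>B\<bar>\<^sup>2 \<le> (A * C)\<^sup>2" by (simp add: power_mult_distrib)
    then show ?thesis using nn by (meson mult_nonneg_nonneg power2_le_imp_le)
  qed
  then show ?thesis by (simp add: A_def B_def C_def)
qed

lemma L2_norm_triangle_scaled:
  fixes f g :: "'a::euclidean_space \<Rightarrow> 'b::euclidean_space"
  assumes "f \<in> L2" "g \<in> L2"
  shows "L2_norm (\<lambda>x. f x + c *\<^sub>R g x) \<le> L2_norm f + \<bar>c\<bar> * L2_norm g"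
proof (rule power2_le_imp_le)
  have "c * (LINT x|lborel. f x \<bullet> g x) \<le> \<bar>c\<bar> * (L2_norm f * L2_norm g)"
  proof -
    have "c * (LINT x|lborel. f x \<bullet> g x) \<le> \<bar>c\<bar> * \<bar>LINT x|lborel. f x \<bullet> g x\<bar>"
      by (metis abs_ge_self abs_mult)
    also have "\<dots> \<le> \<bar>c\<bar> * (L2_norm f * L2_norm g)"
      by (intro mult_left_mono L2_Cauchy_Schwarz assms) simp
    finally show ?thesis .
  qed
  then show "(L2_norm (\<lambda>x. f x + c *\<^sub>R g x))\<^sup>2 \<le> (L2_norm f + \<bar>c\<bar> * L2_norm g)\<^sup>2"
    unfolding L2_lincomb_sq[OF assms] power2_sum power_mult_distrib by (simp add: algebra_simps)
qed simp

lemma L2_norm_triangle: "f \<in> L2 \<Longrightarrow> g \<in> L2 \<Longrightarrow> L2_norm (\<lambda>x. f x + g x) \<le> L2_norm f + L2_norm g"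
  using L2_norm_triangle_scaled[of f g 1] by simp

lemma L2_norm_diff_triangle: "f \<in> L2 \<Longrightarrow> g \<in> L2 \<Longrightarrow> L2_norm (\<lambda>x. f x - g x) \<le> L2_norm f + L2_norm g"
  using L2_norm_triangle_scaled[of f g "-1"] by simp

lemma L2_norm_scaleR: "L2_norm (\<lambda>x. c *\<^sub>R f x) = \<bar>c\<bar> * L2_norm f"
  by (simp add: L2_norm_def power_mult_distrib real_sqrt_mult)

lemma L2_norm_mono:
  assumes "g \<in> L2" "f \<in> borel_measurable borel" "\<And>x. norm (f x) \<le> norm (g x)"
  shows "f \<in> L2" "L2_norm f \<le> L2_norm g"
proof -
  have le: "(norm (f x))\<^sup>2 \<le> (norm (g x))\<^sup>2" for x using assms(3) by (simp add: power_mono)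
  have i: "integrable lborel (\<lambda>x. (norm (f x))\<^sup>2)"
    by (rule Bochner_Integration.integrable_bound[OF L2_integrable_sq[OF assms(1)]]) (use assms(2) le in auto)
  then show "f \<in> L2" using assms(2) by (simp add: L2_def)
  show "L2_norm f \<le> L2_norm g" unfolding L2_norm_def
    by (intro real_sqrt_le_mono integral_mono i L2_integrable_sq assms le)
qed

text \<open>All functions of the construction vanish off one bounded set, so that uniform pointwise
  bounds turn into norm bounds.\<close>

lemma L2_norm_le_bound:
  fixes f :: "'a::euclidean_space \<Rightarrow> 'b::euclidean_space"
  assumes "f \<in> borel_measurable borel" "bounded K" "\<And>x. x \<notin> K \<Longrightarrow> f x = 0" "\<And>x. norm (f x) \<le> M" "K \<in> sets borel"
  shows "f \<in> L2" "L2_norm f \<le> M * sqrt (measure lborel K)"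
proof -
  have M0: "0 \<le> M" using order_trans[OF norm_ge_zero assms(4)] .
  have fin: "emeasure lborel K < top" using emeasure_bounded_finite[OF assms(2)] by (simp add: infinity_ennreal_def)
  have le: "(norm (f x))\<^sup>2 \<le> indicat_real K x * M\<^sup>2" for x
    using assms(3,4)[of x] by (cases "x \<in> K") (auto simp: power_mono)
  have ib: "integrable lborel (\<lambda>x. indicat_real K x * M\<^sup>2)"
    using fin assms(5) by (intro integrable_mult_left integrable_real_indicator) auto
  have i: "integrable lborel (\<lambda>x. (norm (f x))\<^sup>2)"
    by (rule Bochner_Integration.integrable_bound[OF ib]) (use assms(1) le in auto)
  then show "f \<in> L2" using assms(1) by (simp add: L2_def)
  have "(LINT x|lborel. (norm (f x))\<^sup>2) \<le> (LINT x|lborel. indicat_real K x * M\<^sup>2)"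
    by (intro integral_mono i ib le)
  also have "\<dots> = measure lborel K * M\<^sup>2" using assms(5) fin by simp
  finally have "L2_norm f \<le> sqrt (measure lborel K * M\<^sup>2)" unfolding L2_norm_def by (rule real_sqrt_le_mono)
  then show "L2_norm f \<le> M * sqrt (measure lborel K)" using M0 by (simp add: real_sqrt_mult mult.commute)
qed

lemma L2_components:
  fixes f :: "'a::euclidean_space \<Rightarrow> 'b::euclidean_space"
  assumes "\<And>b. b \<in> Basis \<Longrightarrow> (\<lambda>x. f x \<bullet> b) \<in> L2"
  shows "f \<in> L2"
proof (rule L2_I_inner)
  show "f \<in> borel_measurable borel"
    using assms[THEN L2_measurable] by (subst borel_measurable_euclidean_space) auto
  have "integrable lborel (\<lambda>x. \<Sum>b\<in>Basis. (f x \<bullet> b) * (f x \<bullet> b))"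
    by (intro Bochner_Integration.integrable_sum L2_mult_integrable assms)
  then show "integrable lborel (\<lambda>x. f x \<bullet> f x)" by (subst euclidean_inner)
qed

lemma L2_component:
  fixes f :: "'a::euclidean_space \<Rightarrow> 'b::euclidean_space"
  assumes "f \<in> L2" shows "(\<lambda>x. f x \<bullet> b) \<in> L2"
proof (rule L2_norm_mono(1)[OF L2_scaleR[OF assms, of "norm b"]])
  show "(\<lambda>x. f x \<bullet> b) \<in> borel_measurable borel" using L2_measurable[OF assms] by simp
  show "norm (f x \<bullet> b) \<le> norm (norm b *\<^sub>R f x)" for x
    using Cauchy_Schwarz_ineq2[of "f x" b] by (simp add: mult.commute)
qed

lemma test_functions_L2:
  fixes \<phi> :: "'a::euclidean_space \<Rightarrow> real"
  assumes "\<phi> \<in> test_functions S" shows "\<phi> \<in> L2"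
proof (rule L2_I_inner)
  show "\<phi> \<in> borel_measurable borel" by (rule smooth_measurable[OF test_functionsD(1)[OF assms]])
  show "integrable lborel (\<lambda>x. \<phi> x \<bullet> \<phi> x)"
    using test_functions_integrable[OF test_functions_mult_smooth[OF assms test_functionsD(1)[OF assms]]] by simp
qed

lemma L2_locally_integrable:
  fixes f :: "'a::euclidean_space \<Rightarrow> real"
  assumes "f \<in> L2" shows "set_integrable lborel (box a b) f"
proof -
  have "indicat_real (box a b) \<in> L2"
    by (rule L2_norm_le_bound(1)[of _ "box a b" 1]) auto
  from L2_mult_integrable[OF this assms] show ?thesis by (simp add: set_integrable_def)
qed

lemma has_weak_gradD:
  assumes "has_weak_grad u g" "\<phi> \<in> test_functions UNIV" "b \<in> Basis"
  shows "(LINT x|lborel. u x * dir_deriv b \<phi> x) = - (LINT x|lborel. (g x \<bullet> b) * \<phi> x)"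
  using assms by (simp add: has_weak_grad_def dir_deriv_def)

lemma has_weak_grad_lincomb:
  assumes "u \<in> L2" "g \<in> L2" "has_weak_grad u g" "v \<in> L2" "h \<in> L2" "has_weak_grad v h"
  shows "has_weak_grad (\<lambda>x. u x + c * v x) (\<lambda>x. g x + c *\<^sub>R h x)"
  unfolding has_weak_grad_def
proof (intro ballI)
  fix \<phi> :: "'a \<Rightarrow> real" and b :: 'a
  assume \<phi>: "\<phi> \<in> test_functions UNIV" and b: "b \<in> Basis"
  note t = test_functions_L2[OF test_functions_dir_deriv[OF \<phi>], of b] test_functions_L2[OF \<phi>]
  note i = L2_mult_integrable[OF assms(1) t(1)] L2_mult_integrable[OF assms(4) t(1)]
    L2_mult_integrable[OF L2_component[OF assms(2)] t(2), of b] L2_mult_integrable[OF L2_component[OF assms(5)] t(2), of b]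
  have "(LINT x|lborel. (u x + c * v x) * dir_deriv b \<phi> x)
      = (LINT x|lborel. u x * dir_deriv b \<phi> x + c * (v x * dir_deriv b \<phi> x))"
    by (simp add: algebra_simps)
  also have "\<dots> = (LINT x|lborel. u x * dir_deriv b \<phi> x) + c * (LINT x|lborel. v x * dir_deriv b \<phi> x)"
    using i by simp
  also have "\<dots> = - ((LINT x|lborel. (g x \<bullet> b) * \<phi> x) + c * (LINT x|lborel. (h x \<bullet> b) * \<phi> x))"
    using has_weak_gradD[OF assms(3) \<phi> b] has_weak_gradD[OF assms(6) \<phi> b] by (simp add: algebra_simps)
  also have "\<dots> = - (LINT x|lborel. (g x \<bullet> b) * \<phi> x + c * ((h x \<bullet> b) * \<phi> x))"
    using i by simp
  also have "\<dots> = - (LINT x|lborel. ((g x + c *\<^sub>R h x) \<bullet> b) * \<phi> x)"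
    by (simp add: algebra_simps inner_add_left)
  finally show "(LINT x|lborel. (u x + c * v x) * frechet_derivative \<phi> (at x) b)
      = - (LINT x|lborel. ((g x + c *\<^sub>R h x) \<bullet> b) * \<phi> x)" by (simp add: dir_deriv_def)
qed

lemma H1_D:
  assumes "u \<in> H1" shows "u \<in> L2" "weak_grad u \<in> L2" "has_weak_grad u (weak_grad u)"
proof -
  show "u \<in> L2" using assms by (simp add: H1_def)
  have "\<exists>g. g \<in> L2 \<and> has_weak_grad u g" using assms by (auto simp: H1_def)
  from someI_ex[OF this] show "weak_grad u \<in> L2" "has_weak_grad u (weak_grad u)" by (auto simp: weak_grad_def)
qed

lemma H1_I: "u \<in> L2 \<Longrightarrow> g \<in> L2 \<Longrightarrow> has_weak_grad u g \<Longrightarrow> u \<in> H1"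
  by (auto simp: H1_def)

lemma H1_lincomb: assumes "u \<in> H1" "v \<in> H1" shows "(\<lambda>x. u x + c * v x) \<in> H1"
proof (rule H1_I)
  show "(\<lambda>x. u x + c * v x) \<in> L2" using L2_lincomb[of u v 1 c] assms[THEN H1_D(1)] by simp
  show "(\<lambda>x. weak_grad u x + c *\<^sub>R weak_grad v x) \<in> L2"
    using L2_lincomb[of "weak_grad u" "weak_grad v" 1 c] assms[THEN H1_D(2)] by simp
  show "has_weak_grad (\<lambda>x. u x + c * v x) (\<lambda>x. weak_grad u x + c *\<^sub>R weak_grad v x)"
    by (intro has_weak_grad_lincomb H1_D assms)
qed

lemma has_weak_grad_zero: "has_weak_grad (\<lambda>x. 0) (\<lambda>x. 0)"
  by (simp add: has_weak_grad_def)

lemma H1_zero: "(\<lambda>x. 0) \<in> H1"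
  by (rule H1_I[OF L2_zero L2_zero has_weak_grad_zero])

lemma H1_scale: "v \<in> H1 \<Longrightarrow> (\<lambda>x. c * v x) \<in> H1"
  using H1_lincomb[OF H1_zero, of v c] by simp

lemma H1_diff: "u \<in> H1 \<Longrightarrow> v \<in> H1 \<Longrightarrow> u - v \<in> H1"
  using H1_lincomb[of u v "-1"] by (simp add: fun_diff_def)

definition grad :: "('a::euclidean_space \<Rightarrow> real) \<Rightarrow> 'a \<Rightarrow> 'a" where
  "grad f x = (\<Sum>b\<in>Basis. dir_deriv b f x *\<^sub>R b)"

lemma grad_inner: "b \<in> Basis \<Longrightarrow> grad f x \<bullet> b = dir_deriv b f x"
  unfolding grad_def by (simp add: inner_sum_left inner_Basis if_distrib cong: if_cong)

lemma test_functions_weak_grad: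
  assumes u: "u \<in> test_functions UNIV"
  shows "u \<in> H1" "grad u \<in> L2" "has_weak_grad u (grad u)"
proof -
  have L: "(\<lambda>x. grad u x \<bullet> b) \<in> L2" if "b \<in> Basis" for b
    using test_functions_L2[OF test_functions_dir_deriv[OF u]] that by (simp add: grad_inner)
  then show g: "grad u \<in> L2" by (rule L2_components)
  show h: "has_weak_grad u (grad u)"
    unfolding has_weak_grad_def
  proof (intro ballI)
    fix \<phi> :: "'a \<Rightarrow> real" and b :: 'a
    assume \<phi>: "\<phi> \<in> test_functions UNIV" and b: "b \<in> Basis"
    show "(LINT x|lborel. u x * frechet_derivative \<phi> (at x) b) = - (LINT x|lborel. (grad u x \<bullet> b) * \<phi> x)"
      using integral_by_parts_test_function[OF \<phi> test_functionsD(1)[OF u], of b]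
      unfolding grad_inner[OF b] dir_deriv_def .
  qed
  show "u \<in> H1" by (rule H1_I[OF test_functions_L2[OF u] g h])
qed

text \<open>The components of \<open>p\<close> are admissible in the definition of the weak gradient
  of \<open>v\<close>, so that for smooth fields the weak divergence is the classical one.\<close>

lemma weak_div_smooth:
  assumes p: "\<And>b. b \<in> Basis \<Longrightarrow> (\<lambda>x. p x \<bullet> b) \<in> test_functions UNIV" and v: "v \<in> H1"
  shows "weak_div p v = (LINT x|lborel. (\<Sum>b\<in>Basis. dir_deriv b (\<lambda>x. p x \<bullet> b) x) * v x)"
proof -
  note vv = H1_D[OF v]
  have "weak_div p v = - (LINT x|lborel. (\<Sum>b\<in>Basis. (weak_grad v x \<bullet> b) * (p x \<bullet> b)))"
    unfolding weak_div_def by (subst euclidean_inner) (simp add: mult.commute)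
  also have "\<dots> = (\<Sum>b\<in>Basis. - (LINT x|lborel. (weak_grad v x \<bullet> b) * (p x \<bullet> b)))"
    by (subst Bochner_Integration.integral_sum)
      (auto simp: sum_negf intro!: L2_mult_integrable L2_component vv test_functions_L2[OF p])
  also have "\<dots> = (\<Sum>b\<in>Basis. (LINT x|lborel. dir_deriv b (\<lambda>x. p x \<bullet> b) x * v x))"
    using has_weak_gradD[OF vv(3) p] by (intro sum.cong) (auto simp: mult.commute)
  also have "\<dots> = (LINT x|lborel. (\<Sum>b\<in>Basis. dir_deriv b (\<lambda>x. p x \<bullet> b) x * v x))"
    by (subst Bochner_Integration.integral_sum)
      (auto intro!: L2_mult_integrable vv test_functions_L2[OF test_functions_dir_deriv[OF p]])
  finally show ?thesis by (simp add: sum_distrib_right)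
qed

context smooth_cutoff
begin

text \<open>Each component of the difference is orthogonal to all test functions.\<close>

lemma weak_grad_unique:
  fixes g h :: "'a::euclidean_space \<Rightarrow> 'a"
  assumes "g \<in> L2" "has_weak_grad u g" "h \<in> L2" "has_weak_grad u h"
  shows "AE x in lborel. g x = h x"
proof -
  have "AE x in lborel. \<forall>b\<in>Basis. (g x - h x) \<bullet> b = 0"
  proof (subst AE_ball_countable)
    show "countable (Basis :: 'a set)" by (simp add: countable_finite)
    show "\<forall>b\<in>Basis. AE x in lborel. (g x - h x) \<bullet> b = 0"
    proof
      fix b :: 'a assume b: "b \<in> Basis"
      have L: "(\<lambda>x. (g x - h x) \<bullet> b) \<in> L2" by (intro L2_component L2_diff assms)
      show "AE x in lborel. (g x - h x) \<bullet> b = 0"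
      proof (rule fundamental_lemma)
        show "(\<lambda>x. (g x - h x) \<bullet> b) \<in> borel_measurable borel" by (rule L2_measurable[OF L])
        show "set_integrable lborel (box c d) (\<lambda>x. (g x - h x) \<bullet> b)" for c d
          by (rule L2_locally_integrable[OF L])
        fix \<phi> :: "'a \<Rightarrow> real" assume \<phi>: "\<phi> \<in> test_functions UNIV"
        note i = L2_mult_integrable[OF L2_component[OF assms(1)] test_functions_L2[OF \<phi>], of b]
          L2_mult_integrable[OF L2_component[OF assms(3)] test_functions_L2[OF \<phi>], of b]
        have "(LINT x|lborel. ((g x - h x) \<bullet> b) * \<phi> x)
          = (LINT x|lborel. (g x \<bullet> b) * \<phi> x) - (LINT x|lborel. (h x \<bullet> b) * \<phi> x)"
          using i by (simp add: inner_diff_left left_diff_distrib)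
        then show "(LINT x|lborel. ((g x - h x) \<bullet> b) * \<phi> x) = 0"
          using has_weak_gradD[OF assms(2) \<phi> b] has_weak_gradD[OF assms(4) \<phi> b] by simp
      qed
    qed
  qed
  then show ?thesis
  proof eventually_elim
    case (elim x)
    then have "g x - h x = 0" using euclidean_all_zero_iff by blast
    then show ?case by simp
  qed
qed

lemma weak_grad_AE_eq:
  assumes "u \<in> L2" "g \<in> L2" "has_weak_grad u g" shows "AE x in lborel. weak_grad u x = g x"
  using weak_grad_unique H1_D[OF H1_I[OF assms]] assms by blast

lemma weak_grad_test: "u \<in> test_functions UNIV \<Longrightarrow> AE x in lborel. weak_grad u x = grad u x"
  by (rule weak_grad_AE_eq[OF test_functions_L2 test_functions_weak_grad(2,3)])

lemma weak_grad_lincomb: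
  assumes "u \<in> H1" "v \<in> H1"
  shows "AE x in lborel. weak_grad (\<lambda>x. u x + c * v x) x = weak_grad u x + c *\<^sub>R weak_grad v x"
proof (rule weak_grad_AE_eq)
  show "(\<lambda>x. u x + c * v x) \<in> L2" by (rule H1_D(1)[OF H1_lincomb[OF assms]])
  show "(\<lambda>x. weak_grad u x + c *\<^sub>R weak_grad v x) \<in> L2"
    using L2_lincomb[of "weak_grad u" "weak_grad v" 1 c] assms[THEN H1_D(2)] by simp
  show "has_weak_grad (\<lambda>x. u x + c * v x) (\<lambda>x. weak_grad u x + c *\<^sub>R weak_grad v x)"
    by (intro has_weak_grad_lincomb H1_D assms)
qed

text \<open>The \<open>H\<^sup>1\<close> norm is the \<open>L\<^sup>2\<close> norm of the jet, from
  which it inherits the triangle inequality.\<close>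

definition jet :: "('a::euclidean_space \<Rightarrow> real) \<Rightarrow> 'a \<Rightarrow> real \<times> 'a" where
  "jet u x = (u x, weak_grad u x)"

lemma jet_L2: assumes "u \<in> H1" shows "jet u \<in> L2"
proof (rule L2_I_inner)
  show "jet u \<in> borel_measurable borel"
    using assms[THEN H1_D(1), THEN L2_measurable] assms[THEN H1_D(2), THEN L2_measurable]
    unfolding jet_def[abs_def] by (rule borel_measurable_Pair)
  show "integrable lborel (\<lambda>x. jet u x \<bullet> jet u x)"
    using L2_inner_integrable[OF H1_D(1)[OF assms] H1_D(1)[OF assms]] L2_inner_integrable[OF H1_D(2)[OF assms] H1_D(2)[OF assms]]
    by (simp add: jet_def)
qed

lemma H1_norm_jet: assumes "u \<in> H1" shows "H1_norm u = L2_norm (jet u)"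
proof -
  have "(L2_norm (jet u))\<^sup>2 = (L2_norm u)\<^sup>2 + (L2_norm (weak_grad u))\<^sup>2"
    using L2_inner_integrable[OF H1_D(1)[OF assms] H1_D(1)[OF assms]] L2_inner_integrable[OF H1_D(2)[OF assms] H1_D(2)[OF assms]]
    by (simp add: L2_norm_sq jet_def)
  then show ?thesis unfolding H1_norm_def by (metis L2_norm_nonneg real_sqrt_unique)
qed

lemma H1_norm_nonneg [simp]: "0 \<le> H1_norm u"
  by (simp add: H1_norm_def)

lemma jet_lincomb:
  assumes "u \<in> H1" "v \<in> H1"
  shows "AE x in lborel. jet (\<lambda>x. u x + c * v x) x = jet u x + c *\<^sub>R jet v x"
  using weak_grad_lincomb[OF assms, of c] by eventually_elim (simp add: jet_def)

lemma H1_norm_lincomb: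
  assumes "u \<in> H1" "v \<in> H1"
  shows "H1_norm (\<lambda>x. u x + c * v x) = L2_norm (\<lambda>x. jet u x + c *\<^sub>R jet v x)"
proof -
  have "(\<lambda>x. jet u x + c *\<^sub>R jet v x) \<in> L2" using L2_lincomb[OF assms[THEN jet_L2], of 1 c] by simp
  then show ?thesis
    using H1_norm_jet[OF H1_lincomb[OF assms]] L2_norm_cong_AE[OF jet_L2[OF H1_lincomb[OF assms]] _ jet_lincomb[OF assms]]
    by simp
qed

lemma H1_norm_triangle_scaled:
  assumes "u \<in> H1" "v \<in> H1"
  shows "H1_norm (\<lambda>x. u x + c * v x) \<le> H1_norm u + \<bar>c\<bar> * H1_norm v"
  using L2_norm_triangle_scaled[OF assms[THEN jet_L2], of c] assms
  by (simp add: H1_norm_lincomb H1_norm_jet)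

lemma H1_norm_zero: "H1_norm (\<lambda>x. 0) = 0"
proof -
  have "H1_norm (\<lambda>x::'a. 0 + (-1) * 0) = L2_norm (\<lambda>x. jet (\<lambda>x::'a. 0) x + (-1) *\<^sub>R jet (\<lambda>x. 0) x)"
    by (rule H1_norm_lincomb[OF H1_zero H1_zero])
  then show ?thesis by (simp add: L2_norm_def)
qed

lemma H1_norm_scale: assumes "v \<in> H1" shows "H1_norm (\<lambda>x. c * v x) \<le> \<bar>c\<bar> * H1_norm v"
  using H1_norm_triangle_scaled[OF H1_zero assms, of c] by (simp add: H1_norm_zero)

lemma L2_norm_le_H1_norm: "L2_norm u \<le> H1_norm u"
  by (simp add: H1_norm_def real_le_rsqrt)

lemma L2_norm_weak_grad_le_H1_norm: "L2_norm (weak_grad u) \<le> H1_norm u"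
  by (simp add: H1_norm_def real_le_rsqrt)

lemma Hm1_add: "l \<in> Hm1 \<Longrightarrow> u \<in> H1 \<Longrightarrow> v \<in> H1 \<Longrightarrow> l (\<lambda>x. u x + v x) = l u + l v"
  and Hm1_scale: "l \<in> Hm1 \<Longrightarrow> u \<in> H1 \<Longrightarrow> l (\<lambda>x. c * u x) = c * l u"
  by (auto simp: Hm1_def)

lemma Hm1_bdd: assumes "l \<in> Hm1" shows "bdd_above ((\<lambda>v. \<bar>l v\<bar>) ` {v \<in> H1. H1_norm v \<le> 1})"
proof -
  obtain C where C: "\<And>u. u \<in> H1 \<Longrightarrow> \<bar>l u\<bar> \<le> C * H1_norm u" using assms unfolding Hm1_def by blast
  have "\<bar>l v\<bar> \<le> \<bar>C\<bar>" if "v \<in> H1" "H1_norm v \<le> 1" for v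
  proof -
    have "\<bar>l v\<bar> \<le> C * H1_norm v" by (rule C) fact
    also have "\<dots> \<le> \<bar>C\<bar> * H1_norm v" by (intro mult_right_mono) auto
    also have "\<dots> \<le> \<bar>C\<bar> * 1" using that by (intro mult_left_mono) auto
    finally show ?thesis by simp
  qed
  then show ?thesis by (intro bdd_aboveI2[where M = "\<bar>C\<bar>"]) auto
qed

text \<open>By homogeneity one may normalise \<open>v\<close>. A function of zero norm cannot be
  normalised, but there the boundedness of \<open>l\<close> alone gives \<open>l v =
  0\<close>.\<close>

lemma Hm1_bound: assumes l: "l \<in> Hm1" and v: "v \<in> H1" shows "\<bar>l v\<bar> \<le> Hm1_norm l * H1_norm v"
proof (cases "H1_norm v = 0")
  case True
  obtain C where C: "\<And>u. u \<in> H1 \<Longrightarrow> \<bar>l u\<bar> \<le> C * H1_norm u" using l unfolding Hm1_def by blast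
  from C[OF v] True show ?thesis by simp
next
  case False
  define N where "N = H1_norm v"
  have N: "N > 0" using False H1_norm_nonneg[of v] unfolding N_def by linarith
  have "H1_norm (\<lambda>x. (1 / N) * v x) \<le> 1"
    using H1_norm_scale[OF v, of "1 / N"] N unfolding N_def[symmetric] by simp
  then have "\<bar>l (\<lambda>x. (1 / N) * v x)\<bar> \<le> Hm1_norm l"
    unfolding Hm1_norm_def using H1_scale[OF v, of "1/N"] by (intro cSUP_upper Hm1_bdd[OF l]) auto
  then have "\<bar>l v\<bar> / N \<le> Hm1_norm l" using Hm1_scale[OF l v, of "1 / N"] N by (simp add: abs_mult)
  then show ?thesis using N by (simp add: N_def[symmetric] divide_le_eq)
qed

lemma Hm1_norm_le: assumes "\<And>v. v \<in> H1 \<Longrightarrow> \<bar>l v\<bar> \<le> C * H1_norm v" "0 \<le> C" shows "Hm1_norm l \<le> C"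
  unfolding Hm1_norm_def
proof (rule cSUP_least)
  have "(\<lambda>x. 0) \<in> {v \<in> H1. H1_norm v \<le> 1}" by (simp add: H1_zero H1_norm_zero)
  then show "{v \<in> H1. H1_norm v \<le> 1} \<noteq> ({} :: ('a \<Rightarrow> real) set)" by blast
  fix v :: "'a \<Rightarrow> real" assume v: "v \<in> {v \<in> H1. H1_norm v \<le> 1}"
  then have "\<bar>l v\<bar> \<le> C * H1_norm v" using assms by simp
  also have "\<dots> \<le> C * 1" using v assms(2) by (intro mult_left_mono) auto
  finally show "\<bar>l v\<bar> \<le> C" by simp
qed

lemma Hm1_norm_nonneg: assumes "l \<in> Hm1" shows "0 \<le> Hm1_norm l"
proof -
  have "\<bar>l (\<lambda>x. 0)\<bar> \<le> Hm1_norm l" unfolding Hm1_norm_def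
    by (intro cSUP_upper Hm1_bdd[OF assms]) (simp add: H1_zero H1_norm_zero)
  then show ?thesis by linarith
qed

lemma Hm1_diff: assumes "l \<in> Hm1" "k \<in> Hm1" shows "l - k \<in> Hm1"
  unfolding Hm1_def
proof (intro CollectI conjI ballI allI)
  fix u v :: "'a \<Rightarrow> real" assume "u \<in> H1" "v \<in> H1"
  then show "(l - k) (\<lambda>x. u x + v x) = (l - k) u + (l - k) v"
    using assms by (simp add: Hm1_add)
next
  fix c and u :: "'a \<Rightarrow> real" assume "u \<in> H1"
  then show "(l - k) (\<lambda>x. c * u x) = c * (l - k) u"
    using assms by (simp add: Hm1_scale right_diff_distrib)
next
  have "\<bar>(l - k) u\<bar> \<le> (Hm1_norm l + Hm1_norm k) * H1_norm u" if "u \<in> H1" for u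
    using Hm1_bound[OF assms(1) that] Hm1_bound[OF assms(2) that] by (simp add: distrib_right)
  then show "\<exists>C. \<forall>u\<in>H1. \<bar>(l - k) u\<bar> \<le> C * H1_norm u" by blast
qed

lemma embed_Hm1: assumes f: "f \<in> L2" shows "embed f \<in> Hm1" "Hm1_norm (embed f) \<le> L2_norm f"
proof -
  have b: "\<bar>embed f u\<bar> \<le> L2_norm f * H1_norm u" if "u \<in> H1" for u
  proof -
    have "\<bar>embed f u\<bar> \<le> L2_norm f * L2_norm u"
      using L2_Cauchy_Schwarz[OF f H1_D(1)[OF that]] by (simp add: embed_def)
    also have "\<dots> \<le> L2_norm f * H1_norm u" by (intro mult_left_mono L2_norm_le_H1_norm) simp
    finally show ?thesis .
  qed
  show "embed f \<in> Hm1" unfolding Hm1_def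
  proof (intro CollectI conjI ballI allI)
    fix u v :: "'a \<Rightarrow> real" assume "u \<in> H1" "v \<in> H1"
    then show "embed f (\<lambda>x. u x + v x) = embed f u + embed f v"
      using L2_mult_integrable[OF f H1_D(1)] by (simp add: embed_def distrib_left)
  next
    fix c and u :: "'a \<Rightarrow> real" assume "u \<in> H1"
    show "embed f (\<lambda>x. c * u x) = c * embed f u"
      by (simp add: embed_def mult.left_commute)
  qed (use b in blast)
  show "Hm1_norm (embed f) \<le> L2_norm f" by (rule Hm1_norm_le[OF b]) simp_all
qed

lemma embed_diff: "f \<in> L2 \<Longrightarrow> g \<in> L2 \<Longrightarrow> v \<in> H1 \<Longrightarrow> (embed f - embed g) v = embed (f - g) v"
  using L2_mult_integrable[of f v] L2_mult_integrable[of g v] H1_D(1)[of v]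
  by (simp add: embed_def left_diff_distrib)

lemma Hm1_norm_cong: "(\<And>v. v \<in> H1 \<Longrightarrow> l v = k v) \<Longrightarrow> Hm1_norm l = Hm1_norm k"
  unfolding Hm1_norm_def by (intro SUP_cong) auto

lemma Hm1_norm_embed_diff:
  assumes "f \<in> L2" "g \<in> L2" shows "Hm1_norm (embed f - embed g) \<le> L2_norm (f - g)"
proof -
  have "f - g \<in> L2" using L2_diff[OF assms] by (simp add: fun_diff_def)
  moreover have "Hm1_norm (embed f - embed g) = Hm1_norm (embed (f - g))"
    by (rule Hm1_norm_cong) (rule embed_diff[OF assms])
  ultimately show ?thesis using embed_Hm1(2)[of "f - g"] by simp
qed

lemma weak_div_bound:
  assumes p: "p \<in> L2" and v: "v \<in> H1" shows "\<bar>weak_div p v\<bar> \<le> L2_norm p * H1_norm v"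
proof -
  have "\<bar>weak_div p v\<bar> \<le> L2_norm p * L2_norm (weak_grad v)"
    using L2_Cauchy_Schwarz[OF p H1_D(2)[OF v]] by (simp add: weak_div_def)
  also have "\<dots> \<le> L2_norm p * H1_norm v" by (intro mult_left_mono L2_norm_weak_grad_le_H1_norm) simp
  finally show ?thesis .
qed

end

section \<open>Bochner spaces on the unit time interval\<close>

lemma unit_time_AE_iff: "(AE t in unit_time. P t) \<longleftrightarrow> (AE t in lebesgue. t \<in> {0<..<1} \<longrightarrow> P t)"
  by (rule AE_restrict_space_iff) simp

lemma emeasure_unit_time: "emeasure unit_time (space unit_time) = 1"
  by (simp add: emeasure_restrict_space)

lemma finite_measure_unit_time: "finite_measure unit_time"
  by (rule finite_measureI) (simp only: emeasure_unit_time, simp)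

lemma unit_time_measurable_AE:
  fixes f g :: "real \<Rightarrow> real"
  assumes f: "f \<in> borel_measurable unit_time" and eq: "AE t in unit_time. f t = g t"
  shows "g \<in> borel_measurable unit_time"
proof -
  have "(\<lambda>t. indicat_real {0<..<1} t *\<^sub>R g t) \<in> borel_measurable lebesgue"
  proof (rule borel_measurable_AE)
    show "(\<lambda>t. indicat_real {0<..<1} t *\<^sub>R f t) \<in> borel_measurable lebesgue"
      using f by (simp add: borel_measurable_restrict_space_iff)
    show "AE t in lebesgue. indicat_real {0<..<1} t *\<^sub>R f t = indicat_real {0<..<1} t *\<^sub>R g t"
      using eq unfolding unit_time_AE_iff by eventually_elim (auto simp: indicator_def)
  qed
  then show ?thesis by (simp add: borel_measurable_restrict_space_iff)
qed

lemma unit_time_measurable_limit: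
  fixes f :: "nat \<Rightarrow> real \<Rightarrow> real"
  assumes "\<And>n. f n \<in> borel_measurable unit_time" "AE t in unit_time. (\<lambda>n. f n t) \<longlonglongrightarrow> g t"
  shows "g \<in> borel_measurable unit_time"
proof (rule unit_time_measurable_AE)
  show "(\<lambda>t. lim (\<lambda>n. f n t)) \<in> borel_measurable unit_time"
    using assms(1) by (rule borel_measurable_lim_metric)
  show "AE t in unit_time. lim (\<lambda>n. f n t) = g t"
    using assms(2) by eventually_elim (rule limI)
qed

lemma unit_time_integrable_bounded:
  fixes f :: "real \<Rightarrow> real"
  assumes "f \<in> borel_measurable unit_time" "AE t in unit_time. \<bar>f t\<bar> \<le> M"
  shows "integrable unit_time f"
  using assms by (intro finite_measure.integrable_const_bound[OF finite_measure_unit_time, of _ M]) auto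

lemma unit_time_integrable_of_sq:
  fixes f :: "real \<Rightarrow> real"
  assumes "f \<in> borel_measurable unit_time" "integrable unit_time (\<lambda>t. (f t)\<^sup>2)"
  shows "integrable unit_time f"
proof (rule Bochner_Integration.integrable_bound)
  show "integrable unit_time (\<lambda>t. 1 + (f t)\<^sup>2)"
  proof (rule Bochner_Integration.integrable_add[OF _ assms(2)])
    show "integrable unit_time (\<lambda>t. 1 :: real)" by (rule unit_time_integrable_bounded[of _ 1]) auto
  qed
  have "\<bar>x\<bar> \<le> 1 + x\<^sup>2" for x :: real
    using sum_squares_bound[of 1 "\<bar>x\<bar>"] by simp
  then show "AE t in unit_time. norm (f t) \<le> norm (1 + (f t)\<^sup>2)" by (auto intro!: AE_I2)
qed fact

lemma unit_time_integral:
  fixes f :: "real \<Rightarrow> real"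
  assumes "integrable unit_time f"
  shows "(LINT t|unit_time. f t) = integral {0..1} f"
proof -
  have "(LINT t|unit_time. f t) = (LINT t|unit_time. indicat_real {0<..1} t * f t)"
    by (rule Bochner_Integration.integral_cong) auto
  then show ?thesis using unit_time_integral_interval(2)[OF assms, of 0 1] by simp
qed

lemma unit_time_continuous_measurable:
  "continuous_on {0<..<1} f \<Longrightarrow> f \<in> borel_measurable unit_time"
  by (rule continuous_imp_measurable_on_sets_lebesgue) auto

text \<open>What \<open>L\<^sup>2\<close>, \<open>H\<^sup>1\<close> and
  \<open>H\<^sup>-\<^sup>1\<close> have in common as targets of Bochner measurable functions.
  Everything is expressed by differences, as in the definition of strong measurability, so that the
  axioms apply to functions and to functionals alike. The element in the last axiom is the value of
  truncated functions.\<close>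

locale diff_seminorm =
  fixes X :: "'c::minus set" and N :: "'c \<Rightarrow> real"
  assumes nonneg: "x \<in> X \<Longrightarrow> 0 \<le> N x"
    and diff: "x \<in> X \<Longrightarrow> y \<in> X \<Longrightarrow> x - y \<in> X"
    and self: "x \<in> X \<Longrightarrow> N (x - x) = 0"
    and sym: "x \<in> X \<Longrightarrow> y \<in> X \<Longrightarrow> N (x - y) = N (y - x)"
    and tri: "x \<in> X \<Longrightarrow> y \<in> X \<Longrightarrow> z \<in> X \<Longrightarrow> N (x - z) \<le> N (x - y) + N (y - z)"
    and lip: "x \<in> X \<Longrightarrow> y \<in> X \<Longrightarrow> N x - N y \<le> N (x - y)"
    and zero: "\<exists>z\<in>X. \<forall>x\<in>X. N (x - z) = N x"
begin

lemma abs_lip: "x \<in> X \<Longrightarrow> y \<in> X \<Longrightarrow> \<bar>N x - N y\<bar> \<le> N (x - y)"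
  using lip[of x y] lip[of y x] sym[of x y] by linarith

text \<open>A Lipschitz functional, possibly depending on time, commutes with the limit of simple
  functions.\<close>

lemma functional_measurable:
  assumes f: "strongly_measurable X N f" "AE t in unit_time. f t \<in> X"
    and lip: "\<And>t x y. t \<in> {0<..<1} \<Longrightarrow> x \<in> X \<Longrightarrow> y \<in> X \<Longrightarrow> \<bar>\<Lambda> t x - \<Lambda> t y\<bar> \<le> C * N (x - y)"
    and simple: "\<And>s. simple_function unit_time s \<Longrightarrow> (\<And>t. t \<in> {0<..<1} \<Longrightarrow> s t \<in> X) \<Longrightarrow>
       (\<lambda>t. \<Lambda> t (s t)) \<in> borel_measurable unit_time"
  shows "(\<lambda>t. \<Lambda> t (f t)) \<in> borel_measurable unit_time"
proof -
  obtain s where s: "\<And>n::nat. simple_function unit_time (s n)" "\<And>n t. t \<in> {0<..<1} \<Longrightarrow> s n t \<in> X"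
    and lim: "AE t in unit_time. (\<lambda>n. N (s n t - f t)) \<longlonglongrightarrow> 0"
    using f(1) unfolding strongly_measurable_def by blast
  show ?thesis
  proof (rule unit_time_measurable_limit)
    show "(\<lambda>t. \<Lambda> t (s n t)) \<in> borel_measurable unit_time" for n by (rule simple) (use s in auto)
    show "AE t in unit_time. (\<lambda>n. \<Lambda> t (s n t)) \<longlonglongrightarrow> \<Lambda> t (f t)"
      using lim f(2) AE_space
    proof eventually_elim
      case (elim t)
      have "(\<lambda>n. C * N (s n t - f t)) \<longlonglongrightarrow> C * 0" using elim(1) by (rule tendsto_mult_left)
      then have "(\<lambda>n. C * N (s n t - f t)) \<longlonglongrightarrow> 0" by simp
      then have "(\<lambda>n. \<Lambda> t (s n t) - \<Lambda> t (f t)) \<longlonglongrightarrow> 0"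
      proof (rule Lim_null_comparison[rotated])
        show "eventually (\<lambda>n. norm (\<Lambda> t (s n t) - \<Lambda> t (f t)) \<le> C * N (s n t - f t)) sequentially"
          using lip s(2) elim by (intro always_eventually) auto
      qed
      then show ?case by (simp add: LIM_zero_iff)
    qed
  qed
qed

lemma norm_diff_measurable:
  assumes f: "strongly_measurable X N f" "AE t in unit_time. f t \<in> X"
    and S: "simple_function unit_time S" "\<And>t. t \<in> {0<..<1} \<Longrightarrow> S t \<in> X"
  shows "(\<lambda>t. N (f t - S t)) \<in> borel_measurable unit_time"
proof (rule functional_measurable[OF f])
  show "\<bar>N (x - S t) - N (y - S t)\<bar> \<le> 1 * N (x - y)" if "t \<in> {0<..<1}" "x \<in> X" "y \<in> X" for t x y
    using tri[of x y "S t"] tri[of y x "S t"] sym[of x y] that S(2) by fastforce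
  show "(\<lambda>t. N (s t - S t)) \<in> borel_measurable unit_time" if "simple_function unit_time s" for s
    by (rule borel_measurable_simple_function, rule simple_function_compose2[OF that S(1)])
qed

lemma norm_measurable:
  assumes f: "strongly_measurable X N f" "AE t in unit_time. f t \<in> X"
  shows "(\<lambda>t. N (f t)) \<in> borel_measurable unit_time"
proof (rule functional_measurable[OF f])
  show "\<bar>N x - N y\<bar> \<le> 1 * N (x - y)" if "x \<in> X" "y \<in> X" for x y
    using abs_lip[OF that] by simp
  show "(\<lambda>t. N (s t)) \<in> borel_measurable unit_time" if "simple_function unit_time s" for s
    by (rule borel_measurable_simple_function, rule simple_function_compose1[OF that])
qed

text \<open>Approximating simple functions are set to zero where their norm exceeds twice the norm
  of the limit. This does not affect the pointwise limit and makes it dominated.\<close>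

lemma simple_approximation:
  assumes f: "f \<in> L2_Bochner X N" and e: "0 < e"
  obtains S where "simple_function unit_time S" "\<And>t. t \<in> {0<..<1} \<Longrightarrow> S t \<in> X"
    "(\<lambda>t. N (f t - S t)) \<in> borel_measurable unit_time"
    "integrable unit_time (\<lambda>t. (N (f t - S t))\<^sup>2)" "(LINT t|unit_time. (N (f t - S t))\<^sup>2) < e"
proof -
  have fX: "AE t in unit_time. f t \<in> X" and sm: "strongly_measurable X N f"
    and int: "integrable unit_time (\<lambda>t. (N (f t))\<^sup>2)" using f by (auto simp: L2_Bochner_def)
  obtain s where s: "\<And>n::nat. simple_function unit_time (s n)" "\<And>n t. t \<in> {0<..<1} \<Longrightarrow> s n t \<in> X"
    and lim: "AE t in unit_time. (\<lambda>n. N (s n t - f t)) \<longlonglongrightarrow> 0"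
    using sm unfolding strongly_measurable_def by blast
  obtain z where z: "z \<in> X" "\<And>x. x \<in> X \<Longrightarrow> N (x - z) = N x" using zero by blast
  have Nf [measurable]: "(\<lambda>t. N (f t)) \<in> borel_measurable unit_time" by (rule norm_measurable[OF sm fX])
  \<comment> \<open>where \<open>f\<close> has norm zero, the truncated values have norm zero as well\<close>
  define S where "S n t = (if N (s n t) \<le> 2 * N (f t) then s n t else z)" for n t
  have Ss: "simple_function unit_time (S n)" for n
    unfolding S_def[abs_def]
  proof (rule simple_function_If[OF s(1)])
    have [measurable]: "(\<lambda>t. N (s n t)) \<in> borel_measurable unit_time"
      by (rule borel_measurable_simple_function, rule simple_function_compose1[OF s(1)])
    show "{t \<in> space unit_time. N (s n t) \<le> 2 * N (f t)} \<in> sets unit_time" by measurable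
  qed simp
  have SX: "S n t \<in> X" if "t \<in> {0<..<1}" for n t using s(2)[OF that] z(1) by (simp add: S_def)
  have Sm: "(\<lambda>t. N (f t - S n t)) \<in> borel_measurable unit_time" for n
    by (rule norm_diff_measurable[OF sm fX Ss SX])
  have dom: "(N (f t - S n t))\<^sup>2 \<le> 9 * (N (f t))\<^sup>2" if "f t \<in> X" "t \<in> {0<..<1}" for n t
  proof -
    have "N (f t - S n t) \<le> N (f t) + N (S n t - z)"
      using tri[of "f t" z "S n t"] sym[of z "S n t"] that z SX[OF that(2)] by fastforce
    also have "N (S n t - z) \<le> 2 * N (f t)"
      using z s(2)[OF that(2)] self[OF z(1)] nonneg[OF that(1)] by (auto simp: S_def)
    finally have "N (f t - S n t) \<le> 3 * N (f t)" by simp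
    then have "(N (f t - S n t))\<^sup>2 \<le> (3 * N (f t))\<^sup>2"
      using nonneg[OF diff[OF that(1) SX[OF that(2)]]] by (rule power_mono)
    then show ?thesis by (simp add: power_mult_distrib)
  qed
  have i9: "integrable unit_time (\<lambda>t. 9 * (N (f t))\<^sup>2)" using int by simp
  have bd: "AE t in unit_time. norm ((N (f t - S n t))\<^sup>2) \<le> 9 * (N (f t))\<^sup>2" for n
    using fX AE_space by eventually_elim (simp add: dom)
  have conv: "AE t in unit_time. (\<lambda>n. (N (f t - S n t))\<^sup>2) \<longlonglongrightarrow> 0"
    using lim fX AE_space
  proof eventually_elim
    case (elim t)
    then have tt: "t \<in> {0<..<1}" by simp
    have ev: "eventually (\<lambda>n. norm (N (f t - S n t)) \<le> N (s n t - f t)) sequentially"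
    proof (cases "N (f t) = 0")
      case True
      have "norm (N (f t - S n t)) \<le> N (s n t - f t)" for n
        using True sym[OF elim(2) s(2)[OF tt]] nonneg[OF diff[OF elim(2) s(2)[OF tt, of n]]] z elim(2)
          nonneg[OF diff[OF s(2)[OF tt, of n] elim(2)]]
        by (auto simp: S_def)
      then show ?thesis by simp
    next
      case False
      then have pos: "N (f t) > 0" using nonneg[OF elim(2)] by simp
      then have "eventually (\<lambda>n. N (s n t - f t) < N (f t)) sequentially"
        using order_tendstoD(2)[OF elim(1)] by simp
      then show ?thesis
      proof eventually_elim
        case (elim n)
        then have "N (s n t) \<le> 2 * N (f t)" using lip[OF s(2)[OF tt, of n] \<open>f t \<in> X\<close>] by linarith
        then show ?case
          using sym[OF \<open>f t \<in> X\<close> s(2)[OF tt, of n]] nonneg[OF diff[OF s(2)[OF tt, of n] \<open>f t \<in> X\<close>]]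
          by (simp add: S_def)
      qed
    qed
    have "(\<lambda>n. N (f t - S n t)) \<longlonglongrightarrow> 0"
      by (rule Lim_null_comparison[OF ev elim(1)])
    then have "(\<lambda>n. (N (f t - S n t))\<^sup>2) \<longlonglongrightarrow> 0\<^sup>2" by (rule tendsto_power)
    then show ?case by simp
  qed
  have "(\<lambda>n. LINT t|unit_time. (N (f t - S n t))\<^sup>2) \<longlonglongrightarrow> (LINT t|unit_time. 0)"
    by (rule integral_dominated_convergence[OF _ _ i9 conv bd]) (use Sm in auto)
  then have "eventually (\<lambda>n. (LINT t|unit_time. (N (f t - S n t))\<^sup>2) < e) sequentially"
    using order_tendstoD(2)[of _ 0] e by simp
  then obtain n where n: "(LINT t|unit_time. (N (f t - S n t))\<^sup>2) < e"
    by (auto simp: eventually_sequentially)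
  have i: "integrable unit_time (\<lambda>t. (N (f t - S n t))\<^sup>2)"
    by (rule Bochner_Integration.integrable_bound[OF i9])
      (use Sm[of n] bd[of n] in \<open>auto elim: eventually_mono\<close>)
  show thesis by (rule that[OF Ss SX Sm i n])
qed

text \<open>A function that is continuous except at one time is the pointwise limit of its values at
  the midpoints of a grid; midpoints keep the grid inside the open interval. The exceptional time
  will be the accumulation point of the blocks.\<close>

lemma L2_Bochner_I:
  assumes X: "\<And>t. t \<in> {0<..<1} \<Longrightarrow> f t \<in> X"
    and cont: "\<And>t. t \<in> {0<..<1} \<Longrightarrow> t \<noteq> c \<Longrightarrow> ((\<lambda>s. N (f s - f t)) \<longlongrightarrow> 0) (at t)"
    and bound: "\<And>t. t \<in> {0<..<1} \<Longrightarrow> N (f t) \<le> M"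
  shows "f \<in> L2_Bochner X N"
proof -
  have fX: "AE t in unit_time. f t \<in> X" using X by (intro AE_I2) simp
  have neq: "AE t in unit_time. t \<noteq> c"
    unfolding unit_time_AE_iff using AE_lborel_singleton[of c] by (intro AE_completion) (auto elim: eventually_mono)
  define q where "q n t = (real_of_int \<lfloor>real (Suc n) * t\<rfloor> + 1/2) / real (Suc n)" for n t
  have q01: "q n t \<in> {0<..<1}" if "t \<in> {0<..<1}" for n t
  proof -
    have a: "0 \<le> \<lfloor>real (Suc n) * t\<rfloor>" using that by simp
    have "\<lfloor>real (Suc n) * t\<rfloor> < int (Suc n)"
      using that by (simp add: floor_less_iff del: of_nat_Suc)
    then have "real_of_int \<lfloor>real (Suc n) * t\<rfloor> + 1 \<le> real (Suc n)" by linarith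
    then have b: "real_of_int \<lfloor>real (Suc n) * t\<rfloor> + 1/2 < real (Suc n)" by linarith
    have c: "0 < real_of_int \<lfloor>real (Suc n) * t\<rfloor> + 1/2" using a by linarith
    have "0 < q n t" unfolding q_def by (rule divide_pos_pos[OF c]) simp
    moreover have "q n t < 1" unfolding q_def using b by (subst divide_less_eq_1_pos) simp_all
    ultimately show ?thesis by simp
  qed
  have qd: "\<bar>q n t - t\<bar> \<le> 1 / real (Suc n)" for n t
  proof -
    have "\<bar>(real_of_int \<lfloor>real (Suc n) * t\<rfloor> + 1/2) - real (Suc n) * t\<bar> \<le> 1"
      using floor_correct[of "real (Suc n) * t"] by linarith
    moreover have "q n t - t = ((real_of_int \<lfloor>real (Suc n) * t\<rfloor> + 1/2) - real (Suc n) * t) / real (Suc n)"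
      by (simp add: q_def field_simps)
    ultimately show ?thesis by (simp add: abs_divide divide_right_mono del: of_nat_Suc)
  qed
  have qlim: "(\<lambda>n. q n t) \<longlonglongrightarrow> t" for t
  proof -
    have "(\<lambda>n. q n t - t) \<longlonglongrightarrow> 0"
      by (rule Lim_null_comparison[OF _ LIMSEQ_inverse_real_of_nat])
        (use qd in \<open>auto simp: inverse_eq_divide\<close>)
    then show ?thesis by (simp add: LIM_zero_iff)
  qed
  have qs: "simple_function unit_time (q n)" for n
  proof (rule simple_function_borel_measurable)
    have "q n \<in> borel_measurable borel" unfolding q_def[abs_def] by measurable
    then show "q n \<in> borel_measurable unit_time" by (intro measurable_restrict_space1 measurable_completion) simp
    have "q n ` space unit_time \<subseteq> (\<lambda>i. (real_of_int i + 1/2) / real (Suc n)) ` {0..int (Suc n)}"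
    proof
      fix y assume "y \<in> q n ` space unit_time"
      then obtain t where t: "t \<in> {0<..<1}" "y = q n t" by auto
      then have "real (Suc n) * t \<le> real (Suc n)" by (intro mult_left_le) auto
      then have "0 \<le> \<lfloor>real (Suc n) * t\<rfloor>" "\<lfloor>real (Suc n) * t\<rfloor> \<le> int (Suc n)"
        using t by (simp, linarith)
      then show "y \<in> (\<lambda>i. (real_of_int i + 1/2) / real (Suc n)) ` {0..int (Suc n)}"
        using t by (auto simp: q_def simp del: of_nat_Suc)
    qed
    then show "finite (q n ` space unit_time)" by (rule finite_subset) simp
  qed
  have sm: "strongly_measurable X N f"
    unfolding strongly_measurable_def
  proof (intro exI[of _ "\<lambda>n t. f (q n t)"] conjI allI ballI)
    show "simple_function unit_time (\<lambda>t. f (q n t))" for n by (rule simple_function_compose1[OF qs])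
    show "f (q n t) \<in> X" if "t \<in> {0<..<1}" for n t by (rule X[OF q01[OF that]])
    show "AE t in unit_time. (\<lambda>n. N (f (q n t) - f t)) \<longlonglongrightarrow> 0"
      using neq AE_space
    proof eventually_elim
      case (elim t)
      then have t: "t \<in> {0<..<1}" by simp
      have "((\<lambda>s. N (f s - f t)) \<longlongrightarrow> N (f t - f t)) (at t)"
        using cont[OF t elim(1)] self[OF X[OF t]] by simp
      then have "((\<lambda>s. N (f s - f t)) \<longlongrightarrow> N (f t - f t)) (nhds t)"
        by (rule tendsto_at_iff_tendsto_nhds[THEN iffD1])
      then have "((\<lambda>s. N (f s - f t)) \<longlongrightarrow> 0) (nhds t)" by (simp only: self[OF X[OF t]])
      from filterlim_compose[OF this qlim] show ?case .
    qed
  qed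
  have Nm: "(\<lambda>t. N (f t)) \<in> borel_measurable unit_time" by (rule norm_measurable[OF sm fX])
  have "integrable unit_time (\<lambda>t. (N (f t))\<^sup>2)"
  proof (rule unit_time_integrable_bounded[of _ "M\<^sup>2"])
    show "(\<lambda>t. (N (f t))\<^sup>2) \<in> borel_measurable unit_time" using Nm by simp
    show "AE t in unit_time. \<bar>(N (f t))\<^sup>2\<bar> \<le> M\<^sup>2"
      using AE_space by eventually_elim (auto intro!: power_mono bound nonneg X)
  qed
  then show ?thesis using fX sm by (simp add: L2_Bochner_def)
qed

end

lemma L2_seminorm: "diff_seminorm L2 L2_norm"
proof
  fix f g h :: "'a \<Rightarrow> 'b"
  show "f \<in> L2 \<Longrightarrow> 0 \<le> L2_norm f" by simp
  show "f \<in> L2 \<Longrightarrow> L2_norm (f - f) = 0" by (simp add: L2_norm_def)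
  show "L2_norm (f - g) = L2_norm (g - f)" by (simp add: L2_norm_def norm_minus_commute)
  show d: "f - g \<in> L2" if "f \<in> L2" "g \<in> L2" for f g :: "'a \<Rightarrow> 'b"
    using L2_diff[OF that] by (simp add: fun_diff_def)
  show "L2_norm (f - h) \<le> L2_norm (f - g) + L2_norm (g - h)" if "f \<in> L2" "g \<in> L2" "h \<in> L2"
    using L2_norm_triangle[OF d[OF that(1,2)] d[OF that(2,3)]] by (simp add: fun_diff_def)
  show "L2_norm f - L2_norm g \<le> L2_norm (f - g)" if "f \<in> L2" "g \<in> L2"
    using L2_norm_triangle[OF d[OF that] that(2)] by (simp add: fun_diff_def)
  show "\<exists>z\<in>L2. \<forall>f\<in>L2. L2_norm (f - z :: 'a \<Rightarrow> 'b) = L2_norm f"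
    by (rule bexI[OF _ L2_zero]) (simp add: fun_diff_def)
qed

context smooth_cutoff
begin

lemma H1_seminorm: "diff_seminorm H1 H1_norm"
proof
  fix f g h :: "'a \<Rightarrow> real"
  show "0 \<le> H1_norm f" by simp
  have z: "f - f = (\<lambda>x. 0)" by (simp add: fun_diff_def)
  show "H1_norm (f - f) = 0" unfolding z by (rule H1_norm_zero)
  show d: "f - g \<in> H1" if "f \<in> H1" "g \<in> H1" for f g :: "'a \<Rightarrow> real"
    by (rule H1_diff[OF that])
  have s: "H1_norm (f - g) \<le> H1_norm (g - f)" if "f \<in> H1" "g \<in> H1" for f g :: "'a \<Rightarrow> real"
    using H1_norm_scale[OF d[OF that(2,1)], of "-1"] by (simp add: fun_diff_def)
  show "H1_norm (f - g) = H1_norm (g - f)" if "f \<in> H1" "g \<in> H1"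
    using s[OF that] s[OF that(2,1)] by simp
  show "H1_norm (f - h) \<le> H1_norm (f - g) + H1_norm (g - h)" if "f \<in> H1" "g \<in> H1" "h \<in> H1"
    using H1_norm_triangle_scaled[OF d[OF that(1,2)] d[OF that(2,3)], of 1] by (simp add: fun_diff_def)
  show "H1_norm f - H1_norm g \<le> H1_norm (f - g)" if "f \<in> H1" "g \<in> H1"
    using H1_norm_triangle_scaled[OF d[OF that] that(2), of 1] by (simp add: fun_diff_def)
  show "\<exists>z\<in>H1. \<forall>f\<in>H1. H1_norm (f - z :: 'a \<Rightarrow> real) = H1_norm f"
    by (rule bexI[OF _ H1_zero]) (simp add: fun_diff_def)
qed

lemma Hm1_zero: "(\<lambda>v. 0) \<in> Hm1"
  by (auto simp: Hm1_def intro: exI[of _ 0])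

lemma Hm1_seminorm: "diff_seminorm Hm1 Hm1_norm"
proof
  fix f g h :: "('a \<Rightarrow> real) \<Rightarrow> real"
  show "f \<in> Hm1 \<Longrightarrow> 0 \<le> Hm1_norm f" by (rule Hm1_norm_nonneg)
  show d: "f - g \<in> Hm1" if "f \<in> Hm1" "g \<in> Hm1" for f g :: "('a \<Rightarrow> real) \<Rightarrow> real"
    by (rule Hm1_diff[OF that])
  show "f \<in> Hm1 \<Longrightarrow> Hm1_norm (f - f) = 0"
    using Hm1_norm_le[of "f - f" 0] Hm1_norm_nonneg[OF d, of f f] by simp
  show "Hm1_norm (f - g) = Hm1_norm (g - f)"
    unfolding Hm1_norm_def by (simp add: abs_minus_commute)
  show "Hm1_norm (f - h) \<le> Hm1_norm (f - g) + Hm1_norm (g - h)" if "f \<in> Hm1" "g \<in> Hm1" "h \<in> Hm1"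
  proof (rule Hm1_norm_le)
    show "\<bar>(f - h) v\<bar> \<le> (Hm1_norm (f - g) + Hm1_norm (g - h)) * H1_norm v" if v: "v \<in> H1" for v
      using Hm1_bound[OF d[OF \<open>f \<in> Hm1\<close> \<open>g \<in> Hm1\<close>] v] Hm1_bound[OF d[OF \<open>g \<in> Hm1\<close> \<open>h \<in> Hm1\<close>] v]
      by (simp add: distrib_right)
    show "0 \<le> Hm1_norm (f - g) + Hm1_norm (g - h)"
      using Hm1_norm_nonneg[OF d[OF that(1,2)]] Hm1_norm_nonneg[OF d[OF that(2,3)]] by linarith
  qed
  show "Hm1_norm f - Hm1_norm g \<le> Hm1_norm (f - g)" if "f \<in> Hm1" "g \<in> Hm1"
  proof -
    have "Hm1_norm f \<le> Hm1_norm (f - g) + Hm1_norm g"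
    proof (rule Hm1_norm_le)
      show "\<bar>f v\<bar> \<le> (Hm1_norm (f - g) + Hm1_norm g) * H1_norm v" if v: "v \<in> H1" for v
        using Hm1_bound[OF d[OF \<open>f \<in> Hm1\<close> \<open>g \<in> Hm1\<close>] v] Hm1_bound[OF \<open>g \<in> Hm1\<close> v]
        by (simp add: distrib_right)
      show "0 \<le> Hm1_norm (f - g) + Hm1_norm g"
        using Hm1_norm_nonneg[OF d[OF that]] Hm1_norm_nonneg[OF that(2)] by linarith
    qed
    then show ?thesis by simp
  qed
  show "\<exists>z\<in>Hm1. \<forall>f\<in>Hm1. Hm1_norm (f - z :: ('a \<Rightarrow> real) \<Rightarrow> real) = Hm1_norm f"
    by (rule bexI[OF _ Hm1_zero]) (simp add: fun_diff_def)
qed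

text \<open>Evaluation at \<open>v\<close> is Lipschitz on \<open>H\<^sup>-\<^sup>1\<close>, and
  square integrability of the norm implies integrability on a finite measure space.\<close>

lemma Hm1_Bochner_apply:
  assumes G: "G \<in> L2_Bochner Hm1 Hm1_norm" and v: "v \<in> H1"
  shows "integrable unit_time (\<lambda>t. G t v)"
proof -
  interpret Hm1: diff_seminorm "Hm1 :: (('a \<Rightarrow> real) \<Rightarrow> real) set" Hm1_norm by (rule Hm1_seminorm)
  have GX: "AE t in unit_time. G t \<in> Hm1" and sm: "strongly_measurable Hm1 Hm1_norm G"
    and int: "integrable unit_time (\<lambda>t. (Hm1_norm (G t))\<^sup>2)" using G by (auto simp: L2_Bochner_def)
  have m: "(\<lambda>t. G t v) \<in> borel_measurable unit_time"
  proof (rule Hm1.functional_measurable[OF sm GX])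
    show "\<bar>x v - y v\<bar> \<le> H1_norm v * Hm1_norm (x - y)" if "x \<in> Hm1" "y \<in> Hm1" for x y
      using Hm1_bound[OF Hm1.diff[OF that] v] by (simp add: mult.commute)
    show "(\<lambda>t. s t v) \<in> borel_measurable unit_time" if "simple_function unit_time s" for s
      by (rule borel_measurable_simple_function, rule simple_function_compose1[OF that])
  qed
  have i: "integrable unit_time (\<lambda>t. Hm1_norm (G t) * H1_norm v)"
    using unit_time_integrable_of_sq[OF Hm1.norm_measurable[OF sm GX] int] by simp
  show ?thesis
  proof (rule Bochner_Integration.integrable_bound[OF i m])
    show "AE t in unit_time. norm (G t v) \<le> norm (Hm1_norm (G t) * H1_norm v)"
      using GX by eventually_elim (use Hm1_bound[OF _ v] in \<open>force intro: order_trans[OF _ abs_ge_self]\<close>)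
  qed
qed

end

section \<open>Backward averages\<close>

definition prim :: "(real \<Rightarrow> real) \<Rightarrow> real \<Rightarrow> real" where
  "prim \<alpha> t = integral {0..t} \<alpha>"

text \<open>The average of \<open>\<alpha>\<close> over \<open>(t - h, t)\<close>, where
  \<open>\<alpha>\<close> is extended by zero to negative times: the primitive vanishes
  there.\<close>

definition avg :: "real \<Rightarrow> (real \<Rightarrow> real) \<Rightarrow> real \<Rightarrow> real" where
  "avg h \<alpha> t = (prim \<alpha> t - prim \<alpha> (t - h)) / h"

lemma prim_nonpos: "t \<le> 0 \<Longrightarrow> prim \<alpha> t = 0"
  by (cases "t = 0") (auto simp: prim_def)

lemma prim_diff:
  assumes "integrable unit_time \<alpha>" "0 \<le> s" "s \<le> t" "t \<le> 1"
  shows "prim \<alpha> t - prim \<alpha> s = integral {s..t} \<alpha>"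
  using Henstock_Kurzweil_Integration.integral_combine[of 0 s t \<alpha>] unit_time_integral_interval(1)[of \<alpha> 0 t] assms
  by (simp add: prim_def)

lemma prim_diff':
  assumes "integrable unit_time \<alpha>" "s \<le> t" "0 \<le> t" "t \<le> 1"
  shows "prim \<alpha> t - prim \<alpha> s = integral {max 0 s..t} \<alpha>"
  using prim_diff[OF assms(1), of "max 0 s" t] assms by (auto simp: max_def prim_nonpos prim_def split: if_splits)

lemma prim_continuous:
  assumes "integrable unit_time \<alpha>" shows "continuous_on {..1} (prim \<alpha>)"
proof -
  have "{..1::real} = {..0} \<union> {0..1}" by auto
  moreover have "continuous_on {..0} (prim \<alpha>)"
    by (rule continuous_on_eq[of _ "\<lambda>_. 0"]) (auto simp: prim_nonpos)
  moreover have "continuous_on {0..1} (prim \<alpha>)"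
    unfolding prim_def using unit_time_integral_interval(1)[OF assms, of 0 1]
    by (intro indefinite_integral_continuous_1) simp
  ultimately show ?thesis by (simp add: continuous_on_closed_Un)
qed

lemma avg_continuous:
  assumes "integrable unit_time \<alpha>" "0 < h" shows "continuous_on {..1} (avg h \<alpha>)"
proof -
  have "continuous_on {..1} (\<lambda>t. prim \<alpha> (t - h))"
    by (rule continuous_on_compose2[OF prim_continuous[OF assms(1)]]) (use assms in \<open>auto intro!: continuous_intros\<close>)
  then show ?thesis unfolding avg_def
    using assms by (intro continuous_on_divide continuous_on_diff prim_continuous continuous_on_const) auto
qed

lemma unit_time_integrable_continuous:
  fixes f :: "real \<Rightarrow> real"
  assumes "continuous_on {..1} f" shows "integrable unit_time f"
proof -
  have c: "continuous_on {0..1} f" by (rule continuous_on_subset[OF assms]) auto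
  have "bounded (f ` {0..1})" by (rule compact_imp_bounded[OF compact_continuous_image[OF c]]) simp
  then obtain M where "\<forall>y\<in>f ` {0..1}. norm y \<le> M" unfolding bounded_iff by blast
  then have "AE t in unit_time. \<bar>f t\<bar> \<le> M" by (intro AE_I2) simp
  moreover have "f \<in> borel_measurable unit_time"
    by (rule unit_time_continuous_measurable, rule continuous_on_subset[OF c]) auto
  ultimately show ?thesis by (intro unit_time_integrable_bounded)
qed

lemma avg_integrable: "integrable unit_time \<alpha> \<Longrightarrow> 0 < h \<Longrightarrow> integrable unit_time (avg h \<alpha>)"
  by (rule unit_time_integrable_continuous, rule avg_continuous)

lemma avg_mono:
  assumes "integrable unit_time \<alpha>" "integrable unit_time \<beta>" "0 < h" "t \<in> {0<..<1}" "\<And>t. t \<in> {0..1} \<Longrightarrow> \<alpha> t \<le> \<beta> t"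
  shows "avg h \<alpha> t \<le> avg h \<beta> t"
  unfolding avg_def
proof (rule divide_right_mono)
  have "integral {max 0 (t - h)..t} \<alpha> \<le> integral {max 0 (t - h)..t} \<beta>"
    using assms by (intro integral_le unit_time_integral_interval(1)) auto
  then show "prim \<alpha> t - prim \<alpha> (t - h) \<le> prim \<beta> t - prim \<beta> (t - h)"
    using prim_diff'[OF assms(1), of "t - h" t] prim_diff'[OF assms(2), of "t - h" t] assms by auto
qed (use assms in auto)

lemma avg_abs_le:
  assumes "integrable unit_time \<alpha>" "0 < h" "t \<in> {0<..<1}"
  shows "\<bar>avg h \<alpha> t\<bar> \<le> avg h (\<lambda>t. \<bar>\<alpha> t\<bar>) t"
proof -
  have i: "integrable unit_time (\<lambda>t. \<bar>\<alpha> t\<bar>)" using assms by simp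
  have "\<bar>integral {max 0 (t - h)..t} \<alpha>\<bar> \<le> integral {max 0 (t - h)..t} (\<lambda>t. \<bar>\<alpha> t\<bar>)"
    using assms integral_norm_bound_integral[of \<alpha> "{max 0 (t - h)..t}" "\<lambda>t. \<bar>\<alpha> t\<bar>"]
      unit_time_integral_interval(1)[OF assms(1), of "max 0 (t - h)" t] unit_time_integral_interval(1)[OF i, of "max 0 (t - h)" t]
    by auto
  then show ?thesis unfolding avg_def
    using prim_diff'[OF assms(1), of "t - h" t] prim_diff'[OF i, of "t - h" t] assms
    by (simp add: abs_divide divide_right_mono)
qed

lemma avg_nonneg:
  assumes "integrable unit_time \<alpha>" "0 < h" "t \<in> {0<..<1}" "\<And>t. 0 \<le> \<alpha> t"
  shows "0 \<le> avg h \<alpha> t"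
  using avg_abs_le[OF assms(1-3)] assms(4) by (simp add: order_trans[OF abs_ge_zero])

text \<open>The integral of the average telescopes: it is a difference of two integrals of the primitive, of
  which only the last stretch of length \<open>h\<close> survives.\<close>

lemma integral_avg_le:
  assumes \<alpha>: "integrable unit_time \<alpha>" and h: "0 < h" "h < 1" and nn: "\<And>t. 0 \<le> \<alpha> t"
  shows "(LINT t|unit_time. avg h \<alpha> t) \<le> (LINT t|unit_time. \<alpha> t)"
proof -
  note c = prim_continuous[OF \<alpha>]
  have i: "prim \<alpha> integrable_on {a..b}" if "b \<le> 1" for a b
    by (rule integrable_continuous_real, rule continuous_on_subset[OF c]) (use that in auto)
  have i': "(\<lambda>t. prim \<alpha> (t - h)) integrable_on {0..1}"
    by (rule integrable_continuous_real, rule continuous_on_compose2[OF c]) (use h in \<open>auto intro!: continuous_intros\<close>)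
  have "(LINT t|unit_time. avg h \<alpha> t) = integral {0..1} (avg h \<alpha>)"
    by (rule unit_time_integral[OF avg_integrable[OF \<alpha> h(1)]])
  also have "\<dots> = (integral {0..1} (prim \<alpha>) - integral {0..1} (\<lambda>t. prim \<alpha> (t - h))) / h"
    unfolding avg_def by (simp add: Henstock_Kurzweil_Integration.integral_diff[OF i[of 1 0] i'])
  also have "integral {0..1} (\<lambda>t. prim \<alpha> (t - h)) = integral {-h..1-h} (prim \<alpha>)"
    using integral_shift_Icc_real[of 0 1 "prim \<alpha>" "-h"] by (simp add: o_def)
  also have "\<dots> = integral {-h..0} (prim \<alpha>) + integral {0..1-h} (prim \<alpha>)"
    using h by (intro Henstock_Kurzweil_Integration.integral_combine[symmetric] i) auto
  also have "integral {-h..0} (prim \<alpha>) = integral {-h..0} (\<lambda>_. 0)"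
    by (rule integral_cong) (simp add: prim_nonpos)
  also have "integral {0..1} (prim \<alpha>) = integral {0..1-h} (prim \<alpha>) + integral {1-h..1} (prim \<alpha>)"
    using h by (intro Henstock_Kurzweil_Integration.integral_combine[symmetric] i) auto
  also have "integral {1-h..1} (prim \<alpha>) \<le> integral {1-h..1} (\<lambda>_. prim \<alpha> 1)"
  proof (rule integral_le[OF i])
    fix t assume t: "t \<in> {1-h..1}"
    have "0 \<le> integral {t..1} \<alpha>"
      using nn t h by (intro integral_nonneg unit_time_integral_interval(1)[OF \<alpha>]) auto
    then show "prim \<alpha> t \<le> prim \<alpha> 1" using prim_diff[OF \<alpha>, of t 1] t h by simp
  qed auto
  finally have "(LINT t|unit_time. avg h \<alpha> t) \<le> h * prim \<alpha> 1 / h"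
    using h by (simp add: divide_right_mono)
  also have "\<dots> = (LINT t|unit_time. \<alpha> t)" using h unit_time_integral[OF \<alpha>] by (simp add: prim_def)
  finally show ?thesis .
qed

text \<open>Measurable functions are almost everywhere limits of continuous ones. Clamping first the
  function and then its approximants to a bounded range makes both limits dominated.\<close>

lemma unit_time_continuous_dense:
  fixes \<alpha> :: "real \<Rightarrow> real"
  assumes \<alpha>: "integrable unit_time \<alpha>" and e: "0 < e"
  obtains c where "continuous_on UNIV c" "(LINT t|unit_time. \<bar>\<alpha> t - c t\<bar>) < e"
proof -
  have [measurable]: "\<alpha> \<in> borel_measurable unit_time" using \<alpha> by simp
  have "(\<lambda>t. indicat_real {0<..<1} t *\<^sub>R \<alpha> t) \<in> borel_measurable lebesgue"
    using \<alpha> by (subst borel_measurable_restrict_space_iff[symmetric]) auto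
  then have "(\<lambda>t. indicat_real {0<..<1} t *\<^sub>R \<alpha> t) measurable_on UNIV"
    by (intro lebesgue_measurable_imp_measurable_on) auto
  then obtain Z g where Z: "negligible Z" and g: "\<And>n. continuous_on UNIV (g n)"
    and lim: "\<And>t. t \<notin> Z \<Longrightarrow> (\<lambda>n. g n t) \<longlonglongrightarrow> indicat_real {0<..<1} t *\<^sub>R \<alpha> t"
    unfolding measurable_on_def by auto
  have Z': "AE t in unit_time. t \<notin> Z"
    unfolding unit_time_AE_iff using Z by (intro AE_I'[of Z]) (auto simp: negligible_iff_null_sets)
  define cl where "cl M x = max (- real M) (min (real M) x)" for M and x :: real
  have clb: "\<bar>cl M x\<bar> \<le> real M" for M x by (auto simp: cl_def)
  have clx: "\<bar>cl M x\<bar> \<le> \<bar>x\<bar>" for M x by (auto simp: cl_def)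
  have clc: "continuous_on UNIV (cl M)" for M unfolding cl_def[abs_def] by (intro continuous_intros)
  have clm [measurable]: "cl M \<in> borel_measurable borel" for M
    by (rule borel_measurable_continuous_onI[OF clc])
  have "(\<lambda>M. LINT t|unit_time. \<bar>\<alpha> t - cl M (\<alpha> t)\<bar>) \<longlonglongrightarrow> (LINT t|unit_time. 0)"
  proof (rule integral_dominated_convergence[of _ _ _ "\<lambda>t. 2 * \<bar>\<alpha> t\<bar>"])
    show "integrable unit_time (\<lambda>t. 2 * \<bar>\<alpha> t\<bar>)" using \<alpha> by simp
    show "AE t in unit_time. norm \<bar>\<alpha> t - cl M (\<alpha> t)\<bar> \<le> 2 * \<bar>\<alpha> t\<bar>" for M
    proof (rule AE_I2)
      show "norm \<bar>\<alpha> t - cl M (\<alpha> t)\<bar> \<le> 2 * \<bar>\<alpha> t\<bar>" for t using clx[of M "\<alpha> t"] by simp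
    qed
    show "AE t in unit_time. (\<lambda>M. \<bar>\<alpha> t - cl M (\<alpha> t)\<bar>) \<longlonglongrightarrow> 0"
    proof (rule AE_I2)
      fix t
      obtain M0 :: nat where "\<bar>\<alpha> t\<bar> < real M0" using reals_Archimedean2 by blast
      then have "\<bar>\<alpha> t - cl M (\<alpha> t)\<bar> = 0" if "M \<ge> M0" for M using that by (auto simp: cl_def)
      then show "(\<lambda>M. \<bar>\<alpha> t - cl M (\<alpha> t)\<bar>) \<longlonglongrightarrow> 0"
        by (intro tendsto_eventually) (auto simp: eventually_sequentially)
    qed
  qed auto
  then have "eventually (\<lambda>M. (LINT t|unit_time. \<bar>\<alpha> t - cl M (\<alpha> t)\<bar>) < e / 2) sequentially"
    by (rule order_tendstoD(2)) (use e in simp)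
  then obtain M where M: "(LINT t|unit_time. \<bar>\<alpha> t - cl M (\<alpha> t)\<bar>) < e / 2"
    by (auto simp: eventually_sequentially)
  have gc: "continuous_on UNIV (\<lambda>t. cl M (g n t))" for n
    by (rule continuous_on_compose2[OF clc g]) simp
  have gm [measurable]: "(\<lambda>t. cl M (g n t)) \<in> borel_measurable unit_time" for n
    by (rule unit_time_continuous_measurable, rule continuous_on_subset[OF gc]) simp
  have "(\<lambda>n. LINT t|unit_time. \<bar>cl M (\<alpha> t) - cl M (g n t)\<bar>) \<longlonglongrightarrow> (LINT t|unit_time. 0)"
  proof (rule integral_dominated_convergence[of _ _ _ "\<lambda>t. 2 * real M"])
    show "integrable unit_time (\<lambda>t. 2 * real M)" by (rule unit_time_integrable_bounded[of _ "2 * M"]) auto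
    show "AE t in unit_time. norm \<bar>cl M (\<alpha> t) - cl M (g n t)\<bar> \<le> 2 * real M" for n
    proof (rule AE_I2)
      show "norm \<bar>cl M (\<alpha> t) - cl M (g n t)\<bar> \<le> 2 * real M" for t
        using clb[of M "\<alpha> t"] clb[of M "g n t"] by simp
    qed
    show "AE t in unit_time. (\<lambda>n. \<bar>cl M (\<alpha> t) - cl M (g n t)\<bar>) \<longlonglongrightarrow> 0"
      using Z' AE_space
    proof eventually_elim
      case (elim t)
      then have "(\<lambda>n. g n t) \<longlonglongrightarrow> \<alpha> t" using lim[of t] by simp
      moreover have "isCont (cl M) (\<alpha> t)" using clc by (simp add: continuous_on_eq_continuous_at)
      ultimately have "(\<lambda>n. cl M (g n t)) \<longlonglongrightarrow> cl M (\<alpha> t)" by (rule isCont_tendsto_compose[rotated])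
      then have "(\<lambda>n. \<bar>cl M (\<alpha> t) - cl M (g n t)\<bar>) \<longlonglongrightarrow> \<bar>cl M (\<alpha> t) - cl M (\<alpha> t)\<bar>"
        by (intro tendsto_intros)
      then show ?case by simp
    qed
  qed auto
  then have "eventually (\<lambda>n. (LINT t|unit_time. \<bar>cl M (\<alpha> t) - cl M (g n t)\<bar>) < e / 2) sequentially"
    by (rule order_tendstoD(2)) (use e in simp)
  then obtain n where n: "(LINT t|unit_time. \<bar>cl M (\<alpha> t) - cl M (g n t)\<bar>) < e / 2"
    by (auto simp: eventually_sequentially)
  have ic: "integrable unit_time (\<lambda>t. cl M (\<alpha> t))" "integrable unit_time (\<lambda>t. cl M (g n t))"
    using clb by (auto intro!: unit_time_integrable_bounded[of _ "real M"])
  have "(LINT t|unit_time. \<bar>\<alpha> t - cl M (g n t)\<bar>)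
     \<le> (LINT t|unit_time. \<bar>\<alpha> t - cl M (\<alpha> t)\<bar> + \<bar>cl M (\<alpha> t) - cl M (g n t)\<bar>)"
    using \<alpha> ic by (intro integral_mono) auto
  also have "\<dots> = (LINT t|unit_time. \<bar>\<alpha> t - cl M (\<alpha> t)\<bar>) + (LINT t|unit_time. \<bar>cl M (\<alpha> t) - cl M (g n t)\<bar>)"
    using \<alpha> ic by (intro Bochner_Integration.integral_add) auto
  also have "\<dots> < e" using M n by simp
  finally show thesis by (rule that[OF gc])
qed

text \<open>For a continuous function the averages converge at every time by the fundamental theorem
  of calculus and stay bounded. The step \<open>1 / (n + 2)\<close> is always smaller than
  \<open>1\<close>.\<close>

lemma avg_continuous_tendsto:
  assumes c: "continuous_on UNIV c"
  shows "(\<lambda>n. LINT t|unit_time. \<bar>avg (1 / real (Suc (Suc n))) c t - c t\<bar>) \<longlonglongrightarrow> 0"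
proof -
  have ci: "integrable unit_time c"
    by (rule unit_time_integrable_continuous, rule continuous_on_subset[OF c]) simp
  define h where "h n = 1 / real (Suc (Suc n))" for n
  have h: "0 < h n" for n by (simp add: h_def)
  have c01: "continuous_on {0..1} c" by (rule continuous_on_subset[OF c]) simp
  have "bounded (c ` {0..1})" by (rule compact_imp_bounded[OF compact_continuous_image[OF c01]]) simp
  then obtain M where "\<forall>y\<in>c ` {0..1}. norm y \<le> M" unfolding bounded_iff by blast
  then have M: "\<bar>c t\<bar> \<le> M" if "t \<in> {0..1}" for t using that by simp
  have ab: "\<bar>avg (h n) c t\<bar> \<le> M" if t: "t \<in> {0<..<1}" for n t
  proof -
    have "\<bar>integral {max 0 (t - h n)..t} c\<bar> \<le> M * (t - max 0 (t - h n))"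
      using integral_bound[of "max 0 (t - h n)" t c M] M t h[of n] continuous_on_subset[OF c, of "{max 0 (t - h n)..t}"]
      by auto
    also have "\<dots> \<le> M * h n" using M[of t] t h[of n] by (intro mult_left_mono) auto
    finally show ?thesis unfolding avg_def
      using prim_diff'[OF ci, of "t - h n" t] t h[of n] by (simp add: abs_divide divide_le_eq)
  qed
  have "(\<lambda>n. LINT t|unit_time. \<bar>avg (h n) c t - c t\<bar>) \<longlonglongrightarrow> (LINT t|unit_time. 0)"
  proof (rule integral_dominated_convergence[of _ _ _ "\<lambda>t. 2 * M"])
    show "integrable unit_time (\<lambda>t. 2 * M)" by (rule unit_time_integrable_bounded[of _ "\<bar>2 * M\<bar>"]) auto
    show "(\<lambda>t. \<bar>avg (h n) c t - c t\<bar>) \<in> borel_measurable unit_time" for n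
      using avg_integrable[OF ci h, of n] ci by simp
    show "AE t in unit_time. norm \<bar>avg (h n) c t - c t\<bar> \<le> 2 * M" for n
    proof (rule AE_I2)
      fix t assume "t \<in> space unit_time"
      then show "norm \<bar>avg (h n) c t - c t\<bar> \<le> 2 * M" using ab[of t n] M[of t] by simp
    qed
    show "AE t in unit_time. (\<lambda>n. \<bar>avg (h n) c t - c t\<bar>) \<longlonglongrightarrow> 0"
    proof (rule AE_I2)
      fix t assume "t \<in> space unit_time"
      then have t: "t \<in> {0<..<1}" by simp
      have "((\<lambda>x. integral {0..x} c) has_real_derivative c t) (at t within {0..1})"
        by (rule integral_has_real_derivative[OF c01]) (use t in auto)
      moreover have "at t within {0..1} = at t" by (rule at_within_interior) (use t in simp)
      ultimately have "(prim c has_real_derivative c t) (at t)" by (simp add: prim_def[abs_def])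
      then have "(\<lambda>s. (prim c (t + s) - prim c t) / s) \<midarrow>0\<rightarrow> c t" by (simp add: DERIV_def)
      moreover have "filterlim (\<lambda>n. - h n) (at 0) sequentially"
      proof -
        have "(\<lambda>n. 1 / real (Suc n)) \<longlonglongrightarrow> 0" using LIMSEQ_inverse_real_of_nat by (simp add: inverse_eq_divide)
        then have "h \<longlonglongrightarrow> 0" unfolding h_def[abs_def] by (rule LIMSEQ_Suc)
        then have "(\<lambda>n. - h n) \<longlonglongrightarrow> 0" using tendsto_minus[of h 0] by simp
        then show ?thesis using h by (auto simp: filterlim_at less_le)
      qed
      ultimately have "(\<lambda>n. (prim c (t + - h n) - prim c t) / (- h n)) \<longlonglongrightarrow> c t"
        by (rule filterlim_compose)
      then have "(\<lambda>n. avg (h n) c t) \<longlonglongrightarrow> c t" by (simp add: avg_def minus_divide_left[symmetric] diff_divide_distrib)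
      then have "(\<lambda>n. \<bar>avg (h n) c t - c t\<bar>) \<longlonglongrightarrow> \<bar>c t - c t\<bar>" by (intro tendsto_intros)
      then show "(\<lambda>n. \<bar>avg (h n) c t - c t\<bar>) \<longlonglongrightarrow> 0" by simp
    qed
  qed auto
  then show ?thesis by (simp add: h_def)
qed

lemma prim_diff_fun:
  assumes "integrable unit_time \<alpha>" "integrable unit_time \<beta>" "t \<le> 1"
  shows "prim (\<lambda>t. \<alpha> t - \<beta> t) t = prim \<alpha> t - prim \<beta> t"
proof (cases "t \<le> 0")
  case False
  then show ?thesis unfolding prim_def
    using assms by (intro Henstock_Kurzweil_Integration.integral_diff unit_time_integral_interval(1)) auto
qed (simp add: prim_nonpos)

text \<open>Averaging is a contraction on \<open>L\<^sup>1\<close> by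
  \<open>integral_avg_le\<close>, so that the convergence for continuous functions extends to their
  closure.\<close>

lemma avg_tendsto_L1:
  assumes \<alpha>: "integrable unit_time \<alpha>"
  shows "(\<lambda>n. LINT t|unit_time. \<bar>avg (1 / real (Suc (Suc n))) \<alpha> t - \<alpha> t\<bar>) \<longlonglongrightarrow> 0"
proof (rule LIMSEQ_I)
  fix e :: real assume e: "0 < e"
  then obtain c where c: "continuous_on UNIV c" and ce: "(LINT t|unit_time. \<bar>\<alpha> t - c t\<bar>) < e / 3"
    using unit_time_continuous_dense[OF \<alpha>, of "e / 3"] by auto
  have ci: "integrable unit_time c"
    by (rule unit_time_integrable_continuous, rule continuous_on_subset[OF c]) simp
  define h where "h n = 1 / real (Suc (Suc n))" for n
  have h: "0 < h n" "h n < 1" for n by (simp_all add: h_def)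
  from LIMSEQ_D[OF avg_continuous_tendsto[OF c], of "e/3"] e
  obtain n0 where n0: "\<And>n. n \<ge> n0 \<Longrightarrow> \<bar>LINT t|unit_time. \<bar>avg (h n) c t - c t\<bar>\<bar> < e / 3"
    by (auto simp: h_def)
  have "norm ((LINT t|unit_time. \<bar>avg (h n) \<alpha> t - \<alpha> t\<bar>) - 0) < e" if n: "n \<ge> n0" for n
  proof -
    let ?d = "\<lambda>t. \<alpha> t - c t"
    have di: "integrable unit_time ?d" "integrable unit_time (\<lambda>t. \<bar>?d t\<bar>)" using \<alpha> ci by auto
    note ai = avg_integrable[OF \<alpha> h(1), of n] avg_integrable[OF ci h(1), of n] avg_integrable[OF di(2) h(1), of n]
    have pw: "\<bar>avg (h n) \<alpha> t - \<alpha> t\<bar> \<le> (avg (h n) (\<lambda>t. \<bar>?d t\<bar>) t + \<bar>avg (h n) c t - c t\<bar>) + \<bar>?d t\<bar>"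
      if t: "t \<in> {0<..<1}" for t
    proof -
      have "avg (h n) ?d t = avg (h n) \<alpha> t - avg (h n) c t"
        using t h(1)[of n] prim_diff_fun[OF \<alpha> ci, of t] prim_diff_fun[OF \<alpha> ci, of "t - h n"]
        by (simp add: avg_def diff_divide_distrib)
      then show ?thesis using avg_abs_le[OF di(1) h(1) t, of n] by linarith
    qed
    have "(LINT t|unit_time. \<bar>avg (h n) \<alpha> t - \<alpha> t\<bar>)
        \<le> (LINT t|unit_time. (avg (h n) (\<lambda>t. \<bar>?d t\<bar>) t + \<bar>avg (h n) c t - c t\<bar>) + \<bar>?d t\<bar>)"
      using \<alpha> ci ai di pw by (intro integral_mono) auto
    also have "\<dots> = (LINT t|unit_time. avg (h n) (\<lambda>t. \<bar>?d t\<bar>) t) + (LINT t|unit_time. \<bar>avg (h n) c t - c t\<bar>)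
        + (LINT t|unit_time. \<bar>?d t\<bar>)"
      using \<alpha> ci ai di by simp
    also have "(LINT t|unit_time. avg (h n) (\<lambda>t. \<bar>?d t\<bar>) t) \<le> (LINT t|unit_time. \<bar>?d t\<bar>)"
      by (rule integral_avg_le[OF di(2) h]) simp
    finally have "(LINT t|unit_time. \<bar>avg (h n) \<alpha> t - \<alpha> t\<bar>) < e"
      using ce n0[OF n] by simp
    moreover have "0 \<le> (LINT t|unit_time. \<bar>avg (h n) \<alpha> t - \<alpha> t\<bar>)" by simp
    ultimately show ?thesis by simp
  qed
  then show "\<exists>no. \<forall>n\<ge>no. norm ((LINT t|unit_time. \<bar>avg (1 / real (Suc (Suc n))) \<alpha> t - \<alpha> t\<bar>) - 0) < e"
    unfolding h_def by blast
qed

section \<open>Uniqueness of Lions solutions\<close>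

lemma unit_time_integrable_nonneg:
  fixes f :: "real \<Rightarrow> real"
  assumes "f integrable_on {0..1}" "\<And>t. t \<in> {0..1} \<Longrightarrow> 0 \<le> f t"
  shows "integrable unit_time f"
proof -
  have "f absolutely_integrable_on {0..1}"
    using assms by (intro nonnegative_absolutely_integrable_1) auto
  then have "f absolutely_integrable_on {0<..<1}"
    by (rule set_integrable_subset) auto
  then show ?thesis by (simp add: set_integrable_def integrable_restrict_space)
qed

text \<open>Null sets are translation invariant.\<close>

lemma unit_time_AE_shift:
  assumes "AE t in unit_time. P t" "0 < h" shows "AE t in unit_time. h < t \<longrightarrow> P (t - h)"
proof -
  obtain Z where Z: "{t. \<not> (t \<in> {0<..<1} \<longrightarrow> P t)} \<subseteq> Z" "Z \<in> null_sets lebesgue"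
    using assms(1) unfolding unit_time_AE_iff by (auto elim!: AE_E simp: null_sets_def)
  then have "negligible ((+) h ` Z)" by (intro negligible_translation) (simp add: negligible_iff_null_sets)
  then have "(+) h ` Z \<in> null_sets lebesgue" by (simp add: negligible_iff_null_sets)
  moreover have "{t. \<not> (t \<in> {0<..<1} \<longrightarrow> h < t \<longrightarrow> P (t - h))} \<subseteq> (+) h ` Z"
  proof
    fix t assume "t \<in> {t. \<not> (t \<in> {0<..<1} \<longrightarrow> h < t \<longrightarrow> P (t - h))}"
    then have "t - h \<in> Z" using Z(1) assms(2) by auto
    then show "t \<in> (+) h ` Z" by (intro image_eqI[of _ _ "t - h"]) auto
  qed
  ultimately show ?thesis unfolding unit_time_AE_iff by (intro AE_I') auto
qed

text \<open>Summation by parts moves the difference quotient to the weight \<open>1 - t\<close>, where it is \<open>-1\<close>. The energy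
  inequality for \<open>n\<close> thereby controls its integral over the whole interval.\<close>

lemma weighted_difference_integral:
  fixes n :: "real \<Rightarrow> real"
  assumes n: "integrable unit_time n" and nn: "\<And>t. 0 \<le> n t" and h: "0 < h" "h < 1"
  defines "n' \<equiv> \<lambda>t. if t \<le> 0 then 0 else n t"
  shows "integrable unit_time (\<lambda>t. (1 - t) * (n' t - n' (t - h)) / h)"
    "prim n (1 - h) \<le> (LINT t|unit_time. (1 - t) * (n' t - n' (t - h)) / h)"
proof -
  have ni: "n integrable_on {a..b}" if "0 \<le> a" "b \<le> 1" for a b
    using unit_time_integral_interval(1)[OF n, of a b] that by (cases "a \<le> b") auto
  have wi: "(\<lambda>t. (c - t) * n t) integrable_on {a..b}" if "0 \<le> a" "b \<le> 1" for a b c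
  proof (cases "a \<le> b")
    case True
    have "integrable unit_time (\<lambda>t. (c - t) * n t)"
    proof (rule Bochner_Integration.integrable_bound)
      show "integrable unit_time (\<lambda>t. (\<bar>c\<bar> + 1) * n t)" using n by simp
      have "(\<lambda>t. c - t) \<in> borel_measurable unit_time" by (intro unit_time_continuous_measurable continuous_intros)
      then show "(\<lambda>t. (c - t) * n t) \<in> borel_measurable unit_time" using n by simp
      show "AE t in unit_time. norm ((c - t) * n t) \<le> norm ((\<bar>c\<bar> + 1) * n t)"
      proof (rule AE_I2)
        fix t assume "t \<in> space unit_time"
        then have "\<bar>c - t\<bar> \<le> \<bar>\<bar>c\<bar> + 1\<bar>" by auto
        then show "norm ((c - t) * n t) \<le> norm ((\<bar>c\<bar> + 1) * n t)"
          unfolding real_norm_def abs_mult by (intro mult_right_mono) auto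
      qed
    qed
    from unit_time_integral_interval(1)[OF this, of a b] show ?thesis using that True by simp
  qed auto
  have eq0: "integral {-h..0} (\<lambda>s. (1 - h - s) * n' s) = 0" "(\<lambda>s. (1 - h - s) * n' s) integrable_on {-h..0}"
    using integral_cong[of "{-h..0}" "\<lambda>s. (1 - h - s) * n' s" "\<lambda>_. 0"]
      integrable_eq[of "\<lambda>_. 0" "{-h..0}" "\<lambda>s. (1 - h - s) * n' s"] by (auto simp: n'_def)
  have spike: "(\<lambda>s. (c - s) * n' s) integrable_on {0..b}" "integral {0..b} (\<lambda>s. (c - s) * n' s) = integral {0..b} (\<lambda>s. (c - s) * n s)"
    if "b \<le> 1" for b c
    by (rule integrable_spike[OF wi[of 0 b c], of "{0}"], use that in \<open>auto simp: n'_def\<close>)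
      (rule integral_spike[of "{0}"], auto simp: n'_def)
  have i1: "(\<lambda>s. (1 - h - s) * n' s) integrable_on {-h..1-h}"
    by (rule Henstock_Kurzweil_Integration.integrable_combine[of _ 0]) (use h eq0 spike in auto)
  have "((\<lambda>s. (1 - h - s) * n' s) has_integral integral {-h..1-h} (\<lambda>s. (1 - h - s) * n' s)) {0 + - h..1 + - h}"
    using integrable_integral[OF i1] by simp
  then have "((\<lambda>s. (1 - h - s) * n' s) \<circ> (+) (-h) has_integral integral {-h..1-h} (\<lambda>s. (1 - h - s) * n' s)) {0..1}"
    by (simp only: has_integral_shift_Icc_real)
  then have hi: "((\<lambda>t. (1 - t) * n' (t - h)) has_integral integral {-h..1-h} (\<lambda>s. (1 - h - s) * n' s)) {0..1}"
    by (simp add: o_def algebra_simps)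
  have iA: "integrable unit_time (\<lambda>t. (1 - t) * n' (t - h))"
    by (rule unit_time_integrable_nonneg[OF has_integral_integrable[OF hi]]) (auto simp: n'_def nn)
  have iB: "integrable unit_time (\<lambda>t. (1 - t) * n' t)"
    by (rule unit_time_integrable_nonneg) (use spike(1)[of 1 1] in \<open>auto simp: n'_def nn\<close>)
  have eq: "(\<lambda>t. (1 - t) * (n' t - n' (t - h)) / h) = (\<lambda>t. ((1 - t) * n' t - (1 - t) * n' (t - h)) / h)"
    by (simp add: right_diff_distrib)
  show "integrable unit_time (\<lambda>t. (1 - t) * (n' t - n' (t - h)) / h)"
    unfolding eq using iA iB by simp
  have "(LINT t|unit_time. (1 - t) * n' (t - h)) = integral {-h..1-h} (\<lambda>s. (1 - h - s) * n' s)"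
    using unit_time_integral[OF iA] integral_unique[OF hi] by simp
  also have "\<dots> = integral {-h..0} (\<lambda>s. (1 - h - s) * n' s) + integral {0..1-h} (\<lambda>s. (1 - h - s) * n' s)"
    by (rule Henstock_Kurzweil_Integration.integral_combine[symmetric, OF _ _ i1]) (use h in auto)
  also have "\<dots> = integral {0..1-h} (\<lambda>s. (1 - h - s) * n s)" using eq0(1) spike(2)[of "1 - h" "1 - h"] h by simp
  finally have A: "(LINT t|unit_time. (1 - t) * n' (t - h)) = integral {0..1-h} (\<lambda>s. (1 - h - s) * n s)" .
  have "(LINT t|unit_time. (1 - t) * n' t) = integral {0..1} (\<lambda>t. (1 - t) * n t)"
    using unit_time_integral[OF iB] spike(2)[of 1 1] by simp
  moreover have "integral {0..1-h} (\<lambda>t. (1 - t) * n t) \<le> integral {0..1} (\<lambda>t. (1 - t) * n t)"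
    using h by (intro integral_subset_le wi) (auto simp: nn)
  ultimately have B: "integral {0..1-h} (\<lambda>t. (1 - t) * n t) \<le> (LINT t|unit_time. (1 - t) * n' t)" by simp
  have "h * prim n (1 - h) = integral {0..1-h} (\<lambda>t. h * n t)" by (simp add: prim_def)
  also have "\<dots> = integral {0..1-h} (\<lambda>t. (1 - t) * n t - (1 - h - t) * n t)"
    by (rule integral_cong) (simp add: algebra_simps)
  also have "\<dots> = integral {0..1-h} (\<lambda>t. (1 - t) * n t) - integral {0..1-h} (\<lambda>t. (1 - h - t) * n t)"
    using h by (intro Henstock_Kurzweil_Integration.integral_diff wi) auto
  also have "\<dots> \<le> (LINT t|unit_time. (1 - t) * n' t) - (LINT t|unit_time. (1 - t) * n' (t - h))"
    using A B by simp
  also have "\<dots> = (LINT t|unit_time. (1 - t) * n' t - (1 - t) * n' (t - h))" using iA iB by simp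
  finally have "prim n (1 - h) \<le> (LINT t|unit_time. (1 - t) * n' t - (1 - t) * n' (t - h)) / h"
    using h by (simp add: le_divide_eq mult.commute)
  then show "prim n (1 - h) \<le> (LINT t|unit_time. (1 - t) * (n' t - n' (t - h)) / h)"
    unfolding eq by simp
qed

lemma young_inequality:
  fixes a b :: real assumes "0 < \<delta>" shows "a * b \<le> a\<^sup>2 / (2 * \<delta>) + \<delta> / 2 * b\<^sup>2"
proof -
  have "0 \<le> (a - \<delta> * b)\<^sup>2 / (2 * \<delta>)" using assms by simp
  also have "\<dots> = a\<^sup>2 / (2 * \<delta>) + \<delta> / 2 * b\<^sup>2 - a * b" using assms by (simp add: field_simps power2_eq_square)
  finally show ?thesis by simp
qed

text \<open>Young's inequality under the average; it decouples the approximation error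
  \<open>a\<close> from the \<open>L\<^sup>2\<close> function \<open>q\<close> and, unlike the
  Cauchy-Schwarz inequality, does so pointwise in \<open>t\<close>.\<close>

lemma avg_young:
  assumes q: "integrable unit_time q" "integrable unit_time (\<lambda>t. (q t)\<^sup>2)" and h: "0 < h" and t: "t \<in> {0<..<1}"
    and \<delta>: "0 < \<delta>"
  shows "a * avg h q t \<le> a\<^sup>2 / (2 * \<delta>) + \<delta> / 2 * avg h (\<lambda>t. (q t)\<^sup>2) t"
proof -
  let ?I = "{max 0 (t - h)..t}"
  have i: "q integrable_on ?I" "(\<lambda>t. (q t)\<^sup>2) integrable_on ?I"
    using q t h by (auto intro!: unit_time_integral_interval(1))
  have "integral ?I (\<lambda>s. a * q s) \<le> integral ?I (\<lambda>s. a\<^sup>2 / (2 * \<delta>) + \<delta> / 2 * (q s)\<^sup>2)"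
    by (intro integral_le integrable_add integrable_on_mult_right i integrable_const_ivl young_inequality \<delta>)
  also have "\<dots> = integral ?I (\<lambda>s. a\<^sup>2 / (2 * \<delta>)) + integral ?I (\<lambda>s. \<delta> / 2 * (q s)\<^sup>2)"
    by (intro Henstock_Kurzweil_Integration.integral_add integrable_on_mult_right i integrable_const_ivl)
  also have "\<dots> = (t - max 0 (t - h)) * (a\<^sup>2 / (2 * \<delta>)) + \<delta> / 2 * integral ?I (\<lambda>s. (q s)\<^sup>2)"
    using t h by simp
  also have "\<dots> \<le> h * (a\<^sup>2 / (2 * \<delta>)) + \<delta> / 2 * integral ?I (\<lambda>s. (q s)\<^sup>2)"
    using t h \<delta> by (intro add_right_mono mult_right_mono) auto
  finally have "a * integral ?I q \<le> h * (a\<^sup>2 / (2 * \<delta>)) + \<delta> / 2 * integral ?I (\<lambda>s. (q s)\<^sup>2)" by simp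
  then have "a * integral ?I q / h \<le> (h * (a\<^sup>2 / (2 * \<delta>)) + \<delta> / 2 * integral ?I (\<lambda>s. (q s)\<^sup>2)) / h"
    using h by (intro divide_right_mono) auto
  then show ?thesis unfolding avg_def
    using prim_diff'[OF q(1), of "t - h" t] prim_diff'[OF q(2), of "t - h" t] t h by (simp add: add_divide_distrib)
qed

context smooth_cutoff
begin

text \<open>The continuous representative with zero initial value turns the weak time derivative
  into an integral equation that holds for all \<open>v\<close> simultaneously at almost every time.
  The derivative is modified on a null set of times so that all its values lie in
  \<open>H\<^sup>-\<^sup>1\<close>.\<close>

lemma lions_solution_integrated:
  fixes B :: "real \<Rightarrow> real^'n \<Rightarrow> real^'n^'n::finite"
  assumes "lions_solution B F U"
  obtains G where "U \<in> L2_Bochner H1 H1_norm"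
    "\<And>t. G t \<in> Hm1" "(\<lambda>t. Hm1_norm (G t)) \<in> borel_measurable unit_time"
    "integrable unit_time (\<lambda>t. (Hm1_norm (G t))\<^sup>2)"
    "\<And>v. v \<in> H1 \<Longrightarrow> integrable unit_time (\<lambda>t. G t v)"
    "AE t in unit_time. \<forall>v\<in>H1. embed (U t) v = prim (\<lambda>s. G s v) t"
    "AE t in unit_time. \<forall>v\<in>H1. G t v - weak_div (\<lambda>x. B t x *v weak_grad (U t) x) v = embed (F t) v"
proof -
  interpret Hm1: diff_seminorm "Hm1 :: ((real^'n \<Rightarrow> real) \<Rightarrow> real) set" Hm1_norm by (rule Hm1_seminorm)
  from assms obtain G C where U: "U \<in> L2_Bochner H1 H1_norm"
    and G: "has_weak_time_deriv (\<lambda>t. embed (U t)) G"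
    and eq: "AE t in unit_time. \<forall>v\<in>H1. G t v - weak_div (\<lambda>x. B t x *v weak_grad (U t) x) v = embed (F t) v"
    and CX: "\<And>t. t \<in> {0..1} \<Longrightarrow> C t \<in> Hm1"
    and Cc: "\<And>t. t \<in> {0..1} \<Longrightarrow> ((\<lambda>s. Hm1_norm (C s - C t)) \<longlongrightarrow> 0) (at t within {0..1})"
    and CU: "AE t in unit_time. \<forall>v\<in>H1. C t v = embed (U t) v" and C0: "\<And>v. v \<in> H1 \<Longrightarrow> C 0 v = 0"
    unfolding lions_solution_def zero_initial_value_def by blast
  have WB: "(\<lambda>t. embed (U t)) \<in> L2_Bochner Hm1 Hm1_norm" and GB: "G \<in> L2_Bochner Hm1 Hm1_norm"
    and weak: "\<And>\<phi> v. \<phi> \<in> test_functions {0<..<1} \<Longrightarrow> v \<in> H1 \<Longrightarrow>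
      (LINT t|unit_time. deriv \<phi> t * embed (U t) v) = - (LINT t|unit_time. \<phi> t * G t v)"
    using G unfolding has_weak_time_deriv_def by blast+
  have GX: "AE t in unit_time. G t \<in> Hm1" and Gsm: "strongly_measurable Hm1 Hm1_norm G"
    and Gsq: "integrable unit_time (\<lambda>t. (Hm1_norm (G t))\<^sup>2)" using GB by (auto simp: L2_Bochner_def)
  \<comment> \<open>zero is the default value on the null set where \<open>G\<close> leaves \<open>H\<^sup>-\<^sup>1\<close>\<close>
  define G' where "G' t = (if G t \<in> Hm1 then G t else (\<lambda>v. 0))" for t
  have G'eq: "AE t in unit_time. G t = G' t" using GX by eventually_elim (simp add: G'_def)
  have G'X: "G' t \<in> Hm1" for t by (simp add: G'_def Hm1_zero)
  have m: "(\<lambda>t. Hm1_norm (G' t)) \<in> borel_measurable unit_time"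
    by (rule unit_time_measurable_AE[OF Hm1.norm_measurable[OF Gsm GX]])
      (use G'eq in \<open>eventually_elim, simp\<close>)
  have sq: "integrable unit_time (\<lambda>t. (Hm1_norm (G' t))\<^sup>2)"
  proof (rule integrable_cong_AE_imp[OF Gsq])
    show "(\<lambda>t. (Hm1_norm (G' t))\<^sup>2) \<in> borel_measurable unit_time" using m by simp
    show "AE t in unit_time. (Hm1_norm (G t))\<^sup>2 = (Hm1_norm (G' t))\<^sup>2"
      using G'eq by eventually_elim simp
  qed
  have i: "integrable unit_time (\<lambda>t. G t v)" if "v \<in> H1" for v by (rule Hm1_Bochner_apply[OF GB that])
  have iU: "integrable unit_time (\<lambda>t. embed (U t) v)" if "v \<in> H1" for v by (rule Hm1_Bochner_apply[OF WB that])
  have i': "integrable unit_time (\<lambda>t. G' t v)" if "v \<in> H1" for v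
  proof (rule integrable_cong_AE_imp[OF i[OF that]])
    show "(\<lambda>t. G' t v) \<in> borel_measurable unit_time"
      by (rule unit_time_measurable_AE[of "\<lambda>t. G t v"]) (use i[OF that] G'eq in \<open>auto elim: eventually_mono\<close>)
    show "AE t in unit_time. G t v = G' t v" using G'eq by eventually_elim simp
  qed
  have key: "C t v = prim (\<lambda>s. G' s v) t" if v: "v \<in> H1" and t: "t \<in> {0..1}" for t v
  proof -
    have cont: "continuous_on {0..1} (\<lambda>t. C t v)"
      unfolding continuous_on_def
    proof
      fix t :: real assume t: "t \<in> {0..1}"
      have "((\<lambda>s. C s v - C t v) \<longlongrightarrow> 0) (at t within {0..1})"
      proof (rule Lim_null_comparison)
        show "\<forall>\<^sub>F s in at t within {0..1}. norm (C s v - C t v) \<le> Hm1_norm (C s - C t) * H1_norm v"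
          unfolding eventually_at_filter
          by (intro always_eventually) (use Hm1_bound[OF Hm1_diff[OF CX CX[OF t]] v] in auto)
        show "((\<lambda>s. Hm1_norm (C s - C t) * H1_norm v) \<longlongrightarrow> 0) (at t within {0..1})"
          using tendsto_mult_right[OF Cc[OF t], of "H1_norm v"] by simp
      qed
      then show "((\<lambda>s. C s v) \<longlongrightarrow> C t v) (at t within {0..1})" by (simp add: LIM_zero_iff)
    qed
    have "C t v - C 0 v = integral {0..t} (\<lambda>s. G' s v)"
    proof (rule weak_derivative_imp_integral[OF cont i'[OF v]])
      fix \<phi> :: "real \<Rightarrow> real" assume \<phi>: "\<phi> \<in> test_functions {0<..<1}"
      have "smooth \<phi>" using \<phi> by (rule test_functionsD)
      have "deriv \<phi> = dir_deriv 1 \<phi>" by (intro ext DERIV_imp_deriv smooth_real_DERIV) fact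
      then have "continuous_on UNIV (deriv \<phi>)" by (simp add: smooth_continuous smooth_dir_deriv \<open>smooth \<phi>\<close>)
      then have [measurable]: "deriv \<phi> \<in> borel_measurable unit_time"
        by (intro unit_time_continuous_measurable) (rule continuous_on_subset, auto)
      have [measurable]: "\<phi> \<in> borel_measurable unit_time"
        by (intro unit_time_continuous_measurable smooth_continuous) fact
      have [measurable]: "(\<lambda>t. C t v) \<in> borel_measurable unit_time"
        by (rule unit_time_continuous_measurable, rule continuous_on_subset[OF cont]) auto
      have [measurable]: "(\<lambda>t. embed (U t) v) \<in> borel_measurable unit_time"
        "(\<lambda>t. G t v) \<in> borel_measurable unit_time" "(\<lambda>t. G' t v) \<in> borel_measurable unit_time"
        using iU[OF v] i[OF v] i'[OF v] by auto
      have "(LINT t|unit_time. deriv \<phi> t * C t v) = (LINT t|unit_time. deriv \<phi> t * embed (U t) v)"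
        by (rule integral_cong_AE) (use CU v in \<open>auto elim: eventually_mono\<close>)
      also have "\<dots> = - (LINT t|unit_time. \<phi> t * G t v)" by (rule weak[OF \<phi> v])
      also have "(LINT t|unit_time. \<phi> t * G t v) = (LINT t|unit_time. \<phi> t * G' t v)"
        by (rule integral_cong_AE) (use G'eq in \<open>auto elim: eventually_mono\<close>)
      finally show "(LINT t|unit_time. deriv \<phi> t * C t v) = - (LINT t|unit_time. \<phi> t * G' t v)" .
    qed (use t in auto)
    then show ?thesis using C0[OF v] by (simp add: prim_def)
  qed
  show thesis
  proof (rule that[OF U G'X m sq i'])
    show "AE t in unit_time. \<forall>v\<in>H1. embed (U t) v = prim (\<lambda>s. G' s v) t"
      using CU AE_space
    proof eventually_elim
      case (elim t)
      then show ?case using key[of _ t] by auto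
    qed
    show "AE t in unit_time. \<forall>v\<in>H1. G' t v - weak_div (\<lambda>x. B t x *v weak_grad (U t) x) v = embed (F t) v"
      using eq G'eq by eventually_elim simp
  qed
qed

text \<open>Convexity of the square. Only the first argument enters as a test function, so that in
  the energy estimate the equation on \<open>(t - h, t)\<close> is tested with the value at the end
  point \<open>t\<close> alone.\<close>

lemma L2_norm_sq_diff_le:
  fixes f g :: "'a::euclidean_space \<Rightarrow> real"
  assumes "f \<in> L2" "g \<in> L2"
  shows "(L2_norm f)\<^sup>2 - (L2_norm g)\<^sup>2 \<le> 2 * (embed f f - embed g f)"
proof -
  have "0 \<le> (L2_norm (\<lambda>x. f x + (-1) *\<^sub>R g x))\<^sup>2" by simp
  then have "0 \<le> (L2_norm f)\<^sup>2 - 2 * (LINT x|lborel. f x * g x) + (L2_norm g)\<^sup>2"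
    unfolding L2_lincomb_sq[OF assms] by simp
  moreover have "(L2_norm f)\<^sup>2 = embed f f" by (simp add: L2_norm_sq embed_def)
  moreover have "(LINT x|lborel. f x * g x) = embed g f" by (simp add: embed_def mult.commute)
  ultimately show ?thesis by simp
qed

text \<open>Let \<open>W\<close> be the difference of the solutions, \<open>g v s\<close> the
  difference of their time derivatives at time \<open>s\<close> applied to \<open>v\<close>, and
  \<open>n\<close> the square of the norm of \<open>W\<close>. Then \<open>(n t - n (t - h)) /
  h\<close> is at most twice the average of \<open>g (W t)\<close> over \<open>(t - h, t)\<close>.
  The function \<open>s \<mapsto> g (W t) s\<close> changes with \<open>t\<close>, so its averages
  are not of one fixed function; replacing \<open>W\<close> by a simple function \<open>S\<close>
  leaves finitely many functions \<open>g y\<close>, whose averages converge in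
  \<open>L\<^sup>1\<close>. The limit \<open>g (W t) t\<close> is nonpositive because the quadratic
  form of \<open>B\<close> is. The error is controlled by the distance of \<open>S\<close> from
  \<open>W\<close>, chosen of order \<open>\<delta>\<close>.\<close>

theorem lions_solution_unique:
  fixes B :: "real \<Rightarrow> real^'n \<Rightarrow> real^'n^'n::finite" and U V :: "real \<Rightarrow> real^'n \<Rightarrow> real"
  assumes U: "lions_solution B F U" and V: "lions_solution B F V"
    and BL2: "\<And>t p. p \<in> L2 \<Longrightarrow> (\<lambda>x. B t x *v p x) \<in> L2"
    and mono: "\<And>t x y. 0 \<le> (B t x *v y) \<bullet> y"
  shows "AE t in unit_time. AE x in lborel. V t x = U t x"
proof -
  interpret H1: diff_seminorm "H1 :: (real^'n \<Rightarrow> real) set" H1_norm by (rule H1_seminorm)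
  interpret L2: diff_seminorm "L2 :: (real^'n \<Rightarrow> real) set" L2_norm by (rule L2_seminorm)
  obtain G1 where UB: "U \<in> L2_Bochner H1 H1_norm" and G1X: "\<And>t. G1 t \<in> Hm1"
    and G1m: "(\<lambda>t. Hm1_norm (G1 t)) \<in> borel_measurable unit_time"
    and G1sq: "integrable unit_time (\<lambda>t. (Hm1_norm (G1 t))\<^sup>2)"
    and G1i: "\<And>v. v \<in> H1 \<Longrightarrow> integrable unit_time (\<lambda>t. G1 t v)"
    and G1p: "AE t in unit_time. \<forall>v\<in>H1. embed (U t) v = prim (\<lambda>s. G1 s v) t"
    and G1e: "AE t in unit_time. \<forall>v\<in>H1. G1 t v - weak_div (\<lambda>x. B t x *v weak_grad (U t) x) v = embed (F t) v"
    using lions_solution_integrated[OF U] by blast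
  obtain G2 where VB: "V \<in> L2_Bochner H1 H1_norm" and G2X: "\<And>t. G2 t \<in> Hm1"
    and G2m: "(\<lambda>t. Hm1_norm (G2 t)) \<in> borel_measurable unit_time"
    and G2sq: "integrable unit_time (\<lambda>t. (Hm1_norm (G2 t))\<^sup>2)"
    and G2i: "\<And>v. v \<in> H1 \<Longrightarrow> integrable unit_time (\<lambda>t. G2 t v)"
    and G2p: "AE t in unit_time. \<forall>v\<in>H1. embed (V t) v = prim (\<lambda>s. G2 s v) t"
    and G2e: "AE t in unit_time. \<forall>v\<in>H1. G2 t v - weak_div (\<lambda>x. B t x *v weak_grad (V t) x) v = embed (F t) v"
    using lions_solution_integrated[OF V] by blast
  have UX: "AE t in unit_time. U t \<in> H1" and VX: "AE t in unit_time. V t \<in> H1"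
    and Usm: "strongly_measurable H1 H1_norm U" and Vsm: "strongly_measurable H1 H1_norm V"
    and Usq: "integrable unit_time (\<lambda>t. (H1_norm (U t))\<^sup>2)" and Vsq: "integrable unit_time (\<lambda>t. (H1_norm (V t))\<^sup>2)"
    using UB VB by (auto simp: L2_Bochner_def)
  define W where "W t = V t - U t" for t
  define g where "g v t = G2 t v - G1 t v" for v t
  define q where "q t = Hm1_norm (G1 t) + Hm1_norm (G2 t)" for t
  define n where "n t = (L2_norm (W t))\<^sup>2" for t
  have qm: "q \<in> borel_measurable unit_time" unfolding q_def[abs_def] using G1m G2m by simp
  have qsq: "integrable unit_time (\<lambda>t. (q t)\<^sup>2)"
  proof (rule Bochner_Integration.integrable_bound)
    show "integrable unit_time (\<lambda>t. 2 * (Hm1_norm (G1 t))\<^sup>2 + 2 * (Hm1_norm (G2 t))\<^sup>2)" using G1sq G2sq by simp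
    show "AE t in unit_time. norm ((q t)\<^sup>2) \<le> norm (2 * (Hm1_norm (G1 t))\<^sup>2 + 2 * (Hm1_norm (G2 t))\<^sup>2)"
    proof (rule AE_I2)
      fix t
      have "(q t)\<^sup>2 \<le> 2 * (Hm1_norm (G1 t))\<^sup>2 + 2 * (Hm1_norm (G2 t))\<^sup>2"
        using sum_squares_bound[of "Hm1_norm (G1 t)" "Hm1_norm (G2 t)"] by (simp add: q_def power2_sum)
      then show "norm ((q t)\<^sup>2) \<le> norm (2 * (Hm1_norm (G1 t))\<^sup>2 + 2 * (Hm1_norm (G2 t))\<^sup>2)" by simp
    qed
  qed (use qm in simp)
  have q0: "0 \<le> q t" for t using Hm1_norm_nonneg[OF G1X] Hm1_norm_nonneg[OF G2X] by (simp add: q_def)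
  have qi: "integrable unit_time q" by (rule unit_time_integrable_of_sq[OF qm qsq])
  have gi: "integrable unit_time (g v)" if "v \<in> H1" for v
    unfolding g_def[abs_def] using G1i[OF that] G2i[OF that] by simp
  have gq: "\<bar>g v t\<bar> \<le> q t * H1_norm v" if "v \<in> H1" for v t
    using Hm1_bound[OF G1X that, of t] Hm1_bound[OF G2X that, of t] by (simp add: g_def q_def distrib_right)
  have glin: "g v t = g w t + g (v - w) t" if "v \<in> H1" "w \<in> H1" for v w t
    using Hm1_add[OF G1X that(2) H1_diff[OF that], of t] Hm1_add[OF G2X that(2) H1_diff[OF that], of t]
    by (simp add: g_def)
  have prim_g: "prim (g v) t = prim (\<lambda>s. G2 s v) t - prim (\<lambda>s. G1 s v) t" if "v \<in> H1" "t \<le> 1" for v t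
    unfolding g_def[abs_def] by (rule prim_diff_fun[OF G2i[OF that(1)] G1i[OF that(1)] that(2)])
  define good where "good t \<longleftrightarrow> U t \<in> H1 \<and> V t \<in> H1 \<and> (\<forall>v\<in>H1. embed (W t) v = prim (g v) t) \<and> g (W t) t \<le> 0" for t
  have good: "AE t in unit_time. good t"
    using UX VX G1p G2p G1e G2e AE_space
  proof eventually_elim
    case (elim t)
    have tt: "t \<in> {0<..<1}" using elim(7) by simp
    have UH: "U t \<in> H1" and VH: "V t \<in> H1" by fact+
    have WH: "W t \<in> H1" unfolding W_def by (rule H1_diff[OF VH UH])
    have e: "embed (W t) v = prim (g v) t" if "v \<in> H1" for v
      using embed_diff[OF H1_D(1)[OF VH] H1_D(1)[OF UH] that] elim(3,4) that prim_g[OF that, of t] tt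
      by (simp add: W_def)
    let ?P = "\<lambda>x. B t x *v weak_grad (V t) x" and ?Q = "\<lambda>x. B t x *v weak_grad (U t) x"
    have P: "?P \<in> L2" "?Q \<in> L2" by (rule BL2[OF H1_D(2)[OF VH]], rule BL2[OF H1_D(2)[OF UH]])
    have "g (W t) t = weak_div ?P (W t) - weak_div ?Q (W t)"
      using bspec[OF elim(5) WH] bspec[OF elim(6) WH] unfolding g_def by linarith
    also have "\<dots> = - (LINT x|lborel. (?P x - ?Q x) \<bullet> weak_grad (W t) x)" (is "_ = - ?J")
      using L2_inner_integrable[OF P(1) H1_D(2)[OF WH]] L2_inner_integrable[OF P(2) H1_D(2)[OF WH]]
      by (simp add: weak_div_def inner_diff_left)
    finally have gJ: "g (W t) t = - ?J" .
    have J: "0 \<le> (LINT x|lborel. (?P x - ?Q x) \<bullet> weak_grad (W t) x)"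
    proof (rule integral_nonneg_AE)
      have "AE x in lborel. weak_grad (W t) x = weak_grad (V t) x - weak_grad (U t) x"
        using weak_grad_lincomb[OF VH UH, of "-1"] by (simp add: W_def fun_diff_def)
      then show "AE x in lborel. 0 \<le> (?P x - ?Q x) \<bullet> weak_grad (W t) x"
        by eventually_elim (simp add: matrix_vector_mult_diff_distrib[symmetric] mono)
    qed
    have "g (W t) t \<le> 0" using gJ J by simp
    then show ?case using UH VH e by (simp add: good_def)
  qed
  have WH: "W t \<in> H1" if "good t" for t using that H1_diff unfolding good_def W_def by blast
  have n_bound: "AE t in unit_time. n t \<le> 2 * (H1_norm (V t))\<^sup>2 + 2 * (H1_norm (U t))\<^sup>2"
    using VX UX
  proof eventually_elim
    case (elim t)
    have "L2_norm (W t) \<le> L2_norm (V t) + L2_norm (U t)"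
      using L2_norm_diff_triangle[OF H1_D(1)[OF elim(1)] H1_D(1)[OF elim(2)]] by (simp add: W_def fun_diff_def)
    also have "\<dots> \<le> H1_norm (V t) + H1_norm (U t)" by (intro add_mono L2_norm_le_H1_norm)
    finally have "n t \<le> (H1_norm (V t) + H1_norm (U t))\<^sup>2" unfolding n_def by (rule power_mono) simp
    also have "\<dots> \<le> 2 * (H1_norm (V t))\<^sup>2 + 2 * (H1_norm (U t))\<^sup>2"
      using sum_squares_bound[of "H1_norm (V t)" "H1_norm (U t)"] by (simp add: power2_sum)
    finally show ?case .
  qed
  have Wm: "(\<lambda>t. L2_norm (W t)) \<in> borel_measurable unit_time"
  proof (rule L2.norm_measurable)
    obtain s where s: "\<And>k::nat. simple_function unit_time (s k)" "\<And>k t. t \<in> {0<..<1} \<Longrightarrow> s k t \<in> H1"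
      and slim: "AE t in unit_time. (\<lambda>k. H1_norm (s k t - V t)) \<longlonglongrightarrow> 0"
      using Vsm unfolding strongly_measurable_def by blast
    obtain r where r: "\<And>k::nat. simple_function unit_time (r k)" "\<And>k t. t \<in> {0<..<1} \<Longrightarrow> r k t \<in> H1"
      and rlim: "AE t in unit_time. (\<lambda>k. H1_norm (r k t - U t)) \<longlonglongrightarrow> 0"
      using Usm unfolding strongly_measurable_def by blast
    show "strongly_measurable L2 L2_norm W"
      unfolding strongly_measurable_def
    proof (intro exI[of _ "\<lambda>k t. s k t - r k t"] conjI allI ballI)
      show "simple_function unit_time (\<lambda>t. s k t - r k t)" for k
        by (rule simple_function_compose2[OF s(1) r(1)])
      show "s k t - r k t \<in> L2" if "t \<in> {0<..<1}" for k t
        by (rule H1_D(1)[OF H1_diff[OF s(2)[OF that] r(2)[OF that]]])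
      show "AE t in unit_time. (\<lambda>k. L2_norm (s k t - r k t - W t)) \<longlonglongrightarrow> 0"
        using slim rlim VX UX AE_space
      proof eventually_elim
        case (elim t)
        have tt: "t \<in> {0<..<1}" using elim(5) by simp
        show ?case
        proof (rule Lim_null_comparison)
          show "(\<lambda>k. H1_norm (s k t - V t) + H1_norm (r k t - U t)) \<longlonglongrightarrow> 0"
            using tendsto_add[OF elim(1,2)] by simp
          have "L2_norm (s k t - r k t - W t) \<le> H1_norm (s k t - V t) + H1_norm (r k t - U t)" for k
          proof -
            have "s k t - V t \<in> H1" "r k t - U t \<in> H1"
              using H1_diff s(2)[OF tt] r(2)[OF tt] elim(3,4) by blast+
            note L = this[THEN H1_D(1)]
            have "s k t - r k t - W t = (\<lambda>x. (s k t - V t) x - (r k t - U t) x)"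
              by (auto simp: W_def fun_eq_iff)
            then have "L2_norm (s k t - r k t - W t) \<le> L2_norm (s k t - V t) + L2_norm (r k t - U t)"
              using L2_norm_diff_triangle[OF L] by simp
            also have "\<dots> \<le> H1_norm (s k t - V t) + H1_norm (r k t - U t)"
              by (intro add_mono L2_norm_le_H1_norm)
            finally show ?thesis .
          qed
          then show "eventually (\<lambda>k. norm (L2_norm (s k t - r k t - W t)) \<le> H1_norm (s k t - V t) + H1_norm (r k t - U t)) sequentially"
            by simp
        qed
      qed
    qed
    show "AE t in unit_time. W t \<in> L2" using good by eventually_elim (rule H1_D(1)[OF WH])
  qed
  have ni: "integrable unit_time n"
    by (rule Bochner_Integration.integrable_bound[of _ "\<lambda>t. 2 * (H1_norm (V t))\<^sup>2 + 2 * (H1_norm (U t))\<^sup>2"])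
      (use Usq Vsq Wm n_bound in \<open>auto simp: n_def[abs_def] elim!: eventually_mono\<close>)
  have nn: "0 \<le> n t" for t by (simp add: n_def)
  \<comment> \<open>before time zero the solutions are extended by their initial value zero\<close>
  define n' where "n' t = (if t \<le> 0 then 0 else n t)" for t
  have core: "(LINT t|unit_time. n t) \<le> 2 * \<delta> * (1 + (LINT t|unit_time. (q t)\<^sup>2))" if \<delta>: "0 < \<delta>" for \<delta>
  proof -
    have d4: "0 < \<delta>\<^sup>2 / 4" using \<delta> by simp
    obtain S1 where S1: "simple_function unit_time S1" "\<And>t. t \<in> {0<..<1} \<Longrightarrow> S1 t \<in> H1"
      "(\<lambda>t. H1_norm (U t - S1 t)) \<in> borel_measurable unit_time"
      "integrable unit_time (\<lambda>t. (H1_norm (U t - S1 t))\<^sup>2)" "(LINT t|unit_time. (H1_norm (U t - S1 t))\<^sup>2) < \<delta>\<^sup>2 / 4"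
      using H1.simple_approximation[OF UB d4] by blast
    obtain S2 where S2: "simple_function unit_time S2" "\<And>t. t \<in> {0<..<1} \<Longrightarrow> S2 t \<in> H1"
      "(\<lambda>t. H1_norm (V t - S2 t)) \<in> borel_measurable unit_time"
      "integrable unit_time (\<lambda>t. (H1_norm (V t - S2 t))\<^sup>2)" "(LINT t|unit_time. (H1_norm (V t - S2 t))\<^sup>2) < \<delta>\<^sup>2 / 4"
      using H1.simple_approximation[OF VB d4] by blast
    define S where "S t = S2 t - S1 t" for t
    define p where "p t = H1_norm (V t - S2 t) + H1_norm (U t - S1 t)" for t
    define Y where "Y = S ` {0<..<1}"
    have Yfin: "finite Y"
      using simple_functionD(1)[OF simple_function_compose2[OF S2(1) S1(1), of "(-)"]] by (simp add: Y_def S_def[abs_def])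
    have SH: "S t \<in> H1" if "t \<in> {0<..<1}" for t unfolding S_def using S1(2) S2(2) H1_diff that by blast
    have YH: "y \<in> H1" if "y \<in> Y" for y using SH that by (auto simp: Y_def)
    have p0: "0 \<le> p t" for t by (simp add: p_def)
    have p_le: "(p t)\<^sup>2 \<le> 2 * (H1_norm (V t - S2 t))\<^sup>2 + 2 * (H1_norm (U t - S1 t))\<^sup>2" for t
      using sum_squares_bound[of "H1_norm (V t - S2 t)" "H1_norm (U t - S1 t)"] by (simp add: p_def power2_sum)
    have pi: "integrable unit_time (\<lambda>t. (p t)\<^sup>2)"
      by (rule Bochner_Integration.integrable_bound[of _ "\<lambda>t. 2 * (H1_norm (V t - S2 t))\<^sup>2 + 2 * (H1_norm (U t - S1 t))\<^sup>2"])
        (use S1(3,4) S2(3,4) p_le in \<open>auto simp: p_def[abs_def]\<close>)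
    have "(LINT t|unit_time. (p t)\<^sup>2) \<le> (LINT t|unit_time. 2 * (H1_norm (V t - S2 t))\<^sup>2 + 2 * (H1_norm (U t - S1 t))\<^sup>2)"
      by (intro integral_mono pi p_le) (use S1(4) S2(4) in auto)
    also have "\<dots> \<le> \<delta>\<^sup>2" using S1(4,5) S2(4,5) by simp
    finally have p\<delta>: "(LINT t|unit_time. (p t)\<^sup>2) \<le> \<delta>\<^sup>2" .
    have WS: "H1_norm (W t - S t) \<le> p t" if "good t" "t \<in> {0<..<1}" for t
    proof -
      have "V t - S2 t \<in> H1" "U t - S1 t \<in> H1"
        using that S1(2) S2(2) H1_diff unfolding good_def by blast+
      moreover have "W t - S t = (\<lambda>x. (V t - S2 t) x + (-1) * (U t - S1 t) x)"
        by (auto simp: W_def S_def fun_eq_iff)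
      ultimately show ?thesis using H1_norm_triangle_scaled[of "V t - S2 t" "U t - S1 t" "-1"] by (simp add: p_def)
    qed
    define E where "E h t = (\<Sum>y\<in>Y. \<bar>avg h (g y) t - g y t\<bar>)" for h t
    \<comment> \<open>the four terms are the averaging error on the simple function, the approximation error, and the two contributions of \<open>q\<close> from the Young inequality\<close>
    have step: "AE t in unit_time. (1 - t) * (n' t - n' (t - h)) / h
        \<le> 2 * E h t + 2 / \<delta> * (p t)\<^sup>2 + \<delta> * (q t)\<^sup>2 + \<delta> * avg h (\<lambda>t. (q t)\<^sup>2) t"
      if h: "0 < h" "h < 1" for h
      using good unit_time_AE_shift[OF good h(1)] AE_space
    proof eventually_elim
      case (elim t)
      have t: "t \<in> {0<..<1}" using elim(3) by simp
      have gt: "good t" by fact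
      have "n' t - n' (t - h) \<le> 2 * (prim (g (W t)) t - prim (g (W t)) (t - h))"
      proof (cases "h < t")
        case True
        then have gth: "good (t - h)" using elim(2) by simp
        have "n t - n (t - h) \<le> 2 * (embed (W t) (W t) - embed (W (t - h)) (W t))"
          unfolding n_def by (rule L2_norm_sq_diff_le[OF H1_D(1)[OF WH[OF gt]] H1_D(1)[OF WH[OF gth]]])
        also have "embed (W t) (W t) = prim (g (W t)) t" using gt WH[OF gt] by (simp add: good_def)
        also have "embed (W (t - h)) (W t) = prim (g (W t)) (t - h)" using gth WH[OF gt] by (simp add: good_def)
        finally show ?thesis using True h t by (simp add: n'_def)
      next
        case False
        have "n t = embed (W t) (W t)" by (simp add: n_def L2_norm_sq embed_def)
        also have "\<dots> = prim (g (W t)) t" using gt WH[OF gt] by (simp add: good_def)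
        finally show ?thesis using False t nn[of t] by (simp add: n'_def prim_nonpos)
      qed
      then have "(n' t - n' (t - h)) / h \<le> 2 * avg h (g (W t)) t"
        using h by (simp add: avg_def divide_right_mono)
      also have split: "avg h (g (W t)) t = avg h (g (S t)) t + avg h (g (W t - S t)) t"
      proof -
        note H = WH[OF gt] SH[OF t] H1_diff[OF WH[OF gt] SH[OF t]]
        have "prim (g (W t)) r = prim (g (S t)) r + prim (g (W t - S t)) r" if "r \<le> 1" for r
        proof -
          have "g (S t) = (\<lambda>s. g (W t) s - g (W t - S t) s)"
            using glin[OF H(1,2)] by (auto simp: fun_eq_iff)
          then show ?thesis using prim_diff_fun[OF gi[OF H(1)] gi[OF H(3)] that] by simp
        qed
        from this[of t] this[of "t - h"] show ?thesis using t h by (simp add: avg_def add_divide_distrib[symmetric])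
      qed
      finally have 1: "(n' t - n' (t - h)) / h \<le> 2 * (avg h (g (S t)) t + avg h (g (W t - S t)) t)" .
      have DH: "W t - S t \<in> H1" by (rule H1_diff[OF WH[OF gt] SH[OF t]])
      have 2: "avg h (g (W t - S t)) t \<le> (p t)\<^sup>2 / (2 * \<delta>) + \<delta> / 2 * avg h (\<lambda>t. (q t)\<^sup>2) t"
      proof -
        have "avg h (g (W t - S t)) t \<le> avg h (\<lambda>s. p t * q s) t"
        proof (rule avg_mono[OF gi[OF DH] _ h(1) t])
          show "integrable unit_time (\<lambda>s. p t * q s)" using qi by simp
          fix s
          have "g (W t - S t) s \<le> q s * H1_norm (W t - S t)" using gq[OF DH, of s] by linarith
          also have "\<dots> \<le> q s * p t" by (intro mult_left_mono WS gt t q0)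
          finally show "g (W t - S t) s \<le> p t * q s" by (simp add: mult.commute)
        qed
        also have "\<dots> = p t * avg h q t" by (simp add: avg_def prim_def right_diff_distrib)
        also have "\<dots> \<le> (p t)\<^sup>2 / (2 * \<delta>) + \<delta> / 2 * avg h (\<lambda>t. (q t)\<^sup>2) t"
          by (rule avg_young[OF qi qsq h(1) t \<delta>])
        finally show ?thesis .
      qed
      have 3: "avg h (g (S t)) t \<le> E h t + g (S t) t"
      proof -
        have "\<bar>avg h (g (S t)) t - g (S t) t\<bar> \<le> E h t"
          unfolding E_def using Yfin t
          by (intro member_le_sum[of "S t" Y "\<lambda>y. \<bar>avg h (g y) t - g y t\<bar>"]) (auto simp: Y_def)
        then show ?thesis by linarith
      qed
      have 4: "g (S t) t \<le> (p t)\<^sup>2 / (2 * \<delta>) + \<delta> / 2 * (q t)\<^sup>2"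
      proof -
        have "g (S t) t \<le> - g (W t - S t) t"
          using glin[OF WH[OF gt] SH[OF t], of t] gt by (simp add: good_def)
        also have "\<dots> \<le> q t * H1_norm (W t - S t)" using gq[OF DH, of t] by linarith
        also have "\<dots> \<le> q t * p t" by (intro mult_left_mono WS gt t q0)
        also have "\<dots> \<le> (p t)\<^sup>2 / (2 * \<delta>) + \<delta> / 2 * (q t)\<^sup>2"
          using young_inequality[OF \<delta>, of "p t" "q t"] by (simp add: mult.commute)
        finally show ?thesis .
      qed
      let ?R = "2 * E h t + 2 / \<delta> * (p t)\<^sup>2 + \<delta> * (q t)\<^sup>2 + \<delta> * avg h (\<lambda>t. (q t)\<^sup>2) t"
      have le: "(n' t - n' (t - h)) / h \<le> ?R"
      proof -
        define P Q A where "P = (p t)\<^sup>2 / (2 * \<delta>)" and "Q = \<delta> * (q t)\<^sup>2" and "A = \<delta> * avg h (\<lambda>t. (q t)\<^sup>2) t"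
        have "2 / \<delta> * (p t)\<^sup>2 = 4 * P" "\<delta> / 2 * (q t)\<^sup>2 = Q / 2" "\<delta> / 2 * avg h (\<lambda>t. (q t)\<^sup>2) t = A / 2"
          by (simp_all add: P_def Q_def A_def)
        then show ?thesis using 1 2 3 4 by (simp add: P_def[symmetric] Q_def[symmetric] A_def[symmetric])
      qed
      have R0: "0 \<le> ?R"
        using \<delta> avg_nonneg[OF qsq h(1) t] by (intro add_nonneg_nonneg) (auto simp: E_def intro!: sum_nonneg)
      have "(1 - t) * ((n' t - n' (t - h)) / h) \<le> (1 - t) * ?R" using le t by (intro mult_left_mono) auto
      also have "\<dots> \<le> 1 * ?R" using R0 t by (intro mult_right_mono) auto
      finally show ?case by simp
    qed
    define h where "h k = 1 / real (Suc (Suc k))" for k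
    have h: "0 < h k" "h k < 1" for k by (simp_all add: h_def)
    have Ei: "integrable unit_time (E (h k))" for k
      unfolding E_def[abs_def] using avg_integrable[OF gi[OF YH] h(1)] gi[OF YH]
      by (intro Bochner_Integration.integrable_sum) auto
    have ineq: "prim n (1 - h k) \<le> 2 * (LINT t|unit_time. E (h k) t) + 2 / \<delta> * \<delta>\<^sup>2 + 2 * \<delta> * (LINT t|unit_time. (q t)\<^sup>2)" for k
    proof -
      note a = avg_integrable[OF qsq h(1), of k]
      have "prim n (1 - h k) \<le> (LINT t|unit_time. (1 - t) * (n' t - n' (t - h k)) / h k)"
        using weighted_difference_integral(2)[OF ni nn h] by (simp add: n'_def)
      also have "\<dots> \<le> (LINT t|unit_time. 2 * E (h k) t + 2 / \<delta> * (p t)\<^sup>2 + \<delta> * (q t)\<^sup>2 + \<delta> * avg (h k) (\<lambda>t. (q t)\<^sup>2) t)"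
      proof (rule integral_mono_AE[OF _ _ step[OF h]])
        show "integrable unit_time (\<lambda>t. (1 - t) * (n' t - n' (t - h k)) / h k)"
          using weighted_difference_integral(1)[OF ni nn h] by (simp add: n'_def)
        show "integrable unit_time (\<lambda>t. 2 * E (h k) t + 2 / \<delta> * (p t)\<^sup>2 + \<delta> * (q t)\<^sup>2 + \<delta> * avg (h k) (\<lambda>t. (q t)\<^sup>2) t)"
          using Ei pi qsq a by (intro Bochner_Integration.integrable_add integrable_mult_right) auto
      qed
      also have "\<dots> = 2 * (LINT t|unit_time. E (h k) t) + 2 / \<delta> * (LINT t|unit_time. (p t)\<^sup>2)
          + \<delta> * (LINT t|unit_time. (q t)\<^sup>2) + \<delta> * (LINT t|unit_time. avg (h k) (\<lambda>t. (q t)\<^sup>2) t)"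
        using Ei pi qsq a by simp
      also have "\<dots> \<le> 2 * (LINT t|unit_time. E (h k) t) + 2 / \<delta> * \<delta>\<^sup>2
          + \<delta> * (LINT t|unit_time. (q t)\<^sup>2) + \<delta> * (LINT t|unit_time. (q t)\<^sup>2)"
        using \<delta> p\<delta> integral_avg_le[OF qsq h, of k] by (intro add_mono mult_left_mono order_refl) auto
      finally show ?thesis by simp
    qed
    have "(\<lambda>k. LINT t|unit_time. E (h k) t) \<longlonglongrightarrow> 0"
    proof -
      have "(\<lambda>k. \<Sum>y\<in>Y. LINT t|unit_time. \<bar>avg (h k) (g y) t - g y t\<bar>) \<longlonglongrightarrow> (\<Sum>y\<in>Y. 0)"
        unfolding h_def by (intro tendsto_sum avg_tendsto_L1 gi YH)
      moreover have "(LINT t|unit_time. E (h k) t) = (\<Sum>y\<in>Y. LINT t|unit_time. \<bar>avg (h k) (g y) t - g y t\<bar>)" for k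
        unfolding E_def using avg_integrable[OF gi[OF YH] h(1)] gi[OF YH]
        by (intro Bochner_Integration.integral_sum) auto
      ultimately show ?thesis by simp
    qed
    then have lim1: "(\<lambda>k. 2 * (LINT t|unit_time. E (h k) t) + 2 / \<delta> * \<delta>\<^sup>2 + 2 * \<delta> * (LINT t|unit_time. (q t)\<^sup>2))
        \<longlonglongrightarrow> 2 * 0 + 2 / \<delta> * \<delta>\<^sup>2 + 2 * \<delta> * (LINT t|unit_time. (q t)\<^sup>2)"
      by (intro tendsto_intros)
    have hl: "h \<longlonglongrightarrow> 0"
    proof -
      have "(\<lambda>n. 1 / real (Suc n)) \<longlonglongrightarrow> 0" using LIMSEQ_inverse_real_of_nat by (simp add: inverse_eq_divide)
      then show ?thesis unfolding h_def[abs_def] by (rule LIMSEQ_Suc)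
    qed
    have lim2: "(\<lambda>k. prim n (1 - h k)) \<longlonglongrightarrow> prim n 1"
    proof (rule continuous_on_tendsto_compose[OF prim_continuous[OF ni]])
      show "(\<lambda>k. 1 - h k) \<longlonglongrightarrow> 1" using tendsto_diff[OF tendsto_const hl, of 1] by simp
    qed (use h in \<open>auto simp: less_imp_le\<close>)
    have "prim n 1 \<le> 2 * 0 + 2 / \<delta> * \<delta>\<^sup>2 + 2 * \<delta> * (LINT t|unit_time. (q t)\<^sup>2)"
      by (rule LIMSEQ_le[OF lim2 lim1]) (use ineq in auto)
    also have "\<dots> = 2 * \<delta> * (1 + (LINT t|unit_time. (q t)\<^sup>2))"
      using \<delta> by (simp add: power2_eq_square distrib_left)
    finally show ?thesis using unit_time_integral[OF ni] by (simp add: prim_def)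
  qed
  have "(LINT t|unit_time. n t) \<le> 0"
  proof (rule ccontr)
    let ?I = "LINT t|unit_time. n t"
    define Q where "Q = 1 + (LINT t|unit_time. (q t)\<^sup>2)"
    assume "\<not> ?I \<le> 0"
    then have I: "0 < ?I" by simp
    have "0 \<le> (LINT t|unit_time. (q t)\<^sup>2)" by simp
    then have Q: "0 < Q" unfolding Q_def by linarith
    have "?I \<le> 2 * (?I / (4 * Q)) * Q" by (rule core[folded Q_def]) (use I Q in simp)
    also have "\<dots> = ?I / 2" using Q by simp
    finally show False using I by simp
  qed
  moreover have "0 \<le> (LINT t|unit_time. n t)" by (rule integral_nonneg_AE) (simp add: nn)
  ultimately have "(LINT t|unit_time. n t) = 0" by simp
  then have "AE t in unit_time. n t = 0"
    using integral_nonneg_eq_0_iff_AE[OF ni] nn by simp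
  then show ?thesis
    using good
  proof eventually_elim
    case (elim t)
    note L = H1_D(1)[OF WH[OF elim(2)]]
    have "(LINT x|lborel. (norm (W t x))\<^sup>2) = 0" using elim(1) by (simp add: n_def L2_norm_def)
    then have "AE x in lborel. (norm (W t x))\<^sup>2 = 0"
      using integral_nonneg_eq_0_iff_AE[OF L2_integrable_sq[OF L]] by simp
    then show ?case by eventually_elim (simp add: W_def)
  qed
qed

end

section \<open>The coefficient\<close>

lemma ell_eq: assumes "1 \<le> j" shows "ell j = 1 / (16 * real j * real (Suc j))"
proof -
  have "1 / (16 * a) - 1 / (16 * (a + 1)) = 1 / (16 * a * (a + 1))" if "0 < a" for a :: real
    using that by (simp add: divide_simps)
  from this[of "real j"] show ?thesis using assms by (simp add: ell_def tau_def add.commute)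
qed

lemma ell_pos: "1 \<le> j \<Longrightarrow> 0 < ell j"
  by (simp add: ell_eq)

lemma ell_le: assumes "1 \<le> j" shows "ell j \<le> 1/32"
proof -
  have "1 * 2 \<le> real j * real (Suc j)" using assms by (intro mult_mono) auto
  then show ?thesis using assms by (simp add: ell_eq divide_le_eq mult.assoc)
qed

lemma tau_mono: assumes "1 \<le> i" "i \<le> j" shows "tau i \<le> tau j"
  using assms by (simp add: tau_def frac_le)

lemma tau_less: "1 \<le> j \<Longrightarrow> tau j < 5/16"
  by (simp add: tau_def)

lemma tau_ge: assumes "1 \<le> j" shows "1/4 \<le> tau j"
  using tau_mono[of 1 j] assms by (simp add: tau_def)

lemma tau_unbounded: assumes "t < 5/16" obtains J where "1 \<le> J" "t < tau (Suc J)"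
proof -
  obtain n :: nat where n: "1 / (16 * (5/16 - t)) < real n" using reals_Archimedean2 by blast
  define J where "J = Suc n"
  have "1 / (16 * (5/16 - t)) < real (Suc J)" using n by (simp add: J_def)
  then have "1 / (16 * real (Suc J)) < 5/16 - t" using assms by (simp add: field_simps)
  then have "t < tau (Suc J)" unfolding tau_def by linarith
  then show thesis by (rule that[rotated]) (simp add: J_def)
qed

lemma freq_ge: assumes "1 \<le> j" "1 \<le> m" shows "256 * real j * real (Suc j) \<le> freq j m"
proof -
  have "(16::real) ^ 1 \<le> 16 ^ m" using assms by (intro power_increasing) auto
  then have "16 * (16 * real j * real (Suc j)) \<le> 16 ^ m * (16 * real j * real (Suc j))"
    by (intro mult_right_mono) auto
  then show ?thesis using assms by (simp add: freq_def ell_eq)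
qed

lemma freq_pos: "1 \<le> j \<Longrightarrow> 0 < freq j m"
  by (simp add: freq_def ell_pos)

lemma freq_ge_1: assumes "1 \<le> j" "1 \<le> m" shows "1 \<le> freq j m"
proof -
  have "1 * 1 \<le> real j * real (Suc j)" using assms by (intro mult_mono) auto
  then show ?thesis using freq_ge[OF assms] by (simp add: mult.assoc)
qed

lemma inverse_ell_le_freq: assumes "1 \<le> j" shows "1 / ell j \<le> freq j m"
  using ell_pos[OF assms] by (simp add: freq_def divide_right_mono)

text \<open>The \<open>j\<close>-th block has \<open>j\<close> modes. Even with an additional factor
  \<open>j\<close>, the size of a sum of \<open>j\<close> waves of amplitude one, the inverse
  frequencies have a bounded sum.\<close>

lemma sum_inverse_freq: assumes "1 \<le> j" shows "real j * (\<Sum>m=1..j. 1 / freq j m) \<le> 1/256"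
proof -
  have "(\<Sum>m=1..j. 1 / freq j m) \<le> (\<Sum>m=1..j. 1 / (256 * real j * real (Suc j)))"
    using assms by (intro sum_mono divide_left_mono freq_ge mult_pos_pos freq_pos) auto
  also have "\<dots> = 1 / (256 * real (Suc j))" using assms by simp
  finally have "real j * (\<Sum>m=1..j. 1 / freq j m) \<le> real j * (1 / (256 * real (Suc j)))"
    by (intro mult_left_mono) auto
  also have "\<dots> \<le> 1/256" by (simp add: field_simps)
  finally show ?thesis .
qed

lemma sum_inverse_freq': assumes "1 \<le> j" shows "(\<Sum>m=1..j. 1 / freq j m) \<le> 1/256"
proof -
  have "0 \<le> (\<Sum>m=1..j. 1 / freq j m)" using assms freq_pos by (intro sum_nonneg) (auto intro: less_imp_le)
  then have "1 * (\<Sum>m=1..j. 1 / freq j m) \<le> real j * (\<Sum>m=1..j. 1 / freq j m)"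
    using assms by (intro mult_right_mono) auto
  then show ?thesis using sum_inverse_freq[OF assms] by simp
qed

text \<open>The waves of a single block \<open>j\<close>, and below of all blocks: \<open>c\<close>
  contains the amplitudes at a fixed time and \<open>f\<close> is the profile, sine or cosine. As in
  the definition of the coefficient, the index \<open>i\<close> of the series is \<open>j -
  1\<close>.\<close>

definition mode_sum :: "nat \<Rightarrow> (nat \<Rightarrow> real) \<Rightarrow> (real \<Rightarrow> real) \<Rightarrow> real \<Rightarrow> real" where
  "mode_sum j c f x = (\<Sum>m=1..j. c m * f (freq j m * x))"

definition mode_series :: "(nat \<Rightarrow> nat \<Rightarrow> real) \<Rightarrow> (real \<Rightarrow> real) \<Rightarrow> real \<Rightarrow> real" where
  "mode_series c f x = (\<Sum>i. mode_sum (Suc i) (c (Suc i)) f x)"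

lemma mode_sum_zero: "(\<And>m. c m = 0) \<Longrightarrow> mode_sum j c f x = 0"
  by (simp add: mode_sum_def)

lemma mode_series_sum:
  assumes "\<And>j m. J < j \<Longrightarrow> c j m = 0"
  shows "mode_series c f x = (\<Sum>j=1..J. mode_sum j (c j) f x)"
proof -
  have "mode_series c f x = (\<Sum>i<J. mode_sum (Suc i) (c (Suc i)) f x)"
    unfolding mode_series_def by (rule suminf_finite) (auto intro!: mode_sum_zero assms)
  also have "\<dots> = (\<Sum>j=1..J. mode_sum j (c j) f x)"
    by (rule sum.reindex_bij_witness[of _ "\<lambda>j. j - 1" Suc]) auto
  finally show ?thesis .
qed

lemma mode_series_block:
  assumes "1 \<le> J" "\<And>j m. 1 \<le> j \<Longrightarrow> j \<noteq> J \<Longrightarrow> c j m = 0"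
  shows "mode_series c f x = mode_sum J (c J) f x"
proof -
  have "mode_series c f x = (\<Sum>j=1..J. mode_sum j (c j) f x)"
    using assms by (intro mode_series_sum) auto
  also have "\<dots> = (\<Sum>j=1..J. if j = J then mode_sum J (c J) f x else 0)"
    using assms by (intro sum.cong refl) (auto intro!: mode_sum_zero)
  also have "\<dots> = mode_sum J (c J) f x" using assms(1) by simp
  finally show ?thesis .
qed

lemma mode_sum_abs_le:
  assumes "\<And>m. 1 \<le> m \<Longrightarrow> m \<le> j \<Longrightarrow> \<bar>c m\<bar> \<le> b m" "\<And>y. \<bar>f y\<bar> \<le> 1"
  shows "\<bar>mode_sum j c f x\<bar> \<le> (\<Sum>m=1..j. b m)"
proof -
  have "\<bar>mode_sum j c f x\<bar> \<le> (\<Sum>m=1..j. \<bar>c m * f (freq j m * x)\<bar>)"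
    unfolding mode_sum_def by (rule sum_abs)
  also have "\<dots> \<le> (\<Sum>m=1..j. b m)"
  proof (rule sum_mono)
    fix m assume "m \<in> {1..j}"
    then have "\<bar>c m\<bar> * \<bar>f (freq j m * x)\<bar> \<le> b m * 1" using assms by (intro mult_mono) (auto intro: order_trans[OF abs_ge_zero])
    then show "\<bar>c m * f (freq j m * x)\<bar> \<le> b m" by (simp add: abs_mult)
  qed
  finally show ?thesis .
qed

context smooth_cutoff
begin

lemma eta_j_support:
  assumes "1 \<le> j" "eta_j \<eta> j t \<noteq> 0" shows "tau j < t" "t < tau (Suc j)"
proof -
  have "\<not> ((t - tau j) / ell j \<le> 0 \<or> 1 \<le> (t - tau j) / ell j)" using assms(2) eta_zero unfolding eta_j_def by blast
  then show "tau j < t" "t < tau (Suc j)"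
    using ell_pos[OF assms(1)] unfolding ell_def by (auto simp: not_le divide_less_eq zero_less_divide_iff)
qed

lemma eta_j_bounds: "0 \<le> eta_j \<eta> j t" "eta_j \<eta> j t \<le> 1"
  by (simp_all add: eta_j_def eta_nonneg eta_le_1)

text \<open>At each time at most one block is active; outside all blocks the index is arbitrary.\<close>

lemma active_block:
  obtains J where "1 \<le> J" "\<And>j. 1 \<le> j \<Longrightarrow> j \<noteq> J \<Longrightarrow> t \<le> tau j \<or> tau (Suc j) \<le> t"
proof (cases "\<exists>J\<ge>1. tau J < t \<and> t < tau (Suc J)")
  case True
  then obtain J where J: "1 \<le> J" "tau J < t" "t < tau (Suc J)" by blast
  have "t \<le> tau j \<or> tau (Suc j) \<le> t" if "1 \<le> j" "j \<noteq> J" for j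
  proof (cases "j < J")
    case True
    then show ?thesis using J that tau_mono[of "Suc j" J] by auto
  next
    case False
    then show ?thesis using J that tau_mono[of "Suc J" j] by auto
  qed
  then show thesis using J(1) by (rule that[rotated])
next
  case False
  then have "t \<le> tau j \<or> tau (Suc j) \<le> t" if "1 \<le> j" for j using that by (auto simp: not_less)
  then show thesis by (intro that[of 1]) auto
qed

lemma eta_j_inactive: "1 \<le> j \<Longrightarrow> t \<le> tau j \<or> tau (Suc j) \<le> t \<Longrightarrow> eta_j \<eta> j t = 0"
  using eta_j_support[of j t] by fastforce

definition beta_coeff :: "real \<Rightarrow> nat \<Rightarrow> nat \<Rightarrow> real" where
  "beta_coeff t j m = eta_j \<eta> j t / freq j m * sin (theta j m t)"

lemma beta_mode_series: "beta \<eta> t x = mode_series (beta_coeff t) cos x"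
  by (simp add: beta_def mode_series_def mode_sum_def beta_coeff_def num_modes_def)

lemma beta_coeff_inactive: "1 \<le> j \<Longrightarrow> t \<le> tau j \<or> tau (Suc j) \<le> t \<Longrightarrow> beta_coeff t j m = 0"
  by (simp add: beta_coeff_def eta_j_inactive)

lemma beta_coeff_bound: assumes "1 \<le> j" shows "\<bar>beta_coeff t j m\<bar> \<le> 1 / freq j m"
proof -
  have "\<bar>eta_j \<eta> j t\<bar> * \<bar>sin (theta j m t)\<bar> \<le> 1 * 1"
    using eta_j_bounds[of j t] by (intro mult_mono) auto
  then show ?thesis using freq_pos[OF assms, of m]
    by (simp add: beta_coeff_def abs_mult abs_divide divide_right_mono)
qed

lemma beta_bound: "\<bar>beta \<eta> t x\<bar> \<le> 1/256"
proof -
  obtain J where J: "1 \<le> J" "\<And>j. 1 \<le> j \<Longrightarrow> j \<noteq> J \<Longrightarrow> t \<le> tau j \<or> tau (Suc j) \<le> t" using active_block[of t] by blast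
  have "beta \<eta> t x = mode_sum J (beta_coeff t J) cos x"
    unfolding beta_mode_series by (rule mode_series_block[OF J(1)]) (rule beta_coeff_inactive, use J(2) in auto)
  also have "\<bar>\<dots>\<bar> \<le> (\<Sum>m=1..J. 1 / freq J m)"
    by (rule mode_sum_abs_le) (auto simp: beta_coeff_bound J(1))
  also have "\<dots> \<le> 1/256" by (rule sum_inverse_freq'[OF J(1)])
  finally show ?thesis .
qed

lemma beta_measurable: "(\<lambda>p. beta \<eta> (fst p) (snd p)) \<in> borel_measurable borel"
proof -
  have [measurable]: "\<eta> \<in> borel_measurable borel" by (rule smooth_measurable[OF eta_smooth])
  show ?thesis
    unfolding beta_mode_series mode_series_def mode_sum_def beta_coeff_def eta_j_def theta_def
    by (intro borel_measurable_suminf borel_measurable_sum) (simp only: borel_prod[symmetric], measurable)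
qed

end

text \<open>The comparison function \<open>x / (1 + x)\<close> makes the sum over a geometric progression telescope.\<close>

lemma sum_min_geometric:
  fixes y :: real assumes y: "0 < y"
  shows "(\<Sum>m=1..n. min (1 / (16 ^ m * y)) (16 ^ m * y)) \<le> 3"
proof -
  define \<Phi> where "\<Phi> x = x / (1 + x)" for x :: real
  have step: "min (1 / x) x \<le> 34/15 * (\<Phi> (16 * x) - \<Phi> x)" if x: "0 < x" for x
  proof -
    have d: "\<Phi> (16 * x) - \<Phi> x = 15 * x / ((1 + 16 * x) * (1 + x))"
      using x unfolding \<Phi>_def by (simp add: divide_simps) (simp add: algebra_simps)
    show ?thesis
    proof (cases "x \<le> 1")
      case True
      have "(1 + 16 * x) * (1 + x) \<le> 17 * 2" using True x by (intro mult_mono) auto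
      then have "34 * x / 34 \<le> 34 * x / ((1 + 16 * x) * (1 + x))"
        using x by (intro divide_left_mono mult_pos_pos) auto
      then have "x \<le> 34/15 * (\<Phi> (16 * x) - \<Phi> x)" unfolding d by simp
      then show ?thesis by (simp add: min.coboundedI2)
    next
      case False
      have "(1 + 16 * x) * (1 + x) \<le> (17 * x) * (2 * x)" using False by (intro mult_mono) auto
      then have "34 * x / ((17 * x) * (2 * x)) \<le> 34 * x / ((1 + 16 * x) * (1 + x))"
        using x by (intro divide_left_mono mult_pos_pos) auto
      then have "1 / x \<le> 34/15 * (\<Phi> (16 * x) - \<Phi> x)" unfolding d using x by simp
      then show ?thesis by (simp add: min.coboundedI1)
    qed
  qed
  have "(\<Sum>m=1..n. min (1 / (16 ^ m * y)) (16 ^ m * y))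
      \<le> (\<Sum>m=1..n. 34/15 * (\<Phi> (16 ^ Suc m * y) - \<Phi> (16 ^ m * y)))"
    using step[of "16 ^ m * y" for m] y by (intro sum_mono) (simp add: mult.assoc)
  also have "\<dots> = 34/15 * (\<Sum>m=1..n. \<Phi> (16 ^ Suc m * y) - \<Phi> (16 ^ m * y))"
    by (rule sum_distrib_left[symmetric])
  also have "(\<Sum>m=1..n. \<Phi> (16 ^ Suc m * y) - \<Phi> (16 ^ m * y)) = \<Phi> (16 ^ Suc n * y) - \<Phi> (16 ^ 1 * y)"
    by (subst sum_Suc_diff) auto
  also have "\<dots> \<le> 1"
  proof -
    have "\<Phi> x \<le> 1" "0 \<le> \<Phi> x" if "0 < x" for x using that by (simp_all add: \<Phi>_def)
    from this(1)[of "16 ^ Suc n * y"] this(2)[of "16 ^ 1 * y"] show ?thesis using y by simp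
  qed
  finally show ?thesis by simp
qed

context smooth_cutoff
begin

lemma eta_Lipschitz: obtains L where "0 < L" "\<And>a b. \<bar>\<eta> a - \<eta> b\<bar> \<le> L * \<bar>a - b\<bar>"
proof -
  obtain L where L: "\<And>x. \<bar>dir_deriv 1 \<eta> x\<bar> \<le> L" "L > 0"
    using test_functions_bounded[OF test_functions_dir_deriv[OF eta_test]] by blast
  have "\<bar>\<eta> a - \<eta> b\<bar> \<le> L * \<bar>a - b\<bar>" if ab: "b < a" for a b
  proof -
    from MVT2[OF ab, of \<eta>, OF smooth_real_DERIV[OF eta_smooth]]
    obtain z where "\<eta> a - \<eta> b = (a - b) * dir_deriv 1 \<eta> z" by blast
    then show ?thesis using L(1)[of z] ab by (simp add: abs_mult mult.commute mult_left_mono)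
  qed
  then have "\<bar>\<eta> a - \<eta> b\<bar> \<le> L * \<bar>a - b\<bar>" for a b
    by (metis abs_minus_commute abs_zero diff_self linorder_less_linear mult_zero_right order_refl)
  then show thesis by (rule that[OF L(2)])
qed

text \<open>Differentiating the cutoff costs \<open>1 / ell j\<close>, which is at most the
  frequency; differentiating the phase costs its square. The prefactor gains one power.\<close>

lemma beta_coeff_Lipschitz:
  assumes L: "\<And>a b. \<bar>\<eta> a - \<eta> b\<bar> \<le> L * \<bar>a - b\<bar>" "0 < L" and j: "1 \<le> j" "1 \<le> m"
  shows "\<bar>beta_coeff t j m - beta_coeff s j m\<bar> \<le> (L + 1) * (freq j m * \<bar>t - s\<bar>)"
proof -
  let ?K = "freq j m" and ?l = "ell j"
  have K: "1 \<le> ?K" and l: "0 < ?l" and lK: "1 / ?l \<le> ?K"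
    using freq_ge_1[OF j] ell_pos[OF j(1)] inverse_ell_le_freq[OF j(1)] by auto
  have e: "\<bar>eta_j \<eta> j t - eta_j \<eta> j s\<bar> \<le> L * (?K * \<bar>t - s\<bar>)"
  proof -
    have "\<bar>eta_j \<eta> j t - eta_j \<eta> j s\<bar> \<le> L * \<bar>(t - tau j) / ?l - (s - tau j) / ?l\<bar>"
      unfolding eta_j_def by (rule L(1))
    also have "(t - tau j) / ?l - (s - tau j) / ?l = (1 / ?l) * (t - s)" by (simp add: diff_divide_distrib)
    also have "\<bar>(1 / ?l) * (t - s)\<bar> = (1 / ?l) * \<bar>t - s\<bar>" using l by (simp add: abs_mult)
    also have "L * ((1 / ?l) * \<bar>t - s\<bar>) \<le> L * (?K * \<bar>t - s\<bar>)"
      using lK L(2) by (intro mult_left_mono mult_right_mono) auto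
    finally show ?thesis .
  qed
  have sn: "\<bar>sin (theta j m t) - sin (theta j m s)\<bar> \<le> ?K\<^sup>2 * \<bar>t - s\<bar>"
  proof -
    have "\<bar>sin (theta j m t) - sin (theta j m s)\<bar> \<le> \<bar>theta j m t - theta j m s\<bar>"
      using abs_sin_x_le_abs_x[of "(theta j m t - theta j m s) / 2"]
        mult_mono[of "\<bar>sin ((theta j m t - theta j m s) / 2)\<bar>" "\<bar>(theta j m t - theta j m s) / 2\<bar>" "\<bar>cos ((theta j m t + theta j m s) / 2)\<bar>" 1]
      by (simp add: sin_diff_sin abs_mult)
    also have "theta j m t - theta j m s = ?K\<^sup>2 * (t - s)" by (simp add: theta_def algebra_simps)
    finally show ?thesis by (simp add: abs_mult)
  qed
  have "eta_j \<eta> j t * sin (theta j m t) - eta_j \<eta> j s * sin (theta j m s)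
      = (eta_j \<eta> j t - eta_j \<eta> j s) * sin (theta j m t) + eta_j \<eta> j s * (sin (theta j m t) - sin (theta j m s))"
    by (simp add: algebra_simps)
  also have "\<bar>\<dots>\<bar> \<le> \<bar>eta_j \<eta> j t - eta_j \<eta> j s\<bar> * \<bar>sin (theta j m t)\<bar> + \<bar>eta_j \<eta> j s\<bar> * \<bar>sin (theta j m t) - sin (theta j m s)\<bar>"
    by (simp only: abs_mult[symmetric] abs_triangle_ineq)
  also have "\<dots> \<le> (L * (?K * \<bar>t - s\<bar>)) * 1 + 1 * (?K\<^sup>2 * \<bar>t - s\<bar>)"
    using e sn eta_j_bounds[of j s] by (intro add_mono mult_mono) (auto intro: order_trans[OF abs_ge_zero])
  also have "\<dots> \<le> (L + 1) * (?K\<^sup>2 * \<bar>t - s\<bar>)"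
  proof -
    have "?K * \<bar>t - s\<bar> \<le> ?K\<^sup>2 * \<bar>t - s\<bar>" using K by (intro mult_right_mono) (auto simp: power2_eq_square)
    then have "L * (?K * \<bar>t - s\<bar>) \<le> L * (?K\<^sup>2 * \<bar>t - s\<bar>)" using L(2) by (intro mult_left_mono) auto
    then show ?thesis by (simp add: algebra_simps)
  qed
  finally have "\<bar>eta_j \<eta> j t * sin (theta j m t) - eta_j \<eta> j s * sin (theta j m s)\<bar> \<le> (L + 1) * (?K\<^sup>2 * \<bar>t - s\<bar>)" .
  then have "\<bar>eta_j \<eta> j t * sin (theta j m t) - eta_j \<eta> j s * sin (theta j m s)\<bar> / ?K \<le> (L + 1) * (?K\<^sup>2 * \<bar>t - s\<bar>) / ?K"
    using K by (intro divide_right_mono) auto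
  also have "\<dots> = (L + 1) * (?K * \<bar>t - s\<bar>)" using K by (simp add: power2_eq_square)
  also have "\<bar>eta_j \<eta> j t * sin (theta j m t) - eta_j \<eta> j s * sin (theta j m s)\<bar> / ?K = \<bar>beta_coeff t j m - beta_coeff s j m\<bar>"
    using K by (simp add: beta_coeff_def diff_divide_distrib[symmetric] abs_divide)
  finally show ?thesis .
qed

text \<open>The amplitude of a mode changes by at most twice its size \<open>1 / K\<close> and by at
  most its Lipschitz bound. In units of the square root of the time step these are \<open>1 /
  x\<close> and \<open>x\<close> for \<open>x\<close> in a geometric progression.\<close>

lemma beta_block_Holder:
  assumes L: "\<And>a b. \<bar>\<eta> a - \<eta> b\<bar> \<le> L * \<bar>a - b\<bar>" "0 < L" and j: "1 \<le> j"
  shows "\<bar>mode_sum j (beta_coeff t j) cos x - mode_sum j (beta_coeff s j) cos x\<bar> \<le> 3 * (L + 2) * sqrt \<bar>t - s\<bar>"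
proof (cases "t = s")
  case False
  define \<delta> where "\<delta> = sqrt \<bar>t - s\<bar>"
  have \<delta>: "0 < \<delta>" "\<delta> * \<delta> = \<bar>t - s\<bar>" using False by (simp_all add: \<delta>_def)
  define y where "y = \<delta> / ell j"
  have y: "0 < y" using \<delta> ell_pos[OF j] by (simp add: y_def)
  have K: "freq j m * \<delta> = 16 ^ m * y" for m by (simp add: freq_def y_def)
  have le: "\<bar>beta_coeff t j m - beta_coeff s j m\<bar> \<le> (L + 2) * \<delta> * min (1 / (16 ^ m * y)) (16 ^ m * y)" if m: "1 \<le> m" for m
  proof -
    have K0: "0 < freq j m" by (rule freq_pos[OF j])
    have "\<bar>beta_coeff t j m - beta_coeff s j m\<bar> \<le> 2 * (1 / freq j m)"
      using beta_coeff_bound[OF j, of t m] beta_coeff_bound[OF j, of s m] by linarith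
    also have "\<dots> \<le> (L + 2) * (1 / freq j m)" using L(2) K0 by (intro mult_right_mono) auto
    also have "1 / freq j m = \<delta> * (1 / (16 ^ m * y))" unfolding K[symmetric] using \<delta> by simp
    finally have 1: "\<bar>beta_coeff t j m - beta_coeff s j m\<bar> \<le> (L + 2) * \<delta> * (1 / (16 ^ m * y))" by (simp add: mult.assoc)
    have "\<bar>beta_coeff t j m - beta_coeff s j m\<bar> \<le> (L + 1) * (freq j m * \<bar>t - s\<bar>)"
      by (rule beta_coeff_Lipschitz[OF L j m])
    also have "freq j m * \<bar>t - s\<bar> = \<delta> * (16 ^ m * y)" unfolding K[symmetric] \<delta>(2)[symmetric] by simp
    also have "(L + 1) * (\<delta> * (16 ^ m * y)) \<le> (L + 2) * (\<delta> * (16 ^ m * y))"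
      using \<delta> y by (intro mult_right_mono) auto
    finally have 2: "\<bar>beta_coeff t j m - beta_coeff s j m\<bar> \<le> (L + 2) * \<delta> * (16 ^ m * y)" by (simp add: mult.assoc)
    show ?thesis using 1 2 by (simp add: min_def)
  qed
  have "mode_sum j (beta_coeff t j) cos x - mode_sum j (beta_coeff s j) cos x = mode_sum j (\<lambda>m. beta_coeff t j m - beta_coeff s j m) cos x"
    by (simp add: mode_sum_def sum_subtractf left_diff_distrib)
  also have "\<bar>\<dots>\<bar> \<le> (\<Sum>m=1..j. (L + 2) * \<delta> * min (1 / (16 ^ m * y)) (16 ^ m * y))"
    by (rule mode_sum_abs_le) (auto simp: le)
  also have "\<dots> = (L + 2) * \<delta> * (\<Sum>m=1..j. min (1 / (16 ^ m * y)) (16 ^ m * y))"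
    by (rule sum_distrib_left[symmetric])
  also have "\<dots> \<le> (L + 2) * \<delta> * 3" using L(2) \<delta> by (intro mult_left_mono sum_min_geometric[OF y]) auto
  finally show ?thesis unfolding \<delta>_def by (simp add: algebra_simps)
qed simp

text \<open>For times in different blocks both values are compared with zero: the terms of one block
  vanish at the time that belongs to the other.\<close>

lemma beta_Holder:
  obtains C where "0 < C" "\<And>s t x. \<bar>beta \<eta> t x - beta \<eta> s x\<bar> \<le> C * sqrt \<bar>t - s\<bar>"
proof -
  obtain L where L: "0 < L" "\<And>a b. \<bar>\<eta> a - \<eta> b\<bar> \<le> L * \<bar>a - b\<bar>" using eta_Lipschitz by blast
  define C where "C = 3 * (L + 2)"
  have "\<bar>beta \<eta> t x - beta \<eta> s x\<bar> \<le> 2 * C * sqrt \<bar>t - s\<bar>" for s t x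
  proof -
    obtain I where I: "1 \<le> I" "\<And>j. 1 \<le> j \<Longrightarrow> j \<noteq> I \<Longrightarrow> t \<le> tau j \<or> tau (Suc j) \<le> t" using active_block[of t] by blast
    obtain J where J: "1 \<le> J" "\<And>j. 1 \<le> j \<Longrightarrow> j \<noteq> J \<Longrightarrow> s \<le> tau j \<or> tau (Suc j) \<le> s" using active_block[of s] by blast
    let ?b = "\<lambda>j t. mode_sum j (beta_coeff t j) cos x"
    have t: "beta \<eta> t x = ?b I t" unfolding beta_mode_series
      by (rule mode_series_block[OF I(1)]) (rule beta_coeff_inactive, use I(2) in auto)
    have s: "beta \<eta> s x = ?b J s" unfolding beta_mode_series
      by (rule mode_series_block[OF J(1)]) (rule beta_coeff_inactive, use J(2) in auto)
    have H: "\<bar>?b j t - ?b j s\<bar> \<le> C * sqrt \<bar>t - s\<bar>" if "1 \<le> j" for j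
      unfolding C_def by (rule beta_block_Holder[OF L(2,1) that])
    show ?thesis
    proof (cases "I = J")
      case True
      have "C * sqrt \<bar>t - s\<bar> \<le> 2 * C * sqrt \<bar>t - s\<bar>" using L(1) by (intro mult_right_mono) (auto simp: C_def)
      then show ?thesis using H[OF I(1)] True by (simp add: t s)
    next
      case False
      have "?b I s = 0" "?b J t = 0" using False I J by (auto intro!: mode_sum_zero beta_coeff_inactive)
      then show ?thesis using H[OF I(1)] H[OF J(1)] by (simp add: t s)
    qed
  qed
  moreover have "0 < 2 * C" using L(1) by (simp add: C_def)
  ultimately show thesis by (rule that[rotated])
qed

end

lemma Linf_norm_le:
  fixes f :: "'a::euclidean_space \<Rightarrow> 'b::euclidean_space"
  assumes "f \<in> borel_measurable borel" "\<And>x. norm (f x) \<le> M"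
  shows "Linf_norm f \<le> ereal M"
  unfolding Linf_norm_def by (rule esssup_I) (use assms in auto)

lemma Linf_I:
  fixes f :: "'a::euclidean_space \<Rightarrow> 'b::euclidean_space"
  assumes "f \<in> borel_measurable borel" "\<And>x. norm (f x) \<le> M" shows "f \<in> Linf"
  using assms Linf_norm_le[OF assms] unfolding Linf_def by (auto simp: le_less_trans)

context smooth_cutoff
begin

lemma scalar_coeff_measurable:
  "(\<lambda>p. scalar_coeff \<eta> \<epsilon> (fst p) (snd p)) \<in> borel_measurable borel"
  unfolding scalar_coeff_def using beta_measurable by simp

lemma scalar_coeff_bounds:
  assumes "0 < \<epsilon>" "\<epsilon> \<le> 1" shows "1/2 \<le> scalar_coeff \<eta> \<epsilon> t x" "scalar_coeff \<eta> \<epsilon> t x \<le> 2"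
proof -
  have "\<bar>\<epsilon> * beta \<eta> t x\<bar> \<le> 1 * (1/256)"
    unfolding abs_mult using assms beta_bound by (intro mult_mono) auto
  then show "1/2 \<le> scalar_coeff \<eta> \<epsilon> t x" "scalar_coeff \<eta> \<epsilon> t x \<le> 2" by (auto simp: scalar_coeff_def)
qed

lemma coeff_matrix_measurable:
  fixes k :: "'n::finite"
  shows "(\<lambda>p. coeff_matrix \<eta> \<epsilon> k (fst p) (snd p)) \<in> borel_measurable borel"
proof -
  have "(\<lambda>p::real \<times> (real^'n). (fst p, snd p $ k)) \<in> borel_measurable borel"
    by (intro borel_measurable_continuous_onI continuous_intros)
  from measurable_compose[OF this scalar_coeff_measurable[of \<epsilon>]]
  show ?thesis unfolding coeff_matrix_def by simp
qed

lemma coeff_matrix_measurable_space: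
  fixes k :: "'n::finite"
  shows "coeff_matrix \<eta> \<epsilon> k t \<in> borel_measurable borel"
proof -
  have "(\<lambda>x::real^'n. (t, x)) \<in> borel_measurable borel"
    by (intro borel_measurable_continuous_onI continuous_intros)
  from measurable_compose[OF this coeff_matrix_measurable[of \<epsilon> k]] show ?thesis by simp
qed

lemma coeff_matrix_properties:
  fixes k :: "'n::finite"
  assumes \<epsilon>: "0 < \<epsilon>" "\<epsilon> \<le> 1"
  shows "coeff_matrix \<eta> \<epsilon> k \<in> Holder_Linf (1/2)"
    "transpose (coeff_matrix \<eta> \<epsilon> k t x) = coeff_matrix \<eta> \<epsilon> k t x"
    "(\<lambda>(t, x). coeff_matrix \<eta> \<epsilon> k t x) \<in> Linf"
    "uniformly_elliptic (scalar_coeff \<eta> \<epsilon>)"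
proof -
  let ?N = "norm (mat 1 :: real^'n^'n)"
  have nb: "norm (coeff_matrix \<eta> \<epsilon> k t x) \<le> 2 * ?N" for t x
    unfolding coeff_matrix_def norm_scaleR using scalar_coeff_bounds[OF \<epsilon>, of t "x $ k"] by (intro mult_right_mono) auto
  obtain C where C: "0 < C" "\<And>s t x. \<bar>beta \<eta> t x - beta \<eta> s x\<bar> \<le> C * sqrt \<bar>t - s\<bar>" using beta_Holder by blast
  have nd: "norm (coeff_matrix \<eta> \<epsilon> k t x - coeff_matrix \<eta> \<epsilon> k s x) \<le> (C * ?N) * sqrt \<bar>t - s\<bar>" for s t x
  proof -
    have "coeff_matrix \<eta> \<epsilon> k t x - coeff_matrix \<eta> \<epsilon> k s x = (\<epsilon> * (beta \<eta> t (x $ k) - beta \<eta> s (x $ k))) *\<^sub>R mat 1"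
      by (simp add: coeff_matrix_def scalar_coeff_def scaleR_diff_left[symmetric] right_diff_distrib)
    then have "norm (coeff_matrix \<eta> \<epsilon> k t x - coeff_matrix \<eta> \<epsilon> k s x) = (\<epsilon> * \<bar>beta \<eta> t (x $ k) - beta \<eta> s (x $ k)\<bar>) * ?N"
      using \<epsilon> by (simp add: abs_mult)
    also have "\<dots> \<le> (1 * (C * sqrt \<bar>t - s\<bar>)) * ?N"
      using \<epsilon> C by (intro mult_right_mono mult_mono) auto
    finally show ?thesis by (simp add: ac_simps)
  qed
  have m: "(\<lambda>x. coeff_matrix \<eta> \<epsilon> k t x - coeff_matrix \<eta> \<epsilon> k s x) \<in> borel_measurable borel" for s t
    by (intro borel_measurable_diff coeff_matrix_measurable_space)
  show "coeff_matrix \<eta> \<epsilon> k \<in> Holder_Linf (1/2)"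
    unfolding Holder_Linf_def
  proof (intro CollectI conjI ballI exI[of _ "max (2 * ?N) (C * ?N)"])
    fix s t :: real
    show "coeff_matrix \<eta> \<epsilon> k t \<in> Linf" by (rule Linf_I[OF coeff_matrix_measurable_space nb])
    have "Linf_norm (coeff_matrix \<eta> \<epsilon> k t) \<le> ereal (2 * ?N)"
      by (rule Linf_norm_le[OF coeff_matrix_measurable_space nb])
    also have "\<dots> \<le> ereal (max (2 * ?N) (C * ?N))" by simp
    finally show "Linf_norm (coeff_matrix \<eta> \<epsilon> k t) \<le> ereal (max (2 * ?N) (C * ?N))" .
    have "Linf_norm (\<lambda>x. coeff_matrix \<eta> \<epsilon> k t x - coeff_matrix \<eta> \<epsilon> k s x) \<le> ereal (C * ?N * sqrt \<bar>t - s\<bar>)"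
      by (rule Linf_norm_le[OF m nd])
    also have "\<dots> \<le> ereal (max (2 * ?N) (C * ?N) * \<bar>t - s\<bar> powr (1/2))"
      by (simp add: powr_half_sqrt mult_right_mono)
    finally show "Linf_norm (\<lambda>x. coeff_matrix \<eta> \<epsilon> k t x - coeff_matrix \<eta> \<epsilon> k s x) \<le> ereal (max (2 * ?N) (C * ?N) * \<bar>t - s\<bar> powr (1/2))" .
  qed
  show "transpose (coeff_matrix \<eta> \<epsilon> k t x) = coeff_matrix \<eta> \<epsilon> k t x"
    by (simp add: coeff_matrix_def transpose_def mat_def vec_eq_iff)
  show "(\<lambda>(t, x). coeff_matrix \<eta> \<epsilon> k t x) \<in> Linf"
    unfolding case_prod_beta' by (rule Linf_I[OF coeff_matrix_measurable nb])
  show "uniformly_elliptic (scalar_coeff \<eta> \<epsilon>)"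
    unfolding uniformly_elliptic_def using scalar_coeff_bounds[OF \<epsilon>] by (intro exI[of _ "1/2"]) simp
qed

lemma coeff_matrix_mult: "coeff_matrix \<eta> \<epsilon> k t x *v y = scalar_coeff \<eta> \<epsilon> t (x $ k) *\<^sub>R y"
  by (simp add: coeff_matrix_def scaleR_matrix_vector_assoc[symmetric])

lemma coeff_matrix_L2:
  assumes \<epsilon>: "0 < \<epsilon>" "\<epsilon> \<le> 1" and p: "p \<in> L2"
  shows "(\<lambda>x. coeff_matrix \<eta> \<epsilon> k t x *v p x) \<in> L2" "L2_norm (\<lambda>x. coeff_matrix \<eta> \<epsilon> k t x *v p x) \<le> 2 * L2_norm p"
proof -
  have "(\<lambda>x::real^'a. (t, x $ k)) \<in> borel_measurable borel"
    by (intro borel_measurable_continuous_onI continuous_intros)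
  from measurable_compose[OF this scalar_coeff_measurable[of \<epsilon>]]
  have m: "(\<lambda>x. coeff_matrix \<eta> \<epsilon> k t x *v p x) \<in> borel_measurable borel"
    unfolding coeff_matrix_mult using L2_measurable[OF p] by simp
  have le: "norm (coeff_matrix \<eta> \<epsilon> k t x *v p x) \<le> norm (2 *\<^sub>R p x)" for x
    unfolding coeff_matrix_mult norm_scaleR using scalar_coeff_bounds[OF \<epsilon>, of t "x $ k"] by (intro mult_right_mono) auto
  show "(\<lambda>x. coeff_matrix \<eta> \<epsilon> k t x *v p x) \<in> L2" by (rule L2_norm_mono(1)[OF L2_scaleR[OF p] m le])
  show "L2_norm (\<lambda>x. coeff_matrix \<eta> \<epsilon> k t x *v p x) \<le> 2 * L2_norm p"
    using L2_norm_mono(2)[OF L2_scaleR[OF p] m le] by (simp add: L2_norm_scaleR)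
qed

lemma lions_solution_coeff_unique:
  fixes k :: "'n::finite"
  assumes "0 < \<epsilon>" "\<epsilon> \<le> 1" "lions_solution (coeff_matrix \<eta> \<epsilon> k) F U" "lions_solution (coeff_matrix \<eta> \<epsilon> k) F V"
  shows "AE t in unit_time. AE x in lborel. V t x = U t x"
proof (rule lions_solution_unique[OF assms(3,4)])
  show "(\<lambda>x. coeff_matrix \<eta> \<epsilon> k t x *v p x) \<in> L2" if "p \<in> L2" for t p
    by (rule coeff_matrix_L2(1)[OF assms(1,2) that])
  show "0 \<le> (coeff_matrix \<eta> \<epsilon> k t x *v y) \<bullet> y" for t x y
    using scalar_coeff_bounds(1)[OF assms(1,2), of t "x $ k"] by (simp add: coeff_matrix_mult)
qed

end

section \<open>Oscillating series in time and space\<close>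

text \<open>All series start with block \<open>1\<close>, so the conditions do as well.\<close>

definition block_supported :: "(real \<Rightarrow> nat \<Rightarrow> nat \<Rightarrow> real) \<Rightarrow> bool" where
  "block_supported c \<longleftrightarrow> (\<forall>t j m. 1 \<le> j \<longrightarrow> t \<le> tau j \<or> tau (Suc j) \<le> t \<longrightarrow> c t j m = 0)"

lemma mode_sum_smooth: "smooth f \<Longrightarrow> smooth (mode_sum J c f)"
  unfolding mode_sum_def[abs_def]
  using smooth_compose_affine[of f "freq J m" 0 for m]
  by (intro smooth_sum smooth_cmult) auto

lemma mode_sum_dir_deriv:
  assumes "smooth f"
  shows "dir_deriv 1 (mode_sum J c f) = mode_sum J (\<lambda>m. c m * freq J m) (dir_deriv 1 f)"
proof
  fix x
  have d: "((\<lambda>x. f (freq J m * x)) has_real_derivative dir_deriv 1 f (freq J m * x) * freq J m) (at x)" for m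
    by (rule DERIV_chain2[OF smooth_real_DERIV[OF assms]]) (auto intro!: derivative_eq_intros)
  have "(mode_sum J c f has_real_derivative (\<Sum>m=1..J. c m * (dir_deriv 1 f (freq J m * x) * freq J m))) (at x)"
    unfolding mode_sum_def[abs_def] by (intro DERIV_sum DERIV_cmult d)
  from dir_deriv_DERIV[OF this, of 1]
  show "dir_deriv 1 (mode_sum J c f) x = mode_sum J (\<lambda>m. c m * freq J m) (dir_deriv 1 f) x"
    by (simp add: mode_sum_def mult_ac)
qed

lemma mode_sum_uminus: "mode_sum J c (\<lambda>y. - f y) = mode_sum J (\<lambda>m. - c m) f"
  by (simp add: mode_sum_def fun_eq_iff)

context smooth_cutoff
begin

text \<open>At a fixed time all series reduce to the same finite sum.\<close>

lemma single_block:
  obtains J where "1 \<le> J" "\<forall>c f. block_supported c \<longrightarrow> mode_series (c t) f = mode_sum J (c t J) f"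
proof -
  obtain J where J: "1 \<le> J" "\<And>j. 1 \<le> j \<Longrightarrow> j \<noteq> J \<Longrightarrow> t \<le> tau j \<or> tau (Suc j) \<le> t"
    using active_block[of t] by blast
  have "mode_series (c t) f = mode_sum J (c t J) f" if "block_supported c" for c f
  proof
    show "mode_series (c t) f x = mode_sum J (c t J) f x" for x
      by (rule mode_series_block[OF J(1)]) (use that J(2) in \<open>auto simp: block_supported_def\<close>)
  qed
  then show thesis using J(1) by (intro that) auto
qed

text \<open>The blocks accumulate only at \<open>5/16\<close>: before that time finitely many blocks
  have begun, after it all have ended.\<close>

lemma locally_finite_blocks:
  assumes "t \<noteq> 5/16"
  obtains N J where "open N" "t \<in> N"
    "\<forall>c f s x. block_supported c \<longrightarrow> s \<in> N \<longrightarrow> mode_series (c s) f x = (\<Sum>j=1..J. mode_sum j (c s j) f x)"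
proof -
  have "\<exists>J N. open N \<and> t \<in> N \<and> (\<forall>s\<in>N. \<forall>j>J. s \<le> tau j \<or> tau (Suc j) \<le> s)"
  proof (cases "t < 5/16")
    case True
    then obtain J where J: "1 \<le> J" "t < tau (Suc J)" by (rule tau_unbounded)
    have "s \<le> tau j" if "s \<in> {..<tau (Suc J)}" "J < j" for s j
      using tau_mono[of "Suc J" j] that by auto
    then show ?thesis using J by (intro exI[of _ J] exI[of _ "{..<tau (Suc J)}"]) auto
  next
    case False
    have "tau (Suc j) \<le> s" if "s \<in> {5/16<..}" for s j
      using tau_less[of "Suc j"] that by auto
    then show ?thesis using False assms by (intro exI[of _ 0] exI[of _ "{5/16<..}"]) auto
  qed
  then obtain J N where JN: "open N" "t \<in> N" "\<And>s j. s \<in> N \<Longrightarrow> J < j \<Longrightarrow> s \<le> tau j \<or> tau (Suc j) \<le> s" by blast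
  have "mode_series (c s) f x = (\<Sum>j=1..J. mode_sum j (c s j) f x)" if "block_supported c" "s \<in> N" for c f s x
  proof (rule mode_series_sum)
    fix j m assume "J < j"
    then show "c s j m = 0" using JN(3)[OF that(2), of j] that(1) unfolding block_supported_def by auto
  qed
  then show thesis using JN(1,2) by (intro that[of N J]) auto
qed

lemma mode_series_tendsto:
  assumes c: "block_supported c" and t: "t \<noteq> 5/16" and cont: "\<And>j m. 1 \<le> j \<Longrightarrow> isCont (\<lambda>s. c s j m) t"
  shows "((\<lambda>s. mode_series (c s) f x) \<longlongrightarrow> mode_series (c t) f x) (at t)"
proof -
  obtain N J where N: "open N" "t \<in> N"
    and eq': "\<forall>c f s x. block_supported c \<longrightarrow> s \<in> N \<longrightarrow> mode_series (c s) f x = (\<Sum>j=1..J. mode_sum j (c s j) f x)"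
    by (rule locally_finite_blocks[OF t])
  note eq = eq'[rule_format]
  have "((\<lambda>s. \<Sum>j=1..J. mode_sum j (c s j) f x) \<longlongrightarrow> (\<Sum>j=1..J. mode_sum j (c t j) f x)) (at t)"
    unfolding mode_sum_def
    by (intro tendsto_sum tendsto_mult tendsto_const isContD cont) auto
  then have "((\<lambda>s. \<Sum>j=1..J. mode_sum j (c s j) f x) \<longlongrightarrow> mode_series (c t) f x) (at t)"
    using eq[OF c N(2)] by simp
  moreover have "eventually (\<lambda>s. (\<Sum>j=1..J. mode_sum j (c s j) f x) = mode_series (c s) f x) (at t)"
    unfolding eventually_at_topological
    by (intro exI[of _ N] conjI ballI impI N eq[OF c, symmetric])
  ultimately show ?thesis by (rule Lim_transform_eventually)
qed

definition deta_j :: "nat \<Rightarrow> real \<Rightarrow> real" where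
  "deta_j j t = dir_deriv 1 \<eta> ((t - tau j) / ell j) / ell j"

lemma eta_j_DERIV: assumes "1 \<le> j" shows "((\<lambda>t. eta_j \<eta> j t) has_real_derivative deta_j j t) (at t)"
proof -
  have "((\<lambda>t. \<eta> ((t - tau j) / ell j)) has_real_derivative dir_deriv 1 \<eta> ((t - tau j) / ell j) * (1 / ell j)) (at t)"
    by (rule DERIV_chain2[OF smooth_real_DERIV[OF eta_smooth]])
      (use ell_pos[OF assms] in \<open>auto intro!: derivative_eq_intros\<close>)
  then show ?thesis by (simp add: eta_j_def deta_j_def)
qed

lemma deta_j_inactive:
  assumes "1 \<le> j" "t \<le> tau j \<or> tau (Suc j) \<le> t" shows "deta_j j t = 0"
proof -
  have "(t - tau j) / ell j \<le> 0 \<or> 1 \<le> (t - tau j) / ell j"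
    using assms ell_pos[OF assms(1)] unfolding ell_def by (auto simp: divide_le_0_iff)
  then have "(t - tau j) / ell j \<notin> {0<..<1}" by auto
  then have "dir_deriv 1 \<eta> ((t - tau j) / ell j) = 0"
    by (rule test_functionsD(3)[OF test_functions_dir_deriv[OF eta_test]])
  then show ?thesis by (simp add: deta_j_def)
qed

lemma eta_j_isCont: "1 \<le> j \<Longrightarrow> isCont (\<lambda>t. eta_j \<eta> j t) t"
  using eta_j_DERIV DERIV_isCont by blast

lemma deta_j_isCont: assumes "1 \<le> j" shows "isCont (\<lambda>t. deta_j j t) t"
proof -
  have "isCont (dir_deriv 1 \<eta>) y" for y
    using smooth_continuous[OF smooth_dir_deriv[OF eta_smooth], of UNIV] by (simp add: continuous_on_eq_continuous_at)
  then show ?thesis unfolding deta_j_def using ell_pos[OF assms]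
    by (intro continuous_intros isCont_o2[of _ "\<lambda>t. (t - tau j) / ell j"]) auto
qed

lemma theta_isCont: "isCont (\<lambda>t. theta j m t) t"
  unfolding theta_def by (intro continuous_intros)

lemma beta_block_supported: "block_supported beta_coeff"
  by (simp add: block_supported_def beta_coeff_inactive)

end

text \<open>The setting of the counterexample. The bump \<open>\<psi>\<close> is arbitrary; the time derivative fails to be
  square integrable as soon as \<open>\<psi>\<close> varies in the direction of the coordinate \<open>k\<close>.\<close>

locale corrector = smooth_cutoff \<eta> for \<eta> +
  fixes \<epsilon> :: real and k :: "'n::finite" and \<psi> :: "real^'n \<Rightarrow> real"
  assumes eps: "0 < \<epsilon>" "\<epsilon> \<le> 1"
    and psi: "\<psi> \<in> test_functions UNIV"
begin

text \<open>The amplitudes of the corrector. Its time derivative has two parts: \<open>rc\<close>,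
  where the derivative falls on the cutoff, and a multiple of the amplitudes \<open>zc\<close> of
  size one, where it falls on the oscillation.\<close>

definition gc :: "real \<Rightarrow> nat \<Rightarrow> nat \<Rightarrow> real" where
  "gc t j m = - (\<epsilon> / 2) * eta_j \<eta> j t / (freq j m)\<^sup>2 * (sin (theta j m t) - cos (theta j m t))"

definition rc :: "real \<Rightarrow> nat \<Rightarrow> nat \<Rightarrow> real" where
  "rc t j m = - (\<epsilon> / 2) * deta_j j t / (freq j m)\<^sup>2 * (sin (theta j m t) - cos (theta j m t))"

definition zc :: "real \<Rightarrow> nat \<Rightarrow> nat \<Rightarrow> real" where
  "zc t j m = eta_j \<eta> j t * (sin (theta j m t) + cos (theta j m t))"

lemma supported:
  "block_supported gc" "block_supported rc" "block_supported zc"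
  "block_supported (\<lambda>t j m. gc t j m * freq j m)"
  "block_supported (\<lambda>t j m. - (gc t j m * freq j m * freq j m))"
  "block_supported (\<lambda>t j m. rc t j m - \<epsilon> / 2 * zc t j m)"
  "block_supported (\<lambda>t j m. - (beta_coeff t j m * freq j m))"
  by (auto simp: block_supported_def gc_def rc_def zc_def beta_coeff_def eta_j_inactive deta_j_inactive)

lemma coeff_isCont:
  assumes "1 \<le> j"
  shows "isCont (\<lambda>t. gc t j m) t" "isCont (\<lambda>t. rc t j m) t" "isCont (\<lambda>t. zc t j m) t" "isCont (\<lambda>t. beta_coeff t j m) t"
  unfolding gc_def rc_def zc_def beta_coeff_def
  using freq_pos[OF assms, of m]
  by (auto intro!: continuous_intros eta_j_isCont[OF assms] deta_j_isCont[OF assms] theta_isCont)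

lemma gc_DERIV:
  assumes "1 \<le> j"
  shows "((\<lambda>t. gc t j m) has_real_derivative rc t j m - \<epsilon> / 2 * zc t j m) (at t)"
proof -
  let ?K = "freq j m"
  have K: "?K \<noteq> 0" using freq_pos[OF assms, of m] by simp
  have th: "((\<lambda>t. theta j m t) has_real_derivative ?K\<^sup>2) (at t)"
    unfolding theta_def by (auto intro!: derivative_eq_intros)
  have s: "((\<lambda>t. sin (theta j m t) - cos (theta j m t)) has_real_derivative
      (cos (theta j m t) * ?K\<^sup>2 - - sin (theta j m t) * ?K\<^sup>2)) (at t)"
    by (intro DERIV_diff DERIV_chain2[OF DERIV_sin th] DERIV_chain2[OF DERIV_cos th])
  have "((\<lambda>t. (- (\<epsilon> / 2) / ?K\<^sup>2) * (eta_j \<eta> j t * (sin (theta j m t) - cos (theta j m t)))) has_real_derivative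
     (- (\<epsilon> / 2) / ?K\<^sup>2) * (deta_j j t * (sin (theta j m t) - cos (theta j m t))
        + (cos (theta j m t) * ?K\<^sup>2 - - sin (theta j m t) * ?K\<^sup>2) * eta_j \<eta> j t)) (at t)"
    by (intro DERIV_cmult DERIV_mult eta_j_DERIV[OF assms] s)
  also have "(\<lambda>t. (- (\<epsilon> / 2) / ?K\<^sup>2) * (eta_j \<eta> j t * (sin (theta j m t) - cos (theta j m t)))) = (\<lambda>t. gc t j m)"
    by (simp add: gc_def fun_eq_iff)
  also have "(- (\<epsilon> / 2) / ?K\<^sup>2) * (deta_j j t * (sin (theta j m t) - cos (theta j m t))
        + (cos (theta j m t) * ?K\<^sup>2 - - sin (theta j m t) * ?K\<^sup>2) * eta_j \<eta> j t) = rc t j m - \<epsilon> / 2 * zc t j m"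
    using K by (simp add: rc_def zc_def field_simps)
  finally show ?thesis .
qed

text \<open>\<open>g0\<close> is the corrector, \<open>g1\<close> and \<open>g2\<close> are its
  space derivatives, \<open>gt\<close> is its time derivative and \<open>r0\<close> the harmless
  part of it; \<open>z0\<close> collects the oscillations of size one, and \<open>b1\<close> is the
  space derivative of \<open>\<beta>\<close>.\<close>

definition g0 :: "real \<Rightarrow> real \<Rightarrow> real" where "g0 t = mode_series (gc t) sin"
definition g1 :: "real \<Rightarrow> real \<Rightarrow> real" where "g1 t = mode_series (\<lambda>j m. gc t j m * freq j m) cos"
definition g2 :: "real \<Rightarrow> real \<Rightarrow> real" where "g2 t = mode_series (\<lambda>j m. - (gc t j m * freq j m * freq j m)) sin"
definition gt :: "real \<Rightarrow> real \<Rightarrow> real" where "gt t = mode_series (\<lambda>j m. rc t j m - \<epsilon> / 2 * zc t j m) sin"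
definition r0 :: "real \<Rightarrow> real \<Rightarrow> real" where "r0 t = mode_series (rc t) sin"
definition z0 :: "real \<Rightarrow> real \<Rightarrow> real" where "z0 t = mode_series (zc t) sin"
definition b1 :: "real \<Rightarrow> real \<Rightarrow> real" where "b1 t = mode_series (\<lambda>j m. - (beta_coeff t j m * freq j m)) sin"

lemma beta_eq: "beta \<eta> t = mode_series (beta_coeff t) cos"
  by (rule ext) (rule beta_mode_series)

text \<open>The active block is the same for all series, which makes their amplitudes comparable
  term by term.\<close>

lemma modes:
  obtains J where "1 \<le> J" "g0 t = mode_sum J (gc t J) sin" "g1 t = mode_sum J (\<lambda>m. gc t J m * freq J m) cos"
    "g2 t = mode_sum J (\<lambda>m. - (gc t J m * freq J m * freq J m)) sin"
    "gt t = mode_sum J (\<lambda>m. rc t J m - \<epsilon> / 2 * zc t J m) sin"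
    "r0 t = mode_sum J (rc t J) sin" "z0 t = mode_sum J (zc t J) sin"
    "b1 t = mode_sum J (\<lambda>m. - (beta_coeff t J m * freq J m)) sin"
    "beta \<eta> t = mode_sum J (beta_coeff t J) cos"
proof -
  obtain J where J1: "1 \<le> J" and J2: "\<forall>c f. block_supported c \<longrightarrow> mode_series (c t) f = mode_sum J (c t J) f"
    by (rule single_block[of t])
  note J = J1 J2[rule_format]
  show thesis
    unfolding g0_def g1_def g2_def gt_def r0_def z0_def b1_def beta_eq
    by (rule that[unfolded g0_def g1_def g2_def gt_def r0_def z0_def b1_def beta_eq,
        OF J(1) J(2)[OF supported(1)] J(2)[OF supported(4)] J(2)[OF supported(5)] J(2)[OF supported(6)]
          J(2)[OF supported(2)] J(2)[OF supported(3)] J(2)[OF supported(7)] J(2)[OF beta_block_supported]])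
qed

lemma wave_smooth:
  "smooth (g0 t)" "smooth (g1 t)" "smooth (g2 t)" "smooth (gt t)" "smooth (r0 t)" "smooth (z0 t)"
  "smooth (b1 t)" "smooth (beta \<eta> t)"
  and wave_dir_deriv: "dir_deriv 1 (g0 t) = g1 t" "dir_deriv 1 (g1 t) = g2 t" "dir_deriv 1 (beta \<eta> t) = b1 t"
proof -
  obtain J where J: "1 \<le> J" "g0 t = mode_sum J (gc t J) sin" "g1 t = mode_sum J (\<lambda>m. gc t J m * freq J m) cos"
    "g2 t = mode_sum J (\<lambda>m. - (gc t J m * freq J m * freq J m)) sin"
    "gt t = mode_sum J (\<lambda>m. rc t J m - \<epsilon> / 2 * zc t J m) sin"
    "r0 t = mode_sum J (rc t J) sin" "z0 t = mode_sum J (zc t J) sin"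
    "b1 t = mode_sum J (\<lambda>m. - (beta_coeff t J m * freq J m)) sin"
    "beta \<eta> t = mode_sum J (beta_coeff t J) cos"
    by (rule modes[of t])
  show "smooth (g0 t)" "smooth (g1 t)" "smooth (g2 t)" "smooth (gt t)" "smooth (r0 t)" "smooth (z0 t)"
    "smooth (b1 t)" "smooth (beta \<eta> t)"
    unfolding J by (rule mode_sum_smooth, simp add: smooth_sin smooth_cos)+
  show "dir_deriv 1 (g0 t) = g1 t" "dir_deriv 1 (g1 t) = g2 t" "dir_deriv 1 (beta \<eta> t) = b1 t"
    unfolding J by (simp_all add: mode_sum_dir_deriv smooth_sin smooth_cos dir_deriv_sin dir_deriv_cos mode_sum_uminus)
qed

lemma gt_split: "gt t y = r0 t y - \<epsilon> / 2 * z0 t y"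
  and resonance: "gt t y = g2 t y + \<epsilon> * b1 t y + r0 t y"
proof -
  obtain J where J: "1 \<le> J" "g0 t = mode_sum J (gc t J) sin" "g1 t = mode_sum J (\<lambda>m. gc t J m * freq J m) cos"
    "g2 t = mode_sum J (\<lambda>m. - (gc t J m * freq J m * freq J m)) sin"
    "gt t = mode_sum J (\<lambda>m. rc t J m - \<epsilon> / 2 * zc t J m) sin"
    "r0 t = mode_sum J (rc t J) sin" "z0 t = mode_sum J (zc t J) sin"
    "b1 t = mode_sum J (\<lambda>m. - (beta_coeff t J m * freq J m)) sin"
    "beta \<eta> t = mode_sum J (beta_coeff t J) cos"
    by (rule modes[of t])
  show "gt t y = r0 t y - \<epsilon> / 2 * z0 t y"
    unfolding J mode_sum_def by (simp add: sum_distrib_left sum_subtractf[symmetric] left_diff_distrib mult.assoc)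
  \<comment> \<open>the sine parts of \<open>- \<epsilon> / 2 * zc\<close> and of \<open>gc\<close> times the squared frequency add up, the cosine parts cancel\<close>
  have "rc t J m - \<epsilon> / 2 * zc t J m = - (gc t J m * freq J m * freq J m) + \<epsilon> * (- (beta_coeff t J m * freq J m)) + rc t J m" for m
    using freq_pos[OF J(1), of m] by (simp add: zc_def gc_def beta_coeff_def field_simps power2_eq_square)
  then show "gt t y = g2 t y + \<epsilon> * b1 t y + r0 t y"
    unfolding J mode_sum_def sum_distrib_left sum.distrib[symmetric]
    by (intro sum.cong refl) (simp only: distrib_right mult.assoc)
qed

lemma sin_cos_le_2: "\<bar>sin x - cos x\<bar> \<le> (2::real)" "\<bar>sin x + cos x\<bar> \<le> (2::real)"
  using abs_sin_le_one[of x] abs_cos_le_one[of x] by linarith+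

lemma gc_bound: assumes "1 \<le> j" shows "\<bar>gc t j m\<bar> \<le> 1 / (freq j m)\<^sup>2"
proof -
  have "\<bar>\<epsilon> / 2\<bar> * \<bar>eta_j \<eta> j t\<bar> * \<bar>sin (theta j m t) - cos (theta j m t)\<bar> \<le> 1/2 * 1 * 2"
    using eta_j_bounds[of j t] eps sin_cos_le_2 by (intro mult_mono) auto
  then have "\<bar>\<epsilon> / 2\<bar> * \<bar>eta_j \<eta> j t\<bar> * \<bar>sin (theta j m t) - cos (theta j m t)\<bar> / (freq j m)\<^sup>2 \<le> 1 / (freq j m)\<^sup>2"
    by (intro divide_right_mono) auto
  then show ?thesis by (simp add: gc_def abs_mult abs_divide)
qed

lemma gc_bound1: assumes "1 \<le> j" "1 \<le> m" shows "\<bar>gc t j m\<bar> \<le> 1 / freq j m"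
proof -
  have "freq j m * 1 \<le> freq j m * freq j m" using freq_ge_1[OF assms] by (intro mult_left_mono) auto
  then have "1 / (freq j m)\<^sup>2 \<le> 1 / freq j m"
    using freq_pos[OF assms(1), of m] by (intro divide_left_mono) (auto simp: power2_eq_square)
  then show ?thesis using gc_bound[OF assms(1), of t m] by linarith
qed

lemma gc_bound2: assumes "1 \<le> j" shows "\<bar>gc t j m * freq j m\<bar> \<le> 1 / freq j m"
  using mult_right_mono[OF gc_bound[OF assms, of t m], of "freq j m"] freq_pos[OF assms, of m]
  by (simp add: abs_mult power2_eq_square)

lemma gc_bound3: assumes "1 \<le> j" shows "\<bar>gc t j m * freq j m * freq j m\<bar> \<le> 1"
  using mult_right_mono[OF gc_bound2[OF assms, of t m], of "freq j m"] freq_pos[OF assms, of m]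
  by (simp add: abs_mult)

lemma beta_coeff_bound1: assumes "1 \<le> j" shows "\<bar>beta_coeff t j m * freq j m\<bar> \<le> 1"
  using mult_right_mono[OF beta_coeff_bound[OF assms, of t m], of "freq j m"] freq_pos[OF assms, of m]
  by (simp add: abs_mult)

lemma rc_bound:
  obtains L where "0 < L" "\<And>t j m. 1 \<le> j \<Longrightarrow> 1 \<le> m \<Longrightarrow> \<bar>rc t j m\<bar> \<le> L * (1 / freq j m)"
proof -
  obtain L where L: "\<And>x. \<bar>dir_deriv 1 \<eta> x\<bar> \<le> L" "L > 0"
    using test_functions_bounded[OF test_functions_dir_deriv[OF eta_test]] by blast
  have "\<bar>rc t j m\<bar> \<le> L * (1 / freq j m)" if j: "1 \<le> j" "1 \<le> m" for t j m
  proof -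
    let ?K = "freq j m"
    have K: "0 < ?K" by (rule freq_pos[OF j(1)])
    have "\<bar>deta_j j t\<bar> = \<bar>dir_deriv 1 \<eta> ((t - tau j) / ell j)\<bar> * (1 / ell j)"
      using ell_pos[OF j(1)] by (simp add: deta_j_def abs_divide)
    also have "\<dots> \<le> L * ?K"
      using L ell_pos[OF j(1)] inverse_ell_le_freq[OF j(1), of m] by (intro mult_mono) auto
    finally have d: "\<bar>deta_j j t\<bar> \<le> L * ?K" .
    have "\<bar>\<epsilon> / 2\<bar> * \<bar>deta_j j t\<bar> * \<bar>sin (theta j m t) - cos (theta j m t)\<bar> \<le> 1/2 * (L * ?K) * 2"
      using eps d L(2) K sin_cos_le_2 by (intro mult_mono) auto
    then have "\<bar>\<epsilon> / 2\<bar> * \<bar>deta_j j t\<bar> * \<bar>sin (theta j m t) - cos (theta j m t)\<bar> / ?K\<^sup>2 \<le> (L * ?K) / ?K\<^sup>2"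
      by (intro divide_right_mono) auto
    then show ?thesis using K by (simp add: rc_def abs_mult abs_divide power2_eq_square)
  qed
  then show thesis by (rule that[OF L(2)])
qed

lemma zc_bound: "\<bar>zc t j m\<bar> \<le> 2"
proof -
  have "\<bar>eta_j \<eta> j t\<bar> * \<bar>sin (theta j m t) + cos (theta j m t)\<bar> \<le> 1 * 2"
    using eta_j_bounds[of j t] sin_cos_le_2 by (intro mult_mono) auto
  then show ?thesis by (simp add: zc_def abs_mult)
qed

text \<open>Sums over a block of terms of size one are bounded by the number \<open>j\<close> of
  modes; the other factor of each product is bounded by the sum of inverse frequencies, which
  compensates \<open>j\<close>.\<close>

lemma wave_bounds:
  "\<bar>g0 t y\<bar> \<le> 1" "\<bar>g1 t y\<bar> \<le> 1" "\<bar>beta \<eta> t y * g2 t y'\<bar> \<le> 1" "\<bar>b1 t y * g1 t y'\<bar> \<le> 1" "\<bar>b1 t y * g0 t y'\<bar> \<le> 1"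
proof -
  obtain J where J: "1 \<le> J" "g0 t = mode_sum J (gc t J) sin" "g1 t = mode_sum J (\<lambda>m. gc t J m * freq J m) cos"
    "g2 t = mode_sum J (\<lambda>m. - (gc t J m * freq J m * freq J m)) sin"
    "gt t = mode_sum J (\<lambda>m. rc t J m - \<epsilon> / 2 * zc t J m) sin"
    "r0 t = mode_sum J (rc t J) sin" "z0 t = mode_sum J (zc t J) sin"
    "b1 t = mode_sum J (\<lambda>m. - (beta_coeff t J m * freq J m)) sin"
    "beta \<eta> t = mode_sum J (beta_coeff t J) cos"
    by (rule modes[of t])
  let ?s = "\<Sum>m=1..J. 1 / freq J m"
  have s: "?s \<le> 1/256" "real J * ?s \<le> 1/256" by (rule sum_inverse_freq'[OF J(1)], rule sum_inverse_freq[OF J(1)])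
  have G0: "\<bar>g0 t y\<bar> \<le> ?s" and G1: "\<bar>g1 t y\<bar> \<le> ?s" and B: "\<bar>beta \<eta> t y\<bar> \<le> ?s" for y
    unfolding J by (rule mode_sum_abs_le; simp add: gc_bound1[OF J(1)] gc_bound2[OF J(1)] beta_coeff_bound[OF J(1)])+
  have one: "(\<Sum>m=1..J. 1::real) = real J" by simp
  have G2: "\<bar>g2 t y\<bar> \<le> real J" and B1: "\<bar>b1 t y\<bar> \<le> real J" for y
    unfolding J one[symmetric]
    by (rule mode_sum_abs_le; simp add: gc_bound3[OF J(1)] beta_coeff_bound1[OF J(1)])+
  show "\<bar>g0 t y\<bar> \<le> 1" "\<bar>g1 t y\<bar> \<le> 1" using G0[of y] G1[of y] s by linarith+
  have prod: "\<bar>a * b\<bar> \<le> 1" if "\<bar>a\<bar> \<le> real J" "\<bar>b\<bar> \<le> ?s" for a b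
  proof -
    have "\<bar>a\<bar> * \<bar>b\<bar> \<le> real J * ?s" using that by (intro mult_mono) auto
    then show ?thesis using s by (simp add: abs_mult)
  qed
  show "\<bar>beta \<eta> t y * g2 t y'\<bar> \<le> 1" "\<bar>b1 t y * g1 t y'\<bar> \<le> 1" "\<bar>b1 t y * g0 t y'\<bar> \<le> 1"
    using prod[OF G2[of y'] B[of y]] prod[OF B1[of y] G1[of y']] prod[OF B1[of y] G0[of y']] by (simp_all add: mult.commute)
qed

lemma r0_bound: obtains L where "0 < L" "\<And>t y. \<bar>r0 t y\<bar> \<le> L"
proof -
  obtain L where L: "0 < L" "\<And>t j m. 1 \<le> j \<Longrightarrow> 1 \<le> m \<Longrightarrow> \<bar>rc t j m\<bar> \<le> L * (1 / freq j m)"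
    using rc_bound by blast
  have "\<bar>r0 t y\<bar> \<le> L" for t y
  proof -
    obtain J where J1: "1 \<le> J" and J2: "\<forall>c f. block_supported c \<longrightarrow> mode_series (c t) f = mode_sum J (c t J) f"
      by (rule single_block[of t])
    note J = J1 J2[rule_format]
    have "\<bar>r0 t y\<bar> \<le> (\<Sum>m=1..J. L * (1 / freq J m))"
      unfolding r0_def J(2)[OF supported(2)] by (rule mode_sum_abs_le) (auto simp: L(2)[OF J(1), simplified])
    also have "\<dots> = L * (\<Sum>m=1..J. 1 / freq J m)" by (rule sum_distrib_left[symmetric])
    also have "\<dots> \<le> L * 1" using sum_inverse_freq'[OF J(1)] L(1) by (intro mult_left_mono) auto
    finally show ?thesis by simp
  qed
  then show thesis by (rule that[OF L(1)])
qed

text \<open>The time that remains until \<open>5/16\<close> after block \<open>j\<close> is \<open>1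
  / (16 (j + 1))\<close>, and the inverse frequencies of that block sum up to less.\<close>

lemma g0_decay: "\<bar>g0 t y\<bar> \<le> \<bar>t - 5/16\<bar>"
proof (cases "\<exists>J\<ge>1. tau J < t \<and> t < tau (Suc J)")
  case True
  then obtain J where J: "1 \<le> J" "tau J < t" "t < tau (Suc J)" by blast
  have c0: "gc t j m = 0" if "1 \<le> j" "j \<noteq> J" for j m
  proof -
    have "t \<le> tau j \<or> tau (Suc j) \<le> t"
      using tau_mono[of "Suc j" J] tau_mono[of "Suc J" j] J that by (cases "j < J") auto
    then show ?thesis using that supported(1) unfolding block_supported_def by blast
  qed
  have "g0 t y = mode_sum J (gc t J) sin y"
    unfolding g0_def by (rule mode_series_block[OF J(1) c0])
  also have "\<bar>\<dots>\<bar> \<le> (\<Sum>m=1..J. 1 / freq J m)" by (rule mode_sum_abs_le) (auto simp: gc_bound1 J(1))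
  also have "\<dots> \<le> (\<Sum>m=1..J. 1 / (256 * real J * real (Suc J)))"
    using J(1) by (intro sum_mono divide_left_mono freq_ge mult_pos_pos freq_pos) auto
  also have "\<dots> = 1 / (256 * real (Suc J))" using J(1) by simp
  also have "\<dots> \<le> 1 / (16 * real (Suc J))" by (rule frac_le) auto
  also have "\<dots> = 5/16 - tau (Suc J)" by (simp add: tau_def)
  also have "\<dots> \<le> \<bar>t - 5/16\<bar>" using J(3) by simp
  finally show ?thesis .
next
  case False
  then have "t \<le> tau j \<or> tau (Suc j) \<le> t" if "1 \<le> j" for j using that by (auto simp: not_less)
  then have c0: "gc t j m = 0" if "1 \<le> j" for j m
    using that supported(1) unfolding block_supported_def by blast
  then have "g0 t y = mode_sum 1 (gc t 1) sin y"
    unfolding g0_def by (intro mode_series_block) (auto simp: c0)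
  also have "\<dots> = 0" using c0 by (intro mode_sum_zero) auto
  finally show ?thesis by simp
qed

lemma wave_tendsto:
  assumes "t \<noteq> 5/16"
  shows "((\<lambda>s. g1 s y) \<longlongrightarrow> g1 t y) (at t)" "((\<lambda>s. g2 s y) \<longlongrightarrow> g2 t y) (at t)"
    "((\<lambda>s. gt s y) \<longlongrightarrow> gt t y) (at t)" "((\<lambda>s. r0 s y) \<longlongrightarrow> r0 t y) (at t)"
    "((\<lambda>s. b1 s y) \<longlongrightarrow> b1 t y) (at t)" "((\<lambda>s. beta \<eta> s y) \<longlongrightarrow> beta \<eta> t y) (at t)"
  unfolding g1_def g2_def gt_def r0_def b1_def beta_eq
  by (rule mode_series_tendsto[OF _ assms]; (intro supported beta_block_supported)?;
      auto intro!: continuous_intros coeff_isCont)+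

lemma g0_tendsto: "((\<lambda>s. g0 s y) \<longlongrightarrow> g0 t y) (at t)"
proof (cases "t = 5/16")
  case True
  have "((\<lambda>s. g0 s y) \<longlongrightarrow> 0) (at t)"
  proof (rule Lim_null_comparison)
    show "\<forall>\<^sub>F s in at t. norm (g0 s y) \<le> \<bar>s - t\<bar>"
      unfolding True real_norm_def by (intro always_eventually allI g0_decay)
    have "((\<lambda>s. \<bar>s - t\<bar>) \<longlongrightarrow> \<bar>t - t\<bar>) (at t)" by (intro tendsto_intros)
    then show "((\<lambda>s. \<bar>s - t\<bar>) \<longlongrightarrow> 0) (at t)" by simp
  qed
  moreover have "g0 t y = 0" using g0_decay[of t y] unfolding True by simp
  ultimately show ?thesis by simp
next
  case False
  then show ?thesis unfolding g0_def by (intro mode_series_tendsto supported coeff_isCont)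
qed

end

section \<open>The solution and its source\<close>

lemma dir_deriv_coord:
  fixes k :: "'n::finite" and h :: "real \<Rightarrow> real"
  assumes "smooth h"
  shows "dir_deriv v (\<lambda>x::real^'n. h (x $ k)) = (\<lambda>x. v $ k * dir_deriv 1 h (x $ k))"
  using dir_deriv_compose_inner[OF assms, of v "axis k 1" 0] by (simp add: inner_axis)

lemma smooth_coord:
  fixes k :: "'n::finite" and h :: "real \<Rightarrow> real"
  assumes "smooth h" shows "smooth (\<lambda>x::real^'n. h (x $ k))"
  using smooth_compose_inner[OF assms, of "axis k 1 :: real^'n" 0] by (simp add: inner_axis)

text \<open>A unit vector has a nonzero \<open>k\<close>-th coordinate only if it is the
  \<open>k\<close>-th one.\<close>

lemma sum_Basis_coord:
  fixes k :: "'n::finite"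
  shows "(\<Sum>b\<in>(Basis::(real^'n) set). b $ k * f b) = f (axis k 1)"
proof -
  have e: "axis k 1 \<in> (Basis :: (real^'n) set)" by (simp add: axis_in_Basis_iff)
  have "(\<Sum>b\<in>(Basis::(real^'n) set). b $ k * f b) = (\<Sum>b\<in>(Basis::(real^'n) set). if b = axis k 1 then f b else 0)"
  proof (rule sum.cong[OF refl])
    fix b :: "real^'n" assume "b \<in> Basis"
    then have "b \<bullet> axis k 1 = (if b = axis k 1 then 1 else 0)" using e by (simp add: inner_Basis)
    then show "b $ k * f b = (if b = axis k 1 then f b else 0)" by (simp add: inner_axis)
  qed
  then show ?thesis using e by simp
qed

text \<open>Dominated convergence: the square of the uniform bound, times the indicator of the bounded
  set, is an integrable majorant.\<close>

lemma L2_tendsto_bounded: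
  fixes f :: "real \<Rightarrow> 'a::euclidean_space \<Rightarrow> 'b::euclidean_space"
  assumes I: "open I" "t \<in> I"
    and m: "\<And>s. s \<in> I \<Longrightarrow> f s \<in> borel_measurable borel"
    and K: "bounded K" "K \<in> sets borel" "\<And>s x. s \<in> I \<Longrightarrow> x \<notin> K \<Longrightarrow> f s x = 0"
    and M: "\<And>s x. s \<in> I \<Longrightarrow> norm (f s x) \<le> M"
    and lim: "\<And>x. ((\<lambda>s. f s x) \<longlongrightarrow> f t x) (at t)"
  shows "((\<lambda>s. L2_norm (f s - f t)) \<longlongrightarrow> 0) (at t)"
proof -
  have fin: "emeasure lborel K < top" using emeasure_bounded_finite[OF K(1)] by (simp add: infinity_ennreal_def)
  have "((\<lambda>s. L2_norm (f s - f t)) \<longlongrightarrow> 0) (at t within I)"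
    unfolding tendsto_at_iff_sequentially
  proof (intro allI impI)
    fix X :: "nat \<Rightarrow> real" assume X: "\<forall>i. X i \<in> I - {t}" and Xt: "X \<longlonglongrightarrow> t"
    have "(\<lambda>i. LINT x|lborel. (norm (f (X i) x - f t x))\<^sup>2) \<longlonglongrightarrow> (LINT x|(lborel :: 'a measure). 0)"
    proof (rule integral_dominated_convergence)
      show "integrable lborel (\<lambda>x. indicat_real K x * (2 * M)\<^sup>2)"
        using fin K(2) by (intro integrable_mult_left integrable_real_indicator) auto
      show "(\<lambda>x. (norm (f (X i) x - f t x))\<^sup>2) \<in> borel_measurable lborel" for i
        using m[of "X i"] m[OF I(2)] X by simp
      show "AE x in lborel. (\<lambda>i. (norm (f (X i) x - f t x))\<^sup>2) \<longlonglongrightarrow> 0"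
      proof (rule AE_I2)
        fix x
        have "(\<lambda>i. f (X i) x) \<longlonglongrightarrow> f t x"
          using lim[of x] X Xt unfolding tendsto_at_iff_sequentially by (auto simp: o_def)
        then have "(\<lambda>i. (norm (f (X i) x - f t x))\<^sup>2) \<longlonglongrightarrow> (norm (f t x - f t x))\<^sup>2"
          by (intro tendsto_intros)
        then show "(\<lambda>i. (norm (f (X i) x - f t x))\<^sup>2) \<longlonglongrightarrow> 0" by simp
      qed
      show "AE x in lborel. norm ((norm (f (X i) x - f t x))\<^sup>2) \<le> indicat_real K x * (2 * M)\<^sup>2" for i
      proof (rule AE_I2)
        fix x
        show "norm ((norm (f (X i) x - f t x))\<^sup>2) \<le> indicat_real K x * (2 * M)\<^sup>2"
        proof (cases "x \<in> K")
          case True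
          have "norm (f (X i) x - f t x) \<le> norm (f (X i) x) + norm (f t x)" by (rule norm_triangle_ineq4)
          also have "\<dots> \<le> 2 * M" using M[of "X i" x] M[OF I(2), of x] X by auto
          finally have "(norm (f (X i) x - f t x))\<^sup>2 \<le> (2 * M)\<^sup>2" by (intro power_mono) auto
          then show ?thesis using True by simp
        qed (use K(3) X I(2) in auto)
      qed
    qed simp
    then have "(\<lambda>i. sqrt (LINT x|lborel. (norm (f (X i) x - f t x))\<^sup>2)) \<longlonglongrightarrow> sqrt 0"
      by (intro tendsto_real_sqrt) simp
    then show "((\<lambda>s. L2_norm (f s - f t)) \<circ> X) \<longlonglongrightarrow> 0" by (simp add: L2_norm_def o_def)
  qed
  then show ?thesis using at_within_open[OF I(2,1)] by simp
qed

context corrector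
begin

abbreviation e :: "real^'n" where "e \<equiv> axis k 1"
abbreviation \<psi>1 :: "real^'n \<Rightarrow> real" where "\<psi>1 \<equiv> dir_deriv e \<psi>"

definition U :: "real \<Rightarrow> real^'n \<Rightarrow> real" where
  "U t x = t * (\<psi> x + \<psi>1 x * g0 t (x $ k))"

definition Ut :: "real \<Rightarrow> real^'n \<Rightarrow> real" where
  "Ut t x = \<psi> x + \<psi>1 x * g0 t (x $ k) + t * (\<psi>1 x * gt t (x $ k))"

definition dU :: "real^'n \<Rightarrow> real \<Rightarrow> real^'n \<Rightarrow> real" where
  "dU b t x = t * (dir_deriv b \<psi> x + dir_deriv b \<psi>1 x * g0 t (x $ k) + b $ k * (\<psi>1 x * g1 t (x $ k)))"

definition lap :: "(real^'n \<Rightarrow> real) \<Rightarrow> real^'n \<Rightarrow> real" where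
  "lap f x = (\<Sum>b\<in>Basis. dir_deriv b (dir_deriv b f) x)"

text \<open>The Laplacian of \<open>U\<close>, by \<open>lap_U\<close>.\<close>

definition lapU :: "real \<Rightarrow> real^'n \<Rightarrow> real" where
  "lapU t x = t * (lap \<psi> x + lap \<psi>1 x * g0 t (x $ k) + 2 * (dir_deriv e \<psi>1 x * g1 t (x $ k)) + \<psi>1 x * g2 t (x $ k))"

text \<open>The source is defined by the classical form of the equation.\<close>

definition F :: "real \<Rightarrow> real^'n \<Rightarrow> real" where
  "F t x = Ut t x - (scalar_coeff \<eta> \<epsilon> t (x $ k) * lapU t x + \<epsilon> * (b1 t (x $ k) * dU e t x))"

lemma psi_smooth: "smooth \<psi>" "smooth \<psi>1" "smooth (dir_deriv b \<psi>)" "smooth (dir_deriv b \<psi>1)"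
    "smooth (dir_deriv b (dir_deriv b \<psi>))" "smooth (dir_deriv b (dir_deriv b \<psi>1))"
  using test_functionsD(1)[OF psi] by (auto intro!: smooth_dir_deriv)

lemma psi_test: "\<psi>1 \<in> test_functions UNIV" "dir_deriv b \<psi> \<in> test_functions UNIV" "dir_deriv b \<psi>1 \<in> test_functions UNIV"
    "dir_deriv b (dir_deriv b \<psi>) \<in> test_functions UNIV" "dir_deriv b (dir_deriv b \<psi>1) \<in> test_functions UNIV"
  using psi by (auto intro!: test_functions_dir_deriv)

lemma wave_space_smooth:
  "smooth (\<lambda>x::real^'n. g0 t (x $ k))" "smooth (\<lambda>x::real^'n. g1 t (x $ k))" "smooth (\<lambda>x::real^'n. g2 t (x $ k))"
  "smooth (\<lambda>x::real^'n. gt t (x $ k))" "smooth (\<lambda>x::real^'n. b1 t (x $ k))" "smooth (\<lambda>x::real^'n. beta \<eta> t (x $ k))"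
  "smooth (\<lambda>x::real^'n. scalar_coeff \<eta> \<epsilon> t (x $ k))"
proof -
  show "smooth (\<lambda>x::real^'n. g0 t (x $ k))" "smooth (\<lambda>x::real^'n. g1 t (x $ k))" "smooth (\<lambda>x::real^'n. g2 t (x $ k))"
    "smooth (\<lambda>x::real^'n. gt t (x $ k))" "smooth (\<lambda>x::real^'n. b1 t (x $ k))" "smooth (\<lambda>x::real^'n. beta \<eta> t (x $ k))"
    by (rule smooth_coord, rule wave_smooth)+
  then show "smooth (\<lambda>x::real^'n. scalar_coeff \<eta> \<epsilon> t (x $ k))"
    unfolding scalar_coeff_def by (intro smooth_add smooth_cmult smooth_const)
qed

lemma U_test: "U t \<in> test_functions UNIV"
proof -
  have "(\<lambda>x. \<psi> x + g0 t (x $ k) * \<psi>1 x) \<in> test_functions UNIV"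
    by (intro test_functions_add test_functions_mult_smooth psi psi_test wave_space_smooth)
  from test_functions_cmult[OF this, of t] show ?thesis unfolding U_def[abs_def] by (simp add: mult.commute)
qed

lemma Ut_test: "Ut t \<in> test_functions UNIV"
proof -
  have "(\<lambda>x. (\<psi> x + g0 t (x $ k) * \<psi>1 x) + t * (gt t (x $ k) * \<psi>1 x)) \<in> test_functions UNIV"
    by (intro test_functions_add test_functions_mult_smooth test_functions_cmult psi psi_test wave_space_smooth)
  then show ?thesis unfolding Ut_def[abs_def] by (simp add: mult.commute)
qed

lemma dir_deriv_U: "dir_deriv b (U t) = dU b t"
proof -
  have "dir_deriv b (\<lambda>x. \<psi>1 x * g0 t (x $ k)) = (\<lambda>x. \<psi>1 x * (b $ k * g1 t (x $ k)) + dir_deriv b \<psi>1 x * g0 t (x $ k))"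
    by (subst dir_deriv_mult[OF psi_smooth(2) wave_space_smooth(1)]) (simp add: dir_deriv_coord[OF wave_smooth(1)] wave_dir_deriv)
  then have "dir_deriv b (\<lambda>x. \<psi> x + \<psi>1 x * g0 t (x $ k))
      = (\<lambda>x. dir_deriv b \<psi> x + (\<psi>1 x * (b $ k * g1 t (x $ k)) + dir_deriv b \<psi>1 x * g0 t (x $ k)))"
    by (subst dir_deriv_add[OF psi_smooth(1) smooth_mult[OF psi_smooth(2) wave_space_smooth(1)]]) simp
  then show ?thesis
    unfolding U_def[abs_def] dU_def[abs_def]
    by (subst dir_deriv_cmult[OF smooth_add[OF psi_smooth(1) smooth_mult[OF psi_smooth(2) wave_space_smooth(1)]]])
      (simp add: algebra_simps)
qed

lemma dir_deriv_dU:
  "dir_deriv b (dU b t) = (\<lambda>x. t * (dir_deriv b (dir_deriv b \<psi>) x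
     + (dir_deriv b \<psi>1 x * (b $ k * g1 t (x $ k)) + dir_deriv b (dir_deriv b \<psi>1) x * g0 t (x $ k))
     + b $ k * (\<psi>1 x * (b $ k * g2 t (x $ k)) + dir_deriv b \<psi>1 x * g1 t (x $ k))))"
proof -
  have 1: "dir_deriv b (\<lambda>x. dir_deriv b \<psi>1 x * g0 t (x $ k))
      = (\<lambda>x. dir_deriv b \<psi>1 x * (b $ k * g1 t (x $ k)) + dir_deriv b (dir_deriv b \<psi>1) x * g0 t (x $ k))"
    by (subst dir_deriv_mult[OF psi_smooth(4) wave_space_smooth(1)]) (simp add: dir_deriv_coord[OF wave_smooth(1)] wave_dir_deriv)
  have 2: "dir_deriv b (\<lambda>x. \<psi>1 x * g1 t (x $ k))
      = (\<lambda>x. \<psi>1 x * (b $ k * g2 t (x $ k)) + dir_deriv b \<psi>1 x * g1 t (x $ k))"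
    by (subst dir_deriv_mult[OF psi_smooth(2) wave_space_smooth(2)]) (simp add: dir_deriv_coord[OF wave_smooth(2)] wave_dir_deriv)
  have s1: "smooth (\<lambda>x. dir_deriv b \<psi>1 x * g0 t (x $ k))" and s2: "smooth (\<lambda>x. \<psi>1 x * g1 t (x $ k))"
    by (intro smooth_mult psi_smooth wave_space_smooth)+
  note s3 = smooth_add[OF psi_smooth(3)[of b] s1] and s4 = smooth_cmult[OF s2, of "b $ k"]
  show ?thesis
    unfolding dU_def[abs_def] dir_deriv_cmult[OF smooth_add[OF s3 s4]] dir_deriv_add[OF s3 s4]
      dir_deriv_add[OF psi_smooth(3) s1] dir_deriv_cmult[OF s2] 1 2 ..
qed

lemma dU_test: "dU b t \<in> test_functions UNIV"
  using test_functions_dir_deriv[OF U_test, of b t] by (simp add: dir_deriv_U)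

lemma lap_U: "(\<Sum>b\<in>Basis. dir_deriv b (dU b t) x) = lapU t x"
proof -
  have "(\<Sum>b\<in>Basis. dir_deriv b (dU b t) x)
      = (\<Sum>b\<in>Basis. t * dir_deriv b (dir_deriv b \<psi>) x + (t * g0 t (x $ k)) * dir_deriv b (dir_deriv b \<psi>1) x
          + b $ k * (2 * t * dir_deriv b \<psi>1 x * g1 t (x $ k) + b $ k * (t * \<psi>1 x * g2 t (x $ k))))"
    unfolding dir_deriv_dU by (intro sum.cong refl) (simp add: algebra_simps)
  also have "\<dots> = t * lap \<psi> x + (t * g0 t (x $ k)) * lap \<psi>1 x
      + (2 * t * dir_deriv e \<psi>1 x * g1 t (x $ k) + t * \<psi>1 x * g2 t (x $ k))"
    unfolding sum.distrib sum_distrib_left[symmetric] sum_Basis_coord lap_def by simp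
  finally show ?thesis by (simp add: lapU_def algebra_simps)
qed

lemma flux_test: "(\<lambda>x. scalar_coeff \<eta> \<epsilon> t (x $ k) * dU b t x) \<in> test_functions UNIV"
  by (intro test_functions_mult_smooth dU_test wave_space_smooth)

lemma flux_divergence:
  "(\<Sum>b\<in>Basis. dir_deriv b (\<lambda>x. scalar_coeff \<eta> \<epsilon> t (x $ k) * dU b t x) x)
     = scalar_coeff \<eta> \<epsilon> t (x $ k) * lapU t x + \<epsilon> * (b1 t (x $ k) * dU e t x)"
proof -
  have a: "dir_deriv b (\<lambda>x. scalar_coeff \<eta> \<epsilon> t (x $ k)) = (\<lambda>x. b $ k * (\<epsilon> * b1 t (x $ k)))" for b
  proof -
    have "dir_deriv b (\<lambda>x::real^'n. 1 + \<epsilon> * beta \<eta> t (x $ k)) = (\<lambda>x. 0 + \<epsilon> * (b $ k * b1 t (x $ k)))"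
      by (subst dir_deriv_add[OF smooth_const smooth_cmult[OF wave_space_smooth(6)]],
          subst dir_deriv_cmult[OF wave_space_smooth(6)])
        (simp add: dir_deriv_coord[OF wave_smooth(8)] wave_dir_deriv)
    then show ?thesis by (simp add: scalar_coeff_def mult.left_commute)
  qed
  have "(\<Sum>b\<in>Basis. dir_deriv b (\<lambda>x. scalar_coeff \<eta> \<epsilon> t (x $ k) * dU b t x) x)
      = (\<Sum>b\<in>Basis. scalar_coeff \<eta> \<epsilon> t (x $ k) * dir_deriv b (dU b t) x + b $ k * (\<epsilon> * b1 t (x $ k) * dU b t x))"
    unfolding dir_deriv_mult[OF wave_space_smooth(7) test_functionsD(1)[OF dU_test]] a
    by (intro sum.cong refl) (simp add: mult.assoc)
  also have "\<dots> = scalar_coeff \<eta> \<epsilon> t (x $ k) * lapU t x + \<epsilon> * b1 t (x $ k) * dU e t x"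
    unfolding sum.distrib sum_distrib_left[symmetric] lap_U sum_Basis_coord ..
  finally show ?thesis by (simp add: mult.assoc)
qed

lemma F_test: "F t \<in> test_functions UNIV"
proof -
  have "(\<lambda>x. \<Sum>b\<in>Basis. dir_deriv b (\<lambda>x. scalar_coeff \<eta> \<epsilon> t (x $ k) * dU b t x) x) \<in> test_functions UNIV"
  proof -
    have "finite B \<Longrightarrow> (\<lambda>x. \<Sum>b\<in>B. dir_deriv b (\<lambda>x. scalar_coeff \<eta> \<epsilon> t (x $ k) * dU b t x) x) \<in> test_functions UNIV" for B
    proof (induction B rule: finite_induct)
      case empty
      show ?case using test_functions_cmult[OF psi, of 0] by simp
    next
      case (insert b B)
      then show ?case by (simp add: test_functions_add test_functions_dir_deriv flux_test)
    qed
    then show ?thesis by simp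
  qed
  then have "(\<lambda>x. Ut t x + (-1) * (scalar_coeff \<eta> \<epsilon> t (x $ k) * lapU t x + \<epsilon> * (b1 t (x $ k) * dU e t x))) \<in> test_functions UNIV"
    unfolding flux_divergence by (rule test_functions_add[OF Ut_test test_functions_cmult])
  also have "(\<lambda>x. Ut t x + (-1) * (scalar_coeff \<eta> \<epsilon> t (x $ k) * lapU t x + \<epsilon> * (b1 t (x $ k) * dU e t x))) = F t"
    by (rule ext) (simp add: F_def)
  finally show ?thesis .
qed

lemma outside_support:
  assumes "x \<notin> supp \<psi>"
  shows "\<psi> x = 0" "dir_deriv b \<psi> x = 0" "dir_deriv c (dir_deriv b \<psi>) x = 0"
    "dir_deriv d (dir_deriv c (dir_deriv b \<psi>)) x = 0"
proof -
  have sub: "supp (dir_deriv v f) \<subseteq> supp f" for v and f :: "real^'n \<Rightarrow> real"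
  proof -
    have "{x. dir_deriv v f x \<noteq> 0} \<subseteq> supp f" using dir_deriv_outside_supp[of _ f v] by blast
    then show ?thesis unfolding supp_def[of "dir_deriv v f"] by (rule closure_minimal) (simp add: supp_def)
  qed
  show "\<psi> x = 0" "dir_deriv b \<psi> x = 0" using assms by (auto simp: outside_supp dir_deriv_outside_supp)
  show "dir_deriv c (dir_deriv b \<psi>) x = 0" using assms sub by (intro dir_deriv_outside_supp) blast
  show "dir_deriv d (dir_deriv c (dir_deriv b \<psi>)) x = 0" using assms sub by (intro dir_deriv_outside_supp) blast
qed

lemma zero_outside:
  assumes "x \<notin> supp \<psi>" shows "U t x = 0" "Ut t x = 0" "dU b t x = 0" "lapU t x = 0" "F t x = 0"
  using outside_support[OF assms] by (simp_all add: U_def Ut_def dU_def lapU_def F_def lap_def)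

text \<open>The unbounded parts of \<open>U\<^sub>t\<close> and of the divergence cancel.\<close>

lemma F_eq:
  "F t x = \<psi> x + \<psi>1 x * g0 t (x $ k) + t * (\<psi>1 x * r0 t (x $ k))
     - t * (lap \<psi> x + lap \<psi>1 x * g0 t (x $ k) + 2 * (dir_deriv e \<psi>1 x * g1 t (x $ k)))
     - \<epsilon> * t * (beta \<eta> t (x $ k) * (lap \<psi> x + lap \<psi>1 x * g0 t (x $ k) + 2 * (dir_deriv e \<psi>1 x * g1 t (x $ k)))
        + \<psi>1 x * (beta \<eta> t (x $ k) * g2 t (x $ k)))
     - \<epsilon> * t * (dir_deriv e \<psi>1 x * (b1 t (x $ k) * g0 t (x $ k)) + \<psi>1 x * (b1 t (x $ k) * g1 t (x $ k)))"
proof -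
  have "e $ k = 1" by simp
  then show ?thesis
    unfolding F_def Ut_def lapU_def dU_def scalar_coeff_def resonance by (simp add: algebra_simps)
qed

lemma psi_bounds:
  obtains M where "0 < M" "\<And>x. \<bar>\<psi> x\<bar> \<le> M" "\<And>x. \<bar>\<psi>1 x\<bar> \<le> M" "\<And>x. \<bar>lap \<psi> x\<bar> \<le> M" "\<And>x. \<bar>lap \<psi>1 x\<bar> \<le> M"
    "\<And>b x. b \<in> Basis \<Longrightarrow> \<bar>dir_deriv b \<psi> x\<bar> \<le> M" "\<And>b x. b \<in> Basis \<Longrightarrow> \<bar>dir_deriv b \<psi>1 x\<bar> \<le> M"
proof -
  have bd: "\<exists>M>0. \<forall>x. \<bar>f x\<bar> \<le> M" if "f \<in> test_functions UNIV" for f :: "real^'n \<Rightarrow> real"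
    using test_functions_bounded[OF that] by metis
  have fb: "\<exists>M>0. \<forall>b\<in>Basis. \<forall>x. \<bar>f b x\<bar> \<le> M" if "\<And>b. f b \<in> test_functions UNIV" for f :: "real^'n \<Rightarrow> real^'n \<Rightarrow> real"
  proof -
    have "\<forall>b. \<exists>M>0. \<forall>x. \<bar>f b x\<bar> \<le> M" using bd[OF that] by blast
    then obtain M where M: "\<And>b. M b > 0" "\<And>b x. \<bar>f b x\<bar> \<le> M b" by metis
    have "\<bar>f b x\<bar> \<le> sum M Basis" if "b \<in> Basis" for b x
      using M(2)[of b x] member_le_sum[of b Basis M] that M(1) by (auto intro: less_imp_le order_trans)
    moreover have "sum M Basis > 0" using M(1) by (intro sum_pos) auto
    ultimately show ?thesis by blast
  qed
  obtain M1 where M1: "\<And>x. \<bar>\<psi> x\<bar> \<le> M1" using bd[OF psi] by blast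
  obtain M2 where M2: "\<And>x. \<bar>\<psi>1 x\<bar> \<le> M2" using bd[OF psi_test(1)] by blast
  obtain M3 where M3: "M3 > 0" "\<And>b x. b \<in> Basis \<Longrightarrow> \<bar>dir_deriv b \<psi> x\<bar> \<le> M3" using fb[of "\<lambda>b. dir_deriv b \<psi>", OF psi_test(2)] by blast
  obtain M4 where M4: "M4 > 0" "\<And>b x. b \<in> Basis \<Longrightarrow> \<bar>dir_deriv b \<psi>1 x\<bar> \<le> M4" using fb[of "\<lambda>b. dir_deriv b \<psi>1", OF psi_test(3)] by blast
  obtain M5 where M5: "M5 > 0" "\<And>b x. b \<in> Basis \<Longrightarrow> \<bar>dir_deriv b (dir_deriv b \<psi>) x\<bar> \<le> M5" using fb[of "\<lambda>b. dir_deriv b (dir_deriv b \<psi>)", OF psi_test(4)] by blast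
  obtain M6 where M6: "M6 > 0" "\<And>b x. b \<in> Basis \<Longrightarrow> \<bar>dir_deriv b (dir_deriv b \<psi>1) x\<bar> \<le> M6" using fb[of "\<lambda>b. dir_deriv b (dir_deriv b \<psi>1)", OF psi_test(5)] by blast
  have l: "\<bar>lap f x\<bar> \<le> real DIM(real^'n) * C" if "\<And>b x. b \<in> Basis \<Longrightarrow> \<bar>dir_deriv b (dir_deriv b f) x\<bar> \<le> C" for f x C
    unfolding lap_def using that by (intro order_trans[OF sum_abs] sum_bounded_above)
  define M where "M = \<bar>M1\<bar> + \<bar>M2\<bar> + M3 + M4 + real DIM(real^'n) * M5 + real DIM(real^'n) * M6"
  have p: "0 \<le> real DIM(real^'n) * M5" "0 \<le> real DIM(real^'n) * M6" using M5(1) M6(1) by simp_all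
  show thesis
  proof (rule that[of M])
    show "0 < M" using M3(1) M4(1) p by (simp add: M_def)
    show "\<bar>\<psi> x\<bar> \<le> M" for x using M1[of x] M3(1) M4(1) p by (simp add: M_def)
    show "\<bar>\<psi>1 x\<bar> \<le> M" for x using M2[of x] M3(1) M4(1) p by (simp add: M_def)
    show "\<bar>lap \<psi> x\<bar> \<le> M" for x using l[OF M5(2), of x] M3(1) M4(1) p by (simp add: M_def)
    show "\<bar>lap \<psi>1 x\<bar> \<le> M" for x using l[OF M6(2), of x] M3(1) M4(1) p by (simp add: M_def)
    show "\<bar>dir_deriv b \<psi> x\<bar> \<le> M" if "b \<in> Basis" for b x using M3(2)[OF that, of x] M3(1) M4(1) p by (simp add: M_def)
    show "\<bar>dir_deriv b \<psi>1 x\<bar> \<le> M" if "b \<in> Basis" for b x using M4(2)[OF that, of x] M3(1) M4(1) p by (simp add: M_def)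
  qed
qed

lemma abs_mult_le: "\<bar>a\<bar> \<le> A \<Longrightarrow> \<bar>b\<bar> \<le> B \<Longrightarrow> \<bar>a * b\<bar> \<le> A * (B::real)"
  unfolding abs_mult by (intro mult_mono) auto

text \<open>Every term of \<open>F_eq\<close> is a product of a bounded function of space with
  quantities from \<open>wave_bounds\<close> and \<open>r0_bound\<close>. The bound holds on a time
  interval around \<open>[0,1]\<close>, as two-sided limits at the end points are taken.\<close>

lemma uniform_bounds:
  obtains C where "0 < C" "\<And>t x. \<bar>t\<bar> \<le> 2 \<Longrightarrow> \<bar>U t x\<bar> \<le> C" "\<And>t x b. \<bar>t\<bar> \<le> 2 \<Longrightarrow> b \<in> Basis \<Longrightarrow> \<bar>dU b t x\<bar> \<le> C"
    "\<And>t x. \<bar>t\<bar> \<le> 2 \<Longrightarrow> \<bar>F t x\<bar> \<le> C"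
proof -
  obtain M where M0: "0 < M" and M: "\<And>x. \<bar>\<psi> x\<bar> \<le> M" "\<And>x. \<bar>\<psi>1 x\<bar> \<le> M" "\<And>x. \<bar>lap \<psi> x\<bar> \<le> M" "\<And>x. \<bar>lap \<psi>1 x\<bar> \<le> M"
    "\<And>b x. b \<in> Basis \<Longrightarrow> \<bar>dir_deriv b \<psi> x\<bar> \<le> M" "\<And>b x. b \<in> Basis \<Longrightarrow> \<bar>dir_deriv b \<psi>1 x\<bar> \<le> M"
    using psi_bounds by metis
  obtain L where L: "0 < L" "\<And>t y. \<bar>r0 t y\<bar> \<le> L" using r0_bound by metis
  have e: "e \<in> Basis" by (simp add: axis_in_Basis_iff)
  define C where "C = 100 * M + 2 * M * L"
  have bk: "\<bar>b $ k\<bar> \<le> 1" if "b \<in> Basis" for b :: "real^'n"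
    using component_le_norm_cart[of b k] that by simp
  have bnd: "\<bar>U t x\<bar> \<le> C" "b \<in> Basis \<Longrightarrow> \<bar>dU b t x\<bar> \<le> C" "\<bar>F t x\<bar> \<le> C" if t: "\<bar>t\<bar> \<le> 2" for t x b
  proof -
    let ?y = "x $ k"
    note w = wave_bounds[of t ?y] wave_bounds(3-5)[of t ?y ?y]
    have MM: "\<bar>\<psi>1 x * g0 t ?y\<bar> \<le> M * 1" "\<bar>\<psi>1 x * g1 t ?y\<bar> \<le> M * 1" "\<bar>\<psi>1 x * r0 t ?y\<bar> \<le> M * L"
      "\<bar>lap \<psi>1 x * g0 t ?y\<bar> \<le> M * 1" "\<bar>dir_deriv e \<psi>1 x * g1 t ?y\<bar> \<le> M * 1"
      "\<bar>\<psi>1 x * (beta \<eta> t ?y * g2 t ?y)\<bar> \<le> M * 1" "\<bar>dir_deriv e \<psi>1 x * (b1 t ?y * g0 t ?y)\<bar> \<le> M * 1"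
      "\<bar>\<psi>1 x * (b1 t ?y * g1 t ?y)\<bar> \<le> M * 1"
      by (rule abs_mult_le; simp add: M w L e)+
    have u: "\<bar>\<psi> x + \<psi>1 x * g0 t ?y\<bar> \<le> 2 * M" using MM(1) M(1)[of x] by linarith
    have "\<bar>U t x\<bar> \<le> 2 * (2 * M)" unfolding U_def by (rule abs_mult_le[OF t u])
    also have "\<dots> \<le> C" using M0 L by (simp add: C_def)
    finally show "\<bar>U t x\<bar> \<le> C" .
    show "\<bar>dU b t x\<bar> \<le> C" if b: "b \<in> Basis"
    proof -
      have "\<bar>dir_deriv b \<psi>1 x * g0 t ?y\<bar> \<le> M * 1" by (rule abs_mult_le) (simp_all add: M b w)
      moreover have "\<bar>b $ k * (\<psi>1 x * g1 t ?y)\<bar> \<le> 1 * M" by (rule abs_mult_le) (use MM(2) bk[OF b] in simp_all)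
      ultimately have "\<bar>dir_deriv b \<psi> x + dir_deriv b \<psi>1 x * g0 t ?y + b $ k * (\<psi>1 x * g1 t ?y)\<bar> \<le> 3 * M"
        using M(5)[OF b, of x] by linarith
      then have "\<bar>dU b t x\<bar> \<le> 2 * (3 * M)" unfolding dU_def by (rule abs_mult_le[OF t])
      also have "\<dots> \<le> C" using M0 L by (simp add: C_def)
      finally show ?thesis .
    qed
    let ?A = "lap \<psi> x + lap \<psi>1 x * g0 t ?y + 2 * (dir_deriv e \<psi>1 x * g1 t ?y)"
    have A: "\<bar>?A\<bar> \<le> 4 * M" using MM(4,5) M(3)[of x] by linarith
    have tr: "\<bar>t * (\<psi>1 x * r0 t ?y)\<bar> \<le> 2 * (M * L)" by (rule abs_mult_le[OF t MM(3)])
    have tA: "\<bar>t * ?A\<bar> \<le> 2 * (4 * M)" by (rule abs_mult_le[OF t A])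
    have et: "\<bar>\<epsilon> * t\<bar> \<le> 1 * 2" using eps by (intro abs_mult_le t) auto
    have b1: "\<bar>beta \<eta> t ?y\<bar> \<le> 1" using beta_bound[of t ?y] by simp
    have bA: "\<bar>beta \<eta> t ?y * ?A\<bar> \<le> 1 * (4 * M)" by (rule abs_mult_le[OF b1 A])
    have "\<bar>beta \<eta> t ?y * ?A + \<psi>1 x * (beta \<eta> t ?y * g2 t ?y)\<bar> \<le> 5 * M" using bA MM(6) by linarith
    from abs_mult_le[OF et this]
    have e1: "\<bar>\<epsilon> * t * (beta \<eta> t ?y * ?A + \<psi>1 x * (beta \<eta> t ?y * g2 t ?y))\<bar> \<le> 10 * M" by simp
    have "\<bar>dir_deriv e \<psi>1 x * (b1 t ?y * g0 t ?y) + \<psi>1 x * (b1 t ?y * g1 t ?y)\<bar> \<le> 2 * M" using MM(7,8) by linarith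
    from abs_mult_le[OF et this]
    have e2: "\<bar>\<epsilon> * t * (dir_deriv e \<psi>1 x * (b1 t ?y * g0 t ?y) + \<psi>1 x * (b1 t ?y * g1 t ?y))\<bar> \<le> 4 * M" by simp
    have C': "C = 100 * M + 2 * (M * L)" by (simp add: C_def)
    show "\<bar>F t x\<bar> \<le> C"
      unfolding F_eq C' using u tr tA e1 e2 M0 by linarith
  qed
  have "0 < C" using M0 L by (simp add: C_def add_pos_pos)
  then show thesis using bnd by (rule that)
qed

lemma space_tendsto:
  assumes "t \<noteq> 5/16"
  shows "((\<lambda>s. F s x) \<longlongrightarrow> F t x) (at t)" "((\<lambda>s. Ut s x) \<longlongrightarrow> Ut t x) (at t)" "((\<lambda>s. dU b s x) \<longlongrightarrow> dU b t x) (at t)"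
  unfolding F_def Ut_def lapU_def dU_def scalar_coeff_def
  by (intro tendsto_intros g0_tendsto wave_tendsto[OF assms])+

lemma U_tendsto: "((\<lambda>s. U s x) \<longlongrightarrow> U t x) (at t)"
  unfolding U_def by (intro tendsto_intros g0_tendsto)

lemma supp_psi: "bounded (supp \<psi>)" "supp \<psi> \<in> sets borel"
  using test_functionsD(2)[OF psi] by (auto intro: compact_imp_bounded borel_closed simp: supp_def)

lemma test_measurable: "f \<in> test_functions S \<Longrightarrow> (f :: real^'n \<Rightarrow> real) \<in> borel_measurable borel"
  by (rule smooth_measurable[OF test_functionsD(1)])

text \<open>The time derivative is not bounded uniformly, since block \<open>j\<close> contributes
  up to \<open>j\<close> waves of amplitude one; away from \<open>5/16\<close> only finitely many
  blocks contribute.\<close>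

lemma Ut_locally_bounded:
  assumes "t \<noteq> 5/16"
  obtains N C where "open N" "t \<in> N" "\<And>s x. s \<in> N \<Longrightarrow> \<bar>Ut s x\<bar> \<le> C"
proof -
  obtain N J where N: "open N" "t \<in> N"
    and eq': "\<forall>c f s x. block_supported c \<longrightarrow> s \<in> N \<longrightarrow> mode_series (c s) f x = (\<Sum>j=1..J. mode_sum j (c s j) f x)"
    by (rule locally_finite_blocks[OF assms])
  obtain L where L: "0 < L" "\<And>t y. \<bar>r0 t y\<bar> \<le> L" using r0_bound by metis
  obtain M1 where M1: "\<And>x. \<bar>\<psi> x\<bar> \<le> M1" using test_functions_bounded[OF psi] by metis
  obtain M2 where M2: "\<And>x. \<bar>\<psi>1 x\<bar> \<le> M2" using test_functions_bounded[OF psi_test(1)] by metis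
  define D where "D = (\<Sum>j=1..J. \<Sum>m=1..j. 2 :: real)"
  have z: "\<bar>z0 s y\<bar> \<le> D" if "s \<in> N" for s y
  proof -
    have "z0 s y = (\<Sum>j=1..J. mode_sum j (zc s j) sin y)"
      unfolding z0_def using eq' supported(3) that by blast
    also have "\<bar>\<dots>\<bar> \<le> (\<Sum>j=1..J. \<bar>mode_sum j (zc s j) sin y\<bar>)" by (rule sum_abs)
    also have "\<dots> \<le> D" unfolding D_def by (intro sum_mono mode_sum_abs_le zc_bound) auto
    finally show ?thesis .
  qed
  have g: "\<bar>gt s y\<bar> \<le> L + D" if "s \<in> N" for s y
  proof -
    have "\<bar>\<epsilon> / 2 * z0 s y\<bar> \<le> 1 * D" using eps by (intro abs_mult_le z that) auto
    then show ?thesis using L(2)[of s y] unfolding gt_split by linarith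
  qed
  have "\<bar>Ut s x\<bar> \<le> (M1 + M2 * 1) + (\<bar>t\<bar> + 1) * (M2 * (L + D))" if s: "s \<in> N \<inter> {t - 1<..<t + 1}" for s x
  proof -
    have "\<bar>\<psi>1 x * g0 s (x $ k)\<bar> \<le> M2 * 1" by (intro abs_mult_le M2 wave_bounds)
    moreover have "\<bar>s\<bar> \<le> \<bar>t\<bar> + 1" using s by auto
    then have "\<bar>s * (\<psi>1 x * gt s (x $ k))\<bar> \<le> (\<bar>t\<bar> + 1) * (M2 * (L + D))"
      using s by (intro abs_mult_le M2 g) auto
    ultimately show ?thesis using M1[of x] unfolding Ut_def by linarith
  qed
  moreover have "open (N \<inter> {t - 1<..<t + 1})" using N by auto
  moreover have "t \<in> N \<inter> {t - 1<..<t + 1}" using N by auto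
  ultimately show thesis using that by blast
qed

lemma window: "open {-1<..<2::real}" "t \<in> {0..1} \<Longrightarrow> t \<in> {-1<..<2::real}" "t \<in> {-1<..<2::real} \<Longrightarrow> \<bar>t\<bar> \<le> 2"
  by auto

lemma U_L2_continuous: assumes "t \<in> {0..1}" shows "((\<lambda>s. L2_norm (U s - U t)) \<longlongrightarrow> 0) (at t)"
proof -
  obtain C where C: "\<And>t x. \<bar>t\<bar> \<le> 2 \<Longrightarrow> \<bar>U t x\<bar> \<le> C" using uniform_bounds by metis
  show ?thesis
    by (rule L2_tendsto_bounded[OF window(1) window(2)[OF assms] _ supp_psi, of _ C])
      (use window(3) in \<open>auto intro: test_measurable[OF U_test] zero_outside C U_tendsto\<close>)
qed

lemma F_L2_continuous:
  assumes "t \<in> {0..1}" "t \<noteq> 5/16" shows "((\<lambda>s. L2_norm (F s - F t)) \<longlongrightarrow> 0) (at t)"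
proof -
  obtain C where C: "\<And>t x. \<bar>t\<bar> \<le> 2 \<Longrightarrow> \<bar>F t x\<bar> \<le> C" using uniform_bounds by metis
  show ?thesis
    by (rule L2_tendsto_bounded[OF window(1) window(2)[OF assms(1)] _ supp_psi, of _ C])
      (use window(3) in \<open>auto intro: test_measurable[OF F_test] zero_outside C space_tendsto[OF assms(2)]\<close>)
qed

lemma Ut_L2_continuous:
  assumes "t \<noteq> 5/16" shows "((\<lambda>s. L2_norm (Ut s - Ut t)) \<longlongrightarrow> 0) (at t)"
proof -
  obtain N C where N: "open N" "t \<in> N" and C: "\<And>s x. s \<in> N \<Longrightarrow> \<bar>Ut s x\<bar> \<le> C"
    using Ut_locally_bounded[OF assms] by metis
  show ?thesis
    by (rule L2_tendsto_bounded[OF N _ supp_psi, of _ C])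
      (auto intro: test_measurable[OF Ut_test] zero_outside C space_tendsto[OF assms])
qed

lemma grad_U: "grad (U t) x = (\<Sum>b\<in>Basis. dU b t x *\<^sub>R b)"
  by (simp add: grad_def dir_deriv_U)

lemma grad_U_norm:
  assumes "\<And>b. b \<in> Basis \<Longrightarrow> \<bar>dU b t x\<bar> \<le> C" shows "norm (grad (U t) x) \<le> real DIM(real^'n) * C"
  unfolding grad_U
  by (rule order_trans[OF norm_sum], rule sum_bounded_above) (use assms in simp)

lemma U_H1: "U t \<in> H1"
  by (rule test_functions_weak_grad(1)[OF U_test])

lemma H1_norm_test:
  fixes f :: "real^'n \<Rightarrow> real"
  assumes "f \<in> test_functions UNIV" shows "H1_norm f \<le> L2_norm f + L2_norm (grad f)"
proof -
  have "L2_norm (weak_grad f) = L2_norm (grad f)"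
    by (rule L2_norm_cong_AE[OF H1_D(2)[OF test_functions_weak_grad(1)[OF assms]] test_functions_weak_grad(2)[OF assms] weak_grad_test[OF assms]])
  then show ?thesis unfolding H1_norm_def by (simp add: sqrt_sum_squares_le_sum)
qed

lemma U_diff_test: "U s - U t \<in> test_functions UNIV" and grad_U_diff: "grad (U s - U t) = grad (U s) - grad (U t)"
proof -
  have d: "U s - U t = (\<lambda>x. U s x + (-1) * U t x)" by auto
  show "U s - U t \<in> test_functions UNIV" unfolding d by (intro test_functions_add test_functions_cmult U_test)
  have "dir_deriv b (U s - U t) = (\<lambda>x. dU b s x - dU b t x)" for b
  proof -
    note sU = test_functionsD(1)[OF U_test]
    show ?thesis
      unfolding d dir_deriv_add[OF sU smooth_cmult[OF sU]] dir_deriv_cmult[OF sU] dir_deriv_U by simp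
  qed
  then show "grad (U s - U t) = grad (U s) - grad (U t)"
    by (auto simp: grad_def[abs_def] dir_deriv_U fun_eq_iff sum_subtractf scaleR_left_diff_distrib)
qed

lemma grad_U_measurable: "grad (U t) \<in> borel_measurable borel"
  by (rule L2_measurable[OF test_functions_weak_grad(2)[OF U_test]])

text \<open>The gradient contains \<open>g1\<close>, for which the accumulation time is
  excluded.\<close>

lemma U_H1_continuous:
  assumes "t \<in> {0..1}" "t \<noteq> 5/16" shows "((\<lambda>s. H1_norm (U s - U t)) \<longlongrightarrow> 0) (at t)"
proof (rule Lim_null_comparison)
  obtain C where C: "\<And>t x b. \<bar>t\<bar> \<le> 2 \<Longrightarrow> b \<in> Basis \<Longrightarrow> \<bar>dU b t x\<bar> \<le> C" using uniform_bounds by metis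
  have "((\<lambda>s. L2_norm (grad (U s) - grad (U t))) \<longlongrightarrow> 0) (at t)"
  proof (rule L2_tendsto_bounded[OF window(1) window(2)[OF assms(1)] grad_U_measurable supp_psi])
    show "x \<notin> supp \<psi> \<Longrightarrow> grad (U s) x = 0" for s x by (simp add: grad_U zero_outside)
    show "norm (grad (U s) x) \<le> real DIM(real^'n) * C" if "s \<in> {-1<..<2}" for s x
      by (rule grad_U_norm, rule C[OF window(3)[OF that]])
    show "((\<lambda>s. grad (U s) x) \<longlongrightarrow> grad (U t) x) (at t)" for x
      unfolding grad_U by (intro tendsto_intros space_tendsto[OF assms(2)])
  qed
  from tendsto_add[OF U_L2_continuous[OF assms(1)] this]
  show "((\<lambda>s. L2_norm (U s - U t) + L2_norm (grad (U s - U t))) \<longlongrightarrow> 0) (at t)" by (simp add: grad_U_diff)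
  show "\<forall>\<^sub>F s in at t. norm (H1_norm (U s - U t)) \<le> L2_norm (U s - U t) + L2_norm (grad (U s - U t))"
    using H1_norm_test[OF U_diff_test] by simp
qed

lemma L2_members: "U t \<in> L2" "Ut t \<in> L2" "F t \<in> L2" "grad (U t) \<in> L2"
  using U_test Ut_test F_test by (auto intro: test_functions_L2 test_functions_weak_grad(2))

lemma L2_bounds:
  obtains C where "0 < C" "\<And>t. t \<in> {0..1} \<Longrightarrow> L2_norm (U t) \<le> C" "\<And>t. t \<in> {0..1} \<Longrightarrow> L2_norm (F t) \<le> C"
    "\<And>t. t \<in> {0..1} \<Longrightarrow> L2_norm (grad (U t)) \<le> C"
proof -
  obtain C where C0: "0 < C" and C: "\<And>t x. \<bar>t\<bar> \<le> 2 \<Longrightarrow> \<bar>U t x\<bar> \<le> C" "\<And>t x b. \<bar>t\<bar> \<le> 2 \<Longrightarrow> b \<in> Basis \<Longrightarrow> \<bar>dU b t x\<bar> \<le> C"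
    "\<And>t x. \<bar>t\<bar> \<le> 2 \<Longrightarrow> \<bar>F t x\<bar> \<le> C" using uniform_bounds by metis
  let ?d = "real DIM(real^'n)" and ?m = "sqrt (measure lborel (supp \<psi>))"
  have "1 \<le> ?d" using DIM_positive[where 'a = "real^'n"] by linarith
  then have dC: "C \<le> ?d * C" using C0 by (metis mult_1 mult_right_mono less_imp_le)
  have m: "C * ?m \<le> ?d * C * ?m" using dC by (intro mult_right_mono) auto
  have 1: "L2_norm (U t) \<le> C * ?m" "L2_norm (F t) \<le> C * ?m" "L2_norm (grad (U t)) \<le> ?d * C * ?m" if "t \<in> {0..1}" for t
  proof -
    have t: "\<bar>t\<bar> \<le> 2" using that by auto
    show "L2_norm (U t) \<le> C * ?m"
      by (rule L2_norm_le_bound(2)[OF test_measurable[OF U_test] supp_psi(1) _ _ supp_psi(2)]) (simp_all add: zero_outside C(1)[OF t])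
    show "L2_norm (F t) \<le> C * ?m"
      by (rule L2_norm_le_bound(2)[OF test_measurable[OF F_test] supp_psi(1) _ _ supp_psi(2)]) (simp_all add: zero_outside C(3)[OF t])
    show "L2_norm (grad (U t)) \<le> ?d * C * ?m"
      by (rule L2_norm_le_bound(2)[OF grad_U_measurable supp_psi(1) _ _ supp_psi(2)])
        (simp add: grad_U zero_outside, rule grad_U_norm, rule C(2)[OF t])
  qed
  show thesis
  proof (rule that[of "?d * C * ?m + 1"])
    have "0 \<le> ?d * C * ?m" using C0 by simp
    then show "0 < ?d * C * ?m + 1" by linarith
    fix t :: real assume "t \<in> {0..1}"
    from 1[OF this] show "L2_norm (U t) \<le> ?d * C * ?m + 1" "L2_norm (F t) \<le> ?d * C * ?m + 1"
      "L2_norm (grad (U t)) \<le> ?d * C * ?m + 1" using m by linarith+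
  qed
qed

lemma F_Bochner: "F \<in> L2_Bochner L2 L2_norm"
proof -
  interpret L2: diff_seminorm "L2 :: (real^'n \<Rightarrow> real) set" L2_norm by (rule L2_seminorm)
  obtain C where "\<And>t. t \<in> {0..1} \<Longrightarrow> L2_norm (F t) \<le> C" using L2_bounds by metis
  then show ?thesis
    by (intro L2.L2_Bochner_I[of _ "5/16" C] L2_members F_L2_continuous) auto
qed

lemma U_Bochner: "U \<in> L2_Bochner H1 H1_norm"
proof -
  interpret H1: diff_seminorm "H1 :: (real^'n \<Rightarrow> real) set" H1_norm by (rule H1_seminorm)
  obtain C where C: "\<And>t. t \<in> {0..1} \<Longrightarrow> L2_norm (U t) \<le> C" "\<And>t. t \<in> {0..1} \<Longrightarrow> L2_norm (grad (U t)) \<le> C" using L2_bounds by metis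
  have "H1_norm (U t) \<le> C + C" if "t \<in> {0..1}" for t
    using H1_norm_test[OF U_test, of t] C[OF that] by linarith
  then show ?thesis
    by (intro H1.L2_Bochner_I[of _ "5/16" "C + C"] U_H1 U_H1_continuous) auto
qed

lemma embed_U_Hm1_continuous:
  assumes "t \<in> {0..1}" shows "((\<lambda>s. Hm1_norm (embed (U s) - embed (U t))) \<longlongrightarrow> 0) (at t)"
proof (rule Lim_null_comparison[OF _ U_L2_continuous[OF assms]])
  have "norm (Hm1_norm (embed (U s) - embed (U t))) \<le> L2_norm (U s - U t)" for s
    using Hm1_norm_embed_diff[of "U s" "U t"] Hm1_norm_nonneg[OF Hm1_diff[OF embed_Hm1(1) embed_Hm1(1)], of "U s" "U t"] L2_members(1)
    by simp
  then show "\<forall>\<^sub>F s in at t. norm (Hm1_norm (embed (U s) - embed (U t))) \<le> L2_norm (U s - U t)" by simp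
qed

lemma embed_U_Bochner: "(\<lambda>t. embed (U t)) \<in> L2_Bochner Hm1 Hm1_norm"
proof -
  interpret Hm1: diff_seminorm "Hm1 :: ((real^'n \<Rightarrow> real) \<Rightarrow> real) set" Hm1_norm by (rule Hm1_seminorm)
  obtain C where C: "\<And>t. t \<in> {0..1} \<Longrightarrow> L2_norm (U t) \<le> C" using L2_bounds by metis
  have "Hm1_norm (embed (U t)) \<le> C" if "t \<in> {0..1}" for t
    using embed_Hm1(2)[OF L2_members(1), of t] C[OF that] by linarith
  then show ?thesis
    by (intro Hm1.L2_Bochner_I[of _ "5/16" C] embed_Hm1(1) L2_members embed_U_Hm1_continuous) auto
qed

lemma zero_initial: "zero_initial_value (\<lambda>t. embed (U t))"
  unfolding zero_initial_value_def
proof (intro exI[of _ "\<lambda>t. embed (U t)"] conjI ballI)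
  fix t :: real assume t: "t \<in> {0..1}"
  show "embed (U t) \<in> Hm1" by (rule embed_Hm1(1)[OF L2_members(1)])
  show "((\<lambda>s. Hm1_norm (embed (U s) - embed (U t))) \<longlongrightarrow> 0) (at t within {0..1})"
    by (rule tendsto_within_subset[OF embed_U_Hm1_continuous[OF t]]) simp
qed (auto simp: embed_def U_def)

text \<open>For each fixed time this is an integration by parts for smooth functions with compact
  support.\<close>

lemma equation:
  assumes v: "v \<in> H1"
  shows "embed (Ut t) v - weak_div (\<lambda>x. coeff_matrix \<eta> \<epsilon> k t x *v weak_grad (U t) x) v = embed (F t) v"
proof -
  define p where "p x = scalar_coeff \<eta> \<epsilon> t (x $ k) *\<^sub>R grad (U t) x" for x :: "real^'n"
  have pL: "p \<in> L2" using coeff_matrix_L2(1)[OF eps L2_members(4), of k t t] unfolding p_def[abs_def] coeff_matrix_mult .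
  have qL: "(\<lambda>x. coeff_matrix \<eta> \<epsilon> k t x *v weak_grad (U t) x) \<in> L2"
    by (rule coeff_matrix_L2(1)[OF eps H1_D(2)[OF U_H1]])
  have pb: "(\<lambda>x. p x \<bullet> b) = (\<lambda>x. scalar_coeff \<eta> \<epsilon> t (x $ k) * dU b t x)" if "b \<in> Basis" for b
    using that by (simp add: p_def grad_inner dir_deriv_U)
  have "weak_div (\<lambda>x. coeff_matrix \<eta> \<epsilon> k t x *v weak_grad (U t) x) v = weak_div p v"
  proof -
    have "(LINT x|lborel. (coeff_matrix \<eta> \<epsilon> k t x *v weak_grad (U t) x) \<bullet> weak_grad v x) = (LINT x|lborel. p x \<bullet> weak_grad v x)"
    proof (rule integral_cong_AE)
      show "(\<lambda>x. (coeff_matrix \<eta> \<epsilon> k t x *v weak_grad (U t) x) \<bullet> weak_grad v x) \<in> borel_measurable lborel"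
        using L2_inner_integrable[OF qL H1_D(2)[OF v]] by simp
      show "(\<lambda>x. p x \<bullet> weak_grad v x) \<in> borel_measurable lborel"
        using L2_inner_integrable[OF pL H1_D(2)[OF v]] by simp
      show "AE x in lborel. (coeff_matrix \<eta> \<epsilon> k t x *v weak_grad (U t) x) \<bullet> weak_grad v x = p x \<bullet> weak_grad v x"
        using weak_grad_test[OF U_test, of t] by eventually_elim (simp add: coeff_matrix_mult p_def)
    qed
    then show ?thesis by (simp add: weak_div_def)
  qed
  also have "\<dots> = (LINT x|lborel. (\<Sum>b\<in>Basis. dir_deriv b (\<lambda>x. p x \<bullet> b) x) * v x)"
    by (rule weak_div_smooth[OF _ v]) (simp add: pb flux_test)
  also have "\<dots> = (LINT x|lborel. (Ut t x - F t x) * v x)"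
  proof -
    have "(\<Sum>b\<in>Basis. dir_deriv b (\<lambda>x. p x \<bullet> b) x) = Ut t x - F t x" for x
      using flux_divergence[of t x] by (simp add: pb F_def cong: sum.cong)
    then show ?thesis by simp
  qed
  also have "\<dots> = embed (Ut t) v - embed (F t) v"
    using L2_mult_integrable[OF L2_members(2) H1_D(1)[OF v]] L2_mult_integrable[OF L2_members(3) H1_D(1)[OF v]]
    by (simp add: embed_def left_diff_distrib)
  finally show ?thesis by simp
qed

text \<open>The \<open>L\<^sup>2\<close> norm of \<open>Ut t\<close> is unbounded near
  \<open>5/16\<close>. Its \<open>H\<^sup>-\<^sup>1\<close> norm is bounded, because by the equation
  it is a sum of \<open>F t\<close> and the divergence of a bounded field.\<close>

lemma embed_Ut_Bochner: "(\<lambda>t. embed (Ut t)) \<in> L2_Bochner Hm1 Hm1_norm"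
proof -
  interpret Hm1: diff_seminorm "Hm1 :: ((real^'n \<Rightarrow> real) \<Rightarrow> real) set" Hm1_norm by (rule Hm1_seminorm)
  obtain C where C: "\<And>t. t \<in> {0..1} \<Longrightarrow> L2_norm (F t) \<le> C" "\<And>t. t \<in> {0..1} \<Longrightarrow> L2_norm (grad (U t)) \<le> C" using L2_bounds by metis
  have b: "Hm1_norm (embed (Ut t)) \<le> C + 2 * C" if t: "t \<in> {0..1}" for t
  proof (rule Hm1_norm_le)
    show C3: "0 \<le> C + 2 * C" using C(1)[OF t] L2_norm_nonneg[of "F t"] by linarith
    fix v :: "real^'n \<Rightarrow> real" assume v: "v \<in> H1"
    let ?q = "\<lambda>x. coeff_matrix \<eta> \<epsilon> k t x *v weak_grad (U t) x"
    have wg: "L2_norm (weak_grad (U t)) = L2_norm (grad (U t))"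
      by (rule L2_norm_cong_AE[OF H1_D(2)[OF U_H1] L2_members(4) weak_grad_test[OF U_test]])
    have qL: "?q \<in> L2" "L2_norm ?q \<le> 2 * L2_norm (grad (U t))"
      using coeff_matrix_L2[OF eps H1_D(2)[OF U_H1], of k t t] by (simp_all add: wg)
    have "\<bar>embed (Ut t) v\<bar> \<le> \<bar>embed (F t) v\<bar> + \<bar>weak_div ?q v\<bar>" using equation[OF v, of t] by linarith
    also have "\<dots> \<le> L2_norm (F t) * H1_norm v + L2_norm ?q * H1_norm v"
    proof (rule add_mono)
      have "\<bar>embed (F t) v\<bar> \<le> Hm1_norm (embed (F t)) * H1_norm v" by (rule Hm1_bound[OF embed_Hm1(1)[OF L2_members(3)] v])
      also have "\<dots> \<le> L2_norm (F t) * H1_norm v" by (intro mult_right_mono embed_Hm1(2) L2_members) simp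
      finally show "\<bar>embed (F t) v\<bar> \<le> L2_norm (F t) * H1_norm v" .
    qed (rule weak_div_bound[OF qL(1) v])
    also have "\<dots> \<le> C * H1_norm v + (2 * C) * H1_norm v"
      using C[OF t] qL(2) by (intro add_mono mult_right_mono) auto
    finally show "\<bar>embed (Ut t) v\<bar> \<le> (C + 2 * C) * H1_norm v" by (simp add: algebra_simps)
  qed
  show ?thesis
  proof (rule Hm1.L2_Bochner_I[of _ "5/16" "C + 2 * C"])
    fix t :: real assume t: "t \<in> {0<..<1}"
    show "embed (Ut t) \<in> Hm1" by (rule embed_Hm1(1)[OF L2_members(2)])
    show "Hm1_norm (embed (Ut t)) \<le> C + 2 * C" using b[of t] t by simp
    assume "t \<noteq> 5/16"
    show "((\<lambda>s. Hm1_norm (embed (Ut s) - embed (Ut t))) \<longlongrightarrow> 0) (at t)"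
    proof (rule Lim_null_comparison[OF _ Ut_L2_continuous[OF \<open>t \<noteq> 5/16\<close>]])
      have "norm (Hm1_norm (embed (Ut s) - embed (Ut t))) \<le> L2_norm (Ut s - Ut t)" for s
        using Hm1_norm_embed_diff[of "Ut s" "Ut t"] Hm1_norm_nonneg[OF Hm1_diff[OF embed_Hm1(1) embed_Hm1(1)], of "Ut s" "Ut t"] L2_members(2)
        by simp
      then show "\<forall>\<^sub>F s in at t. norm (Hm1_norm (embed (Ut s) - embed (Ut t))) \<le> L2_norm (Ut s - Ut t)" by simp
    qed
  qed
qed

text \<open>Near a time different from \<open>5/16\<close> the solution is a finite sum of fixed
  functions of space with differentiable amplitudes.\<close>

lemma embed_U_DERIV:
  assumes t: "t \<noteq> 5/16" and v: "v \<in> H1"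
  shows "((\<lambda>s. embed (U s) v) has_real_derivative embed (Ut t) v) (at t)"
proof -
  obtain N J where N: "open N" "t \<in> N"
    and eq': "\<forall>c f s x. block_supported c \<longrightarrow> s \<in> N \<longrightarrow> mode_series (c s) f x = (\<Sum>j=1..J. mode_sum j (c s j) f x)"
    by (rule locally_finite_blocks[OF t])
  define w where "w j m x = sin (freq j m * x $ k) * \<psi>1 x" for j m and x :: "real^'n"
  have wL: "w j m \<in> L2" for j m
  proof -
    have "smooth (\<lambda>x::real^'n. sin (freq j m * x $ k))"
      by (rule smooth_coord) (use smooth_compose_affine[OF smooth_sin, of "freq j m" 0] in simp)
    then show ?thesis unfolding w_def[abs_def] by (intro test_functions_L2[where S = UNIV] test_functions_mult_smooth psi_test)
  qed
  note i = L2_mult_integrable[OF wL H1_D(1)[OF v]] L2_mult_integrable[OF test_functions_L2[OF psi] H1_D(1)[OF v]]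
  have combine: "(LINT x|lborel. (a * \<psi> x + (\<Sum>j=1..J. \<Sum>m=1..j. c j m * w j m x)) * v x)
      = a * embed \<psi> v + (\<Sum>j=1..J. \<Sum>m=1..j. c j m * embed (w j m) v)" for a c
  proof -
    have "(LINT x|lborel. (a * \<psi> x + (\<Sum>j=1..J. \<Sum>m=1..j. c j m * w j m x)) * v x)
        = (LINT x|lborel. a * (\<psi> x * v x) + (\<Sum>j=1..J. \<Sum>m=1..j. c j m * (w j m x * v x)))"
      by (rule Bochner_Integration.integral_cong) (simp_all add: distrib_right sum_distrib_right mult.assoc)
    also have "\<dots> = a * (LINT x|lborel. \<psi> x * v x) + (\<Sum>j=1..J. \<Sum>m=1..j. c j m * (LINT x|lborel. w j m x * v x))"
      using i by simp
    finally show ?thesis by (simp add: embed_def)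
  qed
  have U_eq: "U s x = s * \<psi> x + (\<Sum>j=1..J. \<Sum>m=1..j. (s * gc s j m) * w j m x)" if "s \<in> N" for s x
  proof -
    have "g0 s y = (\<Sum>j=1..J. \<Sum>m=1..j. gc s j m * sin (freq j m * y))" for y
      unfolding g0_def using eq' supported(1) that by (simp add: mode_sum_def)
    then show ?thesis by (simp add: U_def w_def distrib_left sum_distrib_left mult_ac)
  qed
  have Ut_eq: "Ut t x = 1 * \<psi> x + (\<Sum>j=1..J. \<Sum>m=1..j. (gc t j m + (rc t j m - \<epsilon> / 2 * zc t j m) * t) * w j m x)" for x
  proof -
    have "g0 t y = (\<Sum>j=1..J. \<Sum>m=1..j. gc t j m * sin (freq j m * y))" for y
      unfolding g0_def using eq' supported(1) N(2) by (simp add: mode_sum_def)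
    moreover have "gt t y = (\<Sum>j=1..J. \<Sum>m=1..j. (rc t j m - \<epsilon> / 2 * zc t j m) * sin (freq j m * y))" for y
      unfolding gt_def using eq'[rule_format, OF supported(6) N(2)] by (simp add: mode_sum_def)
    ultimately show ?thesis
      by (simp add: Ut_def w_def sum_distrib_left sum.distrib[symmetric])
        (intro sum.cong refl, simp add: algebra_simps)
  qed
  have "((\<lambda>s. s * embed \<psi> v + (\<Sum>j=1..J. \<Sum>m=1..j. (s * gc s j m) * embed (w j m) v)) has_real_derivative
      1 * embed \<psi> v + (\<Sum>j=1..J. \<Sum>m=1..j. (1 * gc t j m + (rc t j m - \<epsilon> / 2 * zc t j m) * t) * embed (w j m) v)) (at t)"
    by (intro DERIV_add DERIV_sum DERIV_cmult_right DERIV_mult DERIV_ident gc_DERIV) auto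
  also have "1 * embed \<psi> v + (\<Sum>j=1..J. \<Sum>m=1..j. (1 * gc t j m + (rc t j m - \<epsilon> / 2 * zc t j m) * t) * embed (w j m) v) = embed (Ut t) v"
    using combine[of 1 "\<lambda>j m. gc t j m + (rc t j m - \<epsilon> / 2 * zc t j m) * t"]
    by (simp add: embed_def[of "Ut t"] Ut_eq)
  finally show ?thesis
  proof (rule has_field_derivative_transform_within_open[OF _ N])
    fix s assume "s \<in> N"
    then show "s * embed \<psi> v + (\<Sum>j=1..J. \<Sum>m=1..j. (s * gc s j m) * embed (w j m) v) = embed (U s) v"
      using combine[of s "\<lambda>j m. s * gc s j m"] by (simp add: embed_def[of "U s"] U_eq)
  qed
qed

lemma embed_U_continuous: assumes v: "v \<in> H1" shows "continuous_on {0..1} (\<lambda>t. embed (U t) v)"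
  unfolding continuous_on_def
proof
  fix t :: real assume t: "t \<in> {0..1}"
  have "((\<lambda>s. embed (U s) v - embed (U t) v) \<longlongrightarrow> 0) (at t)"
  proof (rule Lim_null_comparison)
    show "\<forall>\<^sub>F s in at t. norm (embed (U s) v - embed (U t) v) \<le> Hm1_norm (embed (U s) - embed (U t)) * H1_norm v"
      using Hm1_bound[OF Hm1_diff[OF embed_Hm1(1)[OF L2_members(1)] embed_Hm1(1)[OF L2_members(1)]] v] by simp
    show "((\<lambda>s. Hm1_norm (embed (U s) - embed (U t)) * H1_norm v) \<longlongrightarrow> 0) (at t)"
      using tendsto_mult_right[OF embed_U_Hm1_continuous[OF t], of "H1_norm v"] by simp
  qed
  then have "((\<lambda>s. embed (U s) v) \<longlongrightarrow> embed (U t) v) (at t)" by (simp add: LIM_zero_iff)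
  then show "((\<lambda>s. embed (U s) v) \<longlongrightarrow> embed (U t) v) (at t within {0..1})" by (rule tendsto_within_subset) simp
qed

text \<open>The product of \<open>\<phi>\<close> with the pairing is continuous and is
  differentiable except at \<open>5/16\<close>, so that the fundamental theorem of calculus
  applies.\<close>

lemma weak_time_deriv: "has_weak_time_deriv (\<lambda>t. embed (U t)) (\<lambda>t. embed (Ut t))"
  unfolding has_weak_time_deriv_def
proof (intro conjI ballI embed_U_Bochner embed_Ut_Bochner)
  fix \<phi> :: "real \<Rightarrow> real" and v :: "real^'n \<Rightarrow> real" assume \<phi>: "\<phi> \<in> test_functions {0<..<1}" and v: "v \<in> H1"
  have sm: "smooth \<phi>" using \<phi> by (rule test_functionsD)
  have d: "(\<phi> has_real_derivative deriv \<phi> t) (at t)" for t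
    using smooth_real_DERIV[OF sm] DERIV_imp_deriv by metis
  have dd: "deriv \<phi> = dir_deriv 1 \<phi>" by (intro ext DERIV_imp_deriv smooth_real_DERIV sm)
  have cd: "continuous_on S (deriv \<phi>)" for S unfolding dd by (intro smooth_continuous smooth_dir_deriv sm)
  note cU = embed_U_continuous[OF v]
  have "((\<lambda>t. deriv \<phi> t * embed (U t) v + \<phi> t * embed (Ut t) v) has_integral \<phi> 1 * embed (U 1) v - \<phi> 0 * embed (U 0) v) {0..1}"
  proof (rule fundamental_theorem_of_calculus_interior_strong[where S = "{5/16}"])
    show "continuous_on {0..1} (\<lambda>t. \<phi> t * embed (U t) v)"
      by (intro continuous_on_mult cU smooth_continuous sm)
    fix t :: real assume "t \<in> {0<..<1} - {5/16}"
    then have "((\<lambda>t. \<phi> t * embed (U t) v) has_real_derivative deriv \<phi> t * embed (U t) v + embed (Ut t) v * \<phi> t) (at t)"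
      by (intro DERIV_mult d embed_U_DERIV v) auto
    then show "((\<lambda>t. \<phi> t * embed (U t) v) has_vector_derivative deriv \<phi> t * embed (U t) v + \<phi> t * embed (Ut t) v) (at t)"
      by (simp add: has_real_derivative_iff_has_vector_derivative mult.commute)
  qed auto
  then have z: "integral {0..1} (\<lambda>t. deriv \<phi> t * embed (U t) v + \<phi> t * embed (Ut t) v) = 0"
    using test_functionsD(3)[OF \<phi>] by (simp add: integral_unique)
  obtain M where M: "\<And>t. \<bar>\<phi> t\<bar> \<le> M" using test_functions_bounded[OF \<phi>] by metis
  obtain M' where M': "\<And>t. \<bar>deriv \<phi> t\<bar> \<le> M'" unfolding dd using test_functions_bounded[OF test_functions_dir_deriv[OF \<phi>]] by metis
  have mult_int: "integrable unit_time (\<lambda>t. a t * b t)"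
    if "continuous_on {0<..<1} a" "\<And>t. \<bar>a t\<bar> \<le> A" "integrable unit_time b" for a b :: "real \<Rightarrow> real" and A
  proof (rule Bochner_Integration.integrable_bound)
    show "integrable unit_time (\<lambda>t. A * b t)" using that(3) by simp
    show "(\<lambda>t. a t * b t) \<in> borel_measurable unit_time"
      using unit_time_continuous_measurable[OF that(1)] that(3) by simp
    show "AE t in unit_time. norm (a t * b t) \<le> norm (A * b t)"
      using that(2) by (intro AE_I2) (auto simp: abs_mult intro!: mult_right_mono order_trans[OF that(2)])
  qed
  have i1: "integrable unit_time (\<lambda>t. deriv \<phi> t * embed (U t) v)"
    by (rule mult_int[OF cd M' Hm1_Bochner_apply[OF embed_U_Bochner v]])
  have i2: "integrable unit_time (\<lambda>t. \<phi> t * embed (Ut t) v)"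
    by (rule mult_int[OF smooth_continuous[OF sm] M Hm1_Bochner_apply[OF embed_Ut_Bochner v]])
  have "(LINT t|unit_time. deriv \<phi> t * embed (U t) v) + (LINT t|unit_time. \<phi> t * embed (Ut t) v)
      = (LINT t|unit_time. deriv \<phi> t * embed (U t) v + \<phi> t * embed (Ut t) v)"
    using i1 i2 by simp
  also have "\<dots> = 0" using unit_time_integral[OF Bochner_Integration.integrable_add[OF i1 i2]] z by simp
  finally show "(LINT t|unit_time. deriv \<phi> t * embed (U t) v) = - (LINT t|unit_time. \<phi> t * embed (Ut t) v)" by simp
qed

lemma U_lions_solution: "lions_solution (coeff_matrix \<eta> \<epsilon> k) F U"
  unfolding lions_solution_def
  using U_Bochner weak_time_deriv zero_initial equation
  by (intro conjI exI[of _ "\<lambda>t. embed (Ut t)"] AE_I2 ballI) auto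

end

section \<open>The time derivative is not square integrable\<close>

context smooth_cutoff
begin

text \<open>The difference of the two derivatives is a weak derivative of zero, so all its integrals
  vanish. Its averages then vanish too, and they converge to it.\<close>

lemma weak_time_deriv_unique:
  fixes v :: "'a::euclidean_space \<Rightarrow> real"
  assumes "has_weak_time_deriv W G1" "has_weak_time_deriv W G2" "v \<in> H1"
  shows "AE t in unit_time. G1 t v = G2 t v"
proof -
  have i: "integrable unit_time (\<lambda>t. G1 t v)" "integrable unit_time (\<lambda>t. G2 t v)"
    using assms(1,2) Hm1_Bochner_apply[OF _ assms(3)] unfolding has_weak_time_deriv_def by blast+
  define \<gamma> where "\<gamma> t = G1 t v - G2 t v" for t
  have \<gamma>i: "integrable unit_time \<gamma>" unfolding \<gamma>_def[abs_def] using i by simp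
  have zero: "integral {a..b} \<gamma> = 0" if "0 \<le> a" "a \<le> b" "b \<le> 1" for a b
  proof -
    have "0 - 0 = integral {a..b} \<gamma>"
    proof (rule weak_derivative_imp_integral[of "\<lambda>_. 0" \<gamma>, OF _ \<gamma>i _ that])
      fix \<phi> :: "real \<Rightarrow> real" assume \<phi>: "\<phi> \<in> test_functions {0<..<1}"
      obtain M where M: "\<And>t. \<bar>\<phi> t\<bar> \<le> M" using test_functions_bounded[OF \<phi>] by metis
      have [measurable]: "\<phi> \<in> borel_measurable unit_time"
        by (intro unit_time_continuous_measurable smooth_continuous test_functionsD(1)[OF \<phi>])
      have j: "integrable unit_time (\<lambda>t. \<phi> t * f t)" if "integrable unit_time f" for f
      proof (rule Bochner_Integration.integrable_bound)
        show "integrable unit_time (\<lambda>t. M * f t)" using that by simp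
        show "(\<lambda>t. \<phi> t * f t) \<in> borel_measurable unit_time" using that by simp
        show "AE t in unit_time. norm (\<phi> t * f t) \<le> norm (M * f t)"
          by (intro AE_I2) (auto simp: abs_mult intro!: mult_right_mono order_trans[OF M])
      qed
      have "(LINT t|unit_time. \<phi> t * G1 t v) = (LINT t|unit_time. \<phi> t * G2 t v)"
      proof -
        have "(LINT t|unit_time. deriv \<phi> t * W t v) = - (LINT t|unit_time. \<phi> t * G1 t v)"
          "(LINT t|unit_time. deriv \<phi> t * W t v) = - (LINT t|unit_time. \<phi> t * G2 t v)"
          using assms \<phi> unfolding has_weak_time_deriv_def by blast+
        then show ?thesis by linarith
      qed
      then have "(LINT t|unit_time. \<phi> t * \<gamma> t) = 0"
        using j[OF i(1)] j[OF i(2)] by (simp add: \<gamma>_def right_diff_distrib)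
      then show "(LINT t|unit_time. deriv \<phi> t * 0) = - (LINT t|unit_time. \<phi> t * \<gamma> t)" by simp
    qed simp
    then show ?thesis by simp
  qed
  have av: "avg h \<gamma> t = 0" if "t \<in> {0<..<1}" "0 < h" for h t
    using prim_diff'[OF \<gamma>i, of "t - h" t] zero[of "max 0 (t - h)" t] that by (simp add: avg_def)
  have "(\<lambda>n. LINT t|unit_time. \<bar>avg (1 / real (Suc (Suc n))) \<gamma> t - \<gamma> t\<bar>) \<longlonglongrightarrow> 0"
    by (rule avg_tendsto_L1[OF \<gamma>i])
  moreover have "(LINT t|unit_time. \<bar>avg (1 / real (Suc (Suc n))) \<gamma> t - \<gamma> t\<bar>) = (LINT t|unit_time. \<bar>\<gamma> t\<bar>)" for n
    by (rule Bochner_Integration.integral_cong) (simp_all add: av)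
  ultimately have "(LINT t|unit_time. \<bar>\<gamma> t\<bar>) = 0" by (simp add: LIMSEQ_const_iff)
  then have "AE t in unit_time. \<bar>\<gamma> t\<bar> = 0"
    using integral_nonneg_eq_0_iff_AE[of unit_time "\<lambda>t. \<bar>\<gamma> t\<bar>"] \<gamma>i by simp
  then show ?thesis by eventually_elim (simp add: \<gamma>_def)
qed

end

context corrector
begin

text \<open>The density against which products of two waves are integrated.\<close>

definition weight :: "real^'n \<Rightarrow> real" where "weight x = (\<psi>1 x)\<^sup>2"

lemma weight_test: "weight \<in> test_functions UNIV"
  using test_functions_mult_smooth[OF psi_test(1) psi_smooth(2)]
  by (simp add: weight_def[abs_def] power2_eq_square)

text \<open>One integration by parts in the direction \<open>e\<close> gains a factor \<open>1 /
  \<kappa>\<close>.\<close>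

lemma oscillating_integral:
  obtains C where "0 < C" "\<And>\<kappa>. \<kappa> \<noteq> 0 \<Longrightarrow> \<bar>LINT x|lborel. cos (\<kappa> * x $ k) * weight x\<bar> \<le> C / \<bar>\<kappa>\<bar>"
proof -
  define C where "C = (LINT x|lborel. \<bar>dir_deriv e weight x\<bar>)"
  note wt = test_functions_dir_deriv[OF weight_test, of e]
  have "\<bar>LINT x|lborel. cos (\<kappa> * x $ k) * weight x\<bar> \<le> (C + 1) / \<bar>\<kappa>\<bar>" if "\<kappa> \<noteq> 0" for \<kappa>
  proof -
    have s0: "smooth (\<lambda>y. sin (\<kappa> * y))" using smooth_compose_affine[OF smooth_sin, of \<kappa> 0] by simp
    have s: "smooth (\<lambda>x::real^'n. sin (\<kappa> * x $ k))" by (rule smooth_coord[OF s0])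
    have d0: "dir_deriv 1 (\<lambda>y. sin (\<kappa> * y)) = (\<lambda>y. \<kappa> * cos (\<kappa> * y))"
    proof
      fix y
      have "((\<lambda>y. sin (\<kappa> * y)) has_real_derivative cos (\<kappa> * y) * \<kappa>) (at y)"
        by (rule DERIV_chain2[OF DERIV_sin]) (auto intro!: derivative_eq_intros)
      from dir_deriv_DERIV[OF this, of 1] show "dir_deriv 1 (\<lambda>y. sin (\<kappa> * y)) y = \<kappa> * cos (\<kappa> * y)" by simp
    qed
    have d: "dir_deriv e (\<lambda>x. sin (\<kappa> * x $ k)) = (\<lambda>x. \<kappa> * cos (\<kappa> * x $ k))"
      by (simp add: dir_deriv_coord[OF s0] d0)
    have "(LINT x|lborel. sin (\<kappa> * x $ k) * dir_deriv e weight x) = - (LINT x|lborel. (\<kappa> * cos (\<kappa> * x $ k)) * weight x)"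
      using integral_by_parts_test_function[OF weight_test s, of e] unfolding d .
    then have "\<kappa> * (LINT x|lborel. cos (\<kappa> * x $ k) * weight x) = - (LINT x|lborel. sin (\<kappa> * x $ k) * dir_deriv e weight x)"
      by (simp add: mult.assoc)
    then have "\<bar>\<kappa>\<bar> * \<bar>LINT x|lborel. cos (\<kappa> * x $ k) * weight x\<bar> = \<bar>LINT x|lborel. sin (\<kappa> * x $ k) * dir_deriv e weight x\<bar>"
      by (simp only: abs_mult[symmetric] abs_minus_cancel)
    also have "\<dots> \<le> C"
      unfolding C_def
    proof (rule integral_abs_bound_integral)
      show "integrable lborel (\<lambda>x. sin (\<kappa> * x $ k) * dir_deriv e weight x)"
        by (rule test_functions_integrable[OF test_functions_mult_smooth[OF wt s]])
      show "integrable lborel (\<lambda>x. \<bar>dir_deriv e weight x\<bar>)" using test_functions_integrable[OF wt] by simp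
      show "\<bar>sin (\<kappa> * x $ k) * dir_deriv e weight x\<bar> \<le> \<bar>dir_deriv e weight x\<bar>" for x
        by (simp add: abs_mult mult_left_le_one_le)
    qed
    finally have "\<bar>LINT x|lborel. cos (\<kappa> * x $ k) * weight x\<bar> \<le> C / \<bar>\<kappa>\<bar>"
      using that by (simp add: le_divide_eq mult.commute)
    also have "\<dots> \<le> (C + 1) / \<bar>\<kappa>\<bar>" by (intro divide_right_mono) auto
    finally show ?thesis .
  qed
  moreover have "0 < C + 1" unfolding C_def by (rule add_nonneg_pos) simp_all
  ultimately show thesis by (rule that[rotated])
qed

definition wave :: "nat \<Rightarrow> nat \<Rightarrow> real^'n \<Rightarrow> real" where
  "wave j m x = sin (freq j m * x $ k) * \<psi>1 x"

lemma wave_test: "wave j m \<in> test_functions UNIV"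
proof -
  have "smooth (\<lambda>x::real^'n. sin (freq j m * x $ k))"
    by (rule smooth_coord) (use smooth_compose_affine[OF smooth_sin, of "freq j m" 0] in simp)
  then show ?thesis unfolding wave_def[abs_def] by (intro test_functions_mult_smooth psi_test)
qed

lemma inverse_le_swap: "0 < l \<Longrightarrow> 1 / l \<le> y \<Longrightarrow> 1 / y \<le> (l::real)"
proof -
  assume l: "0 < l" and le: "1 / l \<le> y"
  have "0 < 1 / l" using l by simp
  then have "0 < y" using le by linarith
  then show "1 / y \<le> l" using l le by (simp add: field_simps)
qed

text \<open>Frequencies of one block differ by at least \<open>1 / ell j\<close>, since \<open>freq
  j m\<close> is \<open>16 ^ m / ell j\<close>.\<close>

lemma freq_separated:
  assumes "1 \<le> j" "1 \<le> m" "1 \<le> m'"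
  shows "m \<noteq> m' \<Longrightarrow> 1 / \<bar>freq j m - freq j m'\<bar> \<le> ell j" "1 / \<bar>freq j m + freq j m'\<bar> \<le> ell j"
proof -
  have l: "0 < ell j" by (rule ell_pos[OF assms(1)])
  show "1 / \<bar>freq j m + freq j m'\<bar> \<le> ell j"
  proof -
    have "1 / ell j \<le> freq j m + freq j m'"
      using inverse_ell_le_freq[OF assms(1), of m] freq_pos[OF assms(1), of m'] by linarith
    then have "1 / ell j \<le> \<bar>freq j m + freq j m'\<bar>" by linarith
    then show ?thesis by (rule inverse_le_swap[OF l])
  qed
  assume ne: "m \<noteq> m'"
  have gap: "1 \<le> (16::real) ^ b - 16 ^ a" if "a < b" for a b :: nat
  proof -
    have "(16::real) ^ Suc a \<le> 16 ^ b" using that by (intro power_increasing) auto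
    then have "16 * (16::real) ^ a \<le> 16 ^ b" by simp
    moreover have "1 \<le> (16::real) ^ a" by simp
    ultimately show ?thesis by linarith
  qed
  have "1 \<le> \<bar>(16::real) ^ m - 16 ^ m'\<bar>" using gap[of m m'] gap[of m' m] ne by (cases "m < m'") auto
  then have "1 / ell j \<le> \<bar>(16::real) ^ m - 16 ^ m'\<bar> / ell j" using l by (intro divide_right_mono) auto
  also have "\<dots> = \<bar>freq j m - freq j m'\<bar>" using l by (simp add: freq_def diff_divide_distrib[symmetric] abs_divide)
  finally show "1 / \<bar>freq j m - freq j m'\<bar> \<le> ell j" by (rule inverse_le_swap[OF l])
qed

text \<open>A product of two sines is half the difference of two cosines; only the diagonal terms
  contain the frequency zero. All other frequencies are at least \<open>1 / ell j\<close>, so each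
  of the \<open>j\<^sup>2\<close> error terms is of size \<open>ell j\<close>, and their sum is
  bounded.\<close>

lemma almost_orthogonal:
  obtains C where "0 < C" "\<forall>j c. 1 \<le> j \<longrightarrow> (\<forall>m. \<bar>c m\<bar> \<le> 2) \<longrightarrow>
     (L2_norm \<psi>1)\<^sup>2 / 2 * (\<Sum>m=1..j. (c m)\<^sup>2) - C \<le> (L2_norm (\<lambda>x. \<Sum>m=1..j. c m * wave j m x))\<^sup>2"
proof -
  obtain C where C: "0 < C" "\<And>\<kappa>. \<kappa> \<noteq> 0 \<Longrightarrow> \<bar>LINT x|lborel. cos (\<kappa> * x $ k) * weight x\<bar> \<le> C / \<bar>\<kappa>\<bar>"
    using oscillating_integral by metis
  have main: "(L2_norm \<psi>1)\<^sup>2 / 2 * (\<Sum>m=1..j. (c m)\<^sup>2) - C \<le> (L2_norm (\<lambda>x. \<Sum>m=1..j. c m * wave j m x))\<^sup>2"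
    if j: "1 \<le> j" and c: "\<And>m. \<bar>c m\<bar> \<le> 2" for j c
  proof -
    define S where "S m m' = (LINT x|lborel. wave j m x * wave j m' x)" for m m'
    let ?w0 = "(L2_norm \<psi>1)\<^sup>2"
    have l: "0 < ell j" by (rule ell_pos[OF j])
    have w0: "?w0 = (LINT x|lborel. weight x)" unfolding L2_norm_sq by (simp add: weight_def power2_eq_square)
    have osc: "\<bar>LINT x|lborel. cos (\<kappa> * x $ k) * weight x\<bar> \<le> C * ell j" if "1 / \<bar>\<kappa>\<bar> \<le> ell j" "\<kappa> \<noteq> 0" for \<kappa>
      using C(2)[OF that(2)] mult_left_mono[OF that(1), of C] C(1) by simp
    have ic: "integrable lborel (\<lambda>x. cos (\<kappa> * x $ k) * weight x)" for \<kappa>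
    proof (rule test_functions_integrable[OF test_functions_mult_smooth[OF weight_test]])
      show "smooth (\<lambda>x::real^'n. cos (\<kappa> * x $ k))"
        by (rule smooth_coord) (use smooth_compose_affine[OF smooth_cos, of \<kappa> 0] in simp)
    qed
    have S_eq: "S m m' = (LINT x|lborel. cos ((freq j m - freq j m') * x $ k) * weight x) / 2
        - (LINT x|lborel. cos ((freq j m + freq j m') * x $ k) * weight x) / 2" for m m'
    proof -
      have "wave j m x * wave j m' x = (cos ((freq j m - freq j m') * x $ k) * weight x - cos ((freq j m + freq j m') * x $ k) * weight x) / 2" for x
        by (simp add: wave_def weight_def power2_eq_square left_diff_distrib distrib_right cos_add cos_diff)
      then show ?thesis unfolding S_def using ic by (simp add: diff_divide_distrib)
    qed
    have S_bound: "(if m = m' then ?w0 / 2 * (c m)\<^sup>2 else 0) - 4 * C * ell j \<le> c m * c m' * S m m'"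
      if m: "m \<in> {1..j}" "m' \<in> {1..j}" for m m'
    proof -
      have K: "0 < freq j m" "0 < freq j m'" by (rule freq_pos[OF j])+
      have plus: "\<bar>LINT x|lborel. cos ((freq j m + freq j m') * x $ k) * weight x\<bar> \<le> C * ell j"
        using freq_separated(2)[OF j, of m m'] m K by (intro osc) auto
      have cc: "\<bar>c m * c m'\<bar> \<le> 2 * 2" by (rule abs_mult_le[OF c c])
      have Cl: "0 \<le> C * ell j" using C l by simp
      show ?thesis
      proof (cases "m = m'")
        case True
        let ?P = "LINT x|lborel. cos ((freq j m + freq j m') * x $ k) * weight x"
        have Se: "S m m' = ?w0 / 2 - ?P / 2" unfolding S_eq w0 using True by simp
        have e: "c m * c m' * S m m' = ?w0 / 2 * (c m)\<^sup>2 - c m * c m' * (?P / 2)"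
          unfolding Se right_diff_distrib using True by (simp add: power2_eq_square mult_ac)
        have "\<bar>?P / 2\<bar> \<le> C * ell j" using plus Cl by simp
        from abs_mult_le[OF cc this] show ?thesis using True e by (simp add: abs_le_iff)
      next
        case False
        have minus: "\<bar>LINT x|lborel. cos ((freq j m - freq j m') * x $ k) * weight x\<bar> \<le> C * ell j"
        proof (rule osc)
          have s: "1 / \<bar>freq j m - freq j m'\<bar> \<le> ell j" using freq_separated(1)[OF j, of m m'] m False by auto
          then show "1 / \<bar>freq j m - freq j m'\<bar> \<le> ell j" .
          have "(16::real) ^ m \<noteq> 16 ^ m'" using False by simp
          then show "freq j m - freq j m' \<noteq> 0" using l by (simp add: freq_def)
        qed
        have "\<bar>S m m'\<bar> \<le> C * ell j" unfolding S_eq using plus minus by linarith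
        from abs_mult_le[OF cc this] show ?thesis using False by (simp add: abs_le_iff)
      qed
    qed
    have iw: "integrable lborel (\<lambda>x. wave j m x * wave j m' x)" for m m'
      by (rule L2_mult_integrable[OF test_functions_L2[OF wave_test] test_functions_L2[OF wave_test]])
    have "(L2_norm (\<lambda>x. \<Sum>m=1..j. c m * wave j m x))\<^sup>2
        = (LINT x|lborel. (\<Sum>m=1..j. \<Sum>m'=1..j. c m * c m' * (wave j m x * wave j m' x)))"
      unfolding L2_norm_sq inner_real_def sum_product
      by (intro Bochner_Integration.integral_cong refl sum.cong) (simp add: mult_ac)
    also have "\<dots> = (\<Sum>m=1..j. \<Sum>m'=1..j. c m * c m' * S m m')"
      unfolding S_def using iw by simp
    also have "\<dots> \<ge> (\<Sum>m=1..j. \<Sum>m'=1..j. (if m = m' then ?w0 / 2 * (c m)\<^sup>2 else 0) - 4 * C * ell j)"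
      by (intro sum_mono S_bound)
    also have "(\<Sum>m=1..j. \<Sum>m'=1..j. (if m = m' then ?w0 / 2 * (c m)\<^sup>2 else 0) - 4 * C * ell j)
        = ?w0 / 2 * (\<Sum>m=1..j. (c m)\<^sup>2) - 4 * C * (real j * (real j * ell j))"
      by (simp add: sum_subtractf sum_distrib_left)
    finally have "?w0 / 2 * (\<Sum>m=1..j. (c m)\<^sup>2) - 4 * C * (real j * (real j * ell j)) \<le> (L2_norm (\<lambda>x. \<Sum>m=1..j. c m * wave j m x))\<^sup>2" .
    moreover have "4 * C * (real j * (real j * ell j)) \<le> C"
    proof -
      have "real j * ell j = 1 / (16 * real (Suc j))" using j by (simp add: ell_eq)
      then have "real j * (real j * ell j) = real j / (16 * real (Suc j))" by simp
      also have "\<dots> \<le> 1/4" by (simp add: divide_le_eq)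
      finally have "real j * (real j * ell j) \<le> 1/4" .
      then have "4 * C * (real j * (real j * ell j)) \<le> 4 * C * (1/4)" using C by (intro mult_left_mono) auto
      then show ?thesis by simp
    qed
    ultimately show ?thesis by linarith
  qed
  show thesis by (rule that[OF C(1)]) (intro allI impI main, auto)
qed

text \<open>In the middle third of a block the cutoff equals one.\<close>

lemma U_t_decomposition:
  assumes j: "1 \<le> j" and t: "tau j + ell j / 3 < t" "t \<le> tau j + 2 * ell j / 3"
  shows "Ut t x = (\<psi> x + \<psi>1 x * g0 t (x $ k) + t * (\<psi>1 x * r0 t (x $ k)))
      - t * \<epsilon> / 2 * (\<Sum>m=1..j. (sin (theta j m t) + cos (theta j m t)) * wave j m x)"
proof -
  have l: "0 < ell j" "tau (Suc j) = tau j + ell j"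
    by (rule ell_pos[OF j], simp add: ell_def)
  have "1/3 \<le> (t - tau j) / ell j" "(t - tau j) / ell j \<le> 2/3" using l(1) t by (simp_all add: field_simps)
  then have eta1: "eta_j \<eta> j t = 1" unfolding eta_j_def by (rule eta_one)
  have other: "t \<le> tau i \<or> tau (Suc i) \<le> t" if "1 \<le> i" "i \<noteq> j" for i
    using tau_mono[of "Suc i" j] tau_mono[of "Suc j" i] that t l j by (cases "i < j") auto
  have "z0 t y = mode_sum j (zc t j) sin y" for y
    unfolding z0_def
    by (rule mode_series_block[OF j]) (use other supported(3) in \<open>unfold block_supported_def, blast\<close>)
  then have "z0 t y = (\<Sum>m=1..j. (sin (theta j m t) + cos (theta j m t)) * sin (freq j m * y))" for y
    by (simp add: mode_sum_def zc_def eta1)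
  then show ?thesis
    unfolding Ut_def gt_split by (simp add: wave_def sum_distrib_left sum_distrib_right algebra_simps)
qed

lemma mid_block:
  assumes "1 \<le> j" "tau j + ell j / 3 < t" "t \<le> tau j + 2 * ell j / 3"
  shows "tau j < t" "t < tau (Suc j)" "t \<in> {0<..<1}" "1/4 < t"
proof -
  have "0 < ell j" by (rule ell_pos[OF assms(1)])
  then show 1: "tau j < t" and 2: "t < tau (Suc j)" using assms unfolding ell_def by (auto simp: field_simps)
  show "1/4 < t" using tau_ge[OF assms(1)] 1 by simp
  then show "t \<in> {0<..<1}" using 2 tau_less[of "Suc j"] by simp
qed

text \<open>The integrand is the square of the amplitude \<open>sin \<theta> + cos \<theta>\<close>.
  Its oscillating part integrates to at most \<open>1 / K\<^sup>2\<close>, which is small compared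
  with the length \<open>ell j / 3\<close> of the middle third.\<close>

lemma oscillation_time_integral:
  assumes j: "1 \<le> j" "1 \<le> m"
  defines "a \<equiv> tau j + ell j / 3" and "b \<equiv> tau j + 2 * ell j / 3"
  shows "ell j / 4 \<le> integral {a..b} (\<lambda>t. 1 + sin (2 * theta j m t))"
proof -
  let ?K = "freq j m"
  have l: "0 < ell j" by (rule ell_pos[OF j(1)])
  have K: "0 < ?K" by (rule freq_pos[OF j(1)])
  have ab: "a \<le> b" using l by (simp add: a_def b_def)
  let ?P = "\<lambda>t. t - cos (2 * theta j m t) / (2 * ?K\<^sup>2)"
  have "((\<lambda>t. 1 + sin (2 * theta j m t)) has_integral ?P b - ?P a) {a..b}"
  proof (rule fundamental_theorem_of_calculus[OF ab])
    fix t
    have "((\<lambda>t. 2 * theta j m t) has_real_derivative 2 * ?K\<^sup>2) (at t)"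
      unfolding theta_def by (auto intro!: derivative_eq_intros)
    from DERIV_diff[OF DERIV_ident DERIV_cdivide[OF DERIV_chain2[OF DERIV_cos this], of "2 * ?K\<^sup>2"]]
    have "(?P has_real_derivative 1 + sin (2 * theta j m t)) (at t)" using K by simp
    then show "(?P has_vector_derivative 1 + sin (2 * theta j m t)) (at t within {a..b})"
      by (simp add: has_real_derivative_iff_has_vector_derivative has_vector_derivative_at_within)
  qed
  then have eq: "integral {a..b} (\<lambda>t. 1 + sin (2 * theta j m t)) = ?P b - ?P a" by (rule integral_unique)
  have c: "cos (2 * theta j m b) / (2 * ?K\<^sup>2) - cos (2 * theta j m a) / (2 * ?K\<^sup>2) \<le> 1 / ?K\<^sup>2"
  proof -
    have "cos (2 * theta j m b) - cos (2 * theta j m a) \<le> 2"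
      using cos_le_one[of "2 * theta j m b"] cos_ge_minus_one[of "2 * theta j m a"] by linarith
    then have "(cos (2 * theta j m b) - cos (2 * theta j m a)) / (2 * ?K\<^sup>2) \<le> 2 / (2 * ?K\<^sup>2)" by (intro divide_right_mono) auto
    then show ?thesis by (simp add: diff_divide_distrib)
  qed
  have "1 / ?K\<^sup>2 \<le> ell j / 12"
  proof -
    have "1 / ?K \<le> ell j" using inverse_ell_le_freq[OF j(1), of m] l K by (simp add: field_simps)
    moreover have "1 / ?K \<le> 1 / 256"
    proof (rule divide_left_mono)
      have "1 * 1 \<le> real j * real (Suc j)" using j by (intro mult_mono) auto
      then show "256 \<le> ?K" using freq_ge[OF j] by (simp add: mult.assoc)
    qed (use K in auto)
    ultimately have "(1 / ?K) * (1 / ?K) \<le> ell j * (1 / 256)" using K l by (intro mult_mono) auto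
    then have "1 / ?K\<^sup>2 \<le> ell j * (1/256)" by (simp add: power2_eq_square)
    also have "\<dots> \<le> ell j / 12" using l by simp
    finally show ?thesis .
  qed
  then show ?thesis unfolding eq using c l by (simp add: a_def b_def)
qed

text \<open>A square integrable time derivative \<open>H\<close> has, at almost every time, the same
  pairings as \<open>Ut\<close> with the countably many waves. Pairing with the sum \<open>Z\<close>
  of waves that occurs in \<open>Ut\<close> bounds the norm of \<open>Z\<close> by the norm of
  \<open>H\<close> plus a constant. On the middle third of block \<open>j\<close> the squared norm
  of \<open>Z\<close> is bounded below by \<open>almost_orthogonal\<close>, and its time integral is
  at least a multiple of \<open>j * ell j\<close>, that is of \<open>1 / (j + 1)\<close>, minus a
  multiple of \<open>ell j\<close>. Summation over \<open>j\<close> bounds the harmonic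
  series.\<close>

lemma not_in_L2L2:
  assumes nz: "0 < L2_norm \<psi>1" shows "\<not> time_deriv_in_L2L2 U"
proof
  assume "time_deriv_in_L2L2 U"
  then obtain H where HB: "H \<in> L2_Bochner L2 L2_norm" and Hw: "has_weak_time_deriv (\<lambda>t. embed (U t)) (\<lambda>t. embed (H t))"
    unfolding time_deriv_in_L2L2_def by blast
  have HX: "AE t in unit_time. H t \<in> L2" and Hsq: "integrable unit_time (\<lambda>t. (L2_norm (H t))\<^sup>2)"
    using HB by (auto simp: L2_Bochner_def)
  have eq: "AE t in unit_time. \<forall>j m. embed (H t) (wave j m) = embed (Ut t) (wave j m)"
    unfolding AE_all_countable
    by (intro allI weak_time_deriv_unique[OF Hw weak_time_deriv] test_functions_weak_grad(1)[OF wave_test])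
  obtain C where C0: "0 < C" and C': "\<forall>j c. 1 \<le> j \<longrightarrow> (\<forall>m. \<bar>c m\<bar> \<le> 2) \<longrightarrow>
     (L2_norm \<psi>1)\<^sup>2 / 2 * (\<Sum>m=1..j. (c m)\<^sup>2) - C \<le> (L2_norm (\<lambda>x. \<Sum>m=1..j. c m * wave j m x))\<^sup>2"
    by (rule almost_orthogonal)
  note C = C0 C'[rule_format]
  define w where "w = (L2_norm \<psi>1)\<^sup>2 / 2"
  have w: "0 < w" using nz by (simp add: w_def)
  obtain L where L: "0 < L" "\<And>t y. \<bar>r0 t y\<bar> \<le> L" using r0_bound by metis
  obtain M where M0: "0 < M" and M: "\<And>x. \<bar>\<psi> x\<bar> \<le> M" "\<And>x. \<bar>\<psi>1 x\<bar> \<le> M" using psi_bounds by metis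
  define R where "R t x = \<psi> x + \<psi>1 x * g0 t (x $ k) + t * (\<psi>1 x * r0 t (x $ k))" for t x
  have Rt: "R t \<in> test_functions UNIV" for t
  proof -
    have "smooth (\<lambda>x::real^'n. r0 t (x $ k))" by (rule smooth_coord[OF wave_smooth(5)])
    then have "(\<lambda>x. (\<psi> x + g0 t (x $ k) * \<psi>1 x) + t * (r0 t (x $ k) * \<psi>1 x)) \<in> test_functions UNIV"
      by (intro test_functions_add test_functions_mult_smooth test_functions_cmult psi psi_test wave_space_smooth)
    then show ?thesis unfolding R_def[abs_def] by (simp add: mult.commute)
  qed
  define CR where "CR = (2 * M + M * L) * sqrt (measure lborel (supp \<psi>))"
  have RC: "L2_norm (R t) \<le> CR" if t: "t \<in> {0<..<1}" for t
    unfolding CR_def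
  proof (rule L2_norm_le_bound(2)[OF test_measurable[OF Rt] supp_psi(1) _ _ supp_psi(2)])
    show "x \<notin> supp \<psi> \<Longrightarrow> R t x = 0" for x by (simp add: R_def outside_support)
    show "norm (R t x) \<le> 2 * M + M * L" for x
    proof -
      have "\<bar>\<psi>1 x * g0 t (x $ k)\<bar> \<le> M * 1" by (intro abs_mult_le M wave_bounds)
      moreover have "\<bar>t * (\<psi>1 x * r0 t (x $ k))\<bar> \<le> 1 * (M * L)" using t by (intro abs_mult_le M L) auto
      ultimately show ?thesis using M(1)[of x] unfolding R_def real_norm_def by linarith
    qed
  qed
  \<comment> \<open>with \<open>t \<ge> 1/4\<close> the pairing gives \<open>\<epsilon> / 8 * ?z \<le> CR + ?h\<close> below; \<open>D\<close> results from squaring\<close>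
  define D where "D = 2 * (CR\<^sup>2 + 1) * (8 / \<epsilon>)\<^sup>2"
  define a where "a j = tau j + ell j / 3" for j
  define b where "b j = tau j + 2 * ell j / 3" for j
  define Lw where "Lw j t = w * (\<Sum>m=1..j. 1 + sin (2 * theta j m t)) - C" for j t
  have pointwise: "AE t in unit_time. \<forall>j\<ge>1. t \<in> {a j<..b j} \<longrightarrow> Lw j t \<le> D * (1 + (L2_norm (H t))\<^sup>2)"
    using eq HX
  proof eventually_elim
    case (elim t)
    show ?case
    proof (intro allI impI)
      fix j :: nat assume j: "1 \<le> j" and tj: "t \<in> {a j<..b j}"
      then have t1: "tau j + ell j / 3 < t" "t \<le> tau j + 2 * ell j / 3" by (auto simp: a_def b_def)
      note mb = mid_block[OF j t1]
      define c where "c m = sin (theta j m t) + cos (theta j m t)" for m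
      define Z where "Z x = (\<Sum>m=1..j. c m * wave j m x)" for x
      have ZH: "Z \<in> L2 \<and> embed (H t) Z = embed (Ut t) Z"
      proof -
        have "(\<lambda>x. \<Sum>m\<in>A. c m * wave j m x) \<in> L2 \<and>
            embed (H t) (\<lambda>x. \<Sum>m\<in>A. c m * wave j m x) = embed (Ut t) (\<lambda>x. \<Sum>m\<in>A. c m * wave j m x)" if "finite A" for A
          using that
        proof (induction A rule: finite_induct)
          case empty
          then show ?case by (simp add: embed_def L2_zero)
        next
          case (insert m A)
          let ?q = "\<lambda>x. \<Sum>m\<in>A. c m * wave j m x"
          have wL: "wave j m \<in> L2" by (rule test_functions_L2[OF wave_test])
          have cL: "(\<lambda>x. c m * wave j m x) \<in> L2" using L2_scaleR[OF wL, of "c m"] by simp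
          have qL: "?q \<in> L2" using insert by simp
          have add: "embed f (\<lambda>x. c m * wave j m x + ?q x) = c m * embed f (wave j m) + embed f ?q" if "f \<in> L2" for f
          proof -
            have "embed f (\<lambda>x. c m * wave j m x + ?q x) = (LINT x|lborel. c m * (f x * wave j m x) + f x * ?q x)"
              unfolding embed_def by (rule Bochner_Integration.integral_cong) (simp_all add: distrib_left mult.left_commute)
            also have "\<dots> = c m * embed f (wave j m) + embed f ?q"
              using L2_mult_integrable[OF that wL] L2_mult_integrable[OF that qL] by (simp add: embed_def)
            finally show ?thesis .
          qed
          show ?case
            using insert L2_add[OF cL qL] add[OF elim(2)] add[OF L2_members(2)[of t]] elim(1) by simp
        qed
        then show ?thesis unfolding Z_def[abs_def] by simp
      qed
      then have ZL: "Z \<in> L2" by blast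
      have RL: "R t \<in> L2" by (rule test_functions_L2[OF Rt])
      let ?z = "L2_norm Z" and ?h = "L2_norm (H t)"
      have Ut_eq: "Ut t x = R t x - t * \<epsilon> / 2 * Z x" for x
        using U_t_decomposition[OF j t1, of x] by (simp add: R_def Z_def c_def)
      have "embed (Ut t) Z = (LINT x|lborel. R t x * Z x - (t * \<epsilon> / 2) * (Z x * Z x))"
        unfolding embed_def by (rule Bochner_Integration.integral_cong) (simp_all add: Ut_eq algebra_simps)
      also have "\<dots> = embed (R t) Z - t * \<epsilon> / 2 * ?z\<^sup>2"
        using L2_mult_integrable[OF RL ZL] L2_mult_integrable[OF ZL ZL] by (simp add: embed_def L2_norm_sq)
      finally have "t * \<epsilon> / 2 * ?z\<^sup>2 = embed (R t) Z - embed (H t) Z" using ZH by simp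
      also have "\<dots> \<le> CR * ?z + ?h * ?z"
      proof -
        have "\<bar>embed (R t) Z\<bar> \<le> L2_norm (R t) * ?z" using L2_Cauchy_Schwarz[OF RL ZL] by (simp add: embed_def)
        also have "\<dots> \<le> CR * ?z" by (intro mult_right_mono RC mb) simp
        finally have "\<bar>embed (R t) Z\<bar> \<le> CR * ?z" .
        moreover have "\<bar>embed (H t) Z\<bar> \<le> ?h * ?z" using L2_Cauchy_Schwarz[OF elim(2) ZL] by (simp add: embed_def)
        ultimately show ?thesis by linarith
      qed
      finally have up: "t * \<epsilon> / 2 * ?z\<^sup>2 \<le> (CR + ?h) * ?z" by (simp add: distrib_right)
      have CR0: "0 \<le> CR" using M0 L by (simp add: CR_def)
      have "?z \<le> (CR + ?h) * (8 / \<epsilon>)"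
      proof (cases "?z = 0")
        case True
        then show ?thesis using CR0 eps by simp
      next
        case False
        then have z: "0 < ?z" using L2_norm_nonneg[of Z] by linarith
        have "\<epsilon> / 8 * ?z\<^sup>2 \<le> t * \<epsilon> / 2 * ?z\<^sup>2" using mb(4) eps by (intro mult_right_mono) auto
        then have "(\<epsilon> / 8 * ?z) * ?z \<le> (CR + ?h) * ?z" using up by (simp add: power2_eq_square)
        then have "\<epsilon> / 8 * ?z \<le> CR + ?h" using z by (simp only: mult_le_cancel_right_pos)
        then show ?thesis using eps by (simp add: field_simps)
      qed
      then have "?z\<^sup>2 \<le> ((CR + ?h) * (8 / \<epsilon>))\<^sup>2" by (rule power_mono) simp
      also have "\<dots> = (CR + ?h)\<^sup>2 * (8 / \<epsilon>)\<^sup>2" by (simp only: power_mult_distrib)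
      also have "\<dots> \<le> (2 * (CR\<^sup>2 + 1) * (1 + ?h\<^sup>2)) * (8 / \<epsilon>)\<^sup>2"
      proof (rule mult_right_mono)
        have "(CR + ?h)\<^sup>2 \<le> 2 * CR\<^sup>2 + 2 * ?h\<^sup>2" using sum_squares_bound[of CR ?h] by (simp add: power2_sum)
        also have "\<dots> \<le> 2 * (CR\<^sup>2 + 1) * (1 + ?h\<^sup>2)" by (simp add: algebra_simps)
        finally show "(CR + ?h)\<^sup>2 \<le> 2 * (CR\<^sup>2 + 1) * (1 + ?h\<^sup>2)" .
      qed simp
      also have "\<dots> = D * (1 + ?h\<^sup>2)" by (simp only: D_def mult_ac)
      finally have zD: "?z\<^sup>2 \<le> D * (1 + ?h\<^sup>2)" .
      have "\<bar>c m\<bar> \<le> 2" for m unfolding c_def by (rule sin_cos_le_2)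
      from C(2)[OF j this] have "w * (\<Sum>m=1..j. (c m)\<^sup>2) - C \<le> ?z\<^sup>2" by (simp add: w_def Z_def[abs_def])
      moreover have "(c m)\<^sup>2 = 1 + sin (2 * theta j m t)" for m
        using sin_cos_squared_add[of "theta j m t"] by (simp add: c_def power2_sum sin_double)
      ultimately show "Lw j t \<le> D * (1 + ?h\<^sup>2)" using zD by (simp add: Lw_def)
    qed
  qed
  have Lwc: "continuous_on A (Lw j)" for A j
    unfolding Lw_def theta_def by (intro continuous_intros)
  have Lwi: "integrable unit_time (Lw j)" for j by (rule unit_time_integrable_continuous[OF Lwc])
  define B where "B = (LINT t|unit_time. D * (1 + (L2_norm (H t))\<^sup>2))"
  have Bi: "integrable unit_time (\<lambda>t. D * (1 + (L2_norm (H t))\<^sup>2))"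
    by (intro integrable_mult_right Bochner_Integration.integrable_add Hsq unit_time_integrable_bounded[of "\<lambda>_. 1" 1]) auto
  have D0: "0 \<le> D" by (simp add: D_def)
  have ab: "0 \<le> a j" "a j \<le> b j" "b j \<le> 1" if "1 \<le> j" for j
    using ell_pos[OF that] tau_ge[OF that] tau_less[OF that] ell_le[OF that] by (auto simp: a_def b_def)
  have ii: "integrable unit_time (\<lambda>t. indicat_real {a j<..b j} t * Lw j t)" for j
  proof -
    have "indicat_real {a j<..b j} \<in> borel_measurable unit_time"
      by (intro measurable_restrict_space1 measurable_completion) simp
    then show ?thesis
      using Lwi[of j] by (intro Bochner_Integration.integrable_bound[OF Lwi[of j]] borel_measurable_times AE_I2)
        (simp_all add: abs_mult mult_left_le_one_le)
  qed
  have total: "(\<Sum>j=1..N. integral {a j..b j} (Lw j)) \<le> B" for N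
  proof -
    have "(\<Sum>j=1..N. integral {a j..b j} (Lw j)) = (\<Sum>j=1..N. LINT t|unit_time. indicat_real {a j<..b j} t * Lw j t)"
      by (intro sum.cong refl unit_time_integral_interval(2)[OF Lwi] ab) auto
    also have "\<dots> = (LINT t|unit_time. (\<Sum>j=1..N. indicat_real {a j<..b j} t * Lw j t))"
      by (rule Bochner_Integration.integral_sum[symmetric]) (rule ii)
    also have "\<dots> \<le> B"
      unfolding B_def
    proof (rule integral_mono_AE[OF _ Bi])
      show "integrable unit_time (\<lambda>t. \<Sum>j=1..N. indicat_real {a j<..b j} t * Lw j t)"
        by (intro Bochner_Integration.integrable_sum ii)
      show "AE t in unit_time. (\<Sum>j=1..N. indicat_real {a j<..b j} t * Lw j t) \<le> D * (1 + (L2_norm (H t))\<^sup>2)"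
        using pointwise
      proof eventually_elim
        case (elim t)
        show ?case
        proof (cases "\<exists>J\<in>{1..N}. t \<in> {a J<..b J}")
          case True
          then obtain J where J: "J \<in> {1..N}" "t \<in> {a J<..b J}" by blast
          have out: "t \<notin> {a i<..b i}" if i: "i \<in> {1..N}" "i \<noteq> J" for i
          proof
            assume ti: "t \<in> {a i<..b i}"
            have "tau i < t" "t < tau (Suc i)" "tau J < t" "t < tau (Suc J)"
              using mid_block(1,2)[of i t] mid_block(1,2)[of J t] ti J i by (auto simp: a_def b_def)
            then show False
              using tau_mono[of "Suc i" J] tau_mono[of "Suc J" i] i J by (cases "i < J") auto
          qed
          have "(\<Sum>j=1..N. indicat_real {a j<..b j} t * Lw j t) = (\<Sum>j=1..N. if j = J then Lw J t else 0)"
            using out J(2) by (intro sum.cong refl) (auto simp: indicator_def)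
          also have "\<dots> = Lw J t" using J(1) by simp
          also have "\<dots> \<le> D * (1 + (L2_norm (H t))\<^sup>2)" using elim J by auto
          finally show ?thesis .
        next
          case False
          then have "(\<Sum>j=1..N. indicat_real {a j<..b j} t * Lw j t) = 0"
            by (intro sum.neutral) (auto simp: indicator_def)
          then show ?thesis using D0 by simp
        qed
      qed
    qed
    finally show ?thesis .
  qed
  have block: "w / 64 * (1 / real (Suc j)) - C * ell j \<le> integral {a j..b j} (Lw j)" if j: "1 \<le> j" for j
  proof -
    have ci: "(\<lambda>t. 1 + sin (2 * theta j m t)) integrable_on {a j..b j}" for m
      unfolding theta_def by (intro integrable_continuous_real continuous_intros)
    have "integral {a j..b j} (Lw j) = w * (\<Sum>m=1..j. integral {a j..b j} (\<lambda>t. 1 + sin (2 * theta j m t))) - C * (b j - a j)"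
      unfolding Lw_def
      using ab[OF j] ci by (subst Henstock_Kurzweil_Integration.integral_diff)
        (auto intro!: integrable_on_mult_right integrable_sum simp: Henstock_Kurzweil_Integration.integral_sum)
    moreover have "(\<Sum>m=1..j. ell j / 4) \<le> (\<Sum>m=1..j. integral {a j..b j} (\<lambda>t. 1 + sin (2 * theta j m t)))"
      unfolding a_def b_def by (intro sum_mono oscillation_time_integral j) auto
    then have "w * (\<Sum>m=1..j. ell j / 4) \<le> w * (\<Sum>m=1..j. integral {a j..b j} (\<lambda>t. 1 + sin (2 * theta j m t)))"
      using w by (intro mult_left_mono) auto
    moreover have "w * (\<Sum>m=1..j. ell j / 4) = w / 64 * (1 / real (Suc j))"
    proof -
      have "real j * ell j = 1 / (16 * real (Suc j))" using j by (simp add: ell_eq)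
      then show ?thesis by simp
    qed
    moreover have "C * (b j - a j) \<le> C * ell j" using ell_pos[OF j] C by (intro mult_left_mono) (auto simp: a_def b_def)
    ultimately show ?thesis by linarith
  qed
  have ells: "(\<Sum>j=1..N. ell j) \<le> 1" for N
  proof -
    have "(\<Sum>j=1..N. ell j) = tau (Suc N) - tau 1"
      unfolding ell_def using sum_Suc_diff[of 1 N tau] by simp
    then show ?thesis using tau_less[of "Suc N"] tau_ge[of 1] by simp
  qed
  have bounded: "(\<Sum>j=1..N. 1 / real (Suc j)) \<le> (B + C) * (64 / w)" for N
  proof -
    have "(\<Sum>j=1..N. w / 64 * (1 / real (Suc j)) - C * ell j) \<le> (\<Sum>j=1..N. integral {a j..b j} (Lw j))"
      by (intro sum_mono block) auto
    also have "\<dots> \<le> B" by (rule total)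
    finally have "w / 64 * (\<Sum>j=1..N. 1 / real (Suc j)) - C * (\<Sum>j=1..N. ell j) \<le> B"
      by (simp only: sum_subtractf sum_distrib_left)
    moreover have "C * (\<Sum>j=1..N. ell j) \<le> C * 1" using ells[of N] C by (intro mult_left_mono) auto
    ultimately have "w / 64 * (\<Sum>j=1..N. 1 / real (Suc j)) \<le> B + C" by linarith
    then have "(64 / w) * (w / 64 * (\<Sum>j=1..N. 1 / real (Suc j))) \<le> (64 / w) * (B + C)" using w by (intro mult_left_mono) auto
    then show ?thesis using w by (simp add: mult.commute)
  qed
  have "summable (\<lambda>n. 1 / real (Suc (Suc n)))"
  proof (rule summableI_nonneg_bounded)
    show "(\<Sum>i<n. 1 / real (Suc (Suc i))) \<le> (B + C) * (64 / w)" for n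
    proof -
      have "(\<Sum>i<n. 1 / real (Suc (Suc i))) = (\<Sum>j=1..n. 1 / real (Suc j))"
        by (rule sum.reindex_bij_witness[of _ "\<lambda>j. j - 1" Suc]) auto
      then show ?thesis using bounded[of n] by simp
    qed
  qed simp
  then have "summable (\<lambda>n. inverse (real n))"
    using summable_iff_shift[of "\<lambda>n. inverse (real n)" 2] by (simp add: inverse_eq_divide)
  then show False using not_summable_harmonic[where 'a = real] by (simp add: inverse_eq_divide)
qed

end

context smooth_cutoff
begin

definition product_bump :: "real^'n \<Rightarrow> real" where
  "product_bump x = (\<Prod>i\<in>UNIV. \<eta> (x $ i))"

lemma product_bump_test: "(product_bump :: real^'n::finite \<Rightarrow> real) \<in> test_functions UNIV"
proof (rule test_functionsI[of _ "cbox 0 1"])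
  show "smooth (product_bump :: real^'n \<Rightarrow> real)"
    unfolding product_bump_def[abs_def] by (intro smooth_prod smooth_coord eta_smooth)
  fix x :: "real^'n" assume "x \<notin> cbox 0 1"
  then obtain i where "x $ i < 0 \<or> 1 < x $ i" by (auto simp: mem_box_cart not_le)
  then have "\<eta> (x $ i) = 0" by (intro eta_zero) auto
  then show "product_bump x = 0" unfolding product_bump_def by (intro prod_zero) auto
qed auto

text \<open>A compactly supported function with vanishing derivative in one direction would be
  constant along lines in that direction, but the bump is one at the centre of the cube and zero far
  away.\<close>

lemma product_bump_dir_deriv_nonzero:
  fixes k :: "'n::finite"
  shows "0 < L2_norm (dir_deriv (axis k 1) (product_bump :: real^'n \<Rightarrow> real))"
proof (rule ccontr)
  let ?d = "dir_deriv (axis k 1) (product_bump :: real^'n \<Rightarrow> real)"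
  note sm = test_functionsD(1)[OF product_bump_test[where 'n = 'n]]
  have dL: "?d \<in> L2" by (rule test_functions_L2[OF test_functions_dir_deriv[OF product_bump_test]])
  assume "\<not> 0 < L2_norm ?d"
  then have "L2_norm ?d = 0" using L2_norm_nonneg[of ?d] by linarith
  then have "(LINT x|lborel. (norm (?d x))\<^sup>2) = 0" by (simp add: L2_norm_def)
  then have "AE x in lborel. ?d x = 0"
    using integral_nonneg_eq_0_iff_AE[OF L2_integrable_sq[OF dL]] by simp
  then have "AE x in lebesgue. ?d x = 0" by (rule AE_completion)
  then have neg: "negligible {x. ?d x \<noteq> 0}"
    unfolding negligible_iff_null_sets completion.AE_iff_null_sets by simp
  have op: "open {x. ?d x \<noteq> 0}"
    by (intro open_Collect_neq smooth_continuous smooth_dir_deriv sm continuous_on_const)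
  have d0: "?d x = 0" for x
  proof (rule ccontr)
    assume "?d x \<noteq> 0"
    then obtain r where r: "0 < r" "ball x r \<subseteq> {x. ?d x \<noteq> 0}"
      using op unfolding open_contains_ball by blast
    obtain a b where ab: "x \<in> box a b" "box a b \<subseteq> ball x r" using rational_boxes[OF r(1), of x] by blast
    have "negligible (box a b)" by (rule negligible_subset[OF neg]) (use ab r in blast)
    then show False using ab(1) by (auto simp: negligible_interval)
  qed
  define c :: "real^'n" where "c = (\<chi> i. 1/2)"
  have "((\<lambda>s. product_bump (c + s *\<^sub>R axis k 1)) has_real_derivative 0) (at s)" for s
  proof -
    have "((\<lambda>s::real. c + s *\<^sub>R axis k 1) has_derivative (\<lambda>s. s *\<^sub>R axis k 1)) (at s)"
      by (auto intro!: derivative_eq_intros)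
    from diff_chain_at[OF this smooth_has_derivative[OF sm]]
    have "(product_bump \<circ> (\<lambda>s. c + s *\<^sub>R axis k 1) has_derivative
        (\<lambda>v. dir_deriv v product_bump (c + s *\<^sub>R axis k 1)) \<circ> (\<lambda>s. s *\<^sub>R axis k 1)) (at s)" .
    moreover have "dir_deriv (r *\<^sub>R axis k 1) product_bump y = 0" for r and y :: "real^'n"
      using linear_scale[OF has_derivative_linear[OF smooth_has_derivative[OF sm, of y]], of r "axis k 1"] d0 by simp
    ultimately show ?thesis by (simp add: has_field_derivative_def o_def lambda_zero[symmetric])
  qed
  then have "product_bump (c + 1 *\<^sub>R axis k 1) = product_bump (c + 0 *\<^sub>R axis k 1)"
    by (intro DERIV_isconst_all) auto
  moreover have "product_bump (c + 0 *\<^sub>R axis k 1) = 1" by (simp add: product_bump_def c_def eta_one)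
  moreover have "product_bump (c + 1 *\<^sub>R axis k 1) = 0"
  proof -
    have "\<eta> ((c + 1 *\<^sub>R axis k 1) $ k) = 0" by (rule eta_zero) (simp add: c_def)
    then show ?thesis unfolding product_bump_def by (intro prod_zero bexI[of _ k]) auto
  qed
  ultimately show False by simp
qed

end

theorem proposition6p3:
  fixes \<eta> :: "real \<Rightarrow> real" and \<epsilon> :: real and k :: "'n::finite"
  assumes "CARD('n) \<ge> 2"
    and "0 < \<epsilon>" and "\<epsilon> \<le> 1"
    and "cutoff \<eta>"
  shows "(coeff_matrix \<eta> \<epsilon> k \<in> Holder_Linf (1/2) \<and>
      (\<forall>t x. transpose (coeff_matrix \<eta> \<epsilon> k t x) = coeff_matrix \<eta> \<epsilon> k t x) \<and>
      (\<lambda>(t, x). coeff_matrix \<eta> \<epsilon> k t x) \<in> Linf \<and>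
      uniformly_elliptic (scalar_coeff \<eta> \<epsilon>)) \<and>
    (\<exists>(F :: real \<Rightarrow> real^'n \<Rightarrow> real) \<in> L2_Bochner L2 L2_norm.
      \<exists>U :: real \<Rightarrow> real^'n \<Rightarrow> real.
        lions_solution (coeff_matrix \<eta> \<epsilon> k) F U \<and>
        (\<forall>V. lions_solution (coeff_matrix \<eta> \<epsilon> k) F V \<longrightarrow>
             (AE t in unit_time. AE x in lborel. V t x = U t x)) \<and>
        \<not> time_deriv_in_L2L2 U)"
proof -
  interpret smooth_cutoff \<eta> by (rule smooth_cutoff.intro) fact
  interpret corrector \<eta> \<epsilon> k "product_bump :: real^'n \<Rightarrow> real"
    by unfold_locales (use assms product_bump_test in auto)
  have "\<not> time_deriv_in_L2L2 U" by (rule not_in_L2L2[OF product_bump_dir_deriv_nonzero])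
  then show ?thesis
    using coeff_matrix_properties(1-3)[OF eps, where k = k] coeff_matrix_properties(4)[OF eps] F_Bochner U_lions_solution
      lions_solution_coeff_unique[OF eps U_lions_solution]
    by blast
qed

end
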